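(* Let $q\in[1,2)$. Let $b\in L^2(\mathbb{R}^3)\cap L^\infty(\mathbb{R}^3)$ be radially symmetric (i.e. $O(3)$-invariant), and let $$B(x_1,x_2,x_3)=\frac{b(x_1,x_2,x_3)}{\sqrt{x_1^2+x_2^2}}(-x_2,x_1,0).$$ Let $\rho\in X_B^*$, $\rho\neq 0$, be a radial distribution of charge. Then there is a unique and nontrivial minimizer $\phi_\rho$ of the functional $I_B:X_B\to\mathbb{R}$, and $\phi_\rho$ is a weak and radial solution to the electrostatic problem $$-\operatorname{div}\left(\frac{\nabla\phi+(\nabla\phi\cdot B)B}{\big(1+|B|^2-|\nabla \phi|^2-(\nabla \phi\cdot B)^2\big)^{1-q/2}}\right)=\rho\quad\text{in }\mathbb{R}^3.$$
   Context: $\mathcal{D}^{1,2}(\mathbb{R}^3)$ is the completion of $C_0^\infty(\mathbb{R}^3)$ with respect to $\|\phi\|:=\left(\int_{\mathbb{R}^3}|\nabla\phi|^2\,dx\right)^{1/2}$, and $C^{0,1}(\mathbb{R}^3)$ is the set of Lipschitz continuous functions. For $B\in L^2(\mathbb{R}^3,\mathbb{R}^3)\cap L^\infty(\mathbb{R}^3,\mathbb{R}^3)$, $$X_B:=\mathcal{D}^{1,2}(\mathbb{R}^3)\cap\{\phi\in C^{0,1}(\mathbb{R}^3):\ |\nabla\phi|^2+(\nabla\phi\cdot B)^2\le 1+|B|^2\ \text{a.e. in }\mathbb{R}^3\},$$ a convex subset of $\mathcal{D}^{1,2}(\mathbb{R}^3)$ equipped with the norm $\|\cdot\|$. $X_B^*$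 denotes the dual of $X_B$, with duality pairing $\langle\rho,\phi\rangle$. Since $X_B$ is a convex symmetric set, this is understood as follows: $\rho$ is a linear functional on the linear span of $X_B$ (which equals $\mathcal{D}^{1,2}(\mathbb{R}^3)\cap C^{0,1}(\mathbb{R}^3)$) whose restriction to $X_B$ is continuous with respect to $\|\cdot\|$. The functional is $$I_B(\phi)=\frac1q\int_{\mathbb{R}^3}\Big(1-\big(1+|B|^2-|\nabla\phi|^2-(\nabla\phi\cdot B)^2\big)^{q/2}\Big)\,dx-\langle\rho,\phi\rangle,\qquad \phi\in X_B.$$ $\rho$ is a radial distribution of charge if $g\rho=\rho$ for every $g\in O(3)$, where $\langle g\rho,\phi\rangle:=\langle\rho,g\phi\rangle$ and $(g\phi)(x):=\phi(gx)$. A weak solution of the electrostatic problem is a function $\phi_\rho\in X_B$ such that for all $\psi\in X_B$ $$\int_{\mathbb{R}^3}\frac{[\nabla\phi_\rho+(\nabla\phi_\rho\cdot B)B]\cdot\nabla\psi}{\big(1+|B|^2-|\nabla\phi_\rho|^2-(\nabla\phi_\rho\cdot B)^2\big)^{1-q/2}}\,dx=\langle\rho,\psi\rangle.$$ Radial means $O(3)$-invariant. "Nontrivial" means not identically zero. *)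

theory Defs
  imports "HOL-Analysis.Analysis" "HOL-Library.Function_Algebras"
begin

type_synonym R3 = "real^3"

primrec Ck :: "nat \<Rightarrow> (R3 \<Rightarrow> real) \<Rightarrow> bool" where
  "Ck 0 f \<longleftrightarrow> continuous_on UNIV f"
| "Ck (Suc k) f \<longleftrightarrow> (\<exists>D. (\<forall>x. GDERIV f x :> D x) \<and> (\<forall>i. Ck k (\<lambda>x. D x $ i)))"

definition test_function :: "(R3 \<Rightarrow> real) \<Rightarrow> bool" where
  "test_function f \<longleftrightarrow> (\<forall>k. Ck k f) \<and> compact (closure {x. f x \<noteq> 0})"

text \<open>The classical gradient; it is only applied to differentiable functions.\<close>

definition grad :: "(R3 \<Rightarrow> real) \<Rightarrow> R3 \<Rightarrow> R3" where
  "grad f x = (THE D. GDERIV f x :> D)"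

definition locally_integrable :: "(R3 \<Rightarrow> 'a::euclidean_space) \<Rightarrow> bool" where
  "locally_integrable f \<longleftrightarrow> (\<forall>K. compact K \<longrightarrow> set_integrable lebesgue K f)"

definition has_weak_grad :: "(R3 \<Rightarrow> real) \<Rightarrow> (R3 \<Rightarrow> R3) \<Rightarrow> bool" where
  "has_weak_grad \<phi> G \<longleftrightarrow>
     locally_integrable \<phi> \<and> locally_integrable G \<and>
     (\<forall>\<psi>. test_function \<psi> \<longrightarrow>
        (LINT x|lebesgue. \<phi> x *\<^sub>R grad \<psi> x) = - (LINT x|lebesgue. \<psi> x *\<^sub>R G x))"

text \<open>The weak gradient is unique up to null sets, and it is only used below in
  statements that do not depend on the chosen representative. For Lipschitz functions it
  agrees almost everywhere with the classical gradient.\<close>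

definition wgrad :: "(R3 \<Rightarrow> real) \<Rightarrow> R3 \<Rightarrow> R3" where
  "wgrad \<phi> = (SOME G. has_weak_grad \<phi> G)"

definition D12_norm :: "(R3 \<Rightarrow> real) \<Rightarrow> real" where
  "D12_norm \<phi> = sqrt (LINT x|lebesgue. (norm (wgrad \<phi> x))\<^sup>2)"

text \<open>The completion of the test functions, realised as a space of functions: by the Sobolev
  inequality a sequence of test functions that is Cauchy for the Dirichlet norm converges
  in $L^6$, and the element of the completion that it represents is identified with its
  limit. Members are functions, so that almost everywhere equal functions are not
  identified; this does not matter for the continuous functions in \<open>XB\<close> below.\<close>

definition D12 :: "(R3 \<Rightarrow> real) set" where
  "D12 = {\<phi>. \<phi> \<in> borel_measurable lebesgue \<and>
     (\<exists>u. (\<forall>n::nat. test_function (u n)) \<and>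
        (\<forall>e>0. \<exists>N. \<forall>m\<ge>N. \<forall>n\<ge>N.
           sqrt (LINT x|lebesgue. (norm (grad (u m) x - grad (u n) x))\<^sup>2) < e) \<and>
        (\<lambda>n. \<integral>\<^sup>+x. ennreal (\<bar>u n x - \<phi> x\<bar> ^ 6) \<partial>lebesgue) \<longlonglongrightarrow> 0)}"

definition C01 :: "(R3 \<Rightarrow> real) set" where
  "C01 = {\<phi>. \<exists>L. L-lipschitz_on UNIV \<phi>}"

definition L2_Linf :: "(R3 \<Rightarrow> real) set" where
  "L2_Linf = {b. b \<in> borel_measurable lebesgue \<and>
     integrable lebesgue (\<lambda>x. (b x)\<^sup>2) \<and> (\<exists>C. AE x in lebesgue. \<bar>b x\<bar> \<le> C)}"

definition XB :: "(R3 \<Rightarrow> R3) \<Rightarrow> (R3 \<Rightarrow> real) set" where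
  "XB B = D12 \<inter> {\<phi> \<in> C01. AE x in lebesgue.
     (norm (wgrad \<phi> x))\<^sup>2 + (wgrad \<phi> x \<bullet> B x)\<^sup>2 \<le> 1 + (norm (B x))\<^sup>2}"

definition XB_span :: "(R3 \<Rightarrow> R3) \<Rightarrow> (R3 \<Rightarrow> real) set" where
  "XB_span B = module.span (\<lambda>(c::real) \<phi> x. c * \<phi> x) (XB B)"

text \<open>A functional is represented by a total function on \<open>R3 \<Rightarrow> real\<close>, whose values outside
  \<open>XB_span B\<close> are irrelevant.\<close>

definition XB_dual :: "(R3 \<Rightarrow> R3) \<Rightarrow> ((R3 \<Rightarrow> real) \<Rightarrow> real) set" where
  "XB_dual B = {\<rho>.
     (\<forall>\<phi>\<in>XB_span B. \<forall>\<psi>\<in>XB_span B. \<rho> (\<phi> + \<psi>) = \<rho> \<phi> + \<rho> \<psi>) \<and>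
     (\<forall>c. \<forall>\<phi>\<in>XB_span B. \<rho> (\<lambda>x. c * \<phi> x) = c * \<rho> \<phi>) \<and>
     (\<forall>\<phi>\<in>XB B. \<forall>e>0. \<exists>d>0. \<forall>\<psi>\<in>XB B. D12_norm (\<psi> - \<phi>) < d \<longrightarrow> \<bar>\<rho> \<psi> - \<rho> \<phi>\<bar> < e)}"

definition dual_nonzero :: "(R3 \<Rightarrow> R3) \<Rightarrow> ((R3 \<Rightarrow> real) \<Rightarrow> real) \<Rightarrow> bool" where
  "dual_nonzero B \<rho> \<longleftrightarrow> (\<exists>\<phi>\<in>XB_span B. \<rho> \<phi> \<noteq> 0)"

text \<open>The orthogonal group $O(3)$ is \<open>{g. orthogonal_transformation g}\<close>. The invariance of
  \<open>\<rho>\<close> is stated on the span, which is $O(3)$-invariant, while \<open>XB B\<close> need not be.\<close>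

definition radial_distribution :: "(R3 \<Rightarrow> R3) \<Rightarrow> ((R3 \<Rightarrow> real) \<Rightarrow> real) \<Rightarrow> bool" where
  "radial_distribution B \<rho> \<longleftrightarrow>
     (\<forall>g. orthogonal_transformation g \<longrightarrow> (\<forall>\<phi>\<in>XB_span B. \<rho> (\<phi> \<circ> g) = \<rho> \<phi>))"

definition radial :: "(R3 \<Rightarrow> real) \<Rightarrow> bool" where
  "radial \<phi> \<longleftrightarrow> (\<forall>g. orthogonal_transformation g \<longrightarrow> \<phi> \<circ> g = \<phi>)"

text \<open>Radial symmetry of an equivalence class of measurable functions.\<close>

definition ae_radial :: "(R3 \<Rightarrow> real) \<Rightarrow> bool" where
  "ae_radial b \<longleftrightarrow>
     (\<forall>g. orthogonal_transformation g \<longrightarrow> (AE x in lebesgue. b (g x) = b x))"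

definition slack :: "(R3 \<Rightarrow> R3) \<Rightarrow> (R3 \<Rightarrow> real) \<Rightarrow> R3 \<Rightarrow> real" where
  "slack B \<phi> x = 1 + (norm (B x))\<^sup>2 - (norm (wgrad \<phi> x))\<^sup>2 - (wgrad \<phi> x \<bullet> B x)\<^sup>2"

definition IB :: "real \<Rightarrow> (R3 \<Rightarrow> R3) \<Rightarrow> ((R3 \<Rightarrow> real) \<Rightarrow> real) \<Rightarrow> (R3 \<Rightarrow> real) \<Rightarrow> real" where
  "IB q B \<rho> \<phi> = 1 / q * (LINT x|lebesgue. 1 - slack B \<phi> x powr (q / 2)) - \<rho> \<phi>"

text \<open>The quotient in the weak formulation is required to make sense: the denominator is
  positive almost everywhere (it would otherwise be read as a division by 0, which HOL
  evaluates to 0) and the integrand is Lebesgue integrable.\<close>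

definition weak_solution ::
  "real \<Rightarrow> (R3 \<Rightarrow> R3) \<Rightarrow> ((R3 \<Rightarrow> real) \<Rightarrow> real) \<Rightarrow> (R3 \<Rightarrow> real) \<Rightarrow> bool" where
  "weak_solution q B \<rho> \<phi> \<longleftrightarrow> \<phi> \<in> XB B \<and> (AE x in lebesgue. slack B \<phi> x > 0) \<and>
     (\<forall>\<psi>\<in>XB B. has_bochner_integral lebesgue
        (\<lambda>x. ((wgrad \<phi> x + (wgrad \<phi> x \<bullet> B x) *\<^sub>R B x) \<bullet> wgrad \<psi> x)
              / slack B \<phi> x powr (1 - q / 2))
        (\<rho> \<psi>))"

text \<open>On the $x_3$-axis, a null set, the value is 0.\<close>

definition B_field :: "(R3 \<Rightarrow> real) \<Rightarrow> R3 \<Rightarrow> R3" where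
  "B_field b x = (b x / sqrt ((x$1)\<^sup>2 + (x$2)\<^sup>2)) *\<^sub>R vector [- x$2, x$1, 0]"

end

theory Submission
  imports Defs "HOL-Real_Asymp.Real_Asymp"
begin

text \<open>Dropping the term \<open>(\<nabla>\<phi> \<bullet> B)\<^sup>2\<close> from $I_B$ and from its constraint gives an
  $O(3)$-invariant functional $J \le I_B$ on an $O(3)$-invariant convex set \<open>K\<close> that contains
  $X_B$. The concavity of $s^{q/2}$ makes $J$ uniformly convex for the Dirichlet norm, so
  minimizing sequences are Cauchy and $J$ has a unique minimizer \<open>u\<close> on \<open>K\<close>; by uniqueness \<open>u\<close>
  is radial. The gradient of a radial function is parallel to \<open>x\<close>, hence orthogonal to
  \<open>B\<close>. So \<open>u\<close> lies in $X_B$ with $I_B(u) = J(u)$, and it is the unique minimizer of $I_B$.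

  Comparing \<open>u\<close> with \<open>t u\<close> for \<open>t < 1\<close> close to 1 bounds the integral of
  $s^{q/2-1} |\nabla u|^2$, where \<open>s\<close> is the slack of \<open>u\<close>; in particular \<open>s > 0\<close> almost
  everywhere. Minimality along segments in \<open>K\<close> gives a variational inequality for the linear
  functional \<open>A\<close>, the difference of the two sides of the weak equation: \<open>A(v) \<ge> A(u)\<close> for
  \<open>v \<in> K\<close>. For radial \<open>u\<close> the field \<open>\<nabla>u\<close>, truncated to a set where \<open>s\<close> is
  bounded away from 0, is again a gradient, that of a radial potential \<open>w\<close>, and \<open>u + t w \<in> K\<close>
  for small \<open>t > 0\<close>. Hence \<open>A(w) \<ge> 0\<close>, and in the limit \<open>A(u) \<ge> 0\<close>. Since
  \<open>K = -K\<close>, \<open>A\<close> vanishes on \<open>K\<close>.\<close>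

section \<open>Smooth functions\<close>

text \<open>Taking v = 0 in the variational inequality only yields A(u) <= 0. The reverse sign would
  come from (1 + t) u, but this leaves K wherever the slack of u is small compared with t; for this
  reason u is enlarged only by a potential of its truncated gradient. That a truncated gradient is
  again a gradient is special to radial functions: the coefficient is a function of |x|^2, and a
  one-dimensional antiderivative gives the potential. The truncation set, however, is invariant
  under each g only up to a null set that depends on g, so a profile has to be recovered first;
  averaging with a radial kernel does this.

  Uniform convexity comes from the bound on B: slacks stay below 1 + C, where the slope of s^(q/2)
  is bounded away from 0. Integrability of |B|^2 makes J finite. All competitors share the Lipschitz
  constant sqrt(1 + C). With this constant, Sobolev's inequality turns convergence of gradients into
  pointwise convergence, so limits are genuine functions in the space, and uniqueness is equality at
  every point.\<close>

lemma continuous_on_UNIV_compose: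
  "continuous_on UNIV f \<Longrightarrow> continuous_on UNIV g \<Longrightarrow> continuous_on UNIV (\<lambda>x. f (g x))"
  by (rule continuous_on_compose2) auto

lemma GDERIV_unique:
  fixes f :: "R3 \<Rightarrow> real"
  assumes "GDERIV f x :> D" "GDERIV f x :> D'"
  shows "D = D'"
proof -
  have "(\<lambda>h. h \<bullet> D) = (\<lambda>h. h \<bullet> D')"
    using assms unfolding gderiv_def by (rule has_derivative_unique)
  then have "(D - D') \<bullet> D = (D - D') \<bullet> D'" by metis
  then have "(D - D') \<bullet> (D - D') = 0" by (simp add: inner_diff_right)
  then show ?thesis by simp
qed

lemma grad_eq: "GDERIV f x :> D \<Longrightarrow> grad f x = D"
  unfolding grad_def using GDERIV_unique by blast

text \<open>By uniqueness of gradients the witness \<open>D\<close> can only be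
  \<open>grad f\<close>; inductions on smoothness can therefore speak of the components of
  \<open>grad f\<close> itself.\<close>

lemma Ck_Suc: "Ck (Suc k) f \<longleftrightarrow>
    (\<forall>x. GDERIV f x :> grad f x) \<and> (\<forall>i. Ck k (\<lambda>x. grad f x $ i))" (is "_ \<longleftrightarrow> ?R")
proof
  assume "Ck (Suc k) f"
  then obtain D where D: "\<forall>x. GDERIV f x :> D x" "\<forall>i. Ck k (\<lambda>x. D x $ i)" by auto
  moreover have "D = grad f" by (rule ext) (simp add: grad_eq[OF D(1)[rule_format]])
  ultimately show ?R by simp
qed auto

declare Ck.simps(2) [simp del]

lemma Ck_continuous: "Ck k f \<Longrightarrow> continuous_on UNIV f"
proof (cases k)
  case (Suc n)
  assume "Ck k f"
  then have "\<forall>x. GDERIV f x :> grad f x" using Suc Ck_Suc by blast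
  then have "\<forall>x. isCont f x" unfolding gderiv_def using has_derivative_continuous by blast
  then show ?thesis by (simp add: continuous_at_imp_continuous_on)
qed simp

lemma Ck_Suc_imp: "Ck (Suc k) f \<Longrightarrow> Ck k f"
proof (induction k arbitrary: f)
  case 0
  then show ?case using Ck_continuous by simp
next
  case (Suc k)
  then have "\<forall>x. GDERIV f x :> grad f x" "Ck (Suc k) (\<lambda>x. grad f x $ i)" for i
    unfolding Ck_Suc[of "Suc k"] by auto
  then show ?case unfolding Ck_Suc[of k f] using Suc.IH by simp
qed

lemma Ck_add: "Ck k f \<Longrightarrow> Ck k g \<Longrightarrow> Ck k (\<lambda>x. f x + g x)"
proof (induction k arbitrary: f g)
  case 0 then show ?case by (auto intro: continuous_intros)
next
  case (Suc k)
  then have "\<forall>x. GDERIV (\<lambda>x. f x + g x) x :> grad f x + grad g x"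
    by (simp add: Ck_Suc GDERIV_add)
  moreover have "\<forall>i. Ck k (\<lambda>x. (grad f x + grad g x) $ i)"
    using Suc by (auto simp: Ck_Suc)
  ultimately show ?case unfolding Ck.simps by (intro exI[of _ "\<lambda>x. grad f x + grad g x"]) auto
qed

lemma Ck_const: "Ck k (\<lambda>x. c)"
proof (induction k arbitrary: c)
  case (Suc k)
  then show ?case unfolding Ck.simps
    by (intro exI[of _ "\<lambda>x. 0"]) (auto simp: GDERIV_const)
qed simp

lemma Ck_mult: "Ck k f \<Longrightarrow> Ck k g \<Longrightarrow> Ck k (\<lambda>x. f x * g x)"
proof (induction k arbitrary: f g)
  case 0 then show ?case by (auto intro: continuous_intros)
next
  case (Suc k)
  then have "\<forall>x. GDERIV (\<lambda>x. f x * g x) x :> f x *\<^sub>R grad g x + g x *\<^sub>R grad f x"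
    by (simp add: Ck_Suc GDERIV_mult)
  moreover have "Ck k (\<lambda>x. (f x *\<^sub>R grad g x + g x *\<^sub>R grad f x) $ i)" for i
    using Suc Ck_Suc_imp[of k f] Ck_Suc_imp[of k g] by (auto simp: Ck_Suc intro!: Ck_add)
  ultimately show ?case unfolding Ck.simps
    by (intro exI[of _ "\<lambda>x. f x *\<^sub>R grad g x + g x *\<^sub>R grad f x"]) auto
qed

lemma Ck_cmult: "Ck k f \<Longrightarrow> Ck k (\<lambda>x. c * f x)"
  by (intro Ck_mult Ck_const)

lemma Ck_sum: "finite I \<Longrightarrow> (\<And>i. i \<in> I \<Longrightarrow> Ck k (f i)) \<Longrightarrow> Ck k (\<lambda>x. \<Sum>i\<in>I. f i x)"
  by (induction I rule: finite_induct) (auto intro: Ck_const Ck_add)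

lemma GDERIV_inner: "GDERIV (\<lambda>x. x \<bullet> c) x :> c"
  unfolding gderiv_def by (auto intro!: derivative_eq_intros)

lemma Ck_inner: "Ck k (\<lambda>x. x \<bullet> c)"
proof (cases k)
  case 0 then show ?thesis by (auto intro: continuous_intros)
next
  case (Suc n)
  then show ?thesis using GDERIV_inner Ck_const unfolding Suc Ck.simps
    by (intro exI[of _ "\<lambda>x. c"]) auto
qed

lemma Ck_nth: "Ck k (\<lambda>x. x $ i)"
  using Ck_inner[of k "axis i 1"] by (simp add: inner_axis)

lemma GDERIV_linear_compose:
  fixes g :: "R3 \<Rightarrow> R3" and f :: "R3 \<Rightarrow> real"
  assumes "linear g" "GDERIV f (g x + c) :> D"
  shows "GDERIV (\<lambda>x. f (g x + c)) x :> adjoint g D"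
proof -
  have "((\<lambda>x. g x + c) has_derivative g) (at x)"
    using linear_imp_has_derivative[OF assms(1), of "at x"] by (auto intro!: derivative_eq_intros)
  then have "((\<lambda>x. f (g x + c)) has_derivative (\<lambda>h. g h \<bullet> D)) (at x)"
    using has_derivative_compose[of "\<lambda>x. g x + c" g x UNIV f "\<lambda>h. h \<bullet> D"] assms(2)
    unfolding gderiv_def by simp
  then show ?thesis unfolding gderiv_def by (simp add: adjoint_works[OF assms(1)])
qed

lemma Ck_linear_compose:
  fixes g :: "R3 \<Rightarrow> R3"
  assumes "linear g" "Ck k f"
  shows "Ck k (\<lambda>x. f (g x + c))"
  using assms(2)
proof (induction k arbitrary: f)
  case 0
  have "continuous_on UNIV (\<lambda>x. g x + c)"
    using assms(1) by (intro continuous_intros linear_continuous_on linear_linear[THEN iffD2])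
      (simp add: linear_conv_bounded_linear)
  then show ?case using 0 continuous_on_compose2[of UNIV f UNIV "\<lambda>x. g x + c"] by auto
next
  case (Suc k)
  \<comment> \<open>Each component of the adjoint is a fixed linear combination of components, so
    smoothness passes to it component by component.\<close>
  have "adjoint g v $ i = (\<Sum>j\<in>UNIV. g (axis i 1) $ j * v $ j)" for v i
  proof -
    have "adjoint g v $ i = axis i 1 \<bullet> adjoint g v" by (simp add: inner_axis')
    also have "\<dots> = g (axis i 1) \<bullet> v" by (simp add: adjoint_works[OF assms(1)])
    finally show ?thesis by (simp add: inner_vec_def)
  qed
  moreover have "Ck k (\<lambda>x. \<Sum>j\<in>UNIV. g (axis i 1) $ j * grad f (g x + c) $ j)" for i
    using Suc by (intro Ck_sum Ck_cmult) (auto simp: Ck_Suc)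
  moreover have "\<forall>x. GDERIV (\<lambda>x. f (g x + c)) x :> adjoint g (grad f (g x + c))"
    using Suc GDERIV_linear_compose[OF assms(1)] by (auto simp: Ck_Suc)
  ultimately show ?case unfolding Ck.simps
    by (intro exI[of _ "\<lambda>x. adjoint g (grad f (g x + c))"]) auto
qed

text \<open>Together with the Stone-Weierstrass theorem this is the source of test functions: a
  polynomial times a smooth cut-off approximates a continuous function on a compact set.\<close>

lemma Ck_real_polynomial_function:
  assumes "real_polynomial_function p"
  shows "Ck k p"
  using assms
proof (induction rule: real_polynomial_function.induct)
  case (linear f)
  have "f x = (\<Sum>i\<in>UNIV. f (axis i 1) * x $ i)" for x
  proof -
    have "f x = f (\<Sum>i\<in>UNIV. x $ i *\<^sub>R axis i 1)"
      by (simp add: basis_expansion scalar_mult_eq_scaleR[symmetric])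
    also have "\<dots> = (\<Sum>i\<in>UNIV. f (axis i 1) * x $ i)"
      using linear by (simp add: linear_sum bounded_linear.linear linear_cmul mult.commute)
    finally show ?thesis .
  qed
  then have eq: "f = (\<lambda>x. \<Sum>i\<in>UNIV. f (axis i 1) * x $ i)" by (rule ext)
  have "Ck k (\<lambda>x. \<Sum>i\<in>UNIV. f (axis i 1) * x $ i)"
    by (intro Ck_sum Ck_cmult Ck_nth) simp
  then show ?case by (rule iffD2[OF arg_cong[OF eq]])
qed (auto intro: Ck_const Ck_add Ck_mult)

section \<open>Smooth functions of one real variable and the flat function exp(-1/t)\<close>

primrec Ck_real :: "nat \<Rightarrow> (real \<Rightarrow> real) \<Rightarrow> bool" where
  "Ck_real 0 f \<longleftrightarrow> continuous_on UNIV f"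
| "Ck_real (Suc k) f \<longleftrightarrow> (\<exists>f'. (\<forall>x. (f has_real_derivative f' x) (at x)) \<and> Ck_real k f')"

lemma Ck_real_continuous: "Ck_real k f \<Longrightarrow> continuous_on UNIV f"
  by (cases k) (auto intro: DERIV_isCont continuous_at_imp_continuous_on)

lemma Ck_real_Suc_imp: "Ck_real (Suc k) f \<Longrightarrow> Ck_real k f"
proof (induction k arbitrary: f)
  case 0
  then show ?case using Ck_real_continuous[OF 0] by simp
next
  case (Suc k)
  then obtain f' where "\<forall>x. (f has_real_derivative f' x) (at x)" "Ck_real (Suc k) f'"
    unfolding Ck_real.simps(2)[of "Suc k"] by blast
  then show ?case unfolding Ck_real.simps(2)[of k f] using Suc.IH by blast
qed

lemma Ck_real_add: "Ck_real k f \<Longrightarrow> Ck_real k g \<Longrightarrow> Ck_real k (\<lambda>x. f x + g x)"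
proof (induction k arbitrary: f g)
  case 0 then show ?case by (auto intro: continuous_intros)
next
  case (Suc k)
  then obtain f' g' where "\<forall>x. (f has_real_derivative f' x) (at x)" "Ck_real k f'"
    "\<forall>x. (g has_real_derivative g' x) (at x)" "Ck_real k g'" by auto
  then show ?case using Suc.IH by (auto intro!: exI[of _ "\<lambda>x. f' x + g' x"] DERIV_add)
qed

lemma Ck_real_mult: "Ck_real k f \<Longrightarrow> Ck_real k g \<Longrightarrow> Ck_real k (\<lambda>x. f x * g x)"
proof (induction k arbitrary: f g)
  case 0 then show ?case by (auto intro: continuous_intros)
next
  case (Suc k)
  then obtain f' g' where *: "\<forall>x. (f has_real_derivative f' x) (at x)" "Ck_real k f'"
    "\<forall>x. (g has_real_derivative g' x) (at x)" "Ck_real k g'" by auto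
  have "\<forall>x. ((\<lambda>x. f x * g x) has_real_derivative f' x * g x + f x * g' x) (at x)"
    using * by (auto intro!: derivative_eq_intros)
  moreover have "Ck_real k (\<lambda>x. f' x * g x + f x * g' x)"
    using * Suc.prems by (intro Ck_real_add Suc.IH Ck_real_Suc_imp[of k f] Ck_real_Suc_imp[of k g])
  ultimately show ?case unfolding Ck_real.simps
    by (intro exI[of _ "\<lambda>x. f' x * g x + f x * g' x"] conjI)
qed

lemma Ck_real_const: "Ck_real k (\<lambda>x. c)"
  by (induction k arbitrary: c) (auto intro!: exI[of _ "\<lambda>x. 0"])

lemma Ck_real_affine_compose: "Ck_real k f \<Longrightarrow> Ck_real k (\<lambda>x. f (c * x + d))"
proof (induction k arbitrary: f)
  case 0
  then show ?case
    unfolding Ck_real.simps Ck.simps by (rule continuous_on_UNIV_compose[of f]) (auto intro!: continuous_intros)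
next
  case (Suc k)
  then obtain f' where f': "\<forall>x. (f has_real_derivative f' x) (at x)" "Ck_real k f'" by auto
  have "((\<lambda>x. f (c * x + d)) has_real_derivative c * f' (c * x + d)) (at x)" for x
  proof -
    have "((\<lambda>x. c * x + d) has_real_derivative c) (at x)"
      by (auto intro!: derivative_eq_intros)
    from DERIV_chain2[OF f'(1)[rule_format] this] show ?thesis by (simp add: mult.commute)
  qed
  then show ?case using Suc.IH[OF f'(2)]
    by (auto intro!: exI[of _ "\<lambda>x. c * f' (c * x + d)"] Ck_real_mult Ck_real_const)
qed

lemma Ck_real_real_polynomial_function:
  assumes "real_polynomial_function p"
  shows "Ck_real k p"
  using assms
proof (induction rule: real_polynomial_function.induct)
  case (linear f)
  then have "f x = f 1 * x" for x
    using linear_cmul[of f x 1] by (simp add: bounded_linear.linear)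
  then have eq: "f = (\<lambda>x. f 1 * x)" by (rule ext)
  have "Ck_real k (\<lambda>x. f 1 * x)"
    by (cases k) (auto intro!: continuous_intros exI[of _ "\<lambda>x. f 1"] derivative_eq_intros Ck_real_const)
  then show ?case by (rule iffD2[OF arg_cong[OF eq]])
qed (auto intro: Ck_real_const Ck_real_add Ck_real_mult)

text \<open>The index \<open>n\<close> makes the family closed under differentiation: the derivative
  of \<open>flat n\<close> is a combination of \<open>flat (n + 2)\<close> and
  \<open>flat (n + 1)\<close>. Smoothness of exp(-1/t), which is \<open>flat 0\<close>, is then an
  induction over the whole family.\<close>

definition flat :: "nat \<Rightarrow> real \<Rightarrow> real" where
  "flat n t = (if t > 0 then exp (- (1 / t)) / t ^ n else 0)"

lemma flat_tendsto: "((flat n) \<longlongrightarrow> 0) (at 0)"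
proof -
  have "((\<lambda>u. u ^ n / exp u) \<longlongrightarrow> 0) (at_top :: real filter)"
    by (rule tendsto_power_div_exp_0)
  then have "((\<lambda>t. inverse t ^ n / exp (inverse t)) \<longlongrightarrow> 0) (at_right (0::real))"
    by (rule filterlim_compose[OF _ filterlim_inverse_at_top_right])
  moreover have "eventually (\<lambda>t. inverse t ^ n / exp (inverse t) = flat n t) (at_right (0::real))"
    unfolding eventually_at_right_field
    by (auto intro!: exI[of _ 1] simp: flat_def exp_minus field_simps)
  ultimately have r: "((flat n) \<longlongrightarrow> 0) (at_right 0)" by (rule Lim_transform_eventually)
  have "eventually (\<lambda>t. 0 = flat n t) (at_left (0::real))"
    unfolding eventually_at_left_field by (auto intro!: exI[of _ "-1"] simp: flat_def)
  then have "((flat n) \<longlongrightarrow> 0) (at_left 0)" using Lim_transform_eventually tendsto_const by blast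
  with r show ?thesis by (simp add: filterlim_split_at)
qed

lemma flat_deriv: "(flat n has_real_derivative flat (n + 2) t - real n * flat (n + 1) t) (at t)"
proof -
  consider "t > 0" | "t < 0" | "t = 0" by linarith
  then show ?thesis
  proof cases
    case 1
    have "((\<lambda>t. exp (- (1 / t)) / t ^ n) has_real_derivative
        flat (n + 2) t - real n * flat (n + 1) t) (at t)"
      using 1 by (auto intro!: derivative_eq_intros simp: flat_def field_simps power2_eq_square)
        (cases n; simp add: field_simps)
    then show ?thesis
      by (rule DERIV_cong_ev[THEN iffD1, OF refl _ refl, rotated])
        (use 1 in \<open>auto simp: flat_def intro!: eventually_mono[OF eventually_nhds_in_open[of "{0<..}"]]\<close>)
  next
    case 2
    have "((\<lambda>t. 0) has_real_derivative
        flat (n + 2) t - real n * flat (n + 1) t) (at t)"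
      using 2 by (auto intro!: derivative_eq_intros simp: flat_def)
    then show ?thesis
      by (rule DERIV_cong_ev[THEN iffD1, OF refl _ refl, rotated])
        (use 2 in \<open>auto simp: flat_def intro!: eventually_mono[OF eventually_nhds_in_open[of "{..<0}"]]\<close>)
  next
    case 3
    \<comment> \<open>Since \<open>flat n 0 = 0\<close>, the difference quotient at 0 is again a
      member of the family, so its limit is known.\<close>
    have eq: "flat (n + 1) t = (flat n t - flat n 0) / (t - 0)" for t
      by (auto simp: flat_def)
    have "(\<lambda>h. (flat n h - flat n 0) / (h - 0)) \<midarrow>0\<rightarrow> 0"
      using flat_tendsto[of "n + 1"] unfolding eq .
    then have "(flat n has_real_derivative 0) (at 0)"
      by (simp add: has_field_derivative_iff)
    then show ?thesis using 3 by (simp add: flat_def)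
  qed
qed

lemma Ck_real_flat: "Ck_real k (flat n)"
proof (induction k arbitrary: n)
  case 0
  show ?case using flat_deriv DERIV_isCont continuous_at_imp_continuous_on by (metis Ck_real.simps(1))
next
  case (Suc k)
  have "Ck_real k (\<lambda>t. flat (n + 2) t + (- real n) * flat (n + 1) t)"
    by (intro Ck_real_add Ck_real_mult Ck_real_const Suc)
  then show ?case using flat_deriv[of n]
    by (auto intro!: exI[of _ "\<lambda>t. flat (n + 2) t + (- real n) * flat (n + 1) t"])
qed

abbreviation bump :: "real \<Rightarrow> real" where "bump \<equiv> flat 0"

lemma bump_simps: "t \<le> 0 \<Longrightarrow> bump t = 0" "t > 0 \<Longrightarrow> bump t > 0" "0 \<le> bump t" "bump t \<le> 1"
  by (auto simp: flat_def)

text \<open>For \<open>t > 0\<close> the value is exp(-1/(n t)) as soon as n is positive. These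
  smooth cut-offs tend to the indicator of the positive half-line; a product of two of them cuts out
  an interval in \<open>radial_potential_exists\<close>.\<close>

lemma bump_scaled_tendsto: "(\<lambda>n. bump (real n * t)) \<longlonglongrightarrow> (if t > 0 then 1 else 0)"
proof (cases "t > 0")
  case True
  have "(\<lambda>n. exp (- (1 / t) * (1 / real n))) \<longlonglongrightarrow> exp (- (1 / t) * 0)"
    by (intro tendsto_intros lim_1_over_n)
  moreover have "eventually (\<lambda>n. exp (- (1 / t) * (1 / real n)) = bump (real n * t)) sequentially"
    using eventually_gt_at_top[of 0] by eventually_elim (use True in \<open>auto simp: flat_def field_simps\<close>)
  ultimately show ?thesis using True Lim_transform_eventually by fastforce
next
  case False
  then have "bump (real n * t) = 0" for n
    by (intro bump_simps) (simp add: mult_nonneg_nonpos)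
  then show ?thesis using False by simp
qed

section \<open>Smooth radial functions\<close>

lemma GDERIV_radial:
  assumes "(P has_real_derivative P') (at (x \<bullet> x))"
  shows "GDERIV (\<lambda>x::R3. P (x \<bullet> x)) x :> (2 * P') *\<^sub>R x"
proof -
  have "GDERIV (\<lambda>x::R3. x \<bullet> x) x :> 2 *\<^sub>R x" unfolding gderiv_def
    by (auto intro!: derivative_eq_intros simp: inner_commute)
  from GDERIV_DERIV_compose[OF this assms] show ?thesis by (simp add: mult.commute)
qed

text \<open>The profile is a function of \<open>x \<bullet> x\<close>, a polynomial, and not of
  \<open>norm x\<close>, so that the origin is not exceptional. The factor 2 from differentiating
  \<open>x \<bullet> x\<close> reappears in every radial gradient below.\<close>

lemma Ck_radial: "Ck_real k P \<Longrightarrow> Ck k (\<lambda>x. P (x \<bullet> x))"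
proof (induction k arbitrary: P)
  case 0
  then show ?case
    unfolding Ck_real.simps Ck.simps by (rule continuous_on_UNIV_compose[of P]) (auto intro!: continuous_intros)
next
  case (Suc k)
  then obtain P' where P': "\<forall>x. (P has_real_derivative P' x) (at x)" "Ck_real k P'" by auto
  have "Ck k (\<lambda>x. ((2 * P' (x \<bullet> x)) *\<^sub>R x) $ i)" for i
    using Suc.IH[OF P'(2)] by (auto intro!: Ck_mult Ck_const Ck_nth)
  then show ?case using P'(1) GDERIV_radial unfolding Ck.simps
    by (intro exI[of _ "\<lambda>x. (2 * P' (x \<bullet> x)) *\<^sub>R x"]) auto
qed

section \<open>Algebra of test functions\<close>

lemma test_functionI:
  assumes "\<And>k. Ck k f" "\<And>x. norm x > R \<Longrightarrow> f x = 0"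
  shows "test_function f"
proof -
  have "{x. f x \<noteq> 0} \<subseteq> cball 0 R" using assms(2) by (force simp: not_less)
  then have "bounded {x. f x \<noteq> 0}" by (rule bounded_subset[OF bounded_cball])
  then show ?thesis unfolding test_function_def using assms(1) by (simp add: compact_closure)
qed

lemma test_functionD:
  assumes "test_function f"
  shows "Ck k f" "GDERIV f x :> grad f x" "continuous_on UNIV f" "Ck k (\<lambda>x. grad f x $ i)"
    "continuous_on UNIV (grad f)"
proof -
  show 1: "Ck k f" "GDERIV f x :> grad f x" "Ck k (\<lambda>x. grad f x $ i)" for k i x
    using assms Ck_Suc unfolding test_function_def by blast+
  show "continuous_on UNIV f" using 1(1)[of 0] by simp
  have "continuous_on UNIV (\<lambda>x. \<chi> i. grad f x $ i)"
    using Ck_continuous[OF 1(3)] by (intro continuous_on_vec_lambda) auto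
  then show "continuous_on UNIV (grad f)" by simp
qed

lemma grad_eq_0_outside:
  assumes "\<And>x. norm x > R \<Longrightarrow> f x = 0" "norm x > R"
  shows "grad f x = 0"
proof -
  have "open {x::R3. norm x > R}" by (intro open_Collect_less continuous_intros)
  then have "eventually (\<lambda>y. f y = 0) (nhds x)"
    using assms by (auto simp: eventually_nhds)
  moreover have "((\<lambda>y. 0) has_derivative (\<lambda>h. h \<bullet> (0::R3))) (at x)" by simp
  ultimately have "(f has_derivative (\<lambda>h. h \<bullet> 0)) (at x)"
    by (subst has_derivative_transform_eventually[of "\<lambda>y. 0" _ x UNIV])
       (auto simp: eventually_at_filter eventually_mono dest: eventually_nhds_x_imp_x elim: eventually_mono)
  then show ?thesis by (intro grad_eq) (simp add: gderiv_def)
qed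

lemma test_function_support:
  assumes "test_function f"
  obtains R where "R > 0" "\<And>x. norm x > R \<Longrightarrow> f x = 0" "\<And>x. norm x > R \<Longrightarrow> grad f x = 0"
proof -
  have "bounded {x. f x \<noteq> 0}"
    using assms closure_subset bounded_subset compact_imp_bounded unfolding test_function_def by metis
  then obtain R where "\<forall>x\<in>{x. f x \<noteq> 0}. norm x \<le> R" "R > 0" unfolding bounded_pos by auto
  then have "\<And>x. norm x > R \<Longrightarrow> f x = 0" by force
  then show ?thesis using that \<open>R > 0\<close> grad_eq_0_outside by blast
qed

lemma test_function_mult:
  assumes "test_function f" "\<And>k. Ck k g"
  shows "test_function (\<lambda>x. f x * g x)"
proof -
  obtain R where "\<And>x. norm x > R \<Longrightarrow> f x = 0" using test_function_support[OF assms(1)] by metis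
  then show ?thesis
    by (intro test_functionI[of _ R] Ck_mult test_functionD[OF assms(1)] assms) auto
qed

lemma test_function_grad_nth:
  assumes "test_function f"
  shows "test_function (\<lambda>x. grad f x $ i)"
proof -
  obtain R where "\<And>x. norm x > R \<Longrightarrow> grad f x = 0" using test_function_support[OF assms] by metis
  then show ?thesis
    by (intro test_functionI[of _ R] test_functionD[OF assms]) auto
qed

lemma test_function_add:
  assumes "test_function f" "test_function g"
  shows "test_function (\<lambda>x. f x + g x)"
proof -
  obtain R where "\<And>x. norm x > R \<Longrightarrow> f x = 0" using test_function_support[OF assms(1)] by metis
  moreover obtain S where "\<And>x. norm x > S \<Longrightarrow> g x = 0" using test_function_support[OF assms(2)] by metis
  ultimately show ?thesis
    by (intro test_functionI[of _ "max R S"] Ck_add assms[THEN test_functionD(1)]) auto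
qed

lemma test_function_cmult: "test_function f \<Longrightarrow> test_function (\<lambda>x. c * f x)"
  using test_function_mult[of f "\<lambda>x. c"] Ck_const by (simp add: mult.commute)

lemma grad_add: "test_function f \<Longrightarrow> test_function g \<Longrightarrow> grad (\<lambda>x. f x + g x) x = grad f x + grad g x"
  by (intro grad_eq GDERIV_add test_functionD)

lemma grad_cmult: "test_function f \<Longrightarrow> grad (\<lambda>x. c * f x) x = c *\<^sub>R grad f x"
  using GDERIV_mult[OF GDERIV_const[of c x] test_functionD(2)[of f x]] by (intro grad_eq) auto

lemma grad_mult:
  assumes "test_function f" "\<And>k. Ck k g"
  shows "grad (\<lambda>x. f x * g x) x = f x *\<^sub>R grad g x + g x *\<^sub>R grad f x"
proof -
  have "GDERIV g x :> grad g x" using assms(2)[of "Suc 0"] Ck_Suc by blast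
  then show ?thesis by (intro grad_eq GDERIV_mult test_functionD[OF assms(1)])
qed

text \<open>The lower bound on \<open>norm (g x)\<close> keeps the support bounded; for orthogonal
  maps and translations \<open>r\<close> is 1.\<close>

lemma test_function_linear_compose:
  assumes "test_function f" "linear g" "\<And>x. r * norm x \<le> norm (g x)" "r > 0"
  shows "test_function (\<lambda>x. f (g x + c))"
proof -
  obtain R where R: "R > 0" "\<And>x. norm x > R \<Longrightarrow> f x = 0" using test_function_support[OF assms(1)] by metis
  show ?thesis
  proof (rule test_functionI)
    show "Ck k (\<lambda>x. f (g x + c))" for k
      by (intro Ck_linear_compose assms test_functionD)
    show "f (g x + c) = 0" if "norm x > (R + norm c) / r" for x
    proof (rule R(2))
      have "R + norm c < r * norm x" using that \<open>r > 0\<close> by (simp add: field_simps)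
      also have "\<dots> \<le> norm (g x)" by (rule assms)
      also have "\<dots> \<le> norm (g x + c) + norm c" by (metis add.commute add_diff_cancel norm_triangle_ineq4)
      finally show "R < norm (g x + c)" by simp
    qed
  qed
qed

lemma grad_linear_compose:
  assumes "test_function f" "linear g"
  shows "grad (\<lambda>x. f (g x + c)) x = adjoint g (grad f (g x + c))"
  by (intro grad_eq GDERIV_linear_compose assms test_functionD)

text \<open>For \<open>c > 0\<close> the function is positive exactly where
  \<open>x \<bullet> x < R\<close>. Thus \<open>R\<close> is the square of a radius, and the
  function is a smooth radial cut-off for a ball.\<close>

lemma test_function_radial_bump: "test_function (\<lambda>x::R3. bump (c * (R - x \<bullet> x)))" if "c \<ge> 0"
proof (rule test_functionI)
  have "Ck_real k (\<lambda>t. bump ((- c) * t + c * R))" for k by (intro Ck_real_affine_compose Ck_real_flat)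
  then have "Ck k (\<lambda>x. bump ((- c) * (x \<bullet> x) + c * R))" for k by (rule Ck_radial)
  then show "Ck k (\<lambda>x. bump (c * (R - x \<bullet> x)))" for k by (simp add: algebra_simps)
  \<comment> \<open>The radius \<open>1 + \<bar>R\<bar>\<close> is safe for every real
    \<open>R\<close>, since its square is at least \<open>R\<close>.\<close>
  show "bump (c * (R - x \<bullet> x)) = 0" if "norm x > 1 + \<bar>R\<bar>" for x :: R3
  proof (rule bump_simps)
    have "1 + \<bar>R\<bar> \<le> (1 + \<bar>R\<bar>) * (1 + \<bar>R\<bar>)" by (simp add: algebra_simps)
    also have "\<dots> \<le> norm x * norm x" using that by (intro mult_mono) auto
    also have "\<dots> = x \<bullet> x" by (simp add: power2_norm_eq_inner[symmetric] power2_eq_square)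
    finally show "c * (R - x \<bullet> x) \<le> 0" using \<open>c \<ge> 0\<close> by (intro mult_nonneg_nonpos) auto
  qed
qed

section \<open>Lebesgue integration on $R^3$\<close>

definition measure_preserving :: "(R3 \<Rightarrow> R3) \<Rightarrow> bool" where
  "measure_preserving T \<longleftrightarrow> T \<in> lebesgue \<rightarrow>\<^sub>M lebesgue \<and> distr lebesgue lebesgue T = lebesgue"

text \<open>Invariance is checked on Borel sets and passes to the completion: \<open>T\<close> pulls
  null sets back to null sets, and the image of the completed measure is the completion of the
  image.\<close>

lemma measure_preservingI:
  assumes T [measurable]: "T \<in> borel \<rightarrow>\<^sub>M borel" and "distr lborel borel T = lborel"
  shows "measure_preserving T"
proof -
  have d: "distr lebesgue lborel T = lborel"
    using assms by (simp add: distr_completion cong: distr_cong)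
  have eq: "null_sets lborel = null_sets (distr lebesgue lborel T)" using d by simp
  have 1: "T \<in> lebesgue \<rightarrow>\<^sub>M lebesgue"
    by (simp add: completion.measurable_completion2 eq measurable_completion)
  have "lebesgue = completion (distr lebesgue lborel T)" using d by simp
  also have "\<dots> = distr lebesgue lebesgue T"
    by (subst completion.completion_distr_eq) (auto simp: eq measurable_completion)
  finally show ?thesis using 1 unfolding measure_preserving_def by simp
qed

lemma measure_preserving_translation: "measure_preserving (\<lambda>x. x + c)"
proof (rule measure_preservingI)
  show "distr lborel borel (\<lambda>x. x + c) = lborel"
    using lborel_distr_plus[of c] by (simp add: add.commute[of _ c])
qed simp

text \<open>Lebesgue measure is determined by its values on boxes. The preimage of a box under
  \<open>g\<close> is its image under the inverse \<open>h\<close>, and orthogonal images keep their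
  measure.\<close>

lemma measure_preserving_orthogonal:
  fixes g :: "R3 \<Rightarrow> R3"
  assumes "orthogonal_transformation g"
  shows "measure_preserving g"
proof (rule measure_preservingI)
  have lin: "linear g" using assms orthogonal_transformation_linear by blast
  then have "continuous_on UNIV g" by (simp add: linear_continuous_on linear_conv_bounded_linear)
  then show m [measurable]: "g \<in> borel \<rightarrow>\<^sub>M borel" by (rule borel_measurable_continuous_onI)
  show "distr lborel borel g = lborel"
  proof (rule lborel_eqI[symmetric])
    show "sets (distr lborel borel g) = sets borel" by simp
    fix l u :: R3 assume lu: "\<And>b. b \<in> Basis \<Longrightarrow> l \<bullet> b \<le> u \<bullet> b"
    obtain h where h: "orthogonal_transformation h" "\<And>x. g (h x) = x" "\<And>x. h (g x) = x"
      using assms orthogonal_transformation_inv orthogonal_transformation_bij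
      by (metis bij_inv_eq_iff)
    have eq: "g -` box l u = h ` box l u" using h by (auto simp: image_iff) metis+
    have "emeasure (distr lborel borel g) (box l u) = emeasure lborel (h ` box l u)"
      by (subst emeasure_distr) (auto simp: eq)
    also have "\<dots> = emeasure lebesgue (h ` box l u)"
    proof -
      have "h ` box l u \<in> sets borel"
        using measurable_sets[OF m, of "box l u"] eq by simp
      then show ?thesis by simp
    qed
    also have "\<dots> = measure lebesgue (h ` box l u)"
      using measurable_orthogonal_image[OF h(1), of "box l u"] by (simp add: emeasure_eq_measure2 fmeasurableD2)
    also have "\<dots> = measure lebesgue (box l u)"
      using measure_orthogonal_image[OF h(1), of "box l u"] by simp
    also have "\<dots> = (\<Prod>b\<in>Basis. (u - l) \<bullet> b)" using lu by (simp add: measure_lborel_box_eq)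
    finally show "emeasure (distr lborel borel g) (box l u) = (\<Prod>b\<in>Basis. (u - l) \<bullet> b)" .
  qed
qed

lemma measure_preserving_measurable: "measure_preserving T \<Longrightarrow> T \<in> lebesgue \<rightarrow>\<^sub>M lebesgue"
  by (simp add: measure_preserving_def)

lemma measure_preserving_compose_measurable:
  "measure_preserving T \<Longrightarrow> f \<in> borel_measurable lebesgue \<Longrightarrow> (\<lambda>x. f (T x)) \<in> borel_measurable lebesgue"
  by (rule measurable_compose[OF measure_preserving_measurable])

lemma measure_preserving_AE:
  assumes "measure_preserving T" "AE x in lebesgue. P x"
  shows "AE x in lebesgue. P (T x)"
proof -
  have e: "distr lebesgue lebesgue T = lebesgue" using assms(1) by (simp add: measure_preserving_def)
  have "AE x in distr lebesgue lebesgue T. P x" unfolding e by (rule assms(2))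
  then show ?thesis by (rule AE_distrD[OF measure_preserving_measurable[OF assms(1)]])
qed

lemma measure_preserving_integral:
  fixes f :: "R3 \<Rightarrow> 'a::{banach,second_countable_topology}"
  assumes "measure_preserving T" "f \<in> borel_measurable lebesgue"
  shows "(LINT x|lebesgue. f (T x)) = (LINT x|lebesgue. f x)"
  using integral_distr[of T lebesgue lebesgue f] assms unfolding measure_preserving_def by simp

lemma measure_preserving_integrable:
  fixes f :: "R3 \<Rightarrow> 'a::{banach,second_countable_topology}"
  assumes "measure_preserving T" "integrable lebesgue f"
  shows "integrable lebesgue (\<lambda>x. f (T x))"
  using integrable_distr[of T lebesgue lebesgue f] assms unfolding measure_preserving_def by simp

lemma measure_preserving_nn_integral:
  assumes "measure_preserving T" "f \<in> borel_measurable lebesgue"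
  shows "(\<integral>\<^sup>+x. f (T x) \<partial>lebesgue) = (\<integral>\<^sup>+x. f x \<partial>lebesgue)"
  using nn_integral_distr[of T lebesgue lebesgue f] assms unfolding measure_preserving_def by simp

section \<open>Integrability of functions with bounded support\<close>

lemma continuous_imp_measurable_lebesgue:
  "continuous_on UNIV f \<Longrightarrow> f \<in> borel_measurable (lebesgue :: R3 measure)"
  by (intro measurable_completion) (simp add: borel_measurable_continuous_onI)

lemma integrable_indicator_cball:
  "integrable lebesgue (\<lambda>x::R3. indicat_real (cball 0 R) x *\<^sub>R (C::real))"
proof -
  have "integrable lebesgue (indicat_real (cball (0::R3) R))"
    using emeasure_lborel_cball_finite[of 0 R] by (intro integrable_real_indicator) auto
  then show ?thesis by (intro integrable_scaleR_left) auto
qed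

lemma integrable_bounded_support:
  fixes f :: "R3 \<Rightarrow> 'a::{banach,second_countable_topology}"
  assumes "f \<in> borel_measurable lebesgue" "AE x in lebesgue. norm (f x) \<le> C"
    "\<And>x. norm x > R \<Longrightarrow> f x = 0"
  shows "integrable lebesgue f"
proof (rule Bochner_Integration.integrable_bound[of _ "\<lambda>x. indicat_real (cball 0 R) x *\<^sub>R \<bar>C\<bar>"])
  show "integrable lebesgue (\<lambda>x::R3. indicat_real (cball 0 R) x *\<^sub>R \<bar>C\<bar>)"
    by (rule integrable_indicator_cball)
  show "AE x in lebesgue. norm (f x) \<le> norm (indicat_real (cball 0 R) x *\<^sub>R \<bar>C\<bar>)"
    using assms(2) by eventually_elim (use assms(3) in \<open>force simp: indicator_def not_less\<close>)
qed (rule assms)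

lemma continuous_bounded_support:
  fixes f :: "R3 \<Rightarrow> 'a::real_normed_vector"
  assumes "continuous_on UNIV f" "\<And>x. norm x > R \<Longrightarrow> f x = 0"
  obtains M where "M > 0" "\<And>x. norm (f x) \<le> M"
proof -
  have "compact (f ` cball 0 R)"
    using assms by (intro compact_continuous_image continuous_on_subset[OF assms(1)]) auto
  then obtain M where M: "M > 0" "\<And>y. y \<in> f ` cball 0 R \<Longrightarrow> norm y \<le> M"
    using compact_imp_bounded bounded_pos by metis
  have "norm (f x) \<le> M" for x
    using M assms(2)[of x] by (cases "norm x \<le> R") auto
  with M show ?thesis using that by blast
qed

lemma test_function_bounds:
  assumes "test_function f"
  obtains R M where "R > 0" "M > 0" "\<And>x. norm x > R \<Longrightarrow> f x = 0" "\<And>x. norm x > R \<Longrightarrow> grad f x = 0"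
    "\<And>x. \<bar>f x\<bar> \<le> M" "\<And>x. norm (grad f x) \<le> M"
proof -
  obtain R where R: "R > 0" "\<And>x. norm x > R \<Longrightarrow> f x = 0" "\<And>x. norm x > R \<Longrightarrow> grad f x = 0"
    using test_function_support[OF assms] by metis
  obtain M1 where M1: "M1 > 0" "\<And>x. norm (f x) \<le> M1"
    using continuous_bounded_support[OF test_functionD(3)[OF assms] R(2)] by metis
  obtain M2 where M2: "M2 > 0" "\<And>x. norm (grad f x) \<le> M2"
    using continuous_bounded_support[OF test_functionD(5)[OF assms] R(3)] by metis
  show ?thesis using R M1 M2 by (intro that[of R "max M1 M2"]) (auto simp: le_max_iff_disj)
qed

lemma integrable_continuous_bounded_support:
  fixes f :: "R3 \<Rightarrow> 'a::{banach,second_countable_topology}"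
  assumes "continuous_on UNIV f" "\<And>x. norm x > R \<Longrightarrow> f x = 0"
  shows "integrable lebesgue f"
proof -
  obtain M where "\<And>x. norm (f x) \<le> M" using continuous_bounded_support[OF assms] by metis
  then show ?thesis
    by (intro integrable_bounded_support[of f M R] continuous_imp_measurable_lebesgue assms) auto
qed

lemma test_function_integrable:
  assumes "test_function f"
  shows "integrable lebesgue f" "integrable lebesgue (grad f)"
    "f \<in> borel_measurable lebesgue" "grad f \<in> borel_measurable lebesgue"
proof -
  obtain R M where R: "\<And>x. norm x > R \<Longrightarrow> f x = 0" "\<And>x. norm x > R \<Longrightarrow> grad f x = 0"
    using test_function_bounds[OF assms] by metis
  show "integrable lebesgue f" "integrable lebesgue (grad f)"
    using integrable_continuous_bounded_support[OF test_functionD(3)[OF assms] R(1)]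
      integrable_continuous_bounded_support[OF test_functionD(5)[OF assms] R(2)] by auto
  then show "f \<in> borel_measurable lebesgue" "grad f \<in> borel_measurable lebesgue"
    by (auto intro: borel_measurable_integrable)
qed

section \<open>Mean value inequality and integration by parts for test functions\<close>

lemma gradient_bound_imp_Lipschitz:
  assumes "\<And>x. GDERIV f x :> D x" "\<And>x. norm (D x) \<le> M"
  shows "\<bar>f x - f y\<bar> \<le> M * norm (x - y :: R3)"
proof -
  have "norm (f x - f y) \<le> M * norm (x - y)"
  proof (rule differentiable_bound[of UNIV f "\<lambda>x h. h \<bullet> D x"])
    show "(f has_derivative (\<lambda>h. h \<bullet> D x)) (at x within UNIV)" for x
      using assms(1) by (simp add: gderiv_def)
    show "onorm (\<lambda>h. h \<bullet> D x) \<le> M" for x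
    proof (rule onorm_le)
      show "norm (h \<bullet> D x) \<le> M * norm h" for h
        using Cauchy_Schwarz_ineq2[of h "D x"] mult_right_mono[OF assms(2)[of x], of "norm h"]
        by (simp add: mult.commute)
    qed
  qed auto
  then show ?thesis by simp
qed

lemma difference_quotient_tendsto:
  assumes "GDERIV f x :> D"
  shows "(\<lambda>n. (f (x + (1 / real (Suc n)) *\<^sub>R e) - f x) * real (Suc n)) \<longlonglongrightarrow> e \<bullet> (D::R3)"
proof -
  have l: "((\<lambda>t. x + t *\<^sub>R e) has_derivative (\<lambda>t. t *\<^sub>R e)) (at 0)"
    by (auto intro!: derivative_eq_intros)
  have "((\<lambda>t. f (x + t *\<^sub>R e)) has_derivative (\<lambda>t. (t *\<^sub>R e) \<bullet> D)) (at 0)"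
    using has_derivative_compose[OF l, of f "\<lambda>h. h \<bullet> D"] assms unfolding gderiv_def by simp
  then have "((\<lambda>t. f (x + t *\<^sub>R e)) has_field_derivative (e \<bullet> D)) (at 0)"
    by (simp add: has_field_derivative_def mult_commute_abs)
  then have "((\<lambda>h. (f (x + h *\<^sub>R e) - f x) / h) \<longlongrightarrow> e \<bullet> D) (at 0)"
    by (simp add: has_field_derivative_iff)
  moreover have "filterlim (\<lambda>n. 1 / real (Suc n)) (at 0) sequentially"
    unfolding filterlim_at using LIMSEQ_inverse_real_of_nat
    by (auto simp: inverse_eq_divide intro!: always_eventually)
  ultimately have "(\<lambda>n. (f (x + (1 / real (Suc n)) *\<^sub>R e) - f x) / (1 / real (Suc n))) \<longlonglongrightarrow> e \<bullet> D"
    by (rule filterlim_compose)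
  then show ?thesis by simp
qed

text \<open>Difference quotients of \<open>f\<close> integrate to 0 by translation invariance, and
  they converge dominatedly to the directional derivative.\<close>

lemma integral_grad_eq_0:
  assumes "test_function f"
  shows "(LINT x|lebesgue. grad f x) = 0"
proof -
  obtain R M where R: "R > 0" "M > 0" "\<And>x. norm x > R \<Longrightarrow> f x = 0" "\<And>x. norm (grad f x) \<le> M"
    using test_function_bounds[OF assms] by metis
  note [measurable] = test_function_integrable(3,4)[OF assms]
  have "(LINT x|lebesgue. e \<bullet> grad f x) = 0" for e
  proof -
    define q where "q n x = (f (x + (1 / real (Suc n)) *\<^sub>R e) - f x) * real (Suc n)" for n x
    have m1 [measurable]: "(\<lambda>x. f (x + c)) \<in> borel_measurable lebesgue" for c
      by (rule measure_preserving_compose_measurable[OF measure_preserving_translation]) measurable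
    have m: "q n \<in> borel_measurable lebesgue" for n
      unfolding q_def by measurable
    have zero: "(LINT x|lebesgue. q n x) = 0" for n
    proof -
      have "integrable lebesgue (\<lambda>x. f (x + (1 / real (Suc n)) *\<^sub>R e))"
        by (rule measure_preserving_integrable[OF measure_preserving_translation test_function_integrable(1)[OF assms]])
      moreover have "(LINT x|lebesgue. f (x + (1 / real (Suc n)) *\<^sub>R e)) = (LINT x|lebesgue. f x)"
        by (rule measure_preserving_integral[OF measure_preserving_translation]) measurable
      ultimately show ?thesis unfolding q_def using test_function_integrable(1)[OF assms] by simp
    qed
    have "(\<lambda>n. LINT x|lebesgue. q n x) \<longlonglongrightarrow> (LINT x|lebesgue. e \<bullet> grad f x)"
    \<comment> \<open>The shifts have length at most \<open>norm e\<close>, so all quotients live in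
      the ball of radius \<open>R + norm e\<close>; the mean value inequality bounds them by
      \<open>M * norm e\<close>.\<close>
    proof (rule integral_dominated_convergence[where w = "\<lambda>x. indicat_real (cball 0 (R + norm e)) x *\<^sub>R (M * norm e)"])
      show "integrable lebesgue (\<lambda>x::R3. indicat_real (cball 0 (R + norm e)) x *\<^sub>R (M * norm e))"
        by (rule integrable_indicator_cball)
      show "AE x in lebesgue. (\<lambda>n. q n x) \<longlonglongrightarrow> e \<bullet> grad f x"
        unfolding q_def by (intro AE_I2 difference_quotient_tendsto test_functionD assms)
      show "AE x in lebesgue. norm (q n x) \<le> indicat_real (cball 0 (R + norm e)) x *\<^sub>R (M * norm e)" for n
      proof (rule AE_I2)
        fix x :: R3
        have le: "norm ((1 / real (Suc n)) *\<^sub>R e) \<le> norm e" by (simp add: field_simps mult_left_le)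
        show "norm (q n x) \<le> indicat_real (cball 0 (R + norm e)) x *\<^sub>R (M * norm e)"
        proof (cases "norm x \<le> R + norm e")
          case True
          have "\<bar>f (x + (1 / real (Suc n)) *\<^sub>R e) - f x\<bar> \<le> M * norm ((x + (1 / real (Suc n)) *\<^sub>R e) - x)"
            by (rule gradient_bound_imp_Lipschitz[OF test_functionD(2)[OF assms] R(4)])
          then have "\<bar>f (x + (1 / real (Suc n)) *\<^sub>R e) - f x\<bar> * real (Suc n) \<le> M * norm e"
            by (simp add: field_simps)
          then show ?thesis using True by (simp add: q_def abs_mult)
        next
          case False
          have "norm x \<le> norm (x + (1 / real (Suc n)) *\<^sub>R e) + norm ((1 / real (Suc n)) *\<^sub>R e)"
            using norm_triangle_ineq4[of "x + (1 / real (Suc n)) *\<^sub>R e" "(1 / real (Suc n)) *\<^sub>R e"] by simp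
          then have "norm (x + (1 / real (Suc n)) *\<^sub>R e) > R" using False le by linarith
          moreover have "norm x > R" using False norm_ge_zero[of e] by linarith
          ultimately show ?thesis using False R(3) by (simp add: q_def)
        qed
      qed
    qed (use m in \<open>auto\<close>)
    then show ?thesis using zero LIMSEQ_unique[OF _ tendsto_const] by simp
  qed
  \<comment> \<open>Taking \<open>e\<close> to be the integral itself makes its squared norm
    vanish.\<close>
  from this[of "LINT x|lebesgue. grad f x"] show ?thesis
    using integral_inner_right[of "LINT x|lebesgue. grad f x" lebesgue "grad f"] test_function_integrable(2)[OF assms]
    by simp
qed

text \<open>The gradient of the product of \<open>u\<close> and \<open>v\<close> integrates to 0;
  the product inherits compact support from \<open>u\<close>.\<close>

lemma integral_by_parts:
  assumes "test_function u" "\<And>k. Ck k v"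
  shows "(LINT x|lebesgue. v x *\<^sub>R grad u x) = - (LINT x|lebesgue. u x *\<^sub>R grad v x)"
proof -
  obtain R where R: "\<And>x. norm x > R \<Longrightarrow> u x = 0" "\<And>x. norm x > R \<Longrightarrow> grad u x = 0"
    using test_function_bounds[OF assms(1)] by metis
  have c: "continuous_on UNIV v" "continuous_on UNIV (grad v)"
  proof -
    show "continuous_on UNIV v" using assms(2)[of 0] by simp
    have "\<And>i. continuous_on UNIV (\<lambda>x. grad v x $ i)"
      using assms(2)[of "Suc 0"] Ck_Suc[of 0 v] by simp
    then have "continuous_on UNIV (\<lambda>x. \<chi> i. grad v x $ i)" by (intro continuous_on_vec_lambda) auto
    then show "continuous_on UNIV (grad v)" by simp
  qed
  have 1: "integrable lebesgue (\<lambda>x. v x *\<^sub>R grad u x)"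
    by (rule integrable_continuous_bounded_support[of _ R])
       (auto intro!: continuous_intros c test_functionD assms simp: R)
  have 2: "integrable lebesgue (\<lambda>x. u x *\<^sub>R grad v x)"
    by (rule integrable_continuous_bounded_support[of _ R])
       (auto intro!: continuous_intros c test_functionD assms simp: R)
  have "0 = (LINT x|lebesgue. grad (\<lambda>x. u x * v x) x)"
    using integral_grad_eq_0[OF test_function_mult[OF assms]] by simp
  also have "\<dots> = (LINT x|lebesgue. u x *\<^sub>R grad v x + v x *\<^sub>R grad u x)"
    by (simp add: grad_mult[OF assms])
  also have "\<dots> = (LINT x|lebesgue. u x *\<^sub>R grad v x) + (LINT x|lebesgue. v x *\<^sub>R grad u x)"
    by (rule Bochner_Integration.integral_add[OF 2 1])
  finally show ?thesis by (simp add: eq_neg_iff_add_eq_0 add.commute)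
qed

section \<open>Local integrability and the fundamental lemma of the calculus of variations\<close>

lemma compact_subset_cball:
  fixes K :: "'a::euclidean_space set"
  assumes "compact K"
  obtains R where "K \<subseteq> cball 0 R"
proof -
  obtain a where "\<forall>x\<in>K. norm x \<le> a"
    using compact_imp_bounded[OF assms] unfolding bounded_iff by blast
  then show ?thesis by (intro that[of a]) auto
qed

text \<open>Lebesgue measurable functions are limits of continuous ones off a negligible set.
  Clamping these to the interval from \<open>- C\<close> to \<open>C\<close> keeps the limit,
  because the limit obeys the bound already.\<close>

lemma measurable_imp_AE_limit_continuous:
  fixes s :: "R3 \<Rightarrow> real"
  assumes "s \<in> borel_measurable lebesgue" "\<And>x. \<bar>s x\<bar> \<le> C"
  obtains c :: "nat \<Rightarrow> R3 \<Rightarrow> real" where "\<And>n. continuous_on UNIV (c n)" "\<And>n x. \<bar>c n x\<bar> \<le> C"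
    "AE x in lebesgue. (\<lambda>n. c n x) \<longlonglongrightarrow> s x"
proof -
  have "s measurable_on UNIV"
    using lebesgue_measurable_imp_measurable_on[OF assms(1), of UNIV] by simp
  then obtain N g where g: "negligible N" "\<And>n. continuous_on UNIV (g n)"
    "\<And>x. x \<notin> N \<Longrightarrow> (\<lambda>n. g n x) \<longlonglongrightarrow> s x"
    unfolding measurable_on_def by auto
  have C: "C \<ge> 0" using assms(2)[of 0] by linarith
  show ?thesis
  proof (rule that[of "\<lambda>n x. max (- C) (min C (g n x))"])
    show "continuous_on UNIV (\<lambda>x. max (- C) (min C (g n x)))" for n
      by (intro continuous_intros g)
    show "\<bar>max (- C) (min C (g n x))\<bar> \<le> C" for n x using C by auto
    have N: "N \<in> null_sets lebesgue" using g(1) by (simp add: negligible_iff_null_sets)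
    show "AE x in lebesgue. (\<lambda>n. max (- C) (min C (g n x))) \<longlonglongrightarrow> s x"
    proof (rule AE_I'[OF N], rule subsetI)
      fix x assume *: "x \<in> {x \<in> space lebesgue. \<not> (\<lambda>n. max (- C) (min C (g n x))) \<longlonglongrightarrow> s x}"
      show "x \<in> N"
      proof (rule ccontr)
        assume "x \<notin> N"
        then have "(\<lambda>n. max (- C) (min C (g n x))) \<longlonglongrightarrow> max (- C) (min C (s x))"
          by (intro tendsto_intros g)
        moreover have "max (- C) (min C (s x)) = s x" using assms(2)[of x] by auto
        ultimately show False using * by simp
      qed
    qed
  qed
qed

lemma locally_integrable_measurable:
  fixes f :: "R3 \<Rightarrow> 'a::euclidean_space"
  assumes "locally_integrable f"
  shows "f \<in> borel_measurable lebesgue"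
proof (rule borel_measurable_LIMSEQ_metric)
  show "(\<lambda>x. indicat_real (cball 0 (real n)) x *\<^sub>R f x) \<in> borel_measurable lebesgue" for n
    using assms compact_cball unfolding locally_integrable_def set_integrable_def
    by (intro borel_measurable_integrable) blast
  show "(\<lambda>n. indicat_real (cball 0 (real n)) x *\<^sub>R f x) \<longlonglongrightarrow> f x" for x
  proof (rule tendsto_eventually)
    obtain N :: nat where "norm x \<le> real N" using real_arch_simple by blast
    then show "eventually (\<lambda>n. indicat_real (cball 0 (real n)) x *\<^sub>R f x = f x) sequentially"
      by (intro eventually_mono[OF eventually_ge_at_top[of N]]) (auto simp: indicator_def)
  qed
qed

lemma locally_integrable_cball:
  "locally_integrable f \<Longrightarrow> integrable lebesgue (\<lambda>x. indicat_real (cball 0 R) x *\<^sub>R f x)"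
  unfolding locally_integrable_def set_integrable_def by (metis compact_cball)

lemma integrable_locally_bounded:
  fixes f :: "R3 \<Rightarrow> 'a::euclidean_space"
  assumes "locally_integrable f" "\<psi> \<in> borel_measurable lebesgue" "\<And>x. \<bar>\<psi> x\<bar> \<le> M"
    "\<And>x. norm x > R \<Longrightarrow> \<psi> x = 0"
  shows "integrable lebesgue (\<lambda>x. \<psi> x *\<^sub>R f x)"
proof (rule Bochner_Integration.integrable_bound)
  show "integrable lebesgue (\<lambda>x. M *\<^sub>R (indicat_real (cball 0 R) x *\<^sub>R f x))"
    by (intro integrable_scaleR_right locally_integrable_cball assms)
  note [measurable] = assms(2) locally_integrable_measurable[OF assms(1)]
  show "(\<lambda>x. \<psi> x *\<^sub>R f x) \<in> borel_measurable lebesgue" by measurable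
  have M: "M \<ge> 0" using assms(3)[of 0] by linarith
  show "AE x in lebesgue. norm (\<psi> x *\<^sub>R f x) \<le> norm (M *\<^sub>R (indicat_real (cball 0 R) x *\<^sub>R f x))"
    using M assms(3,4) by (intro AE_I2) (auto simp: indicator_def mult_right_mono not_le)
qed

lemma locally_integrableI:
  fixes f :: "R3 \<Rightarrow> 'a::euclidean_space"
  assumes "f \<in> borel_measurable lebesgue" "integrable lebesgue (\<lambda>x. (norm (f x))\<^sup>2)"
  shows "locally_integrable f"
  unfolding locally_integrable_def set_integrable_def
proof (intro allI impI)
  fix K :: "R3 set" assume K: "compact K"
  then obtain R where R: "K \<subseteq> cball 0 R" using compact_subset_cball by metis
  have "K \<in> sets lebesgue" using K by (simp add: borel_compact)
  note [measurable] = this assms(1)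
  show "integrable lebesgue (\<lambda>x. indicat_real K x *\<^sub>R f x)"
  proof (rule Bochner_Integration.integrable_bound)
    show "integrable lebesgue (\<lambda>x. indicat_real (cball 0 R) x *\<^sub>R (1::real) + (norm (f x))\<^sup>2)"
      by (intro Bochner_Integration.integrable_add integrable_indicator_cball assms)
    show "AE x in lebesgue. norm (indicat_real K x *\<^sub>R f x)
        \<le> norm (indicat_real (cball 0 R) x *\<^sub>R (1::real) + (norm (f x))\<^sup>2)"
    proof (intro AE_I2)
      fix x
      have "norm (f x) \<le> 1 + (norm (f x))\<^sup>2"
        using zero_le_power2[of "norm (f x) - 1 / 2"] by (simp add: power2_eq_square algebra_simps)
      then show "norm (indicat_real K x *\<^sub>R f x)
        \<le> norm (indicat_real (cball 0 R) x *\<^sub>R (1::real) + (norm (f x))\<^sup>2)"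
        using R by (auto simp: indicator_def)
    qed
  qed measurable
qed

lemma continuous_locally_integrable:
  fixes f :: "R3 \<Rightarrow> 'a::euclidean_space"
  assumes "continuous_on UNIV f"
  shows "locally_integrable f"
  unfolding locally_integrable_def
proof (intro allI impI)
  fix K :: "R3 set" assume K: "compact K"
  have "set_integrable lborel K f"
    using borel_integrable_compact[OF K continuous_on_subset[OF assms]] by (simp add: set_integrable_def)
  then have i: "integrable lborel (\<lambda>x. indicat_real K x *\<^sub>R f x)" by (simp add: set_integrable_def)
  show "set_integrable lebesgue K f"
    unfolding set_integrable_def
    using i integrable_completion[OF borel_measurable_integrable[OF i]] by simp
qed

lemma locally_integrable_add:
  fixes f :: "R3 \<Rightarrow> 'a::euclidean_space"
  assumes "locally_integrable f" "locally_integrable g"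
  shows "locally_integrable (\<lambda>x. f x + g x)"
  using assms unfolding locally_integrable_def set_integrable_def by (simp add: scaleR_add_right)

lemma locally_integrable_scaleR:
  fixes f :: "R3 \<Rightarrow> 'a::euclidean_space"
  assumes "locally_integrable f"
  shows "locally_integrable (\<lambda>x. c *\<^sub>R f x)"
  unfolding locally_integrable_def set_integrable_def
proof (intro allI impI)
  fix K :: "R3 set" assume "compact K"
  then have "integrable lebesgue (\<lambda>x. c *\<^sub>R (indicat_real K x *\<^sub>R f x))"
    using assms unfolding locally_integrable_def set_integrable_def by (intro integrable_scaleR_right) auto
  then show "integrable lebesgue (\<lambda>x. indicat_real K x *\<^sub>R c *\<^sub>R f x)"
    by (subst scaleR_left_commute)
qed

lemma locally_integrable_inner:
  fixes f :: "R3 \<Rightarrow> 'a::euclidean_space"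
  assumes "locally_integrable f"
  shows "locally_integrable (\<lambda>x. f x \<bullet> b)"
  unfolding locally_integrable_def set_integrable_def
proof (intro allI impI)
  fix K :: "R3 set" assume "compact K"
  then have "integrable lebesgue (\<lambda>x. (indicat_real K x *\<^sub>R f x) \<bullet> b)"
    using assms unfolding locally_integrable_def set_integrable_def by (intro integrable_inner_left) auto
  then show "integrable lebesgue (\<lambda>x. indicat_real K x *\<^sub>R (f x \<bullet> b))" by simp
qed

text \<open>If \<open>sgn g\<close> times a cut-off were admissible as a test function, the modulus
  of \<open>g\<close> would have local integral 0. So \<open>sgn g\<close> is approximated a.e. by
  continuous functions, and these on a ball by polynomials, which become test functions after
  multiplication by a bump.\<close>

lemma real_fundamental_lemma:
  fixes g :: "R3 \<Rightarrow> real"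
  assumes li: "locally_integrable g"
    and z: "\<And>\<psi>. test_function \<psi> \<Longrightarrow> (LINT x|lebesgue. \<psi> x * g x) = 0"
  shows "AE x in lebesgue. g x = 0"
proof -
  note [measurable] = locally_integrable_measurable[OF li]
  have "(\<lambda>x. sgn (g x)) \<in> borel_measurable lebesgue" unfolding sgn_if by measurable
  moreover have "\<And>x. \<bar>sgn (g x)\<bar> \<le> 1" by (simp add: sgn_if)
  ultimately obtain c :: "nat \<Rightarrow> R3 \<Rightarrow> real" where c: "\<And>n. continuous_on UNIV (c n)" "\<And>n x. \<bar>c n x\<bar> \<le> 1"
    "AE x in lebesgue. (\<lambda>n. c n x) \<longlonglongrightarrow> sgn (g x)"
    by (rule measurable_imp_AE_limit_continuous) blast
  have "AE x in lebesgue. norm x < real R \<longrightarrow> g x = 0" for R :: nat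
  proof -
    \<comment> \<open>Approximation on the ball suffices, since the cut-off \<open>\<kappa>\<close>
      vanishes outside it.\<close>
    have "\<exists>p. real_polynomial_function p \<and> (\<forall>x\<in>cball 0 (real R). \<bar>c n x - p x\<bar> < 1 / real (Suc n))" for n
    proof -
      have "continuous_on (cball 0 (real R)) (c n)" by (rule continuous_on_subset[OF c(1)]) simp
      moreover have "1 / real (Suc n) > 0" by simp
      ultimately obtain p where "real_polynomial_function p"
        "\<And>x. x \<in> cball 0 (real R) \<Longrightarrow> \<bar>c n x - p x\<bar> < 1 / real (Suc n)"
        by (rule Stone_Weierstrass_real_polynomial_function[OF compact_cball]) blast
      then show ?thesis by blast
    qed
    then obtain p where p: "\<And>n. real_polynomial_function (p n)"
      "\<And>n x. x \<in> cball 0 (real R) \<Longrightarrow> \<bar>c n x - p n x\<bar> < 1 / real (Suc n)" by metis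
    define \<kappa> where "\<kappa> x = bump (1 * ((real R)\<^sup>2 - x \<bullet> x))" for x :: R3
    have \<kappa>: "test_function \<kappa>" unfolding \<kappa>_def by (rule test_function_radial_bump) simp
    have \<kappa>b: "0 \<le> \<kappa> x" "\<kappa> x \<le> 1" for x by (auto simp: \<kappa>_def bump_simps)
    have \<kappa>0: "\<kappa> x = 0" if "norm x > real R" for x
    proof -
      have "(real R)\<^sup>2 \<le> (norm x)\<^sup>2" using that by (intro power_mono) auto
      then show ?thesis by (simp add: \<kappa>_def bump_simps power2_norm_eq_inner)
    qed
    have \<kappa>1: "\<kappa> x > 0" if "norm x < real R" for x
    proof -
      have "(norm x)\<^sup>2 < (real R)\<^sup>2" using that by (intro power_strict_mono) auto
      then show ?thesis by (simp add: \<kappa>_def bump_simps power2_norm_eq_inner)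
    qed
    have t: "test_function (\<lambda>x. \<kappa> x * p n x)" for n
      by (intro test_function_mult \<kappa> Ck_real_polynomial_function p)
    \<comment> \<open>Here 2 is the bound 1 for \<open>c n\<close> plus an error of at most
      1.\<close>
    have pb: "\<bar>\<kappa> x * p n x\<bar> \<le> 2 * indicat_real (cball 0 (real R)) x" for n x
    proof (cases "norm x \<le> real R")
      case True
      have "1 / real (Suc n) \<le> 1" by simp
      moreover have "\<bar>c n x - p n x\<bar> < 1 / real (Suc n)" using True by (intro p(2)) auto
      ultimately have "\<bar>p n x\<bar> \<le> 2" using c(2)[of n x] by argo
      then show ?thesis using True \<kappa>b[of x] mult_mono[of "\<bar>\<kappa> x\<bar>" 1 "\<bar>p n x\<bar>" 2] by (auto simp: abs_mult)
    qed (simp add: \<kappa>0)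
    have "(\<lambda>n. LINT x|lebesgue. (\<kappa> x * p n x) * g x) \<longlonglongrightarrow> (LINT x|lebesgue. \<kappa> x * \<bar>g x\<bar>)"
    proof (rule integral_dominated_convergence[where w = "\<lambda>x. 2 * \<bar>indicat_real (cball 0 (real R)) x *\<^sub>R g x\<bar>"])
      show "integrable lebesgue (\<lambda>x. 2 * \<bar>indicat_real (cball 0 (real R)) x *\<^sub>R g x\<bar>)"
        by (intro integrable_mult_right integrable_abs locally_integrable_cball li)
      note [measurable] = test_function_integrable(3)[OF t] test_function_integrable(3)[OF \<kappa>]
      show "(\<lambda>x. (\<kappa> x * p n x) * g x) \<in> borel_measurable lebesgue" for n by measurable
      show "(\<lambda>x. \<kappa> x * \<bar>g x\<bar>) \<in> borel_measurable lebesgue" by measurable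
      show "AE x in lebesgue. norm (\<kappa> x * p n x * g x) \<le> 2 * \<bar>indicat_real (cball 0 (real R)) x *\<^sub>R g x\<bar>" for n
        using mult_right_mono[OF pb[of _ n] abs_ge_zero[of "g _"]] by (intro AE_I2) (simp add: abs_mult mult.assoc)
      show "AE x in lebesgue. (\<lambda>n. \<kappa> x * p n x * g x) \<longlonglongrightarrow> \<kappa> x * \<bar>g x\<bar>"
        using c(3)
      proof eventually_elim
        case (elim x)
        show ?case
        proof (cases "norm x \<le> real R")
          case True
          have "(\<lambda>n. p n x - c n x) \<longlonglongrightarrow> 0"
          proof (rule Lim_null_comparison)
            show "\<forall>\<^sub>F n in sequentially. norm (p n x - c n x) \<le> 1 / real (Suc n)"
              using p(2)[of x] True by (intro always_eventually) (auto simp: abs_minus_commute less_imp_le)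
            show "(\<lambda>n. 1 / real (Suc n)) \<longlonglongrightarrow> 0"
              using LIMSEQ_inverse_real_of_nat by (simp add: inverse_eq_divide)
          qed
          from tendsto_add[OF this elim] have "(\<lambda>n. p n x) \<longlonglongrightarrow> sgn (g x)" by simp
          then have "(\<lambda>n. \<kappa> x * p n x * g x) \<longlonglongrightarrow> \<kappa> x * sgn (g x) * g x" by (intro tendsto_intros)
          then show ?thesis by (simp add: mult.assoc abs_sgn[symmetric] mult.commute[of "sgn _"])
        qed (simp add: \<kappa>0)
      qed
    qed
    then have "(LINT x|lebesgue. \<kappa> x * \<bar>g x\<bar>) = 0"
      using z[OF t] LIMSEQ_unique[OF _ tendsto_const] by simp
    moreover have "integrable lebesgue (\<lambda>x. \<kappa> x *\<^sub>R g x)"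
      by (rule integrable_locally_bounded[of _ _ 1 "real R"])
        (use li \<kappa>b \<kappa>0 test_function_integrable(3)[OF \<kappa>] in auto)
    then have "integrable lebesgue (\<lambda>x. \<bar>\<kappa> x *\<^sub>R g x\<bar>)" by (rule integrable_abs)
    then have "integrable lebesgue (\<lambda>x. \<kappa> x * \<bar>g x\<bar>)" using \<kappa>b by (simp add: abs_mult)
    ultimately have "AE x in lebesgue. \<kappa> x * \<bar>g x\<bar> = 0"
      using integral_nonneg_eq_0_iff_AE[of lebesgue "\<lambda>x. \<kappa> x * \<bar>g x\<bar>"] \<kappa>b by simp
    then show ?thesis
      by eventually_elim (use \<kappa>1 in force)
  qed
  then have "AE x in lebesgue. \<forall>R::nat. norm x < real R \<longrightarrow> g x = 0"
    unfolding AE_all_countable by blast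
  then show ?thesis
    by eventually_elim (use reals_Archimedean2 in blast)
qed

lemma fundamental_lemma:
  fixes G :: "R3 \<Rightarrow> 'a::euclidean_space"
  assumes li: "locally_integrable G"
    and z: "\<And>\<psi>. test_function \<psi> \<Longrightarrow> (LINT x|lebesgue. \<psi> x *\<^sub>R G x) = 0"
  shows "AE x in lebesgue. G x = 0"
proof -
  have "AE x in lebesgue. G x \<bullet> b = 0" for b
  proof (rule real_fundamental_lemma)
    show "locally_integrable (\<lambda>x. G x \<bullet> b)" by (rule locally_integrable_inner[OF li])
    fix \<psi> assume \<psi>: "test_function \<psi>"
    obtain R M where *: "\<And>x. norm x > R \<Longrightarrow> \<psi> x = 0" "\<And>x. \<bar>\<psi> x\<bar> \<le> M"
      using test_function_bounds[OF \<psi>] by metis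
    have "integrable lebesgue (\<lambda>x. \<psi> x *\<^sub>R G x)"
      by (rule integrable_locally_bounded[OF li test_function_integrable(3)[OF \<psi>] *(2,1)])
    then have "(LINT x|lebesgue. (\<psi> x *\<^sub>R G x) \<bullet> b) = (LINT x|lebesgue. \<psi> x *\<^sub>R G x) \<bullet> b"
      by (intro integral_inner_left)
    then show "(LINT x|lebesgue. \<psi> x * (G x \<bullet> b)) = 0" using z[OF \<psi>] by simp
  qed
  then have "AE x in lebesgue. \<forall>b\<in>Basis. G x \<bullet> b = 0"
    by (subst AE_ball_countable[OF countable_finite[OF finite_Basis]]) auto
  then show ?thesis by eventually_elim (simp add: euclidean_all_zero_iff)
qed

section \<open>Weak gradients\<close>

lemma test_function_times_locally_integrable:
  fixes f :: "R3 \<Rightarrow> 'a::euclidean_space"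
  assumes "test_function \<psi>" "locally_integrable f"
  shows "integrable lebesgue (\<lambda>x. \<psi> x *\<^sub>R f x)"
proof -
  obtain R M where *: "\<And>x. norm x > R \<Longrightarrow> \<psi> x = 0" "\<And>x. \<bar>\<psi> x\<bar> \<le> M"
    using test_function_bounds[OF assms(1)] by metis
  show ?thesis
    by (rule integrable_locally_bounded[OF assms(2) test_function_integrable(3)[OF assms(1)] *(2,1)])
qed

lemma locally_integrable_times_grad:
  assumes "test_function \<psi>" "locally_integrable (\<phi> :: R3 \<Rightarrow> real)"
  shows "integrable lebesgue (\<lambda>x. \<phi> x *\<^sub>R grad \<psi> x)"
proof -
  obtain R M where *: "\<And>x. norm x > R \<Longrightarrow> grad \<psi> x = 0" "\<And>x. norm (grad \<psi> x) \<le> M" "M > 0"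
    using test_function_bounds[OF assms(1)] by metis
  note [measurable] = test_function_integrable(4)[OF assms(1)] locally_integrable_measurable[OF assms(2)]
  show ?thesis
  proof (rule Bochner_Integration.integrable_bound)
    show "integrable lebesgue (\<lambda>x. (indicat_real (cball 0 R) x *\<^sub>R \<phi> x) * M)"
      by (intro integrable_mult_left locally_integrable_cball assms)
    show "AE x in lebesgue. norm (\<phi> x *\<^sub>R grad \<psi> x) \<le> norm ((indicat_real (cball 0 R) x *\<^sub>R \<phi> x) * M)"
    proof (rule AE_I2)
      fix x
      show "norm (\<phi> x *\<^sub>R grad \<psi> x) \<le> norm ((indicat_real (cball 0 R) x *\<^sub>R \<phi> x) * M)"
        using * by (cases "norm x \<le> R") (auto simp: indicator_def abs_mult intro!: mult_left_mono)
    qed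
  qed measurable
qed

lemma has_weak_grad_unique:
  assumes "has_weak_grad \<phi> G" "has_weak_grad \<phi> H"
  shows "AE x in lebesgue. G x = H x"
proof -
  have li: "locally_integrable G" "locally_integrable H" using assms by (auto simp: has_weak_grad_def)
  have "AE x in lebesgue. G x + (-1) *\<^sub>R H x = 0"
  proof (rule fundamental_lemma)
    show "locally_integrable (\<lambda>x. G x + (-1) *\<^sub>R H x)"
      by (intro locally_integrable_add locally_integrable_scaleR li)
    fix \<psi> assume \<psi>: "test_function \<psi>"
    have "(LINT x|lebesgue. \<phi> x *\<^sub>R grad \<psi> x) = - (LINT x|lebesgue. \<psi> x *\<^sub>R G x)"
      "(LINT x|lebesgue. \<phi> x *\<^sub>R grad \<psi> x) = - (LINT x|lebesgue. \<psi> x *\<^sub>R H x)"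
      using assms \<psi> by (auto simp: has_weak_grad_def)
    then have "(LINT x|lebesgue. \<psi> x *\<^sub>R G x) = (LINT x|lebesgue. \<psi> x *\<^sub>R H x)" by simp
    then show "(LINT x|lebesgue. \<psi> x *\<^sub>R (G x + (-1) *\<^sub>R H x)) = 0"
      using test_function_times_locally_integrable[OF \<psi> li(1)] test_function_times_locally_integrable[OF \<psi> li(2)]
      by (simp add: scaleR_diff_right)
  qed
  then show ?thesis by eventually_elim simp
qed

lemma wgrad_works: "has_weak_grad \<phi> G \<Longrightarrow> has_weak_grad \<phi> (wgrad \<phi>)"
  unfolding wgrad_def by (rule someI[where P = "has_weak_grad \<phi>"])

lemma wgrad_AE_eq: "has_weak_grad \<phi> G \<Longrightarrow> AE x in lebesgue. wgrad \<phi> x = G x"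
  by (rule has_weak_grad_unique[OF wgrad_works])

lemma test_function_has_weak_grad: "test_function u \<Longrightarrow> has_weak_grad u (grad u)"
  unfolding has_weak_grad_def
proof (intro conjI allI impI)
  assume u: "test_function u"
  show "locally_integrable u" "locally_integrable (grad u)"
    by (auto intro!: continuous_locally_integrable test_functionD u)
  fix \<psi> assume \<psi>: "test_function \<psi>"
  show "(LINT x|lebesgue. u x *\<^sub>R grad \<psi> x) = - (LINT x|lebesgue. \<psi> x *\<^sub>R grad u x)"
    by (rule integral_by_parts[OF \<psi> test_functionD(1)[OF u]])
qed

lemma has_weak_grad_add:
  assumes "has_weak_grad \<phi> G" "has_weak_grad \<psi> H"
  shows "has_weak_grad (\<lambda>x. \<phi> x + \<psi> x) (\<lambda>x. G x + H x)"
  unfolding has_weak_grad_def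
proof (intro conjI allI impI)
  have li: "locally_integrable \<phi>" "locally_integrable \<psi>" "locally_integrable G" "locally_integrable H"
    using assms by (auto simp: has_weak_grad_def)
  then show "locally_integrable (\<lambda>x. \<phi> x + \<psi> x)" "locally_integrable (\<lambda>x. G x + H x)"
    by (auto intro: locally_integrable_add)
  fix \<eta> assume \<eta>: "test_function \<eta>"
  have "(LINT x|lebesgue. \<phi> x *\<^sub>R grad \<eta> x) = - (LINT x|lebesgue. \<eta> x *\<^sub>R G x)"
    "(LINT x|lebesgue. \<psi> x *\<^sub>R grad \<eta> x) = - (LINT x|lebesgue. \<eta> x *\<^sub>R H x)"
    using assms \<eta> by (auto simp: has_weak_grad_def)
  then show "(LINT x|lebesgue. (\<phi> x + \<psi> x) *\<^sub>R grad \<eta> x) = - (LINT x|lebesgue. \<eta> x *\<^sub>R (G x + H x))"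
    using li \<eta> by (simp add: scaleR_add_left scaleR_add_right locally_integrable_times_grad test_function_times_locally_integrable)
qed

lemma has_weak_grad_cmult:
  assumes "has_weak_grad \<phi> G"
  shows "has_weak_grad (\<lambda>x. c * \<phi> x) (\<lambda>x. c *\<^sub>R G x)"
  unfolding has_weak_grad_def
proof (intro conjI allI impI)
  have li: "locally_integrable \<phi>" "locally_integrable G"
    using assms by (auto simp: has_weak_grad_def)
  then show "locally_integrable (\<lambda>x. c * \<phi> x)" "locally_integrable (\<lambda>x. c *\<^sub>R G x)"
    using locally_integrable_scaleR[of \<phi> c] by (auto intro: locally_integrable_scaleR)
  fix \<eta> assume \<eta>: "test_function \<eta>"
  have "(LINT x|lebesgue. \<phi> x *\<^sub>R grad \<eta> x) = - (LINT x|lebesgue. \<eta> x *\<^sub>R G x)"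
    using assms \<eta> by (auto simp: has_weak_grad_def)
  then show "(LINT x|lebesgue. (c * \<phi> x) *\<^sub>R grad \<eta> x) = - (LINT x|lebesgue. \<eta> x *\<^sub>R c *\<^sub>R G x)"
    by (simp add: scaleR_left_commute[of _ c] flip: scaleR_scaleR)
qed

lemma locally_integrable_orthogonal:
  fixes f :: "R3 \<Rightarrow> 'a::euclidean_space"
  assumes "locally_integrable f" "orthogonal_transformation g"
  shows "locally_integrable (\<lambda>x. f (g x))"
  unfolding locally_integrable_def set_integrable_def
proof (intro allI impI)
  fix K :: "R3 set" assume K: "compact K"
  then obtain R where R: "K \<subseteq> cball 0 R" using compact_subset_cball by metis
  have "integrable lebesgue (\<lambda>x. indicat_real (cball 0 R) (g x) *\<^sub>R f (g x))"
    by (rule measure_preserving_integrable[OF measure_preserving_orthogonal[OF assms(2)] locally_integrable_cball[OF assms(1)]])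
  moreover have "indicat_real (cball 0 R) (g x) = indicat_real (cball 0 R) x" for x
    using orthogonal_transformation_norm[OF assms(2), of x] by (simp add: indicator_def)
  ultimately have "set_integrable lebesgue (cball 0 R) (\<lambda>x. f (g x))"
    unfolding set_integrable_def by simp
  then have "set_integrable lebesgue K (\<lambda>x. f (g x))"
    by (rule set_integrable_subset) (use K R in \<open>auto simp: borel_compact\<close>)
  then show "integrable lebesgue (\<lambda>x. indicat_real K x *\<^sub>R f (g x))" unfolding set_integrable_def .
qed

lemma adjoint_orthogonal:
  fixes g :: "R3 \<Rightarrow> R3"
  assumes "orthogonal_transformation g"
  shows "adjoint g (g x) = x" "g (adjoint g x) = x" "norm (adjoint g x) = norm x"
proof -
  have l: "linear g" using assms orthogonal_transformation_linear by blast
  have 1: "adjoint g (g x) = x" for x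
  proof (rule vector_eq_ldot[THEN iffD1], rule allI)
    fix z show "z \<bullet> adjoint g (g x) = z \<bullet> x"
      using assms by (simp add: adjoint_works[OF l] orthogonal_transformation_def)
  qed
  then show "adjoint g (g x) = x" .
  have "surj g" using assms by (rule orthogonal_transformation_surj)
  then obtain y where y: "x = g y" by blast
  show "g (adjoint g x) = x" unfolding y 1 ..
  show "norm (adjoint g x) = norm x"
    unfolding y 1 using orthogonal_transformation_norm[OF assms] by simp
qed

text \<open>Substituting \<open>g\<close> in the integrals moves the rotation from
  \<open>\<phi>\<close> to the test function, which becomes \<open>\<psi>\<close> composed with the
  inverse \<open>h\<close>, the adjoint of \<open>g\<close>.\<close>

lemma has_weak_grad_orthogonal:
  assumes "has_weak_grad \<phi> G" "orthogonal_transformation g"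
  shows "has_weak_grad (\<lambda>x. \<phi> (g x)) (\<lambda>x. adjoint g (G (g x)))"
  unfolding has_weak_grad_def
proof (intro conjI allI impI)
  have l: "linear g" using assms orthogonal_transformation_linear by blast
  then have bl: "bounded_linear (adjoint g)" by (simp add: adjoint_linear linear_conv_bounded_linear[symmetric])
  have li: "locally_integrable \<phi>" "locally_integrable G" using assms by (auto simp: has_weak_grad_def)
  show "locally_integrable (\<lambda>x. \<phi> (g x))" by (rule locally_integrable_orthogonal[OF li(1) assms(2)])
  have li2: "locally_integrable (\<lambda>x. G (g x))" by (rule locally_integrable_orthogonal[OF li(2) assms(2)])
  show "locally_integrable (\<lambda>x. adjoint g (G (g x)))"
    unfolding locally_integrable_def set_integrable_def
  proof (intro allI impI)
    fix K :: "R3 set" assume "compact K"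
    then have "integrable lebesgue (\<lambda>x. adjoint g (indicat_real K x *\<^sub>R G (g x)))"
      using li2 unfolding locally_integrable_def set_integrable_def by (intro integrable_bounded_linear[OF bl]) auto
    then show "integrable lebesgue (\<lambda>x. indicat_real K x *\<^sub>R adjoint g (G (g x)))"
      by (simp add: linear_cmul[OF adjoint_linear[OF l]])
  qed
  fix \<psi> assume \<psi>: "test_function \<psi>"
  define h where "h = adjoint g"
  have h: "linear h" "orthogonal_transformation h" "\<And>x. h (g x) = x" "\<And>x. g (h x) = x"
    "adjoint h = g"
    unfolding h_def using adjoint_orthogonal[OF assms(2)] adjoint_linear[OF l] adjoint_adjoint[OF l]
    by (auto simp: orthogonal_transformation)
  \<comment> \<open>The summand 0 only fits \<open>\<eta>\<close> to the affine form of the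
    composition lemmas.\<close>
  define \<eta> where "\<eta> x = \<psi> (h x + 0)" for x
  have \<eta>: "test_function \<eta>" unfolding \<eta>_def
    by (rule test_function_linear_compose[OF \<psi> h(1), of 1])
       (use h(2) in \<open>auto simp: orthogonal_transformation_norm\<close>)
  have g\<eta>: "grad \<eta> x = g (grad \<psi> (h x))" for x
    unfolding \<eta>_def using grad_linear_compose[OF \<psi> h(1), of 0 x] h(5) by simp
  have mp: "measure_preserving g" by (rule measure_preserving_orthogonal[OF assms(2)])
  have "(LINT x|lebesgue. \<phi> (g x) *\<^sub>R grad \<psi> x) = (LINT x|lebesgue. h (\<phi> (g x) *\<^sub>R grad \<eta> (g x)))"
    by (simp add: g\<eta> h linear_cmul[OF h(1)])
  also have "\<dots> = h (LINT x|lebesgue. \<phi> (g x) *\<^sub>R grad \<eta> (g x))"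
    using h(1) measure_preserving_integrable[OF mp locally_integrable_times_grad[OF \<eta> li(1)]]
    by (intro integral_bounded_linear) (auto simp: linear_conv_bounded_linear)
  also have "\<dots> = h (LINT x|lebesgue. \<phi> x *\<^sub>R grad \<eta> x)"
    by (subst measure_preserving_integral[OF mp, of "\<lambda>x. \<phi> x *\<^sub>R grad \<eta> x"])
       (auto intro!: borel_measurable_integrable locally_integrable_times_grad \<eta> li)
  also have "\<dots> = h (- (LINT x|lebesgue. \<eta> x *\<^sub>R G x))"
    using assms(1) \<eta> by (simp add: has_weak_grad_def)
  also have "\<dots> = - h (LINT x|lebesgue. \<eta> (g x) *\<^sub>R G (g x))"
    by (subst measure_preserving_integral[OF mp, of "\<lambda>x. \<eta> x *\<^sub>R G x"])
       (auto intro!: borel_measurable_integrable test_function_times_locally_integrable \<eta> li simp: linear_neg[OF h(1)])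
  also have "\<dots> = - (LINT x|lebesgue. h (\<eta> (g x) *\<^sub>R G (g x)))"
    using h(1) measure_preserving_integrable[OF mp test_function_times_locally_integrable[OF \<eta> li(2)]]
    by (subst integral_bounded_linear) (auto simp: linear_conv_bounded_linear)
  also have "\<dots> = - (LINT x|lebesgue. \<psi> x *\<^sub>R adjoint g (G (g x)))"
    by (simp add: \<eta>_def h linear_cmul[OF h(1)] h_def[symmetric])
  finally show "(LINT x|lebesgue. \<phi> (g x) *\<^sub>R grad \<psi> x) = - (LINT x|lebesgue. \<psi> x *\<^sub>R adjoint g (G (g x)))" .
qed

section \<open>The Sobolev inequality\<close>

text \<open>The fundamental theorem of calculus, started from a point where \<open>v\<close>
  vanishes.\<close>

lemma nn_integral_abs_deriv_ge:
  fixes v v' :: "real \<Rightarrow> real"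
  assumes "\<And>t. (v has_real_derivative v' t) (at t)" "continuous_on UNIV v'"
    "\<And>t. \<bar>t\<bar> > R \<Longrightarrow> v t = 0"
  shows "ennreal \<bar>v t\<bar> \<le> (\<integral>\<^sup>+s. ennreal \<bar>v' s\<bar> \<partial>lborel)"
proof -
  \<comment> \<open>A point to the left of \<open>t\<close> and outside the support of
    \<open>v\<close>.\<close>
  define a where "a = - (\<bar>t\<bar> + \<bar>R\<bar> + 1)"
  have a: "a \<le> t" "v a = 0" using assms(3)[of a] by (auto simp: a_def)
  have "has_bochner_integral lborel (\<lambda>x. indicator {a..t} x *\<^sub>R v' x) (v t - v a)"
  proof (rule has_bochner_integral_FTC_Icc[OF a(1)])
    show "continuous_on {a..t} v'" by (rule continuous_on_subset[OF assms(2)]) simp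
    show "(v has_vector_derivative v' x) (at x within {a..t})" for x
      using has_field_derivative_at_within[OF assms(1)] by (simp add: has_real_derivative_iff_has_vector_derivative)
  qed
  then have i: "integrable lborel (\<lambda>x. indicator {a..t} x *\<^sub>R v' x)"
    "(LINT x|lborel. indicator {a..t} x *\<^sub>R v' x) = v t"
    using a by (auto simp: has_bochner_integral_iff)
  have "ennreal \<bar>v t\<bar> \<le> (\<integral>\<^sup>+s. ennreal (norm (indicator {a..t} s *\<^sub>R v' s)) \<partial>lborel)"
    using integral_norm_bound_ennreal[OF i(1)] i(2) by simp
  also have "\<dots> \<le> (\<integral>\<^sup>+s. ennreal \<bar>v' s\<bar> \<partial>lborel)"
    by (intro nn_integral_mono) (auto simp: indicator_def)
  finally show ?thesis .
qed

text \<open>Loomis and Whitney's inequality: \<open>s\<^sup>3\<close> is dominated by a product of three functions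
  of two variables each, and two applications of the Cauchy--Schwarz inequality separate them.\<close>

lemma Loomis_Whitney:
  fixes s w :: "real \<times> real \<times> real \<Rightarrow> real"
  assumes [measurable]: "w \<in> borel_measurable (lborel \<Otimes>\<^sub>M (lborel \<Otimes>\<^sub>M lborel))"
      "s \<in> borel_measurable (lborel \<Otimes>\<^sub>M (lborel \<Otimes>\<^sub>M lborel))"
    and s: "\<And>x y z. 0 \<le> s (x, y, z)"
    and w0: "\<And>x y z. \<bar>x\<bar> > R \<or> \<bar>y\<bar> > R \<or> \<bar>z\<bar> > R \<Longrightarrow> w (x, y, z) = 0"
    and wM: "\<And>x y z. w (x, y, z) \<le> M"
    and s1: "\<And>x y z. ennreal ((s (x, y, z))\<^sup>2) \<le> (\<integral>\<^sup>+x. ennreal (w (x, y, z)) \<partial>lborel)"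
    and s2: "\<And>x y z. ennreal ((s (x, y, z))\<^sup>2) \<le> (\<integral>\<^sup>+y. ennreal (w (x, y, z)) \<partial>lborel)"
    and s3: "\<And>x y z. ennreal ((s (x, y, z))\<^sup>2) \<le> (\<integral>\<^sup>+z. ennreal (w (x, y, z)) \<partial>lborel)"
  shows "(\<integral>\<^sup>+x. \<integral>\<^sup>+y. \<integral>\<^sup>+z. ennreal ((s (x, y, z)) ^ 3) \<partial>lborel \<partial>lborel \<partial>lborel)\<^sup>2
    \<le> (\<integral>\<^sup>+x. \<integral>\<^sup>+y. \<integral>\<^sup>+z. ennreal (w (x, y, z)) \<partial>lborel \<partial>lborel \<partial>lborel) ^ 3"
proof -
  \<comment> \<open>A square root on \<open>ennreal\<close>. Through \<open>enn2real\<close> its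
    value at infinity is 0, so the laws below require finite arguments; boundedness and bounded
    support of \<open>w\<close> make the line integrals \<open>F1\<close>, \<open>F2\<close> and
    \<open>F3\<close> finite.\<close>
  define rt where "rt e = ennreal (sqrt (enn2real e))" for e
  have [measurable]: "rt \<in> borel_measurable borel" unfolding rt_def by measurable
  have rt2: "(rt e)\<^sup>2 = e" if "e < \<infinity>" for e
    using that unfolding rt_def by (simp add: ennreal_power ennreal_enn2real)
  have le_rt: "ennreal r \<le> rt e" if le: "ennreal (r\<^sup>2) \<le> e" "e < \<infinity>" "r \<ge> 0" for r e
  proof -
    obtain e' where e: "e = ennreal e'" "e' \<ge> 0" using le(2) by (cases e) auto
    then have "r\<^sup>2 \<le> e'" using le by simp
    then have "r \<le> sqrt e'" by (simp add: real_le_rsqrt)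
    then show ?thesis using e by (simp add: rt_def ennreal_leI)
  qed
  define F1 where "F1 y z = (\<integral>\<^sup>+x. ennreal (w (x, y, z)) \<partial>lborel)" for y z
  define F2 where "F2 x z = (\<integral>\<^sup>+y. ennreal (w (x, y, z)) \<partial>lborel)" for x z
  define F3 where "F3 x y = (\<integral>\<^sup>+z. ennreal (w (x, y, z)) \<partial>lborel)" for x y
  have m1 [measurable]: "(\<lambda>(y, z). F1 y z) \<in> borel_measurable (lborel \<Otimes>\<^sub>M lborel)" unfolding F1_def by measurable
  have m2 [measurable]: "(\<lambda>(x, z). F2 x z) \<in> borel_measurable (lborel \<Otimes>\<^sub>M lborel)" unfolding F2_def by measurable
  have m3 [measurable]: "(\<lambda>(x, y). F3 x y) \<in> borel_measurable (lborel \<Otimes>\<^sub>M lborel)" unfolding F3_def by measurable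
  have fin: "(\<integral>\<^sup>+t. ennreal (h t) \<partial>lborel) < \<infinity>" if "\<And>t. \<bar>t\<bar> > R \<Longrightarrow> h t = 0" "\<And>t. h t \<le> M" for h :: "real \<Rightarrow> real"
  proof -
    have "(\<integral>\<^sup>+t. ennreal (h t) \<partial>lborel) \<le> (\<integral>\<^sup>+t. ennreal \<bar>M\<bar> * indicator {-\<bar>R\<bar>..\<bar>R\<bar>} t \<partial>lborel)"
    proof (rule nn_integral_mono)
      fix t
      have "h t \<le> \<bar>M\<bar>" using that(2)[of t] by linarith
      moreover have "h t = 0" if "\<bar>t\<bar> > \<bar>R\<bar>" using that by (intro \<open>\<And>t. \<bar>t\<bar> > R \<Longrightarrow> h t = 0\<close>) linarith
      ultimately show "ennreal (h t) \<le> ennreal \<bar>M\<bar> * indicator {-\<bar>R\<bar>..\<bar>R\<bar>} t"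
        by (cases "\<bar>t\<bar> \<le> \<bar>R\<bar>") (auto simp: indicator_def intro!: ennreal_leI)
    qed
    also have "\<dots> < \<infinity>" by (simp add: nn_integral_cmult ennreal_mult_less_top)
    finally show ?thesis .
  qed
  have fF: "F1 y z < \<infinity>" "F2 x z < \<infinity>" "F3 x y < \<infinity>" for x y z
    unfolding F1_def F2_def F3_def by (rule fin; use w0 wM in auto)+
  define W where "W = (\<integral>\<^sup>+x. \<integral>\<^sup>+y. \<integral>\<^sup>+z. ennreal (w (x, y, z)) \<partial>lborel \<partial>lborel \<partial>lborel)"
  have W3: "(\<integral>\<^sup>+x. \<integral>\<^sup>+y. F3 x y \<partial>lborel \<partial>lborel) = W" by (simp add: F3_def W_def)
  have W2: "(\<integral>\<^sup>+x. \<integral>\<^sup>+z. F2 x z \<partial>lborel \<partial>lborel) = W"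
    unfolding F2_def W_def by (intro nn_integral_cong lborel_pair.Fubini') measurable
  have "(\<integral>\<^sup>+y. \<integral>\<^sup>+z. F1 y z \<partial>lborel \<partial>lborel) = (\<integral>\<^sup>+y. \<integral>\<^sup>+x. \<integral>\<^sup>+z. ennreal (w (x, y, z)) \<partial>lborel \<partial>lborel \<partial>lborel)"
    unfolding F1_def by (intro nn_integral_cong lborel_pair.Fubini') measurable
  also have "\<dots> = W" unfolding W_def by (intro lborel_pair.Fubini') measurable
  finally have W1: "(\<integral>\<^sup>+y. \<integral>\<^sup>+z. F1 y z \<partial>lborel \<partial>lborel) = W" .
  define G where "G x y = (\<integral>\<^sup>+z. rt (F1 y z) * rt (F2 x z) \<partial>lborel)" for x y
  have mG [measurable]: "(\<lambda>(x, y). G x y) \<in> borel_measurable (lborel \<Otimes>\<^sub>M lborel)" unfolding G_def by measurable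
  \<comment> \<open>First Cauchy-Schwarz inequality, in \<open>z\<close>: it separates the
    dependence on \<open>x\<close> from that on \<open>y\<close>.\<close>
  have G2: "(G x y)\<^sup>2 \<le> (\<integral>\<^sup>+z. F1 y z \<partial>lborel) * (\<integral>\<^sup>+z. F2 x z \<partial>lborel)" for x y
    using Cauchy_Schwarz_nn_integral[of "\<lambda>z. rt (F1 y z)" lborel "\<lambda>z. rt (F2 x z)"] fF
    unfolding G_def by (simp add: rt2)
  have "(\<integral>\<^sup>+x. \<integral>\<^sup>+y. \<integral>\<^sup>+z. ennreal ((s (x, y, z)) ^ 3) \<partial>lborel \<partial>lborel \<partial>lborel)
      \<le> (\<integral>\<^sup>+x. \<integral>\<^sup>+y. \<integral>\<^sup>+z. rt (F3 x y) * (rt (F1 y z) * rt (F2 x z)) \<partial>lborel \<partial>lborel \<partial>lborel)"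
  proof (intro nn_integral_mono)
    \<comment> \<open>Each of the three factors \<open>s\<close> is estimated by the line integral
      in a different direction.\<close>
    fix x y z
    have "ennreal ((s (x, y, z)) ^ 3) = ennreal (s (x, y, z)) * (ennreal (s (x, y, z)) * ennreal (s (x, y, z)))"
      using s by (simp add: power3_eq_cube ennreal_mult' mult.assoc)
    also have "\<dots> \<le> rt (F3 x y) * (rt (F1 y z) * rt (F2 x z))"
      using s1 s2 s3 fF s unfolding F1_def F2_def F3_def by (intro mult_mono le_rt) auto
    finally show "ennreal ((s (x, y, z)) ^ 3) \<le> rt (F3 x y) * (rt (F1 y z) * rt (F2 x z))" .
  qed
  also have "\<dots> = (\<integral>\<^sup>+x. \<integral>\<^sup>+y. rt (F3 x y) * G x y \<partial>lborel \<partial>lborel)"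
    unfolding G_def by (intro nn_integral_cong nn_integral_cmult) measurable
  also have "\<dots> = (\<integral>\<^sup>+p. rt (F3 (fst p) (snd p)) * G (fst p) (snd p) \<partial>(lborel \<Otimes>\<^sub>M lborel))"
    by (subst lborel.nn_integral_fst[symmetric]) (auto simp: split_beta')
  finally have "(\<integral>\<^sup>+x. \<integral>\<^sup>+y. \<integral>\<^sup>+z. ennreal ((s (x, y, z)) ^ 3) \<partial>lborel \<partial>lborel \<partial>lborel)\<^sup>2 \<le> (\<dots>)\<^sup>2"
    by (intro power_mono) auto
  \<comment> \<open>Second Cauchy-Schwarz inequality, in the pair of \<open>x\<close> and
    \<open>y\<close>.\<close>
  also have "\<dots> \<le> (\<integral>\<^sup>+p. (rt (F3 (fst p) (snd p)))\<^sup>2 \<partial>(lborel \<Otimes>\<^sub>M lborel))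
      * (\<integral>\<^sup>+p. (G (fst p) (snd p))\<^sup>2 \<partial>(lborel \<Otimes>\<^sub>M lborel))"
    by (rule Cauchy_Schwarz_nn_integral) measurable
  also have "(\<integral>\<^sup>+p. (rt (F3 (fst p) (snd p)))\<^sup>2 \<partial>(lborel \<Otimes>\<^sub>M lborel)) = W"
    unfolding W3[symmetric] using fF by (subst lborel.nn_integral_fst[symmetric]) (auto simp: rt2)
  also have "(\<integral>\<^sup>+p. (G (fst p) (snd p))\<^sup>2 \<partial>(lborel \<Otimes>\<^sub>M lborel)) = (\<integral>\<^sup>+x. \<integral>\<^sup>+y. (G x y)\<^sup>2 \<partial>lborel \<partial>lborel)"
    by (subst lborel.nn_integral_fst[symmetric]) auto
  also have "W * \<dots> \<le> W * (\<integral>\<^sup>+x. \<integral>\<^sup>+y. (\<integral>\<^sup>+z. F1 y z \<partial>lborel) * (\<integral>\<^sup>+z. F2 x z \<partial>lborel) \<partial>lborel \<partial>lborel)"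
    by (intro mult_left_mono nn_integral_mono G2) auto
  also have "(\<integral>\<^sup>+x. \<integral>\<^sup>+y. (\<integral>\<^sup>+z. F1 y z \<partial>lborel) * (\<integral>\<^sup>+z. F2 x z \<partial>lborel) \<partial>lborel \<partial>lborel)
      = (\<integral>\<^sup>+x. W * (\<integral>\<^sup>+z. F2 x z \<partial>lborel) \<partial>lborel)"
    by (subst nn_integral_multc) (auto simp: W1)
  also have "\<dots> = W * W" by (subst nn_integral_cmult) (auto simp: W2)
  finally show ?thesis unfolding W_def[symmetric] by (simp add: power3_eq_cube mult.assoc)
qed

section \<open>Lebesgue measure on R^3 in coordinates\<close>

definition triple :: "real \<times> real \<times> real \<Rightarrow> R3" where
  "triple p = vector [fst p, fst (snd p), snd (snd p)]"

lemma triple_eq: "triple (x, y, z) = x *\<^sub>R axis 1 1 + y *\<^sub>R axis 2 1 + z *\<^sub>R axis 3 1"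
  unfolding triple_def vec_eq_iff forall_3 by (simp add: axis_def)

lemma continuous_triple: "continuous_on UNIV triple"
proof -
  have "continuous_on UNIV (\<lambda>p. fst p *\<^sub>R axis 1 1 + fst (snd p) *\<^sub>R axis 2 1 + snd (snd p) *\<^sub>R (axis 3 1 :: R3))"
    by (intro continuous_intros)
  moreover have eq: "triple = (\<lambda>p. fst p *\<^sub>R axis 1 1 + fst (snd p) *\<^sub>R axis 2 1 + snd (snd p) *\<^sub>R (axis 3 1 :: R3))"
    by (rule ext) (metis triple_eq prod.collapse)
  ultimately show ?thesis unfolding eq by blast
qed

text \<open>Both measures give a box the product of its three side lengths, and boxes determine
  Lebesgue measure.\<close>

lemma distr_triple: "distr (lborel \<Otimes>\<^sub>M (lborel \<Otimes>\<^sub>M lborel)) borel triple = lborel"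
proof (rule lborel_eqI[symmetric])
  have [measurable]: "triple \<in> borel_measurable (lborel \<Otimes>\<^sub>M (lborel \<Otimes>\<^sub>M lborel))"
    using borel_measurable_continuous_onI[OF continuous_triple] by (simp add: lborel_prod)
  fix l u :: R3 assume "\<And>b. b \<in> Basis \<Longrightarrow> l \<bullet> b \<le> u \<bullet> b"
  then have lu: "l $ i \<le> u $ i" for i
    by (metis axis_in_Basis_iff Basis_real_def inner_axis insertI1 mult.right_neutral inner_real_def)
  have "triple -` box l u = {l$1<..<u$1} \<times> {l$2<..<u$2} \<times> {l$3<..<u$3}"
    by (auto simp: triple_def mem_box_cart forall_3)
  then have "emeasure (distr (lborel \<Otimes>\<^sub>M (lborel \<Otimes>\<^sub>M lborel)) borel triple) (box l u)
      = emeasure (lborel \<Otimes>\<^sub>M (lborel \<Otimes>\<^sub>M lborel)) ({l$1<..<u$1} \<times> {l$2<..<u$2} \<times> {l$3<..<u$3})"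
    by (subst emeasure_distr) (auto simp: space_pair_measure)
  also have "\<dots> = ennreal (u$1 - l$1) * (ennreal (u$2 - l$2) * ennreal (u$3 - l$3))"
    using lu by (subst lborel_pair.emeasure_pair_measure_Times lborel.emeasure_pair_measure_Times; simp add: lborel.emeasure_pair_measure_Times lborel_prod[symmetric])+
  also have "\<dots> = ennreal ((u$1 - l$1) * (u$2 - l$2) * (u$3 - l$3))"
    using lu by (simp add: ennreal_mult mult.assoc)
  also have "(u$1 - l$1) * (u$2 - l$2) * (u$3 - l$3) = (\<Prod>b\<in>Basis. (u - l) \<bullet> b)"
  proof -
    have "(\<Prod>b\<in>Basis. (u - l) \<bullet> b) = (\<Prod>i\<in>UNIV. (u - l) $ i)"
      unfolding Basis_vec_def
      by (simp add: prod.UNION_disjoint inner_axis axis_eq_axis prod.reindex[OF injI])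
    also have "\<dots> = (u$1 - l$1) * (u$2 - l$2) * (u$3 - l$3)"
      unfolding UNIV_3 by (subst prod.insert, simp, simp)+ (simp add: mult.assoc)
    finally show ?thesis by (rule sym)
  qed
  finally show "emeasure (distr (lborel \<Otimes>\<^sub>M (lborel \<Otimes>\<^sub>M lborel)) borel triple) (box l u) = (\<Prod>b\<in>Basis. (u - l) \<bullet> b)" .
qed simp

lemma nn_integral_R3:
  assumes [measurable]: "f \<in> borel_measurable borel"
  shows "(\<integral>\<^sup>+x. f x \<partial>lebesgue) = (\<integral>\<^sup>+x. \<integral>\<^sup>+y. \<integral>\<^sup>+z. f (triple (x, y, z)) \<partial>lborel \<partial>lborel \<partial>lborel)"
proof -
  have [measurable]: "triple \<in> borel_measurable (lborel \<Otimes>\<^sub>M (lborel \<Otimes>\<^sub>M lborel))"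
    using borel_measurable_continuous_onI[OF continuous_triple] by (simp add: lborel_prod)
  have sf: "sigma_finite_measure (lborel \<Otimes>\<^sub>M lborel :: (real \<times> real) measure)"
    by (simp add: lborel_prod sigma_finite_lborel)
  have "(\<integral>\<^sup>+x. f x \<partial>lebesgue) = (\<integral>\<^sup>+x. f x \<partial>(lborel :: R3 measure))" by (rule nn_integral_completion)
  also have "\<dots> = (\<integral>\<^sup>+p. f (triple p) \<partial>(lborel \<Otimes>\<^sub>M (lborel \<Otimes>\<^sub>M lborel)))"
    unfolding distr_triple[symmetric] by (rule nn_integral_distr) auto
  also have "\<dots> = (\<integral>\<^sup>+x. \<integral>\<^sup>+q. f (triple (x, q)) \<partial>(lborel \<Otimes>\<^sub>M lborel) \<partial>lborel)"
    by (rule sigma_finite_measure.nn_integral_fst[symmetric, OF sf]) measurable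
  also have "\<dots> = (\<integral>\<^sup>+x. \<integral>\<^sup>+y. \<integral>\<^sup>+z. f (triple (x, y, z)) \<partial>lborel \<partial>lborel \<partial>lborel)"
    by (intro nn_integral_cong lborel.nn_integral_fst[symmetric]) measurable
  finally show ?thesis .
qed

lemma norm_triple_ge: "\<bar>x\<bar> \<le> norm (triple (x, y, z))" "\<bar>y\<bar> \<le> norm (triple (x, y, z))" "\<bar>z\<bar> \<le> norm (triple (x, y, z))"
  using component_le_norm_cart[of "triple (x, y, z)" 1] component_le_norm_cart[of "triple (x, y, z)" 2]
    component_le_norm_cart[of "triple (x, y, z)" 3] by (auto simp: triple_def)

text \<open>The argument of Gagliardo and Nirenberg. Along every coordinate line
  \<open>\<bar>u\<bar> ^ 4\<close> is at most the integral of \<open>w\<close>, the bound 4 |u|^3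
  |grad u| for the derivative of u^4. Loomis and Whitney's inequality with s = u^2 gives I^2 <= W^3
  for the integrals I of u^6 and W of w, and the Cauchy-Schwarz inequality gives W^2 <= 16 I E with
  the Dirichlet integral E. Hence I^4 <= (16 I E)^3, and 4096 is 16^3.\<close>

theorem Sobolev_test_function:
  assumes u: "test_function u"
  shows "(\<integral>\<^sup>+x. ennreal (\<bar>u x\<bar> ^ 6) \<partial>lebesgue) \<le> ennreal (4096 * (LINT x|lebesgue. (norm (grad u x))\<^sup>2) ^ 3)"
proof -
  obtain R M where R: "R > 0" "M > 0" "\<And>x. norm x > R \<Longrightarrow> u x = 0" "\<And>x. norm x > R \<Longrightarrow> grad u x = 0"
    "\<And>x. \<bar>u x\<bar> \<le> M" "\<And>x. norm (grad u x) \<le> M"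
    using test_function_bounds[OF u] by metis
  define w where "w p = 4 * \<bar>u p\<bar> ^ 3 * norm (grad u p)" for p
  have cu: "continuous_on UNIV u" "continuous_on UNIV (grad u)" using test_functionD[OF u] by auto
  have cw: "continuous_on UNIV w" unfolding w_def by (intro continuous_intros cu)
  have [measurable]: "u \<in> borel_measurable borel" "w \<in> borel_measurable borel" "grad u \<in> borel_measurable borel"
    using cu cw by (auto intro: borel_measurable_continuous_onI)
  have [measurable]: "triple \<in> borel_measurable (lborel \<Otimes>\<^sub>M (lborel \<Otimes>\<^sub>M lborel))"
    using borel_measurable_continuous_onI[OF continuous_triple] by (simp add: lborel_prod)
  \<comment> \<open>The shift by \<open>c\<close> makes the integration variable a coordinate
    itself: \<open>e\<close> will be a coordinate direction and \<open>c\<close> the corresponding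
    coordinate of \<open>p\<close>.\<close>
  have line: "ennreal (\<bar>u p\<bar> ^ 4) \<le> (\<integral>\<^sup>+s. ennreal (w (p + (s - c) *\<^sub>R e)) \<partial>lborel)"
    if "norm e = 1" for p e :: R3 and c :: real
  proof -
    have d: "((\<lambda>s. u (p + (s - c) *\<^sub>R e)) has_real_derivative e \<bullet> grad u (p + (s - c) *\<^sub>R e)) (at s)" for s
    proof -
      have "((\<lambda>s. p + (s - c) *\<^sub>R e) has_derivative (\<lambda>t. 0 + (t - 0) *\<^sub>R e)) (at s)"
        by (intro derivative_intros)
      then have "((\<lambda>s. p + (s - c) *\<^sub>R e) has_derivative (\<lambda>t. t *\<^sub>R e)) (at s)" by simp
      from has_derivative_compose[OF this, of u "\<lambda>h. h \<bullet> grad u (p + (s - c) *\<^sub>R e)"] test_functionD(2)[OF u]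
      show ?thesis unfolding gderiv_def has_field_derivative_def by (simp add: mult_commute_abs)
    qed
    have cl: "continuous_on UNIV (\<lambda>s. p + (s - c) *\<^sub>R e)" by (intro continuous_intros)
    have "ennreal \<bar>u (p + (c - c) *\<^sub>R e) ^ 4\<bar> \<le> (\<integral>\<^sup>+s. ennreal \<bar>4 * (u (p + (s - c) *\<^sub>R e)) ^ 3 * (e \<bullet> grad u (p + (s - c) *\<^sub>R e))\<bar> \<partial>lborel)"
    proof (rule nn_integral_abs_deriv_ge[where R = "R + norm p + \<bar>c\<bar>" and v = "\<lambda>s. u (p + (s - c) *\<^sub>R e) ^ 4"])
      show "((\<lambda>s. u (p + (s - c) *\<^sub>R e) ^ 4) has_real_derivative 4 * (u (p + (s - c) *\<^sub>R e)) ^ 3 * (e \<bullet> grad u (p + (s - c) *\<^sub>R e))) (at s)" for s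
        using DERIV_power[OF d, of 4 s] by (simp add: ac_simps)
      show "continuous_on UNIV (\<lambda>s. 4 * (u (p + (s - c) *\<^sub>R e)) ^ 3 * (e \<bullet> grad u (p + (s - c) *\<^sub>R e)))"
        by (intro continuous_intros continuous_on_UNIV_compose[OF cu(1) cl] continuous_on_UNIV_compose[OF cu(2) cl])
      show "u (p + (s - c) *\<^sub>R e) ^ 4 = 0" if "\<bar>s\<bar> > R + norm p + \<bar>c\<bar>" for s
      proof -
        have "\<bar>s - c\<bar> = norm ((s - c) *\<^sub>R e)" using \<open>norm e = 1\<close> by simp
        also have "\<dots> \<le> norm (p + (s - c) *\<^sub>R e) + norm p"
          using norm_triangle_ineq4[of "p + (s - c) *\<^sub>R e" p] by simp
        finally have "norm (p + (s - c) *\<^sub>R e) > R" using that by linarith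
        then show ?thesis using R(3) by simp
      qed
    qed
    also have "\<dots> \<le> (\<integral>\<^sup>+s. ennreal (w (p + (s - c) *\<^sub>R e)) \<partial>lborel)"
    proof (intro nn_integral_mono ennreal_leI)
      fix s
      have "\<bar>e \<bullet> grad u (p + (s - c) *\<^sub>R e)\<bar> \<le> norm (grad u (p + (s - c) *\<^sub>R e))"
        using Cauchy_Schwarz_ineq2[of e] that by simp
      then show "\<bar>4 * u (p + (s - c) *\<^sub>R e) ^ 3 * (e \<bullet> grad u (p + (s - c) *\<^sub>R e))\<bar> \<le> w (p + (s - c) *\<^sub>R e)"
        unfolding w_def abs_mult power_abs by (intro mult_mono) auto
    qed
    finally show ?thesis by (simp add: power_abs)
  qed
  have ua: "(\<bar>u p\<bar>\<^sup>2)\<^sup>2 = \<bar>u p\<bar> ^ 4" "(\<bar>u p\<bar>\<^sup>2) ^ 3 = \<bar>u p\<bar> ^ 6" for p by (simp_all flip: power_mult)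
  define I where "I = (\<integral>\<^sup>+x. ennreal (\<bar>u x\<bar> ^ 6) \<partial>lebesgue)"
  define W where "W = (\<integral>\<^sup>+x. ennreal (w x) \<partial>lebesgue)"
  define E where "E = (\<integral>\<^sup>+x. ennreal ((norm (grad u x))\<^sup>2) \<partial>lebesgue)"
  have "(\<integral>\<^sup>+x. \<integral>\<^sup>+y. \<integral>\<^sup>+z. ennreal ((\<bar>u (triple (x, y, z))\<bar>\<^sup>2) ^ 3) \<partial>lborel \<partial>lborel \<partial>lborel)\<^sup>2
      \<le> (\<integral>\<^sup>+x. \<integral>\<^sup>+y. \<integral>\<^sup>+z. ennreal (w (triple (x, y, z))) \<partial>lborel \<partial>lborel \<partial>lborel) ^ 3"
  proof (rule Loomis_Whitney[where R = R and M = "4 * M ^ 3 * M" and w = "\<lambda>p. w (triple p)" and s = "\<lambda>p. \<bar>u (triple p)\<bar>\<^sup>2"])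
    show "(\<lambda>p. w (triple p)) \<in> borel_measurable (lborel \<Otimes>\<^sub>M (lborel \<Otimes>\<^sub>M lborel))"
      "(\<lambda>p. \<bar>u (triple p)\<bar>\<^sup>2) \<in> borel_measurable (lborel \<Otimes>\<^sub>M (lborel \<Otimes>\<^sub>M lborel))"
      by measurable
    show "w (triple (x, y, z)) = 0" if "\<bar>x\<bar> > R \<or> \<bar>y\<bar> > R \<or> \<bar>z\<bar> > R" for x y z
    proof -
      have "norm (triple (x, y, z)) > R" using that norm_triple_ge[where x = x and y = y and z = z] by linarith
      then show ?thesis using R by (simp add: w_def)
    qed
    show "w (triple (x, y, z)) \<le> 4 * M ^ 3 * M" for x y z
      unfolding w_def using R by (intro mult_mono power_mono) auto
    have T: "triple (x, y, z) = triple (x', y, z) + (x - x') *\<^sub>R axis 1 1"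
       "triple (x, y, z) = triple (x, y', z) + (y - y') *\<^sub>R axis 2 1"
       "triple (x, y, z) = triple (x, y, z') + (z - z') *\<^sub>R axis 3 1" for x y z x' y' z'
      by (simp_all add: triple_eq algebra_simps)
    show "ennreal ((\<bar>u (triple (x, y, z))\<bar>\<^sup>2)\<^sup>2) \<le> (\<integral>\<^sup>+x. ennreal (w (triple (x, y, z))) \<partial>lborel)" for x y z
      using line[of "axis 1 1" "triple (x, y, z)" x] unfolding ua T(1)[symmetric] by simp
    show "ennreal ((\<bar>u (triple (x, y, z))\<bar>\<^sup>2)\<^sup>2) \<le> (\<integral>\<^sup>+y. ennreal (w (triple (x, y, z))) \<partial>lborel)" for x y z
      using line[of "axis 2 1" "triple (x, y, z)" y] unfolding ua T(2)[symmetric] by simp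
    show "ennreal ((\<bar>u (triple (x, y, z))\<bar>\<^sup>2)\<^sup>2) \<le> (\<integral>\<^sup>+z. ennreal (w (triple (x, y, z))) \<partial>lborel)" for x y z
      using line[of "axis 3 1" "triple (x, y, z)" z] unfolding ua T(3)[symmetric] by simp
  qed simp
  then have IW: "I\<^sup>2 \<le> W ^ 3"
    unfolding I_def W_def ua by (simp add: nn_integral_R3)
  note [measurable] = test_function_integrable(3,4)[OF u]
  have "W = (\<integral>\<^sup>+x. ennreal (4 * \<bar>u x\<bar> ^ 3) * ennreal (norm (grad u x)) \<partial>lebesgue)"
    unfolding W_def w_def by (intro nn_integral_cong ennreal_mult) auto
  then have "W\<^sup>2 \<le> (\<integral>\<^sup>+x. (ennreal (4 * \<bar>u x\<bar> ^ 3))\<^sup>2 \<partial>lebesgue) * (\<integral>\<^sup>+x. (ennreal (norm (grad u x)))\<^sup>2 \<partial>lebesgue)"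
    by (simp only:, intro Cauchy_Schwarz_nn_integral) measurable
  also have "(\<integral>\<^sup>+x. (ennreal (norm (grad u x)))\<^sup>2 \<partial>lebesgue) = E"
    unfolding E_def by (simp add: ennreal_power)
  also have "(\<integral>\<^sup>+x. (ennreal (4 * \<bar>u x\<bar> ^ 3))\<^sup>2 \<partial>lebesgue) = (\<integral>\<^sup>+x. 16 * ennreal (\<bar>u x\<bar> ^ 6) \<partial>lebesgue)"
    by (intro nn_integral_cong) (simp add: ennreal_power power_mult_distrib ennreal_mult flip: power_mult)
  also have "\<dots> = 16 * I"
    unfolding I_def by (intro nn_integral_cmult) measurable
  finally have W2: "W\<^sup>2 \<le> 16 * I * E" .
  have iE: "integrable lebesgue (\<lambda>x. (norm (grad u x))\<^sup>2)"
    by (rule integrable_continuous_bounded_support[of _ R]) (auto intro!: continuous_intros cu simp: R)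
  have iI: "integrable lebesgue (\<lambda>x. \<bar>u x\<bar> ^ 6)"
    by (rule integrable_continuous_bounded_support[of _ R]) (auto intro!: continuous_intros cu simp: R)
  \<comment> \<open>Real versions of the integrals: the last step cancels \<open>i ^ 3\<close>,
    which requires finiteness.\<close>
  define i where "i = (LINT x|lebesgue. \<bar>u x\<bar> ^ 6)"
  define e where "e = (LINT x|lebesgue. (norm (grad u x))\<^sup>2)"
  have ie: "0 \<le> i" "0 \<le> e" "I = ennreal i" "E = ennreal e"
    unfolding i_def e_def I_def E_def using nn_integral_eq_integral[OF iE] nn_integral_eq_integral[OF iI] by auto
  have "(I\<^sup>2)\<^sup>2 \<le> (W ^ 3)\<^sup>2" using IW by (intro power_mono) auto
  also have "\<dots> = (W\<^sup>2) ^ 3" by (simp flip: power_mult)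
  also have "\<dots> \<le> (16 * I * E) ^ 3" using W2 by (intro power_mono) auto
  also have "16 * I * E = ennreal (16 * i * e)"
    unfolding ie using ie(1,2) by (simp add: ennreal_mult)
  finally have "ennreal ((i\<^sup>2)\<^sup>2) \<le> ennreal ((16 * i * e) ^ 3)"
    unfolding ie using ie(1,2) by (simp add: ennreal_power)
  then have "(i\<^sup>2)\<^sup>2 \<le> (16 * i * e) ^ 3" using ie by (subst (asm) ennreal_le_iff) auto
  then have "i ^ 3 * i \<le> i ^ 3 * (4096 * e ^ 3)"
    by (simp add: power_mult_distrib power2_eq_square power3_eq_cube mult.assoc mult.left_commute)
  then have "i \<le> 4096 * e ^ 3"
    using ie by (cases "i = 0") (auto simp: mult_le_cancel_left)
  then show ?thesis unfolding I_def[symmetric] ie e_def[symmetric] by (rule ennreal_leI)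
qed

section \<open>Square-integrable fields\<close>

text \<open>Fatou's lemma, in the form in which upper bounds survive a.e. limits.\<close>

lemma nn_integral_le_of_AE_limit:
  fixes f :: "nat \<Rightarrow> 'a \<Rightarrow> ennreal"
  assumes "\<And>n. f n \<in> borel_measurable M" "AE x in M. (\<lambda>n. f n x) \<longlonglongrightarrow> g x"
    "eventually (\<lambda>n. (\<integral>\<^sup>+x. f n x \<partial>M) \<le> c) sequentially"
  shows "(\<integral>\<^sup>+x. g x \<partial>M) \<le> c"
proof -
  have "(\<integral>\<^sup>+x. g x \<partial>M) = (\<integral>\<^sup>+x. liminf (\<lambda>n. f n x) \<partial>M)"
    by (rule nn_integral_cong_AE) (use assms(2) in eventually_elim, auto dest: lim_imp_Liminf[rotated])
  also have "\<dots> \<le> liminf (\<lambda>n. \<integral>\<^sup>+x. f n x \<partial>M)" by (rule nn_integral_liminf[OF assms(1)])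
  also have "\<dots> \<le> limsup (\<lambda>n. \<integral>\<^sup>+x. f n x \<partial>M)" by (rule Liminf_le_Limsup) simp
  also have "\<dots> \<le> c" by (rule Limsup_bounded[OF assms(3)])
  finally show ?thesis .
qed

text \<open>Weighted Young inequalities produce such bounds. The first term is small with
  \<open>\<delta>\<close>; the coefficient \<open>c \<delta>\<close> may blow up as
  \<open>\<delta>\<close> tends to 0, since \<open>\<epsilon>\<close> tends to 0 for each fixed
  \<open>\<delta>\<close>. This serves as a substitute for Hoelder's inequality in the convergence
  proofs.\<close>

lemma ennreal_null_from_bounds:
  fixes X \<epsilon> :: "nat \<Rightarrow> ennreal"
  assumes le: "\<And>\<delta> n. \<delta> > 0 \<Longrightarrow> X n \<le> ennreal (\<delta> * A) + ennreal (c \<delta>) * \<epsilon> n"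
    and \<epsilon>: "\<epsilon> \<longlonglongrightarrow> 0" and A: "A \<ge> 0"
  shows "X \<longlonglongrightarrow> 0"
proof (rule order_tendstoI)
  fix a :: ennreal assume "0 < a"
  then obtain b where b: "0 < b" "b < a" using dense by blast
  then obtain r where r: "b = ennreal r" "r > 0" by (cases b) (auto simp: ennreal_less_zero_iff top_unique)
  \<comment> \<open>The 1 added to \<open>A\<close> covers the case \<open>A = 0\<close>.\<close>
  define \<delta> where "\<delta> = r / (2 * (A + 1))"
  have \<delta>: "\<delta> > 0" "\<delta> * A \<le> r / 2"
    using r A by (auto simp: \<delta>_def field_simps)
  have "(\<lambda>n. ennreal (c \<delta>) * \<epsilon> n) \<longlonglongrightarrow> ennreal (c \<delta>) * 0"
    by (intro ennreal_tendsto_cmult \<epsilon>) simp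
  then have "eventually (\<lambda>n. ennreal (c \<delta>) * \<epsilon> n < ennreal (r / 2)) sequentially"
    by (rule order_tendstoD) (use r in simp)
  then show "eventually (\<lambda>n. X n < a) sequentially"
  proof eventually_elim
    case (elim n)
    have "X n \<le> ennreal (\<delta> * A) + ennreal (c \<delta>) * \<epsilon> n" by (rule le[OF \<delta>(1)])
    also have "\<dots> \<le> ennreal (r / 2) + ennreal (r / 2)"
      using elim \<delta> by (intro add_mono ennreal_leI) auto
    also have "\<dots> = b" using r by (simp flip: ennreal_plus)
    finally show ?case using b by simp
  qed
qed simp

definition square_integrable :: "(R3 \<Rightarrow> R3) \<Rightarrow> bool" where
  "square_integrable G \<longleftrightarrow> G \<in> borel_measurable lebesgue \<and> integrable lebesgue (\<lambda>x. (norm (G x))\<^sup>2)"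

text \<open>The square of the L^2 distance; avoiding the root costs the factors 2 in the triangle
  inequality.\<close>

definition sq_dist :: "(R3 \<Rightarrow> R3) \<Rightarrow> (R3 \<Rightarrow> R3) \<Rightarrow> real" where
  "sq_dist G H = (LINT x|lebesgue. (norm (G x - H x))\<^sup>2)"

lemma norm_sum_sq_le: "(norm (a + b :: 'a::real_normed_vector))\<^sup>2 \<le> 2 * (norm a)\<^sup>2 + 2 * (norm b)\<^sup>2"
proof -
  have "(norm (a + b))\<^sup>2 \<le> (norm a + norm b)\<^sup>2" by (intro power_mono norm_triangle_ineq) auto
  also have "\<dots> \<le> 2 * (norm a)\<^sup>2 + 2 * (norm b)\<^sup>2"
    using zero_le_power2[of "norm a - norm b"] by (simp add: power2_eq_square algebra_simps)
  finally show ?thesis .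
qed

lemma square_integrable_measurable: "square_integrable G \<Longrightarrow> G \<in> borel_measurable lebesgue" by (simp add: square_integrable_def)

lemma square_integrable_integrable: "square_integrable G \<Longrightarrow> integrable lebesgue (\<lambda>x. (norm (G x))\<^sup>2)" by (simp add: square_integrable_def)

lemma square_integrable_add:
  assumes "square_integrable G" "square_integrable H"
  shows "square_integrable (\<lambda>x. G x + H x)"
  unfolding square_integrable_def
proof (intro conjI)
  note [measurable] = assms[THEN square_integrable_measurable]
  show "(\<lambda>x. G x + H x) \<in> borel_measurable lebesgue" by measurable
  show "integrable lebesgue (\<lambda>x. (norm (G x + H x))\<^sup>2)"
  proof (rule Bochner_Integration.integrable_bound)
    show "integrable lebesgue (\<lambda>x. 2 * (norm (G x))\<^sup>2 + 2 * (norm (H x))\<^sup>2)"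
      using assms by (auto simp: square_integrable_def)
    show "AE x in lebesgue. norm ((norm (G x + H x))\<^sup>2) \<le> norm (2 * (norm (G x))\<^sup>2 + 2 * (norm (H x))\<^sup>2)"
      using norm_sum_sq_le[of "G _" "H _"] by (intro AE_I2) auto
  qed measurable
qed

lemma square_integrable_scaleR: "square_integrable G \<Longrightarrow> square_integrable (\<lambda>x. c *\<^sub>R G x)"
  unfolding square_integrable_def by (auto simp: power_mult_distrib)

lemma square_integrable_diff: "square_integrable G \<Longrightarrow> square_integrable H \<Longrightarrow> square_integrable (\<lambda>x. G x - H x)"
  using square_integrable_add[of G "\<lambda>x. (-1) *\<^sub>R H x"] square_integrable_scaleR[of H "-1"] by simp

lemma square_integrable_AE_cong:
  assumes "square_integrable G" "H \<in> borel_measurable lebesgue" "AE x in lebesgue. G x = H x"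
  shows "square_integrable H"
proof -
  note [measurable] = square_integrable_measurable[OF assms(1)] assms(2)
  have "integrable lebesgue (\<lambda>x. (norm (H x))\<^sup>2)"
  proof (rule integrable_cong_AE_imp)
    show "integrable lebesgue (\<lambda>x. (norm (G x))\<^sup>2)" using assms by (simp add: square_integrable_def)
    show "AE x in lebesgue. (norm (G x))\<^sup>2 = (norm (H x))\<^sup>2" using assms(3) by eventually_elim simp
  qed measurable
  then show ?thesis using assms(2) by (simp add: square_integrable_def)
qed

lemma square_integrable_inner_integrable:
  assumes "square_integrable G" "square_integrable H"
  shows "integrable lebesgue (\<lambda>x. G x \<bullet> H x)"
proof (rule Bochner_Integration.integrable_bound)
  note [measurable] = assms[THEN square_integrable_measurable]
  show "integrable lebesgue (\<lambda>x. (norm (G x))\<^sup>2 + (norm (H x))\<^sup>2)"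
    using assms by (auto simp: square_integrable_def)
  show "(\<lambda>x. G x \<bullet> H x) \<in> borel_measurable lebesgue" by measurable
  show "AE x in lebesgue. norm (G x \<bullet> H x) \<le> norm ((norm (G x))\<^sup>2 + (norm (H x))\<^sup>2)"
  proof (intro AE_I2)
    fix x
    have "\<bar>G x \<bullet> H x\<bar> \<le> norm (G x) * norm (H x)" by (rule Cauchy_Schwarz_ineq2)
    also have "\<dots> \<le> (norm (G x))\<^sup>2 + (norm (H x))\<^sup>2"
      using zero_le_power2[of "norm (G x) - norm (H x)"] zero_le_power2[of "norm (G x)"] zero_le_power2[of "norm (H x)"]
      unfolding power2_diff by linarith
    finally show "norm (G x \<bullet> H x) \<le> norm ((norm (G x))\<^sup>2 + (norm (H x))\<^sup>2)" by simp
  qed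
qed

lemma sq_dist_nonneg: "0 \<le> sq_dist G H" unfolding sq_dist_def by simp

lemma sq_dist_commute: "sq_dist G H = sq_dist H G" unfolding sq_dist_def by (simp add: norm_minus_commute)

lemma sq_dist_triangle:
  assumes "square_integrable G" "square_integrable H" "square_integrable K"
  shows "sq_dist G H \<le> 2 * sq_dist G K + 2 * sq_dist K H"
proof -
  have "sq_dist G H \<le> (LINT x|lebesgue. 2 * (norm (G x - K x))\<^sup>2 + 2 * (norm (K x - H x))\<^sup>2)"
    unfolding sq_dist_def
  proof (rule integral_mono)
    show "integrable lebesgue (\<lambda>x. (norm (G x - H x))\<^sup>2)" "integrable lebesgue (\<lambda>x. 2 * (norm (G x - K x))\<^sup>2 + 2 * (norm (K x - H x))\<^sup>2)"
      using square_integrable_diff[OF assms(1,2)] square_integrable_diff[OF assms(1,3)] square_integrable_diff[OF assms(3,2)] by (auto simp: square_integrable_def)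
    show "(norm (G x - H x))\<^sup>2 \<le> 2 * (norm (G x - K x))\<^sup>2 + 2 * (norm (K x - H x))\<^sup>2" for x
      using norm_sum_sq_le[of "G x - K x" "K x - H x"] by simp
  qed
  also have "\<dots> = 2 * sq_dist G K + 2 * sq_dist K H"
    using square_integrable_diff[OF assms(1,3)] square_integrable_diff[OF assms(3,2)] unfolding sq_dist_def by (auto simp: square_integrable_def)
  finally show ?thesis .
qed

lemma nn_sq_dist: "square_integrable G \<Longrightarrow> square_integrable H \<Longrightarrow> (\<integral>\<^sup>+x. ennreal ((norm (G x - H x))\<^sup>2) \<partial>lebesgue) = ennreal (sq_dist G H)"
  unfolding sq_dist_def using square_integrable_diff[of G H] by (intro nn_integral_eq_integral) (auto simp: square_integrable_def)

lemma square_integrable_of_nn_sq_dist: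
  assumes "square_integrable F" "G \<in> borel_measurable lebesgue" "(\<integral>\<^sup>+x. ennreal ((norm (F x - G x))\<^sup>2) \<partial>lebesgue) \<le> ennreal e"
  shows "square_integrable G"
proof -
  note [measurable] = square_integrable_measurable[OF assms(1)] assms(2)
  have "(\<integral>\<^sup>+x. ennreal ((norm (F x - G x))\<^sup>2) \<partial>lebesgue) < \<infinity>"
    using le_less_trans[OF assms(3)] by simp
  then have "square_integrable (\<lambda>x. F x - G x)" unfolding square_integrable_def by (auto intro!: integrableI_bounded)
  from square_integrable_diff[OF assms(1) this] show ?thesis by simp
qed

text \<open>The Riesz-Fischer theorem for vector fields: a fast subsequence converges a.e., and
  Fatou's lemma carries the Cauchy estimate to the limit.\<close>

lemma square_integrable_complete:
  assumes F: "\<And>n::nat. square_integrable (F n)"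
    and cau: "\<And>e. e > 0 \<Longrightarrow> \<exists>N. \<forall>m\<ge>N. \<forall>n\<ge>N. sq_dist (F m) (F n) < e"
  obtains G where "square_integrable G" "(\<lambda>n. sq_dist (F n) G) \<longlonglongrightarrow> 0"
proof -
  note [measurable] = F[THEN square_integrable_measurable]
  \<comment> \<open>With errors \<open>(1 / 8) ^ k\<close> the weights \<open>4 ^ k\<close> still
    leave a convergent series. Finiteness of the weighted sum of squares then forces increments of
    order \<open>(1 / 2) ^ k\<close>, which are summable.\<close>
  have "\<forall>k. \<exists>N. \<forall>m\<ge>N. \<forall>n\<ge>N. sq_dist (F m) (F n) < (1 / 8) ^ k" using cau by simp
  then obtain N where N: "\<And>k m n. m \<ge> N k \<Longrightarrow> n \<ge> N k \<Longrightarrow> sq_dist (F m) (F n) < (1 / 8) ^ k" by metis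
  \<comment> \<open>Partial sums make the indices increasing and at least \<open>k\<close>, besides
    being at least \<open>N k\<close>.\<close>
  define R where "R k = (\<Sum>j\<le>k. N j + 1)" for k
  have RN: "R k \<ge> N k" "R (Suc k) \<ge> R k" "R k \<ge> k" for k
  proof -
    show "R k \<ge> N k" unfolding R_def using member_le_sum[of k "{..k}" "\<lambda>j. N j + 1"] by simp
    show "R (Suc k) \<ge> R k" unfolding R_def by simp
    show "R k \<ge> k" unfolding R_def using sum_mono[of "{..k}" "\<lambda>j. 1" "\<lambda>j. N j + 1"] by simp
  qed
  define g where "g k x = norm (F (R (Suc k)) x - F (R k) x)" for k x
  have [measurable]: "g k \<in> borel_measurable lebesgue" for k unfolding g_def by measurable
  have "(\<integral>\<^sup>+x. (\<Sum>k. ennreal (4 ^ k * (g k x)\<^sup>2)) \<partial>lebesgue) = (\<Sum>k. \<integral>\<^sup>+x. ennreal (4 ^ k * (g k x)\<^sup>2) \<partial>lebesgue)"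
    by (rule nn_integral_suminf) measurable
  also have "\<dots> \<le> (\<Sum>k. ennreal ((1 / 2) ^ k))"
  proof (rule suminf_le)
    fix k
    have "(\<integral>\<^sup>+x. ennreal (4 ^ k * (g k x)\<^sup>2) \<partial>lebesgue) = ennreal (4 ^ k) * (\<integral>\<^sup>+x. ennreal ((g k x)\<^sup>2) \<partial>lebesgue)"
      by (subst nn_integral_cmult[symmetric]) (auto simp: ennreal_mult)
    also have "\<dots> = ennreal (4 ^ k * sq_dist (F (R (Suc k))) (F (R k)))"
      unfolding g_def by (subst nn_sq_dist[OF F F]) (simp add: ennreal_mult sq_dist_nonneg)
    also have "\<dots> \<le> ennreal (4 ^ k * (1 / 8) ^ k)"
      using N[of k "R (Suc k)" "R k"] RN[of k] by (intro ennreal_leI mult_left_mono less_imp_le) auto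
    also have "4 ^ k * (1 / 8) ^ k = ((1 / 2) ^ k :: real)" by (simp flip: power_mult_distrib)
    finally show "(\<integral>\<^sup>+x. ennreal (4 ^ k * (g k x)\<^sup>2) \<partial>lebesgue) \<le> ennreal ((1 / 2) ^ k)" .
  qed auto
  also have "\<dots> < \<infinity>"
  proof -
    have "summable (\<lambda>k. (1 / 2) ^ k :: real)" by (rule summable_geometric) simp
    then have "(\<Sum>k. ennreal ((1 / 2) ^ k)) \<noteq> top" by (rule ennreal_suminf_neq_top) simp
    then show ?thesis unfolding infinity_ennreal_def less_top[symmetric] .
  qed
  finally have "AE x in lebesgue. (\<Sum>k. ennreal (4 ^ k * (g k x)\<^sup>2)) \<noteq> \<infinity>"
    by (intro nn_integral_PInf_AE) auto
  then have conv: "AE x in lebesgue. convergent (\<lambda>k. F (R k) x)"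
  proof eventually_elim
    case (elim x)
    have "\<exists>S. e = ennreal S \<and> S \<ge> 0" if "e \<noteq> \<infinity>" for e using that by (cases e) auto
    from this[OF elim] obtain S where S: "(\<Sum>k. ennreal (4 ^ k * (g k x)\<^sup>2)) = ennreal S" "S \<ge> 0" by blast
    have "g k x \<le> sqrt S * (1 / 2) ^ k" for k
    proof -
      have "ennreal (4 ^ k * (g k x)\<^sup>2) \<le> ennreal S"
        unfolding S(1)[symmetric] using sum_le_suminf[OF summableI, of "{k}" "\<lambda>k. ennreal (4 ^ k * (g k x)\<^sup>2)"]
        by (simp del: suminf_ennreal)
      then have "4 ^ k * (g k x)\<^sup>2 \<le> S" using S(2) by (simp add: ennreal_le_iff)
      moreover have "4 ^ k = ((2 ^ k)\<^sup>2 :: real)" by (simp add: power2_eq_square flip: power_mult_distrib)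
      ultimately have "(2 ^ k * g k x)\<^sup>2 \<le> S" by (simp add: power_mult_distrib)
      then have "2 ^ k * g k x \<le> sqrt S" by (rule real_le_rsqrt)
      then show ?thesis by (simp add: field_simps)
    qed
    moreover have "summable (\<lambda>k. sqrt S * (1 / 2) ^ k)"
      by (rule summable_mult[OF summable_geometric]) simp
    moreover have "norm (g k x) = g k x" for k by (simp add: g_def)
    ultimately have "summable (\<lambda>k. g k x)"
      using summable_comparison_test'[of "\<lambda>k. sqrt S * (1 / 2) ^ k" 0 "\<lambda>k. g k x"] by simp
    then have "summable (\<lambda>k. F (R (Suc k)) x - F (R k) x)"
      unfolding g_def by (rule summable_norm_cancel)
    then have "convergent (\<lambda>n. \<Sum>k<n. F (R (Suc k)) x - F (R k) x)" by (simp add: summable_iff_convergent)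
    then have "convergent (\<lambda>n. F (R n) x - F (R 0) x)" by (simp add: sum_lessThan_telescope[of "\<lambda>k. F (R k) x"])
    then have "convergent (\<lambda>n. (F (R n) x - F (R 0) x) + F (R 0) x)"
      by (intro convergent_add convergent_const)
    then show ?case by simp
  qed
  define G where "G x = lim (\<lambda>k. F (R k) x)" for x
  have [measurable]: "G \<in> borel_measurable lebesgue" unfolding G_def by measurable
  have lim: "AE x in lebesgue. (\<lambda>k. F (R k) x) \<longlonglongrightarrow> G x"
    using conv unfolding G_def by eventually_elim (simp add: convergent_LIMSEQ_iff)
  \<comment> \<open>Fatou's lemma along the subsequence, with \<open>n\<close> fixed: the estimate
    concerns the whole sequence.\<close>
  have le: "(\<integral>\<^sup>+x. ennreal ((norm (F n x - G x))\<^sup>2) \<partial>lebesgue) \<le> ennreal ((1 / 8) ^ k)" if n: "n \<ge> N k" for n k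
  proof (rule nn_integral_le_of_AE_limit[where f = "\<lambda>m x. ennreal ((norm (F n x - F (R m) x))\<^sup>2)"])
    show "AE x in lebesgue. (\<lambda>m. ennreal ((norm (F n x - F (R m) x))\<^sup>2)) \<longlonglongrightarrow> ennreal ((norm (F n x - G x))\<^sup>2)"
      using lim by eventually_elim (intro tendsto_intros tendsto_ennrealI)
    show "\<forall>\<^sub>F m in sequentially. (\<integral>\<^sup>+ x. ennreal ((norm (F n x - F (R m) x))\<^sup>2) \<partial>lebesgue) \<le> ennreal ((1 / 8) ^ k)"
      using eventually_ge_at_top[of "N k"]
    proof eventually_elim
      case (elim m)
      then have "R m \<ge> N k" using RN(3)[of m] by linarith
      then show ?case unfolding nn_sq_dist[OF F F] using N[OF n] by (intro ennreal_leI less_imp_le)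
    qed
  qed measurable
  have G: "square_integrable G" by (rule square_integrable_of_nn_sq_dist[OF F _ le[OF order_refl]]) measurable
  have "(\<lambda>n. sq_dist (F n) G) \<longlonglongrightarrow> 0"
  proof (rule LIMSEQ_I)
    fix e :: real assume "e > 0"
    then obtain k where k: "(1 / 8) ^ k < e" using real_arch_pow_inv[of e "1 / 8"] by auto
    have "sq_dist (F n) G < e" if "n \<ge> N k" for n
      using le[OF that] nn_sq_dist[OF F G, of n] k by (simp add: ennreal_le_iff)
    then show "\<exists>no. \<forall>n\<ge>no. norm (sq_dist (F n) G - 0) < e" using sq_dist_nonneg by (intro exI[of _ "N k"]) auto
  qed
  with G show ?thesis by (rule that)
qed

lemma sq_dist_AE_subseq:
  assumes "\<And>n. square_integrable (F n)" "square_integrable G" "(\<lambda>n. sq_dist (F n) G) \<longlonglongrightarrow> 0"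
  obtains r :: "nat \<Rightarrow> nat" where "strict_mono r" "AE x in lebesgue. (\<lambda>n. F (r n) x) \<longlonglongrightarrow> G x"
proof -
  have i: "integrable lebesgue (\<lambda>x. (norm (F n x - G x))\<^sup>2)" for n
    using square_integrable_diff[OF assms(1,2)] by (simp add: square_integrable_def)
  have "(\<lambda>n. LINT x|lebesgue. norm ((norm (F n x - G x))\<^sup>2)) \<longlonglongrightarrow> 0"
    using assms(3) by (simp add: sq_dist_def)
  from tendsto_L1_AE_subseq[OF i this] obtain r :: "nat \<Rightarrow> nat" where r: "strict_mono r"
    "AE x in lebesgue. (\<lambda>n. (norm (F (r n) x - G x))\<^sup>2) \<longlonglongrightarrow> 0" by blast
  have "AE x in lebesgue. (\<lambda>n. F (r n) x) \<longlonglongrightarrow> G x"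
    using r(2)
  proof eventually_elim
    case (elim x)
    from tendsto_real_sqrt[OF elim] have "(\<lambda>n. norm (F (r n) x - G x)) \<longlonglongrightarrow> 0" by simp
    then show ?case by (simp add: tendsto_norm_zero_iff LIM_zero_iff)
  qed
  with r(1) show ?thesis by (rule that)
qed

text \<open>Convergence of the integrands in L^1, from the Young inequality b a <= \<delta> a^2 +
  b^2 / \<delta> with a the norm of \<open>H\<close> and b the norm of the difference.\<close>

lemma sq_dist_integral_tendsto:
  assumes "\<And>n. square_integrable (F n)" "square_integrable G" "(\<lambda>n. sq_dist (F n) G) \<longlonglongrightarrow> 0" "square_integrable H"
  shows "(\<lambda>n. LINT x|lebesgue. F n x \<bullet> H x) \<longlonglongrightarrow> (LINT x|lebesgue. G x \<bullet> H x)"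
proof (rule tendsto_L1_int)
  show "integrable lebesgue (\<lambda>x. F n x \<bullet> H x)" "integrable lebesgue (\<lambda>x. G x \<bullet> H x)" for n
    using assms by (auto intro: square_integrable_inner_integrable)
  note [measurable] = assms(1)[THEN square_integrable_measurable] assms(2,4)[THEN square_integrable_measurable]
  define A where "A = (LINT x|lebesgue. (norm (H x))\<^sup>2)"
  have A: "(\<integral>\<^sup>+x. ennreal ((norm (H x))\<^sup>2) \<partial>lebesgue) = ennreal A" "A \<ge> 0"
    unfolding A_def using assms(4) by (auto simp: square_integrable_def nn_integral_eq_integral)
  show "(\<lambda>n. \<integral>\<^sup>+x. ennreal (norm (F n x \<bullet> H x - G x \<bullet> H x)) \<partial>lebesgue) \<longlonglongrightarrow> 0"
  proof (rule ennreal_null_from_bounds[where A = A and c = "\<lambda>\<delta>. 1 / \<delta>" and \<epsilon> = "\<lambda>n. ennreal (sq_dist (F n) G)"])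
    fix \<delta> :: real and n assume \<delta>: "\<delta> > 0"
    have "(\<integral>\<^sup>+x. ennreal (norm (F n x \<bullet> H x - G x \<bullet> H x)) \<partial>lebesgue)
        \<le> (\<integral>\<^sup>+x. ennreal \<delta> * ennreal ((norm (H x))\<^sup>2) + ennreal (1 / \<delta>) * ennreal ((norm (F n x - G x))\<^sup>2) \<partial>lebesgue)"
    proof (rule nn_integral_mono)
      fix x
      define a b where "a = norm (H x)" and "b = norm (F n x - G x)"
      have "\<bar>F n x \<bullet> H x - G x \<bullet> H x\<bar> \<le> b * a"
        unfolding a_def b_def inner_diff_left[symmetric] by (rule Cauchy_Schwarz_ineq2)
      also have "b * a \<le> \<delta> * a\<^sup>2 + (1 / \<delta>) * b\<^sup>2"
      proof -
        \<comment> \<open>Expanding gives twice the Young inequality multiplied by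
          \<open>\<delta>\<close>.\<close>
        have "0 \<le> (\<delta> * a - b)\<^sup>2 + (\<delta> * a)\<^sup>2 + b\<^sup>2" by simp
        then have "\<delta> * (b * a) \<le> \<delta> * (\<delta> * a\<^sup>2 + (1 / \<delta>) * b\<^sup>2)"
          using \<delta> by (simp add: power2_eq_square algebra_simps)
        then show ?thesis using \<delta> by simp
      qed
      finally show "ennreal (norm (F n x \<bullet> H x - G x \<bullet> H x))
          \<le> ennreal \<delta> * ennreal ((norm (H x))\<^sup>2) + ennreal (1 / \<delta>) * ennreal ((norm (F n x - G x))\<^sup>2)"
        using \<delta> by (simp add: a_def b_def ennreal_leI flip: ennreal_mult ennreal_plus)
    qed
    also have "\<dots> = ennreal \<delta> * ennreal A + ennreal (1 / \<delta>) * ennreal (sq_dist (F n) G)"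
      by (subst nn_integral_add) (auto simp: nn_integral_cmult A nn_sq_dist[OF assms(1,2)])
    also have "ennreal \<delta> * ennreal A = ennreal (\<delta> * A)" using \<delta> A by (simp add: ennreal_mult)
    finally show "(\<integral>\<^sup>+x. ennreal (norm (F n x \<bullet> H x - G x \<bullet> H x)) \<partial>lebesgue)
        \<le> ennreal (\<delta> * A) + ennreal (1 / \<delta>) * ennreal (sq_dist (F n) G)" .
  qed (use assms(3) A sq_dist_nonneg in \<open>auto simp: ennreal_tendsto_0_iff\<close>)
qed

section \<open>Lipschitz functions in the homogeneous Sobolev space\<close>

text \<open>Members are continuous functions, so a.e. identities between them turn into pointwise
  ones.\<close>

definition lip_D12 :: "(R3 \<Rightarrow> real) set" where "lip_D12 = D12 \<inter> C01"

lemma lip_D12_continuous: "\<phi> \<in> lip_D12 \<Longrightarrow> continuous_on UNIV \<phi>"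
  unfolding lip_D12_def C01_def by (auto intro: lipschitz_on_continuous_on)

lemma lip_D12_measurable: "\<phi> \<in> lip_D12 \<Longrightarrow> \<phi> \<in> borel_measurable lebesgue"
  by (intro continuous_imp_measurable_lebesgue lip_D12_continuous)

lemma test_function_square_integrable: "test_function u \<Longrightarrow> square_integrable (grad u)"
proof -
  assume u: "test_function u"
  obtain R where R: "\<And>x. norm x > R \<Longrightarrow> grad u x = 0" using test_function_bounds[OF u] by metis
  have "integrable lebesgue (\<lambda>x. (norm (grad u x))\<^sup>2)"
    by (rule integrable_continuous_bounded_support[of _ R])
       (auto intro!: continuous_intros test_functionD(5)[OF u] simp: R)
  then show ?thesis unfolding square_integrable_def using test_function_integrable(4)[OF u] by simp
qed

text \<open>Both sides of the integration by parts formula for \<open>u n\<close> converge: the left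
  one by L^6 convergence of \<open>u n\<close> against a bounded field of compact support, the right
  one by L^2 convergence of the gradients.\<close>

lemma has_weak_grad_limit:
  assumes u: "\<And>n. test_function (u n)" and \<phi>: "continuous_on UNIV \<phi>"
    and l: "(\<lambda>n. \<integral>\<^sup>+x. ennreal (\<bar>u n x - \<phi> x\<bar> ^ 6) \<partial>lebesgue) \<longlonglongrightarrow> 0"
    and G: "square_integrable G" and d: "(\<lambda>n. sq_dist (grad (u n)) G) \<longlonglongrightarrow> 0"
  shows "has_weak_grad \<phi> G"
  unfolding has_weak_grad_def
proof (intro conjI allI impI)
  show "locally_integrable \<phi>" by (rule continuous_locally_integrable[OF \<phi>])
  show "locally_integrable G" using G by (intro locally_integrableI) (auto simp: square_integrable_def)
  fix \<psi> assume \<psi>: "test_function \<psi>"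
  obtain R M where R: "R > 0" "M > 0" "\<And>x. norm x > R \<Longrightarrow> \<psi> x = 0" "\<And>x. norm x > R \<Longrightarrow> grad \<psi> x = 0"
    "\<And>x. norm (grad \<psi> x) \<le> M"
    using test_function_bounds[OF \<psi>] by metis
  note [measurable] = test_function_integrable(3,4)[OF u] test_function_integrable(3,4)[OF \<psi>]
    continuous_imp_measurable_lebesgue[OF \<phi>]
  have 1: "(\<lambda>n. LINT x|lebesgue. u n x *\<^sub>R grad \<psi> x) \<longlonglongrightarrow> (LINT x|lebesgue. \<phi> x *\<^sub>R grad \<psi> x)"
  proof (rule tendsto_L1_int)
    show "integrable lebesgue (\<lambda>x. u n x *\<^sub>R grad \<psi> x)" "integrable lebesgue (\<lambda>x. \<phi> x *\<^sub>R grad \<psi> x)" for n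
      by (intro locally_integrable_times_grad \<psi> continuous_locally_integrable \<phi> test_functionD u)+
    have ig: "integrable lebesgue (\<lambda>x. norm (grad \<psi> x))" using test_function_integrable(2)[OF \<psi>] by simp
    define A where "A = (LINT x|lebesgue. norm (grad \<psi> x))"
    have A: "(\<integral>\<^sup>+x. ennreal (norm (grad \<psi> x)) \<partial>lebesgue) = ennreal A" "A \<ge> 0"
      unfolding A_def using nn_integral_eq_integral[OF ig] by auto
    show "(\<lambda>n. \<integral>\<^sup>+x. ennreal (norm (u n x *\<^sub>R grad \<psi> x - \<phi> x *\<^sub>R grad \<psi> x)) \<partial>lebesgue) \<longlonglongrightarrow> 0"
    proof (rule ennreal_null_from_bounds[where A = A and c = "\<lambda>\<delta>. M / \<delta> ^ 5"
          and \<epsilon> = "\<lambda>n. \<integral>\<^sup>+x. ennreal (\<bar>u n x - \<phi> x\<bar> ^ 6) \<partial>lebesgue"])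
      fix \<delta> :: real and n assume \<delta>: "\<delta> > 0"
      have "(\<integral>\<^sup>+x. ennreal (norm (u n x *\<^sub>R grad \<psi> x - \<phi> x *\<^sub>R grad \<psi> x)) \<partial>lebesgue)
          \<le> (\<integral>\<^sup>+x. ennreal \<delta> * ennreal (norm (grad \<psi> x)) + ennreal (M / \<delta> ^ 5) * ennreal (\<bar>u n x - \<phi> x\<bar> ^ 6) \<partial>lebesgue)"
      proof (rule nn_integral_mono)
        fix x
        define a where "a = \<bar>u n x - \<phi> x\<bar>"
        have a: "a \<ge> 0" by (simp add: a_def)
        \<comment> \<open>Either \<open>a \<le> \<delta>\<close>, or \<open>a ^ 5\<close> is at
          least \<open>\<delta> ^ 5\<close>.\<close>
        have "a \<le> \<delta> + a ^ 6 / \<delta> ^ 5"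
        proof (cases "a \<le> \<delta>")
          case True
          then show ?thesis using a \<delta> by (simp add: add_increasing2)
        next
          case False
          then have "a * \<delta> ^ 5 \<le> a * a ^ 5" using \<delta> a by (intro mult_left_mono power_mono) auto
          then have "a \<le> a ^ 6 / \<delta> ^ 5" using \<delta> by (simp add: field_simps power_Suc[of a 5, simplified, symmetric] eval_nat_numeral)
          then show ?thesis using \<delta> by linarith
        qed
        then have "a * norm (grad \<psi> x) \<le> (\<delta> + a ^ 6 / \<delta> ^ 5) * norm (grad \<psi> x)"
          by (intro mult_right_mono) auto
        also have "\<dots> = \<delta> * norm (grad \<psi> x) + (a ^ 6 / \<delta> ^ 5) * norm (grad \<psi> x)" by (simp add: algebra_simps)
        also have "\<dots> \<le> \<delta> * norm (grad \<psi> x) + (a ^ 6 / \<delta> ^ 5) * M"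
          using R(5) a \<delta> by (intro add_left_mono mult_left_mono) auto
        finally have "norm (u n x *\<^sub>R grad \<psi> x - \<phi> x *\<^sub>R grad \<psi> x) \<le> \<delta> * norm (grad \<psi> x) + (M / \<delta> ^ 5) * a ^ 6"
          by (simp add: a_def mult.commute flip: scaleR_diff_left)
        then show "ennreal (norm (u n x *\<^sub>R grad \<psi> x - \<phi> x *\<^sub>R grad \<psi> x))
            \<le> ennreal \<delta> * ennreal (norm (grad \<psi> x)) + ennreal (M / \<delta> ^ 5) * ennreal (\<bar>u n x - \<phi> x\<bar> ^ 6)"
          using \<delta> R(2) unfolding a_def by (simp add: ennreal_leI flip: ennreal_mult ennreal_plus)
      qed
      also have "\<dots> = ennreal \<delta> * ennreal A + ennreal (M / \<delta> ^ 5) * (\<integral>\<^sup>+x. ennreal (\<bar>u n x - \<phi> x\<bar> ^ 6) \<partial>lebesgue)"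
        by (subst nn_integral_add) (auto simp: nn_integral_cmult A)
      also have "ennreal \<delta> * ennreal A = ennreal (\<delta> * A)" using \<delta> A by (simp add: ennreal_mult)
      finally show "(\<integral>\<^sup>+x. ennreal (norm (u n x *\<^sub>R grad \<psi> x - \<phi> x *\<^sub>R grad \<psi> x)) \<partial>lebesgue)
          \<le> ennreal (\<delta> * A) + ennreal (M / \<delta> ^ 5) * (\<integral>\<^sup>+x. ennreal (\<bar>u n x - \<phi> x\<bar> ^ 6) \<partial>lebesgue)" .
    qed (use l A in auto)
  qed
  have sq: "square_integrable (\<lambda>x. \<psi> x *\<^sub>R e)" for e :: R3
  proof -
    have "integrable lebesgue (\<lambda>x. (norm (\<psi> x *\<^sub>R e))\<^sup>2)"
      by (rule integrable_continuous_bounded_support[of _ R])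
         (auto intro!: continuous_intros test_functionD(3)[OF \<psi>] simp: R)
    then show ?thesis unfolding square_integrable_def by simp
  qed
  have 2: "(\<lambda>n. (LINT x|lebesgue. \<psi> x *\<^sub>R grad (u n) x) \<bullet> e) \<longlonglongrightarrow> (LINT x|lebesgue. \<psi> x *\<^sub>R G x) \<bullet> e" for e
  proof -
    have i: "integrable lebesgue (\<lambda>x. \<psi> x *\<^sub>R H x)" if "square_integrable H" for H :: "R3 \<Rightarrow> R3"
      using that by (intro test_function_times_locally_integrable \<psi> locally_integrableI) (auto simp: square_integrable_def)
    have eq: "(LINT x|lebesgue. \<psi> x *\<^sub>R H x) \<bullet> e = (LINT x|lebesgue. H x \<bullet> (\<psi> x *\<^sub>R e))" if "square_integrable H" for H
      using integral_inner_left[of e lebesgue "\<lambda>x. \<psi> x *\<^sub>R H x"] i[OF that] by simp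
    show ?thesis unfolding eq[OF G] eq[OF test_function_square_integrable[OF u]]
      by (rule sq_dist_integral_tendsto[OF test_function_square_integrable[OF u] G d sq])
  qed
  have e: "(LINT x|lebesgue. u n x *\<^sub>R grad \<psi> x) = - (LINT x|lebesgue. \<psi> x *\<^sub>R grad (u n) x)" for n
    using test_function_has_weak_grad[OF u] \<psi> unfolding has_weak_grad_def by blast
  show "(LINT x|lebesgue. \<phi> x *\<^sub>R grad \<psi> x) = - (LINT x|lebesgue. \<psi> x *\<^sub>R G x)"
  proof (rule vector_eq_rdot[THEN iffD1], rule allI)
    fix e
    have "(\<lambda>n. (LINT x|lebesgue. u n x *\<^sub>R grad \<psi> x) \<bullet> e) \<longlonglongrightarrow> (LINT x|lebesgue. \<phi> x *\<^sub>R grad \<psi> x) \<bullet> e"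
      by (intro tendsto_intros 1)
    moreover have "(\<lambda>n. (LINT x|lebesgue. u n x *\<^sub>R grad \<psi> x) \<bullet> e) \<longlonglongrightarrow> (- (LINT x|lebesgue. \<psi> x *\<^sub>R G x)) \<bullet> e"
      unfolding e inner_minus_left by (intro tendsto_intros 2)
    ultimately show "(LINT x|lebesgue. \<phi> x *\<^sub>R grad \<psi> x) \<bullet> e = (- (LINT x|lebesgue. \<psi> x *\<^sub>R G x)) \<bullet> e"
      by (rule LIMSEQ_unique)
  qed
qed

lemma sq_dist_grad: "sqrt (LINT x|lebesgue. (norm (grad u x - grad v x))\<^sup>2) = sqrt (sq_dist (grad u) (grad v))"
  by (simp add: sq_dist_def)

text \<open>\<open>D12\<close> only provides test functions whose gradients are Cauchy. By
  completeness these gradients have an L^2 limit, which is a weak gradient by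
  \<open>has_weak_grad_limit\<close> and hence agrees a.e. with \<open>wgrad \<phi>\<close>.\<close>

lemma lip_D12_cases:
  assumes "\<phi> \<in> lip_D12"
  obtains u where "\<And>n::nat. test_function (u n)" "square_integrable (wgrad \<phi>)" "has_weak_grad \<phi> (wgrad \<phi>)"
    "(\<lambda>n. sq_dist (grad (u n)) (wgrad \<phi>)) \<longlonglongrightarrow> 0"
    "(\<lambda>n. \<integral>\<^sup>+x. ennreal (\<bar>u n x - \<phi> x\<bar> ^ 6) \<partial>lebesgue) \<longlonglongrightarrow> 0"
proof -
  obtain u where u: "\<And>n::nat. test_function (u n)"
    and c: "\<And>e. e > 0 \<Longrightarrow> \<exists>N. \<forall>m\<ge>N. \<forall>n\<ge>N. sqrt (sq_dist (grad (u m)) (grad (u n))) < e"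
    and l: "(\<lambda>n. \<integral>\<^sup>+x. ennreal (\<bar>u n x - \<phi> x\<bar> ^ 6) \<partial>lebesgue) \<longlonglongrightarrow> 0"
    using assms unfolding lip_D12_def D12_def sq_dist_grad by blast
  have c2: "\<exists>N. \<forall>m\<ge>N. \<forall>n\<ge>N. sq_dist (grad (u m)) (grad (u n)) < e" if "e > 0" for e
    using c[of "sqrt e"] that by simp
  obtain G where G: "square_integrable G" "(\<lambda>n. sq_dist (grad (u n)) G) \<longlonglongrightarrow> 0"
    using square_integrable_complete[OF test_function_square_integrable[OF u] c2] by blast
  have w: "has_weak_grad \<phi> G"
    by (rule has_weak_grad_limit[OF u lip_D12_continuous[OF assms] l G])
  have ae: "AE x in lebesgue. wgrad \<phi> x = G x" by (rule wgrad_AE_eq[OF w])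
  have h: "has_weak_grad \<phi> (wgrad \<phi>)" by (rule wgrad_works[OF w])
  have m: "wgrad \<phi> \<in> borel_measurable lebesgue"
    using h by (auto simp: has_weak_grad_def intro: locally_integrable_measurable)
  have s: "square_integrable (wgrad \<phi>)"
    by (rule square_integrable_AE_cong[OF G(1) m]) (use ae in eventually_elim, simp)
  have "sq_dist (grad (u n)) (wgrad \<phi>) = sq_dist (grad (u n)) G" for n
    unfolding sq_dist_def
    by (rule integral_cong_AE)
       (use ae m G(1) test_function_integrable(4)[OF u] in \<open>auto simp: square_integrable_def\<close>)
  then show ?thesis using that[OF u s h _ l] G by simp
qed

lemma lip_D12_square_integrable: "\<phi> \<in> lip_D12 \<Longrightarrow> square_integrable (wgrad \<phi>)" by (erule lip_D12_cases)

lemma lip_D12_has_weak_grad: "\<phi> \<in> lip_D12 \<Longrightarrow> has_weak_grad \<phi> (wgrad \<phi>)" by (erule lip_D12_cases)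

text \<open>A converse of \<open>lip_D12_cases\<close>, used to enter the space; it also identifies
  the weak gradient.\<close>

lemma lip_D12_I:
  assumes u: "\<And>n::nat. test_function (u n)" and G: "square_integrable G" "(\<lambda>n. sq_dist (grad (u n)) G) \<longlonglongrightarrow> 0"
    and l: "(\<lambda>n. \<integral>\<^sup>+x. ennreal (\<bar>u n x - \<phi> x\<bar> ^ 6) \<partial>lebesgue) \<longlonglongrightarrow> 0"
    and \<phi>: "\<phi> \<in> C01"
  shows "\<phi> \<in> lip_D12" "AE x in lebesgue. wgrad \<phi> x = G x"
proof -
  have c: "continuous_on UNIV \<phi>"
    using \<phi> unfolding C01_def by (auto intro: lipschitz_on_continuous_on)
  show "AE x in lebesgue. wgrad \<phi> x = G x"
    by (rule wgrad_AE_eq[OF has_weak_grad_limit[OF u c l G]])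
  have "\<exists>N. \<forall>m\<ge>N. \<forall>n\<ge>N. sqrt (sq_dist (grad (u m)) (grad (u n))) < e" if e: "e > 0" for e
  proof -
    have "eventually (\<lambda>n. sq_dist (grad (u n)) G < e\<^sup>2 / 4) sequentially"
      by (rule order_tendstoD[OF G(2)]) (use e in simp)
    then obtain N where N: "\<And>n. n \<ge> N \<Longrightarrow> sq_dist (grad (u n)) G < e\<^sup>2 / 4" by (auto simp: eventually_sequentially)
    have "sqrt (sq_dist (grad (u m)) (grad (u n))) < e" if "m \<ge> N" "n \<ge> N" for m n
    proof -
      have "sq_dist (grad (u m)) (grad (u n)) < e\<^sup>2"
        using sq_dist_triangle[OF test_function_square_integrable[OF u, of m] test_function_square_integrable[OF u, of n] G(1)]
          N[OF that(1)] N[OF that(2)] sq_dist_commute[of G "grad (u n)"] by simp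
      then have "sqrt (sq_dist (grad (u m)) (grad (u n))) < sqrt (e\<^sup>2)" by (rule real_sqrt_less_mono)
      then show ?thesis using e by simp
    qed
    then show ?thesis by blast
  qed
  then show "\<phi> \<in> lip_D12"
    unfolding lip_D12_def D12_def sq_dist_grad using u l \<phi> continuous_imp_measurable_lebesgue[OF c] by blast
qed

lemma lip_D12_approx:
  assumes "\<phi> \<in> lip_D12"
  obtains u where "\<And>n::nat. test_function (u n)" "square_integrable (wgrad \<phi>)" "(\<lambda>n. sq_dist (grad (u n)) (wgrad \<phi>)) \<longlonglongrightarrow> 0"
    "(\<lambda>n. \<integral>\<^sup>+x. ennreal (\<bar>u n x - \<phi> x\<bar> ^ 6) \<partial>lebesgue) \<longlonglongrightarrow> 0"
  by (rule lip_D12_cases[OF assms]) blast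

section \<open>Closure of \<open>lip_D12\<close> under linear combinations and orthogonal
  maps\<close>

lemma C01_add: "\<phi> \<in> C01 \<Longrightarrow> \<psi> \<in> C01 \<Longrightarrow> (\<lambda>x. \<phi> x + \<psi> x) \<in> C01"
  unfolding C01_def using lipschitz_on_add by blast

lemma C01_cmult: "\<phi> \<in> C01 \<Longrightarrow> (\<lambda>x. c * \<phi> x) \<in> C01"
  unfolding C01_def using lipschitz_on_cmult_real[of _ UNIV \<phi> c] by auto

lemma C01_orthogonal:
  assumes "\<phi> \<in> C01" "orthogonal_transformation g"
  shows "(\<lambda>x. \<phi> (g x)) \<in> C01"
proof -
  obtain L where L: "L-lipschitz_on UNIV \<phi>" using assms by (auto simp: C01_def)
  have "L-lipschitz_on UNIV (\<lambda>x. \<phi> (g x))"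
  proof (rule lipschitz_onI)
    fix x y
    have "dist (\<phi> (g x)) (\<phi> (g y)) \<le> L * dist (g x) (g y)" by (rule lipschitz_onD[OF L]) auto
    also have "dist (g x) (g y) = dist x y" using orthogonal_transformation_norm[OF assms(2), of "x - y"] orthogonal_transformation_linear[OF assms(2)]
      by (simp add: dist_norm linear_diff)
    finally show "dist (\<phi> (g x)) (\<phi> (g y)) \<le> L * dist x y" .
  qed (rule lipschitz_on_nonneg[OF L])
  then show ?thesis by (auto simp: C01_def)
qed

lemma abs_add_pow6_le: "\<bar>a + b\<bar> ^ 6 \<le> 64 * (\<bar>a\<bar> ^ 6 + \<bar>b :: real\<bar> ^ 6)"
proof -
  define m where "m = max \<bar>a\<bar> \<bar>b\<bar>"
  have "\<bar>a + b\<bar> ^ 6 \<le> (2 * m) ^ 6" by (intro power_mono) (auto simp: m_def)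
  also have "\<dots> = 64 * m ^ 6" by (simp add: power_mult_distrib)
  also have "m ^ 6 \<le> \<bar>a\<bar> ^ 6 + \<bar>b\<bar> ^ 6" unfolding m_def max_def by auto
  finally show ?thesis by simp
qed

lemma nn_pow6_add_le:
  assumes [measurable]: "f \<in> borel_measurable lebesgue" "g \<in> borel_measurable lebesgue"
  shows "(\<integral>\<^sup>+x. ennreal (\<bar>f x + g x\<bar> ^ 6) \<partial>lebesgue)
    \<le> 64 * ((\<integral>\<^sup>+x. ennreal (\<bar>f x\<bar> ^ 6) \<partial>lebesgue) + (\<integral>\<^sup>+x. ennreal (\<bar>g x\<bar> ^ 6) \<partial>(lebesgue :: R3 measure)))"
proof -
  have "(\<integral>\<^sup>+x. ennreal (\<bar>f x + g x\<bar> ^ 6) \<partial>lebesgue)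
      \<le> (\<integral>\<^sup>+x. 64 * (ennreal (\<bar>f x\<bar> ^ 6) + ennreal (\<bar>g x\<bar> ^ 6)) \<partial>lebesgue)"
  proof (rule nn_integral_mono)
    fix x
    have "64 * (ennreal (\<bar>f x\<bar> ^ 6) + ennreal (\<bar>g x\<bar> ^ 6)) = ennreal (64 * (\<bar>f x\<bar> ^ 6 + \<bar>g x\<bar> ^ 6))"
      by (simp add: ennreal_mult)
    then show "ennreal (\<bar>f x + g x\<bar> ^ 6) \<le> 64 * (ennreal (\<bar>f x\<bar> ^ 6) + ennreal (\<bar>g x\<bar> ^ 6))"
      using ennreal_leI[OF abs_add_pow6_le[of "f x" "g x"]] by simp
  qed
  also have "\<dots> = 64 * ((\<integral>\<^sup>+x. ennreal (\<bar>f x\<bar> ^ 6) \<partial>lebesgue) + (\<integral>\<^sup>+x. ennreal (\<bar>g x\<bar> ^ 6) \<partial>lebesgue))"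
    by (subst nn_integral_cmult) (auto simp: nn_integral_add)
  finally show ?thesis .
qed

lemma real_null_mono:
  fixes X Y :: "nat \<Rightarrow> real"
  assumes "\<And>n. 0 \<le> X n" "\<And>n. X n \<le> Y n" "Y \<longlonglongrightarrow> 0"
  shows "X \<longlonglongrightarrow> 0"
  by (rule tendsto_sandwich[OF always_eventually always_eventually tendsto_const assms(3)]) (use assms in auto)

lemma ennreal_null_mono:
  fixes X \<epsilon> :: "nat \<Rightarrow> ennreal"
  assumes "\<And>n. X n \<le> c * \<epsilon> n" "c < top" "\<epsilon> \<longlonglongrightarrow> 0"
  shows "X \<longlonglongrightarrow> 0"
proof (rule tendsto_sandwich[of "\<lambda>_. 0"])
  show "(\<lambda>n. c * \<epsilon> n) \<longlonglongrightarrow> 0" using ennreal_tendsto_cmult[OF assms(2,3)] by simp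
qed (use assms(1) in auto)

lemma lip_D12_add:
  assumes "\<phi> \<in> lip_D12" "\<psi> \<in> lip_D12"
  shows "(\<lambda>x. \<phi> x + \<psi> x) \<in> lip_D12"
proof -
  obtain u where u: "\<And>n::nat. test_function (u n)" "square_integrable (wgrad \<phi>)" "(\<lambda>n. sq_dist (grad (u n)) (wgrad \<phi>)) \<longlonglongrightarrow> 0"
    "(\<lambda>n. \<integral>\<^sup>+x. ennreal (\<bar>u n x - \<phi> x\<bar> ^ 6) \<partial>lebesgue) \<longlonglongrightarrow> 0" by (rule lip_D12_approx[OF assms(1)]) blast
  obtain v where v: "\<And>n::nat. test_function (v n)" "square_integrable (wgrad \<psi>)" "(\<lambda>n. sq_dist (grad (v n)) (wgrad \<psi>)) \<longlonglongrightarrow> 0"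
    "(\<lambda>n. \<integral>\<^sup>+x. ennreal (\<bar>v n x - \<psi> x\<bar> ^ 6) \<partial>lebesgue) \<longlonglongrightarrow> 0" by (rule lip_D12_approx[OF assms(2)]) blast
  note [measurable] = test_function_integrable(3)[OF u(1)] test_function_integrable(3)[OF v(1)] assms[THEN lip_D12_measurable]
  show ?thesis
  proof (rule lip_D12_I(1)[where u = "\<lambda>n x. u n x + v n x" and G = "\<lambda>x. wgrad \<phi> x + wgrad \<psi> x"])
    show "test_function (\<lambda>x. u n x + v n x)" for n by (intro test_function_add u v)
    show sq: "square_integrable (\<lambda>x. wgrad \<phi> x + wgrad \<psi> x)" by (intro square_integrable_add u v)
    show "(\<lambda>x. \<phi> x + \<psi> x) \<in> C01" using assms by (auto simp: lip_D12_def intro: C01_add)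
    have "sq_dist (grad (\<lambda>x. u n x + v n x)) (\<lambda>x. wgrad \<phi> x + wgrad \<psi> x) \<le> 2 * sq_dist (grad (u n)) (wgrad \<phi>) + 2 * sq_dist (grad (v n)) (wgrad \<psi>)" for n
    proof -
      have "sq_dist (grad (\<lambda>x. u n x + v n x)) (\<lambda>x. wgrad \<phi> x + wgrad \<psi> x)
         = (LINT x|lebesgue. (norm ((grad (u n) x - wgrad \<phi> x) + (grad (v n) x - wgrad \<psi> x)))\<^sup>2)"
        unfolding sq_dist_def by (simp add: grad_add[OF u(1) v(1)] algebra_simps)
      also have "\<dots> \<le> (LINT x|lebesgue. 2 * (norm (grad (u n) x - wgrad \<phi> x))\<^sup>2 + 2 * (norm (grad (v n) x - wgrad \<psi> x))\<^sup>2)"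
        using square_integrable_add[OF square_integrable_diff[OF test_function_square_integrable[OF u(1)] u(2)] square_integrable_diff[OF test_function_square_integrable[OF v(1)] v(2)]]
          square_integrable_diff[OF test_function_square_integrable[OF u(1)] u(2)] square_integrable_diff[OF test_function_square_integrable[OF v(1)] v(2)]
        by (intro integral_mono norm_sum_sq_le) (auto simp: square_integrable_def)
      also have "\<dots> = 2 * sq_dist (grad (u n)) (wgrad \<phi>) + 2 * sq_dist (grad (v n)) (wgrad \<psi>)"
        using square_integrable_diff[OF test_function_square_integrable[OF u(1)] u(2)] square_integrable_diff[OF test_function_square_integrable[OF v(1)] v(2)]
        unfolding sq_dist_def by (auto simp: square_integrable_def)
      finally show ?thesis .
    qed
    moreover have "(\<lambda>n. 2 * sq_dist (grad (u n)) (wgrad \<phi>) + 2 * sq_dist (grad (v n)) (wgrad \<psi>)) \<longlonglongrightarrow> 2 * 0 + 2 * 0"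
      by (intro tendsto_intros u v)
    ultimately show "(\<lambda>n. sq_dist (grad (\<lambda>x. u n x + v n x)) (\<lambda>x. wgrad \<phi> x + wgrad \<psi> x)) \<longlonglongrightarrow> 0"
      by (intro real_null_mono[OF sq_dist_nonneg, where Y = "\<lambda>n. 2 * sq_dist (grad (u n)) (wgrad \<phi>) + 2 * sq_dist (grad (v n)) (wgrad \<psi>)"]) auto
    have "(\<integral>\<^sup>+x. ennreal (\<bar>u n x + v n x - (\<phi> x + \<psi> x)\<bar> ^ 6) \<partial>lebesgue)
       \<le> 64 * ((\<integral>\<^sup>+x. ennreal (\<bar>u n x - \<phi> x\<bar> ^ 6) \<partial>lebesgue) + (\<integral>\<^sup>+x. ennreal (\<bar>v n x - \<psi> x\<bar> ^ 6) \<partial>lebesgue))" for n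
      using nn_pow6_add_le[of "\<lambda>x. u n x - \<phi> x" "\<lambda>x. v n x - \<psi> x"] by (simp add: algebra_simps)
    then show "(\<lambda>n. \<integral>\<^sup>+x. ennreal (\<bar>u n x + v n x - (\<phi> x + \<psi> x)\<bar> ^ 6) \<partial>lebesgue) \<longlonglongrightarrow> 0"
      by (rule ennreal_null_mono) (use tendsto_add[OF u(4) v(4)] in auto)
  qed
qed

lemma lip_D12_cmult:
  assumes "\<phi> \<in> lip_D12"
  shows "(\<lambda>x. c * \<phi> x) \<in> lip_D12"
proof -
  obtain u where u: "\<And>n::nat. test_function (u n)" "square_integrable (wgrad \<phi>)" "(\<lambda>n. sq_dist (grad (u n)) (wgrad \<phi>)) \<longlonglongrightarrow> 0"
    "(\<lambda>n. \<integral>\<^sup>+x. ennreal (\<bar>u n x - \<phi> x\<bar> ^ 6) \<partial>lebesgue) \<longlonglongrightarrow> 0" by (rule lip_D12_approx[OF assms(1)]) blast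
  note [measurable] = test_function_integrable(3)[OF u(1)] assms[THEN lip_D12_measurable]
  show ?thesis
  proof (rule lip_D12_I(1)[where u = "\<lambda>n x. c * u n x" and G = "\<lambda>x. c *\<^sub>R wgrad \<phi> x"])
    show "test_function (\<lambda>x. c * u n x)" for n by (intro test_function_cmult u)
    show "square_integrable (\<lambda>x. c *\<^sub>R wgrad \<phi> x)" by (intro square_integrable_scaleR u)
    show "(\<lambda>x. c * \<phi> x) \<in> C01" using assms by (auto simp: lip_D12_def intro: C01_cmult)
    have "sq_dist (grad (\<lambda>x. c * u n x)) (\<lambda>x. c *\<^sub>R wgrad \<phi> x) = c\<^sup>2 * sq_dist (grad (u n)) (wgrad \<phi>)" for n
      unfolding sq_dist_def by (simp add: grad_cmult[OF u(1)] power_mult_distrib flip: scaleR_diff_right)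
    moreover have "(\<lambda>n. c\<^sup>2 * sq_dist (grad (u n)) (wgrad \<phi>)) \<longlonglongrightarrow> c\<^sup>2 * 0"
      by (intro tendsto_intros u)
    ultimately show "(\<lambda>n. sq_dist (grad (\<lambda>x. c * u n x)) (\<lambda>x. c *\<^sub>R wgrad \<phi> x)) \<longlonglongrightarrow> 0" by simp
    have "(\<integral>\<^sup>+x. ennreal (\<bar>c * u n x - c * \<phi> x\<bar> ^ 6) \<partial>lebesgue)
       \<le> ennreal (\<bar>c\<bar> ^ 6) * (\<integral>\<^sup>+x. ennreal (\<bar>u n x - \<phi> x\<bar> ^ 6) \<partial>lebesgue)" for n
      by (subst nn_integral_cmult[symmetric])
         (auto simp: abs_mult power_mult_distrib ennreal_mult simp flip: right_diff_distrib)
    then show "(\<lambda>n. \<integral>\<^sup>+x. ennreal (\<bar>c * u n x - c * \<phi> x\<bar> ^ 6) \<partial>lebesgue) \<longlonglongrightarrow> 0"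
      by (rule ennreal_null_mono) (use u(4) in auto)
  qed
qed

lemma lip_D12_orthogonal:
  assumes "\<phi> \<in> lip_D12" "orthogonal_transformation g"
  shows "(\<lambda>x. \<phi> (g x)) \<in> lip_D12"
proof -
  obtain u where u: "\<And>n::nat. test_function (u n)" "square_integrable (wgrad \<phi>)" "(\<lambda>n. sq_dist (grad (u n)) (wgrad \<phi>)) \<longlonglongrightarrow> 0"
    "(\<lambda>n. \<integral>\<^sup>+x. ennreal (\<bar>u n x - \<phi> x\<bar> ^ 6) \<partial>lebesgue) \<longlonglongrightarrow> 0" by (rule lip_D12_approx[OF assms(1)]) blast
  note [measurable] = test_function_integrable(3,4)[OF u(1)] assms(1)[THEN lip_D12_measurable] square_integrable_measurable[OF u(2)]
  have lin: "linear g" using assms(2) orthogonal_transformation_linear by blast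
  have la: "linear (adjoint g)" by (rule adjoint_linear[OF lin])
  have mp: "measure_preserving g" by (rule measure_preserving_orthogonal[OF assms(2)])
  note na = adjoint_orthogonal(3)[OF assms(2)]
  show ?thesis
  proof (rule lip_D12_I(1)[where u = "\<lambda>n x. u n (g x + 0)" and G = "\<lambda>x. adjoint g (wgrad \<phi> (g x))"])
    show "test_function (\<lambda>x. u n (g x + 0))" for n
      by (rule test_function_linear_compose[OF u(1) lin, of 1]) (simp_all add: orthogonal_transformation_norm[OF assms(2)])
    have m: "(\<lambda>x. wgrad \<phi> (g x)) \<in> borel_measurable lebesgue" by (rule measure_preserving_compose_measurable[OF mp]) measurable
    show "square_integrable (\<lambda>x. adjoint g (wgrad \<phi> (g x)))" unfolding square_integrable_def na
    proof
      have "adjoint g \<in> borel_measurable borel"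
        using la by (intro borel_measurable_continuous_onI linear_continuous_on) (simp add: linear_conv_bounded_linear)
      then show "(\<lambda>x. adjoint g (wgrad \<phi> (g x))) \<in> borel_measurable lebesgue"
        by (rule measurable_compose[OF m])
      show "integrable lebesgue (\<lambda>x. (norm (wgrad \<phi> (g x)))\<^sup>2)"
        by (rule measure_preserving_integrable[OF mp square_integrable_integrable[OF u(2)]])
    qed
    show "(\<lambda>x. \<phi> (g x)) \<in> C01" using assms by (auto simp: lip_D12_def intro: C01_orthogonal)
    have "sq_dist (grad (\<lambda>x. u n (g x + 0))) (\<lambda>x. adjoint g (wgrad \<phi> (g x))) = sq_dist (grad (u n)) (wgrad \<phi>)" for n
    proof -
      have "sq_dist (grad (\<lambda>x. u n (g x + 0))) (\<lambda>x. adjoint g (wgrad \<phi> (g x)))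
        = (LINT x|lebesgue. (norm (grad (u n) (g x) - wgrad \<phi> (g x)))\<^sup>2)"
        unfolding sq_dist_def grad_linear_compose[OF u(1) lin] by (simp add: na flip: linear_diff[OF la])
      also have "\<dots> = sq_dist (grad (u n)) (wgrad \<phi>)"
        unfolding sq_dist_def by (rule measure_preserving_integral[OF mp]) measurable
      finally show ?thesis .
    qed
    then show "(\<lambda>n. sq_dist (grad (\<lambda>x. u n (g x + 0))) (\<lambda>x. adjoint g (wgrad \<phi> (g x)))) \<longlonglongrightarrow> 0" using u(3) by simp
    have "(\<integral>\<^sup>+x. ennreal (\<bar>u n (g x + 0) - \<phi> (g x)\<bar> ^ 6) \<partial>lebesgue) = (\<integral>\<^sup>+x. ennreal (\<bar>u n x - \<phi> x\<bar> ^ 6) \<partial>lebesgue)" for n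
      using measure_preserving_nn_integral[OF mp, of "\<lambda>x. ennreal (\<bar>u n x - \<phi> x\<bar> ^ 6)"] by simp
    then show "(\<lambda>n. \<integral>\<^sup>+x. ennreal (\<bar>u n (g x + 0) - \<phi> (g x)\<bar> ^ 6) \<partial>lebesgue) \<longlonglongrightarrow> 0" using u(4) by simp
  qed
qed

lemma lip_D12_wgrad_add: "\<phi> \<in> lip_D12 \<Longrightarrow> \<psi> \<in> lip_D12 \<Longrightarrow> AE x in lebesgue. wgrad (\<lambda>x. \<phi> x + \<psi> x) x = wgrad \<phi> x + wgrad \<psi> x"
  by (intro wgrad_AE_eq has_weak_grad_add lip_D12_has_weak_grad)

lemma lip_D12_wgrad_cmult: "\<phi> \<in> lip_D12 \<Longrightarrow> AE x in lebesgue. wgrad (\<lambda>x. c * \<phi> x) x = c *\<^sub>R wgrad \<phi> x"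
  by (intro wgrad_AE_eq has_weak_grad_cmult lip_D12_has_weak_grad)

lemma lip_D12_wgrad_orthogonal: "\<phi> \<in> lip_D12 \<Longrightarrow> orthogonal_transformation g \<Longrightarrow>
    AE x in lebesgue. wgrad (\<lambda>x. \<phi> (g x)) x = adjoint g (wgrad \<phi> (g x))"
  by (intro wgrad_AE_eq has_weak_grad_orthogonal lip_D12_has_weak_grad)

lemma lip_D12_diff:
  assumes "\<phi> \<in> lip_D12" "\<psi> \<in> lip_D12"
  shows "(\<lambda>x. \<phi> x - \<psi> x) \<in> lip_D12" "AE x in lebesgue. wgrad (\<lambda>x. \<phi> x - \<psi> x) x = wgrad \<phi> x - wgrad \<psi> x"
proof -
  have eq: "(\<lambda>x. \<phi> x - \<psi> x) = (\<lambda>x. \<phi> x + (-1) * \<psi> x)" by simp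
  show "(\<lambda>x. \<phi> x - \<psi> x) \<in> lip_D12" unfolding eq by (intro lip_D12_add lip_D12_cmult assms)
  show "AE x in lebesgue. wgrad (\<lambda>x. \<phi> x - \<psi> x) x = wgrad \<phi> x - wgrad \<psi> x"
    unfolding eq using lip_D12_wgrad_add[OF assms(1) lip_D12_cmult[OF assms(2), of "-1"]] lip_D12_wgrad_cmult[OF assms(2), of "-1"]
    by eventually_elim simp
qed

lemma test_function_in_lip_D12: "test_function u \<Longrightarrow> u \<in> lip_D12" "test_function u \<Longrightarrow> AE x in lebesgue. wgrad u x = grad u x"
proof -
  assume u: "test_function u"
  show "AE x in lebesgue. wgrad u x = grad u x" by (rule wgrad_AE_eq[OF test_function_has_weak_grad[OF u]])
  obtain M where M: "M > 0" "\<And>x. norm (grad u x) \<le> M" using test_function_bounds[OF u] by metis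
  have "M-lipschitz_on UNIV u"
    using gradient_bound_imp_Lipschitz[OF test_functionD(2)[OF u] M(2)] M(1)
    by (intro lipschitz_onI) (auto simp: dist_norm)
  then have c: "u \<in> C01" by (auto simp: C01_def)
  show "u \<in> lip_D12"
    by (rule lip_D12_I(1)[where u = "\<lambda>n. u" and G = "grad u", OF u test_function_square_integrable[OF u] _ _ c])
       (simp_all add: sq_dist_def)
qed

lemma zero_in_lip_D12: "(\<lambda>x. 0) \<in> lip_D12" "AE x in lebesgue. wgrad (\<lambda>x. 0) x = 0"
proof -
  have t: "test_function (\<lambda>x. 0)" by (rule test_functionI[of _ 0]) (auto intro: Ck_const)
  show "(\<lambda>x. 0) \<in> lip_D12" by (rule test_function_in_lip_D12(1)[OF t])
  have "grad (\<lambda>x. 0) x = 0" for x by (intro grad_eq GDERIV_const)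
  then show "AE x in lebesgue. wgrad (\<lambda>x. 0) x = 0" using test_function_in_lip_D12(2)[OF t] by simp
qed

section \<open>Sobolev's inequality, uniqueness and completeness in \<open>lip_D12\<close>\<close>

lemma Sobolev_lip_D12:
  assumes "\<phi> \<in> lip_D12"
  shows "(\<integral>\<^sup>+x. ennreal (\<bar>\<phi> x\<bar> ^ 6) \<partial>lebesgue) \<le> ennreal (2097152 * (LINT x|lebesgue. (norm (wgrad \<phi> x))\<^sup>2) ^ 3)"
proof -
  obtain u where u: "\<And>n::nat. test_function (u n)" "square_integrable (wgrad \<phi>)" "(\<lambda>n. sq_dist (grad (u n)) (wgrad \<phi>)) \<longlonglongrightarrow> 0"
    "(\<lambda>n. \<integral>\<^sup>+x. ennreal (\<bar>u n x - \<phi> x\<bar> ^ 6) \<partial>lebesgue) \<longlonglongrightarrow> 0" by (rule lip_D12_approx[OF assms(1)]) blast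
  note [measurable] = test_function_integrable(3)[OF u(1)] assms[THEN lip_D12_measurable]
  define E where "E = (LINT x|lebesgue. (norm (wgrad \<phi> x))\<^sup>2)"
  define \<delta> where "\<delta> n = sq_dist (grad (u n)) (wgrad \<phi>)" for n
  define \<epsilon> where "\<epsilon> n = (\<integral>\<^sup>+x. ennreal (\<bar>u n x - \<phi> x\<bar> ^ 6) \<partial>lebesgue)" for n
  have "(\<integral>\<^sup>+x. ennreal (\<bar>\<phi> x\<bar> ^ 6) \<partial>lebesgue) \<le> 64 * (\<epsilon> n + ennreal (4096 * (2 * \<delta> n + 2 * E) ^ 3))" for n
  proof -
    have "(\<integral>\<^sup>+x. ennreal (\<bar>\<phi> x\<bar> ^ 6) \<partial>lebesgue)
        \<le> 64 * ((\<integral>\<^sup>+x. ennreal (\<bar>\<phi> x - u n x\<bar> ^ 6) \<partial>lebesgue) + (\<integral>\<^sup>+x. ennreal (\<bar>u n x\<bar> ^ 6) \<partial>lebesgue))"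
      using nn_pow6_add_le[of "\<lambda>x. \<phi> x - u n x" "u n"] by simp
    also have "(\<integral>\<^sup>+x. ennreal (\<bar>\<phi> x - u n x\<bar> ^ 6) \<partial>lebesgue) = \<epsilon> n" unfolding \<epsilon>_def by (simp add: abs_minus_commute)
    also have "(\<integral>\<^sup>+x. ennreal (\<bar>u n x\<bar> ^ 6) \<partial>lebesgue) \<le> ennreal (4096 * (2 * \<delta> n + 2 * E) ^ 3)"
    proof (rule order_trans[OF Sobolev_test_function[OF u(1)]], intro ennreal_leI mult_left_mono power_mono)
      have "sq_dist (grad (u n)) (\<lambda>x. 0) \<le> 2 * sq_dist (grad (u n)) (wgrad \<phi>) + 2 * sq_dist (wgrad \<phi>) (\<lambda>x. 0)"
        by (rule sq_dist_triangle[OF test_function_square_integrable[OF u(1)] _ u(2)]) (simp add: square_integrable_def)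
      then show "(LINT x|lebesgue. (norm (grad (u n) x))\<^sup>2) \<le> 2 * \<delta> n + 2 * E"
        by (simp add: \<delta>_def E_def sq_dist_def)
    qed auto
    finally show ?thesis by (simp add: mult_left_mono)
  qed
  moreover have "(\<lambda>n. 64 * (\<epsilon> n + ennreal (4096 * (2 * \<delta> n + 2 * E) ^ 3))) \<longlonglongrightarrow> 64 * (0 + ennreal (4096 * (2 * 0 + 2 * E) ^ 3))"
    using u(3,4) unfolding \<epsilon>_def[symmetric] \<delta>_def[symmetric]
    by (intro ennreal_tendsto_cmult tendsto_add tendsto_ennrealI tendsto_intros) auto
  ultimately have "(\<integral>\<^sup>+x. ennreal (\<bar>\<phi> x\<bar> ^ 6) \<partial>lebesgue) \<le> 64 * (0 + ennreal (4096 * (2 * 0 + 2 * E) ^ 3))"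
    by (intro LIMSEQ_le_const) auto
  \<comment> \<open>The constant is the product of 64, 4096 and 8: 64 is 2^6 from the sixth power of
    a sum, and 8 is 2^3 from the squared triangle inequality.\<close>
  also have "\<dots> = ennreal (2097152 * E ^ 3)"
  proof -
    have "E \<ge> 0" by (simp add: E_def)
    have "64 * ennreal (4096 * (2 * E) ^ 3) = ennreal (64 * (4096 * (2 * E) ^ 3))"
      using \<open>E \<ge> 0\<close> by (subst ennreal_mult) auto
    then show ?thesis by (simp add: power_mult_distrib)
  qed
  finally show ?thesis unfolding E_def .
qed

lemma continuous_AE_zero:
  fixes f :: "R3 \<Rightarrow> real"
  assumes "continuous_on UNIV f" "AE x in lebesgue. f x = 0"
  shows "f = (\<lambda>x. 0)"
proof -
  have o: "open {x. f x \<noteq> 0}" using assms(1) by (intro open_Collect_neq continuous_intros)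
  have "{x. f x \<noteq> 0} \<in> null_sets lebesgue"
    using assms(2) o by (subst (asm) AE_iff_null) auto
  then have "negligible {x. f x \<noteq> 0}" by (simp add: negligible_iff_null_sets)
  then have "{x. f x \<noteq> 0} = {}" using open_not_negligible[OF o] by blast
  then show ?thesis by auto
qed

text \<open>Sobolev's inequality excludes nonzero constants, and continuity upgrades the conclusion
  from a.e. to everywhere.\<close>

lemma lip_D12_zero_of_wgrad:
  assumes "\<phi> \<in> lip_D12" "AE x in lebesgue. wgrad \<phi> x = 0"
  shows "\<phi> = (\<lambda>x. 0)"
proof (rule continuous_AE_zero[OF lip_D12_continuous[OF assms(1)]])
  have "(LINT x|lebesgue. (norm (wgrad \<phi> x))\<^sup>2) = (LINT x|(lebesgue :: R3 measure). 0)"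
    by (rule integral_cong_AE) (use assms(2) square_integrable_measurable[OF lip_D12_square_integrable[OF assms(1)]] in auto)
  then have "(\<integral>\<^sup>+x. ennreal (\<bar>\<phi> x\<bar> ^ 6) \<partial>lebesgue) = 0" using Sobolev_lip_D12[OF assms(1)] by simp
  then have "AE x in lebesgue. ennreal (\<bar>\<phi> x\<bar> ^ 6) = 0"
    using lip_D12_measurable[OF assms(1)] by (subst (asm) nn_integral_0_iff_AE) auto
  then show "AE x in lebesgue. \<phi> x = 0" by eventually_elim auto
qed

lemma lip_D12_eqI:
  assumes "\<phi> \<in> lip_D12" "\<psi> \<in> lip_D12" "AE x in lebesgue. wgrad \<phi> x = wgrad \<psi> x"
  shows "\<phi> = \<psi>"
proof -
  have "(\<lambda>x. \<phi> x - \<psi> x) = (\<lambda>x. 0)"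
    by (rule lip_D12_zero_of_wgrad[OF lip_D12_diff(1)[OF assms(1,2)]])
      (use lip_D12_diff(2)[OF assms(1,2)] assms(3) in eventually_elim, simp)
  then show ?thesis by (auto simp: fun_eq_iff)
qed

text \<open>On the ball of radius \<open>\<bar>f x\<bar> / (2 * M)\<close> around \<open>x\<close>
  the function keeps at least half of its modulus. The exponent 9 is 6 + 3, and 512 is 2^6 times
  2^3. This turns L^6 convergence into pointwise convergence.\<close>

lemma Lipschitz_pow9_le:
  fixes f :: "R3 \<Rightarrow> real"
  assumes lip: "M-lipschitz_on UNIV f" and M: "M > 0"
  shows "ennreal (unit_ball_vol 3 / (512 * M ^ 3) * \<bar>f x\<bar> ^ 9) \<le> (\<integral>\<^sup>+y. ennreal (\<bar>f y\<bar> ^ 6) \<partial>lebesgue)"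
proof -
  define a where "a = \<bar>f x\<bar>"
  define r where "r = a / (2 * M)"
  have r: "r \<ge> 0" "a \<ge> 0" using M by (auto simp: r_def a_def)
  have "(a / 2) ^ 6 \<le> \<bar>f y\<bar> ^ 6" if "y \<in> ball x r" for y
  proof (rule power_mono)
    have "\<bar>f x - f y\<bar> \<le> M * dist x y" using lipschitz_onD[OF lip, of x y] by (simp add: dist_real_def)
    also have "\<dots> \<le> M * r" using that M by (intro mult_left_mono) auto
    also have "\<dots> = a / 2" using M by (simp add: r_def)
    finally show "a / 2 \<le> \<bar>f y\<bar>" unfolding a_def by linarith
  qed (use r in auto)
  then have "(\<integral>\<^sup>+y. ennreal ((a / 2) ^ 6) * indicator (ball x r) y \<partial>lebesgue) \<le> (\<integral>\<^sup>+y. ennreal (\<bar>f y\<bar> ^ 6) \<partial>lebesgue)"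
    by (intro nn_integral_mono) (auto simp: indicator_def intro!: ennreal_leI)
  moreover have "(\<integral>\<^sup>+y. ennreal ((a / 2) ^ 6) * indicator (ball x r) y \<partial>lebesgue)
      = ennreal ((a / 2) ^ 6) * emeasure lebesgue (ball x r)"
    by (rule nn_integral_cmult_indicator) auto
  moreover have "emeasure lebesgue (ball x r) = ennreal (unit_ball_vol 3 * r ^ 3)"
    using emeasure_ball[of r x] r by simp
  moreover have "ennreal ((a / 2) ^ 6) * ennreal (unit_ball_vol 3 * r ^ 3) = ennreal (unit_ball_vol 3 / (512 * M ^ 3) * a ^ 9)"
  proof -
    have "(a / 2) ^ 6 * (unit_ball_vol 3 * r ^ 3) = unit_ball_vol 3 / (512 * M ^ 3) * a ^ 9"
      by (simp add: r_def power_divide power_mult_distrib power_add[of a 6 3, simplified])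
    then show ?thesis using r by (subst ennreal_mult[symmetric]) auto
  qed
  ultimately show ?thesis by (simp add: a_def)
qed

text \<open>Sobolev's inequality makes the sequence Cauchy in L^6, \<open>Lipschitz_pow9_le\<close>
  makes it pointwise Cauchy, and the pointwise limit inherits the Lipschitz constant. A diagonal
  choice of test functions shows that the limit lies in \<open>D12\<close>.\<close>

lemma lip_D12_limit:
  assumes \<phi>: "\<And>n::nat. \<phi> n \<in> lip_D12" and lip: "\<And>n. L-lipschitz_on UNIV (\<phi> n)"
    and cau: "\<And>e. e > 0 \<Longrightarrow> \<exists>N. \<forall>m\<ge>N. \<forall>n\<ge>N. sq_dist (wgrad (\<phi> m)) (wgrad (\<phi> n)) < e"
  obtains \<psi> where "\<psi> \<in> lip_D12" "L-lipschitz_on UNIV \<psi>" "(\<lambda>n. sq_dist (wgrad (\<phi> n)) (wgrad \<psi>)) \<longlonglongrightarrow> 0"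
proof -
  note sq = lip_D12_square_integrable[OF \<phi>]
  note [measurable] = lip_D12_measurable[OF \<phi>]
  have L: "L \<ge> 0" by (rule lipschitz_on_nonneg[OF lip])
  obtain G where G: "square_integrable G" "(\<lambda>n. sq_dist (wgrad (\<phi> n)) G) \<longlonglongrightarrow> 0" by (rule square_integrable_complete[OF sq cau])
  have S: "(\<integral>\<^sup>+x. ennreal (\<bar>\<phi> m x - \<phi> n x\<bar> ^ 6) \<partial>lebesgue) \<le> ennreal (2097152 * (sq_dist (wgrad (\<phi> m)) (wgrad (\<phi> n))) ^ 3)" for m n
  proof -
    have "(LINT x|lebesgue. (norm (wgrad (\<lambda>x. \<phi> m x - \<phi> n x) x))\<^sup>2) = sq_dist (wgrad (\<phi> m)) (wgrad (\<phi> n))"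
      unfolding sq_dist_def using lip_D12_diff[OF \<phi> \<phi>, of m n] sq[THEN square_integrable_measurable] square_integrable_measurable[OF lip_D12_square_integrable[OF lip_D12_diff(1)[OF \<phi> \<phi>, of m n]]]
      by (intro integral_cong_AE) auto
    then show ?thesis using Sobolev_lip_D12[OF lip_D12_diff(1)[OF \<phi> \<phi>, of m n]] by simp
  qed
  have S': "\<exists>N. \<forall>m\<ge>N. \<forall>n\<ge>N. (\<integral>\<^sup>+x. ennreal (\<bar>\<phi> m x - \<phi> n x\<bar> ^ 6) \<partial>lebesgue) \<le> ennreal e" if e: "e > 0" for e
  proof -
    define e' where "e' = root 3 (e / 2097152)"
    have e': "e' > 0" "2097152 * e' ^ 3 = e" using e by (auto simp: e'_def)
    from cau[OF e'(1)] obtain N where N: "\<And>m n. m \<ge> N \<Longrightarrow> n \<ge> N \<Longrightarrow> sq_dist (wgrad (\<phi> m)) (wgrad (\<phi> n)) < e'" by blast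
    have "(\<integral>\<^sup>+x. ennreal (\<bar>\<phi> m x - \<phi> n x\<bar> ^ 6) \<partial>lebesgue) \<le> ennreal e" if "m \<ge> N" "n \<ge> N" for m n
    proof (rule order_trans[OF S], rule ennreal_leI)
      have "sq_dist (wgrad (\<phi> m)) (wgrad (\<phi> n)) ^ 3 \<le> e' ^ 3"
        using N[OF that] sq_dist_nonneg by (intro power_mono) auto
      then show "2097152 * sq_dist (wgrad (\<phi> m)) (wgrad (\<phi> n)) ^ 3 \<le> e" using e' by linarith
    qed
    then show ?thesis by blast
  qed
  have "Cauchy (\<lambda>n. \<phi> n x)" for x
  proof (rule metric_CauchyI)
    fix e :: real assume e: "e > 0"
    \<comment> \<open>A difference of two \<open>L\<close>-Lipschitz functions has constant
      \<open>2 * L\<close>; 1 is added for positivity.\<close>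
    define M where "M = 2 * L + 1"
    define c where "c = unit_ball_vol 3 / (512 * M ^ 3)"
    have M: "M > 0" using L by (simp add: M_def)
    have c: "c > 0" using M by (simp add: c_def)
    from S'[of "c * (e / 2) ^ 9"] e c obtain N where
      N: "\<And>m n. m \<ge> N \<Longrightarrow> n \<ge> N \<Longrightarrow> (\<integral>\<^sup>+x. ennreal (\<bar>\<phi> m x - \<phi> n x\<bar> ^ 6) \<partial>lebesgue) \<le> ennreal (c * (e / 2) ^ 9)" by auto
    have "dist (\<phi> m x) (\<phi> n x) < e" if "m \<ge> N" "n \<ge> N" for m n
    proof -
      have "(L + L)-lipschitz_on UNIV (\<lambda>x. \<phi> m x - \<phi> n x)" by (rule lipschitz_on_diff[OF lip lip])
      then have "M-lipschitz_on UNIV (\<lambda>x. \<phi> m x - \<phi> n x)" by (rule lipschitz_on_le) (simp add: M_def)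
      from order_trans[OF Lipschitz_pow9_le[OF this M] N[OF that]]
      have "ennreal (c * \<bar>\<phi> m x - \<phi> n x\<bar> ^ 9) \<le> ennreal (c * (e / 2) ^ 9)" unfolding c_def .
      then have "c * \<bar>\<phi> m x - \<phi> n x\<bar> ^ 9 \<le> c * (e / 2) ^ 9" using c e by (subst (asm) ennreal_le_iff) auto
      then have "\<bar>\<phi> m x - \<phi> n x\<bar> ^ 9 \<le> (e / 2) ^ 9" using c by simp
      then have "\<bar>\<phi> m x - \<phi> n x\<bar> \<le> e / 2" using e by (subst (asm) power_mono_iff) auto
      then show ?thesis using e by (simp add: dist_real_def)
    qed
    then show "\<exists>N. \<forall>m\<ge>N. \<forall>n\<ge>N. dist (\<phi> m x) (\<phi> n x) < e" by blast
  qed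
  then have "\<forall>x. \<exists>l. (\<lambda>n. \<phi> n x) \<longlonglongrightarrow> l" by (simp add: Cauchy_convergent convergent_def[symmetric])
  from choice[OF this] obtain \<psi> where \<psi>: "\<And>x. (\<lambda>n. \<phi> n x) \<longlonglongrightarrow> \<psi> x" by blast
  have lip\<psi>: "L-lipschitz_on UNIV \<psi>"
  proof (rule lipschitz_onI)
    fix x y
    have "(\<lambda>n. dist (\<phi> n x) (\<phi> n y)) \<longlonglongrightarrow> dist (\<psi> x) (\<psi> y)" by (intro tendsto_intros \<psi>)
    then show "dist (\<psi> x) (\<psi> y) \<le> L * dist x y"
      by (rule LIMSEQ_le_const2) (use lipschitz_onD[OF lip] in auto)
  qed (rule L)
  \<comment> \<open>Diagonal sequence: one test function that is close to \<open>\<phi> n\<close> in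
    both senses at once.\<close>
  have "\<exists>u. test_function u \<and> sq_dist (grad u) (wgrad (\<phi> n)) < 1 / real (Suc n) \<and> (\<integral>\<^sup>+x. ennreal (\<bar>u x - \<phi> n x\<bar> ^ 6) \<partial>lebesgue) < ennreal (1 / real (Suc n))" for n
  proof -
    obtain u where u: "\<And>k::nat. test_function (u k)" "square_integrable (wgrad (\<phi> n))" "(\<lambda>k. sq_dist (grad (u k)) (wgrad (\<phi> n))) \<longlonglongrightarrow> 0"
      "(\<lambda>k. \<integral>\<^sup>+x. ennreal (\<bar>u k x - \<phi> n x\<bar> ^ 6) \<partial>lebesgue) \<longlonglongrightarrow> 0" by (rule lip_D12_approx[OF \<phi>[of n]]) blast
    have "eventually (\<lambda>k. sq_dist (grad (u k)) (wgrad (\<phi> n)) < 1 / real (Suc n)) sequentially"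
      by (rule order_tendstoD[OF u(3)]) simp
    moreover have "eventually (\<lambda>k. (\<integral>\<^sup>+x. ennreal (\<bar>u k x - \<phi> n x\<bar> ^ 6) \<partial>lebesgue) < ennreal (1 / real (Suc n))) sequentially"
      by (rule order_tendstoD[OF u(4)]) simp
    ultimately have "eventually (\<lambda>k. sq_dist (grad (u k)) (wgrad (\<phi> n)) < 1 / real (Suc n) \<and>
        (\<integral>\<^sup>+x. ennreal (\<bar>u k x - \<phi> n x\<bar> ^ 6) \<partial>lebesgue) < ennreal (1 / real (Suc n))) sequentially"
      by (rule eventually_conj)
    then obtain k where "sq_dist (grad (u k)) (wgrad (\<phi> n)) < 1 / real (Suc n)"
        "(\<integral>\<^sup>+x. ennreal (\<bar>u k x - \<phi> n x\<bar> ^ 6) \<partial>lebesgue) < ennreal (1 / real (Suc n))"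
      using eventually_happens'[OF sequentially_bot] by blast
    then show ?thesis using u(1) by blast
  qed
  then have "\<forall>n. \<exists>u. test_function u \<and> sq_dist (grad u) (wgrad (\<phi> n)) < 1 / real (Suc n) \<and> (\<integral>\<^sup>+x. ennreal (\<bar>u x - \<phi> n x\<bar> ^ 6) \<partial>lebesgue) < ennreal (1 / real (Suc n))"
    by blast
  from choice[OF this] obtain u where u: "\<And>n. test_function (u n)" "\<And>n. sq_dist (grad (u n)) (wgrad (\<phi> n)) < 1 / real (Suc n)"
    "\<And>n. (\<integral>\<^sup>+x. ennreal (\<bar>u n x - \<phi> n x\<bar> ^ 6) \<partial>lebesgue) < ennreal (1 / real (Suc n))" by blast
  note [measurable] = test_function_integrable(3)[OF u(1)]
  have inv0: "(\<lambda>n. 1 / real (Suc n)) \<longlonglongrightarrow> 0"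
    using LIMSEQ_inverse_real_of_nat by (simp add: inverse_eq_divide)
  have dG: "(\<lambda>n. sq_dist (grad (u n)) G) \<longlonglongrightarrow> 0"
  proof (rule Lim_null_comparison[OF always_eventually])
    show "(\<lambda>n. 2 * (1 / real (Suc n)) + 2 * sq_dist (wgrad (\<phi> n)) G) \<longlonglongrightarrow> 0"
      using tendsto_add[OF tendsto_mult_left[OF inv0, of 2] tendsto_mult_left[OF G(2), of 2]] by simp
    show "\<forall>n. norm (sq_dist (grad (u n)) G) \<le> 2 * (1 / real (Suc n)) + 2 * sq_dist (wgrad (\<phi> n)) G"
    proof
      fix n
      show "norm (sq_dist (grad (u n)) G) \<le> 2 * (1 / real (Suc n)) + 2 * sq_dist (wgrad (\<phi> n)) G"
        using sq_dist_triangle[OF test_function_square_integrable[OF u(1)] G(1) sq, of n n] u(2)[of n] sq_dist_nonneg[of "grad (u n)" G]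
        unfolding real_norm_def by argo
    qed
  qed
  have m\<psi> [measurable]: "\<psi> \<in> borel_measurable lebesgue"
    by (intro continuous_imp_measurable_lebesgue lipschitz_on_continuous_on[OF lip\<psi>])
  have l6: "(\<lambda>n. \<integral>\<^sup>+x. ennreal (\<bar>u n x - \<psi> x\<bar> ^ 6) \<partial>lebesgue) \<longlonglongrightarrow> 0"
  proof (rule order_tendstoI)
    fix a :: ennreal assume "0 < a"
    then obtain b where b: "0 < b" "b < a" using dense by blast
    then obtain r where r: "b = ennreal r" "r > 0" by (cases b) (auto simp: ennreal_less_zero_iff top_unique)
    \<comment> \<open>Two errors \<open>r / 128\<close>, times 64 from the sixth power of a sum,
      make \<open>r\<close>.\<close>
    obtain N where N: "\<And>m n. m \<ge> N \<Longrightarrow> n \<ge> N \<Longrightarrow> (\<integral>\<^sup>+x. ennreal (\<bar>\<phi> m x - \<phi> n x\<bar> ^ 6) \<partial>lebesgue) \<le> ennreal (r / 128)"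
      using S'[of "r / 128"] r by auto
    have "eventually (\<lambda>n. 1 / real (Suc n) < r / 128) sequentially"
      by (rule order_tendstoD[OF inv0]) (use r in simp)
    then show "eventually (\<lambda>n. (\<integral>\<^sup>+x. ennreal (\<bar>u n x - \<psi> x\<bar> ^ 6) \<partial>lebesgue) < a) sequentially"
      using eventually_ge_at_top[of N]
    proof eventually_elim
      case (elim n)
      have "(\<integral>\<^sup>+x. ennreal (\<bar>u n x - \<psi> x\<bar> ^ 6) \<partial>lebesgue) \<le> ennreal r"
      proof (rule nn_integral_le_of_AE_limit[where f = "\<lambda>m x. ennreal (\<bar>u n x - \<phi> m x\<bar> ^ 6)"])
        show "AE x in lebesgue. (\<lambda>m. ennreal (\<bar>u n x - \<phi> m x\<bar> ^ 6)) \<longlonglongrightarrow> ennreal (\<bar>u n x - \<psi> x\<bar> ^ 6)"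
          by (intro AE_I2 tendsto_ennrealI tendsto_intros \<psi>)
        have "(\<integral>\<^sup>+x. ennreal (\<bar>u n x - \<phi> m x\<bar> ^ 6) \<partial>lebesgue) \<le> ennreal r" if "m \<ge> N" for m
        proof -
          have "(\<integral>\<^sup>+x. ennreal (\<bar>u n x - \<phi> m x\<bar> ^ 6) \<partial>lebesgue)
             \<le> 64 * ((\<integral>\<^sup>+x. ennreal (\<bar>u n x - \<phi> n x\<bar> ^ 6) \<partial>lebesgue) + (\<integral>\<^sup>+x. ennreal (\<bar>\<phi> n x - \<phi> m x\<bar> ^ 6) \<partial>lebesgue))"
            using nn_pow6_add_le[of "\<lambda>x. u n x - \<phi> n x" "\<lambda>x. \<phi> n x - \<phi> m x"] by simp
          also have "\<dots> \<le> 64 * (ennreal (r / 128) + ennreal (r / 128))"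
            using N[OF elim(2) that] order_trans[OF less_imp_le[OF u(3)[of n]] ennreal_leI[OF less_imp_le[OF elim(1)]]]
            by (intro mult_left_mono add_mono) auto
          also have "ennreal (r / 128) + ennreal (r / 128) = ennreal (r / 64)" using r by (simp flip: ennreal_plus)
          also have "64 * ennreal (r / 64) = ennreal (64 * (r / 64))" using r by (subst ennreal_mult) auto
          finally show ?thesis by simp
        qed
        then show "\<forall>\<^sub>F m in sequentially. (\<integral>\<^sup>+ x. ennreal (\<bar>u n x - \<phi> m x\<bar> ^ 6) \<partial>lebesgue) \<le> ennreal r"
          by (auto simp: eventually_sequentially)
      qed measurable
      then show ?case using b r by simp
    qed
  qed simp
  have c01: "\<psi> \<in> C01" using lip\<psi> by (auto simp: C01_def)
  note VI = lip_D12_I[OF u(1) G(1) dG l6 c01]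
  have "sq_dist (wgrad (\<phi> n)) (wgrad \<psi>) = sq_dist (wgrad (\<phi> n)) G" for n
    unfolding sq_dist_def using VI(2) square_integrable_measurable[OF lip_D12_square_integrable[OF VI(1)]] sq[THEN square_integrable_measurable] square_integrable_measurable[OF G(1)]
    by (intro integral_cong_AE) auto
  then show ?thesis using that[OF VI(1) lip\<psi>] G(2) by simp
qed

section \<open>From gradient bounds to Lipschitz constants\<close>

lemma translated_test_function:
  assumes "test_function \<eta>"
  shows "test_function (\<lambda>x. \<eta> (x + c))" "grad (\<lambda>x. \<eta> (x + c)) x = grad \<eta> (x + c)"
proof -
  show "test_function (\<lambda>x. \<eta> (x + c))"
    using test_function_linear_compose[OF assms linear_id, of 1 c] by simp
  have "((\<lambda>x. x + c) has_derivative (\<lambda>h. h)) (at x)" by (auto intro!: derivative_eq_intros)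
  from has_derivative_compose[OF this, of \<eta> "\<lambda>h. h \<bullet> grad \<eta> (x + c)"] test_functionD(2)[OF assms]
  show "grad (\<lambda>x. \<eta> (x + c)) x = grad \<eta> (x + c)"
    by (intro grad_eq) (simp add: gderiv_def)
qed

text \<open>Differentiation under the integral, along sequences of increments so that dominated
  convergence applies.\<close>

lemma translated_pairing_deriv:
  fixes \<phi> :: "R3 \<Rightarrow> real"
  assumes \<phi>: "continuous_on UNIV \<phi>" and \<eta>: "test_function \<eta>"
  shows "((\<lambda>t. LINT x|lebesgue. \<phi> x * \<eta> (x - t *\<^sub>R h)) has_real_derivative
    - (LINT x|lebesgue. \<phi> x * (h \<bullet> grad \<eta> (x - t *\<^sub>R h)))) (at t)"
proof -
  obtain R M where R: "R > 0" "M > 0" "\<And>x. norm x > R \<Longrightarrow> \<eta> x = 0" "\<And>x. norm x > R \<Longrightarrow> grad \<eta> x = 0"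
    "\<And>x. \<bar>\<eta> x\<bar> \<le> M" "\<And>x. norm (grad \<eta> x) \<le> M"
    using test_function_bounds[OF \<eta>] by metis
  note [measurable] = continuous_imp_measurable_lebesgue[OF \<phi>]
    test_function_integrable(3,4)[OF \<eta>]
  have t\<eta>: "test_function (\<lambda>x. \<eta> (x - s *\<^sub>R h))" for s
    using translated_test_function(1)[OF \<eta>, of "- (s *\<^sub>R h)"] by simp
  note [measurable] = test_function_integrable(3)[OF t\<eta>]
  have mg [measurable]: "(\<lambda>x. grad \<eta> (x - s *\<^sub>R h)) \<in> borel_measurable lebesgue" for s
    using measure_preserving_compose_measurable[OF measure_preserving_translation[of "- (s *\<^sub>R h)"] test_function_integrable(4)[OF \<eta>]] by simp
  have int: "integrable lebesgue (\<lambda>x. \<phi> x * \<eta> (x - s *\<^sub>R h))" for s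
    using test_function_times_locally_integrable[OF t\<eta> continuous_locally_integrable[OF \<phi>], of s] by (simp add: mult.commute)
  define F where "F s = (LINT x|lebesgue. \<phi> x * \<eta> (x - s *\<^sub>R h))" for s
  define D where "D = - (LINT x|lebesgue. \<phi> x * (h \<bullet> grad \<eta> (x - t *\<^sub>R h)))"
  \<comment> \<open>For increments of modulus at most 1 all translated supports lie in the ball of
    radius \<open>R'\<close>; the restriction on the increments is lifted afterwards by dropping
    initial terms.\<close>
  define R' where "R' = R + (\<bar>t\<bar> + 1) * norm h"
  have "(\<lambda>n. (F (t + X n) - F t) / X n) \<longlonglongrightarrow> D" if X: "\<And>n. X n \<noteq> 0" "X \<longlonglongrightarrow> 0" "\<And>n. \<bar>X n\<bar> \<le> 1" for X
  proof -
    define q where "q n x = \<phi> x * ((\<eta> (x - (t + X n) *\<^sub>R h) - \<eta> (x - t *\<^sub>R h)) / X n)" for n x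
    have "(\<lambda>n. LINT x|lebesgue. q n x) \<longlonglongrightarrow> (LINT x|lebesgue. - (\<phi> x * (h \<bullet> grad \<eta> (x - t *\<^sub>R h))))"
    proof (rule integral_dominated_convergence[where w = "\<lambda>x. \<bar>indicat_real (cball 0 R') x *\<^sub>R \<phi> x\<bar> * (M * norm h)"])
      show "integrable lebesgue (\<lambda>x. \<bar>indicat_real (cball 0 R') x *\<^sub>R \<phi> x\<bar> * (M * norm h))"
        by (intro integrable_mult_left integrable_abs locally_integrable_cball continuous_locally_integrable \<phi>)
      show "(\<lambda>x. - (\<phi> x * (h \<bullet> grad \<eta> (x - t *\<^sub>R h)))) \<in> borel_measurable lebesgue" by measurable
      show "q n \<in> borel_measurable lebesgue" for n unfolding q_def by measurable
      show "AE x in lebesgue. (\<lambda>n. q n x) \<longlonglongrightarrow> - (\<phi> x * (h \<bullet> grad \<eta> (x - t *\<^sub>R h)))"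
      proof (rule AE_I2)
        fix x
        have "((\<lambda>s. x - s *\<^sub>R h) has_derivative (\<lambda>s. - (s *\<^sub>R h))) (at t)"
          by (auto intro!: derivative_eq_intros)
        from has_derivative_compose[OF this, of \<eta> "\<lambda>v. v \<bullet> grad \<eta> (x - t *\<^sub>R h)"] test_functionD(2)[OF \<eta>]
        have "((\<lambda>s. \<eta> (x - s *\<^sub>R h)) has_derivative (\<lambda>s. (- (h \<bullet> grad \<eta> (x - t *\<^sub>R h))) * s)) (at t)"
          by (simp add: gderiv_def mult.commute)
        then have "((\<lambda>s. \<eta> (x - s *\<^sub>R h)) has_real_derivative - (h \<bullet> grad \<eta> (x - t *\<^sub>R h))) (at t)"
          unfolding has_field_derivative_def .
        then have "((\<lambda>s. (\<eta> (x - (t + s) *\<^sub>R h) - \<eta> (x - t *\<^sub>R h)) / s) \<longlongrightarrow> - (h \<bullet> grad \<eta> (x - t *\<^sub>R h))) (at 0)"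
          by (simp add: DERIV_def)
        moreover have "filterlim X (at 0) sequentially"
          using X by (auto simp: filterlim_at intro!: always_eventually)
        ultimately have "(\<lambda>n. (\<eta> (x - (t + X n) *\<^sub>R h) - \<eta> (x - t *\<^sub>R h)) / X n) \<longlonglongrightarrow> - (h \<bullet> grad \<eta> (x - t *\<^sub>R h))"
          by (rule filterlim_compose)
        then have "(\<lambda>n. \<phi> x * ((\<eta> (x - (t + X n) *\<^sub>R h) - \<eta> (x - t *\<^sub>R h)) / X n)) \<longlonglongrightarrow> \<phi> x * (- (h \<bullet> grad \<eta> (x - t *\<^sub>R h)))"
          by (intro tendsto_intros)
        then show "(\<lambda>n. q n x) \<longlonglongrightarrow> - (\<phi> x * (h \<bullet> grad \<eta> (x - t *\<^sub>R h)))" unfolding q_def by simp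
      qed
      show "AE x in lebesgue. norm (q n x) \<le> \<bar>indicat_real (cball 0 R') x *\<^sub>R \<phi> x\<bar> * (M * norm h)" for n
      proof (rule AE_I2)
        fix x
        show "norm (q n x) \<le> \<bar>indicat_real (cball 0 R') x *\<^sub>R \<phi> x\<bar> * (M * norm h)"
        proof (cases "norm x \<le> R'")
          case True
          have "\<bar>\<eta> (x - (t + X n) *\<^sub>R h) - \<eta> (x - t *\<^sub>R h)\<bar> \<le> M * norm ((x - (t + X n) *\<^sub>R h) - (x - t *\<^sub>R h))"
            by (rule gradient_bound_imp_Lipschitz[OF test_functionD(2)[OF \<eta>] R(6)])
          also have "(x - (t + X n) *\<^sub>R h) - (x - t *\<^sub>R h) = - (X n *\<^sub>R h)" by (simp add: algebra_simps)
          finally have "\<bar>(\<eta> (x - (t + X n) *\<^sub>R h) - \<eta> (x - t *\<^sub>R h)) / X n\<bar> \<le> M * norm h"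
            using X(1)[of n] by (simp add: field_simps abs_divide)
          then have "\<bar>\<phi> x\<bar> * \<bar>(\<eta> (x - (t + X n) *\<^sub>R h) - \<eta> (x - t *\<^sub>R h)) / X n\<bar> \<le> \<bar>\<phi> x\<bar> * (M * norm h)"
            by (intro mult_left_mono) auto
          then show ?thesis using True unfolding q_def by (simp add: abs_mult)
        next
          case False
          have far: "\<eta> (x - s *\<^sub>R h) = 0" if "\<bar>s\<bar> \<le> \<bar>t\<bar> + 1" for s
          proof (rule R(3))
            have "norm (s *\<^sub>R h) \<le> (\<bar>t\<bar> + 1) * norm h" using that by (simp add: mult_right_mono)
            moreover have "norm x \<le> norm (x - s *\<^sub>R h) + norm (s *\<^sub>R h)"
              using norm_triangle_ineq[of "x - s *\<^sub>R h" "s *\<^sub>R h"] by simp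
            ultimately show "R < norm (x - s *\<^sub>R h)" using False unfolding R'_def by linarith
          qed
          have "\<bar>t + X n\<bar> \<le> \<bar>t\<bar> + 1" using X(3)[of n] by linarith
          then show ?thesis unfolding q_def using far[of t] far[of "t + X n"] R by simp
        qed
      qed
    qed
    moreover have "(LINT x|lebesgue. q n x) = (F (t + X n) - F t) / X n" for n
    proof -
      have "(LINT x|lebesgue. q n x) = (LINT x|lebesgue. (\<phi> x * \<eta> (x - (t + X n) *\<^sub>R h) - \<phi> x * \<eta> (x - t *\<^sub>R h)) / X n)"
        unfolding q_def by (simp add: algebra_simps diff_divide_distrib)
      also have "\<dots> = (LINT x|lebesgue. \<phi> x * \<eta> (x - (t + X n) *\<^sub>R h) - \<phi> x * \<eta> (x - t *\<^sub>R h)) / X n"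
        by (rule integral_divide_zero)
      also have "\<dots> = (F (t + X n) - F t) / X n"
        unfolding F_def using int[of "t + X n"] int[of t] by simp
      finally show ?thesis .
    qed
    ultimately show ?thesis unfolding D_def by simp
  qed
  then have key: "(\<lambda>n. (F (t + X n) - F t) / X n) \<longlonglongrightarrow> D" if X: "\<And>n. X n \<noteq> 0" "X \<longlonglongrightarrow> 0" for X
  proof -
    have "eventually (\<lambda>n. dist (X n) 0 < 1) sequentially" by (rule tendstoD[OF X(2)]) simp
    then obtain N where N: "\<And>n. n \<ge> N \<Longrightarrow> \<bar>X n\<bar> < 1" by (auto simp: eventually_sequentially dist_real_def)
    have "(\<lambda>n. (F (t + X (n + N)) - F t) / X (n + N)) \<longlonglongrightarrow> D"
      using X LIMSEQ_ignore_initial_segment[OF X(2), of N] N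
      by (intro \<open>\<And>X. (\<And>n. X n \<noteq> 0) \<Longrightarrow> X \<longlonglongrightarrow> 0 \<Longrightarrow> (\<And>n. \<bar>X n\<bar> \<le> 1) \<Longrightarrow> (\<lambda>n. (F (t + X n) - F t) / X n) \<longlonglongrightarrow> D\<close>)
         (auto intro: less_imp_le)
    then show ?thesis by (rule LIMSEQ_offset)
  qed
  have "((\<lambda>s. (F (t + s) - F t) / s) \<longlongrightarrow> D) (at 0)"
    unfolding tendsto_at_iff_sequentially using key by (auto simp: comp_def)
  then have "(F has_real_derivative D) (at t)" by (simp add: DERIV_def)
  then show ?thesis unfolding F_def D_def .
qed

text \<open>If the increment along \<open>h\<close> exceeded \<open>L * norm h\<close> at one point,
  it would do so on a ball. A bump \<open>\<eta>\<close> on that ball is translated along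
  \<open>h\<close> and paired with \<open>\<phi>\<close>. The derivative of the pairing is at most
  \<open>L * norm h\<close> times the integral of \<open>\<eta>\<close>, so by the mean value
  theorem the averaged increment obeys the bound, a contradiction.\<close>

lemma weak_grad_bound_imp_Lipschitz:
  assumes \<phi>: "continuous_on UNIV \<phi>" and w: "has_weak_grad \<phi> G"
    and b: "AE x in lebesgue. norm (G x) \<le> L" and L: "L \<ge> 0"
  shows "L-lipschitz_on UNIV \<phi>"
proof -
  have main: "\<phi> (x0 + h) - \<phi> x0 \<le> L * norm h" for x0 h
  proof (rule ccontr)
    assume "\<not> \<phi> (x0 + h) - \<phi> x0 \<le> L * norm h"
    then have pos: "\<phi> (x0 + h) - \<phi> x0 - L * norm h > 0" by simp
    define f where "f x = \<phi> (x + h) - \<phi> x - L * norm h" for x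
    have cf: "continuous_on UNIV f" unfolding f_def
      by (intro continuous_intros \<phi> continuous_on_UNIV_compose[OF \<phi>])
    have "open {x. f x > 0}" by (intro open_Collect_less continuous_intros cf)
    moreover have "x0 \<in> {x. f x > 0}" using pos by (simp add: f_def)
    ultimately obtain r where r: "r > 0" "ball x0 r \<subseteq> {x. f x > 0}" by (meson open_contains_ball)
    define \<eta> where "\<eta> x = bump (1 * (r\<^sup>2 - (x + (- x0)) \<bullet> (x + (- x0))))" for x
    have \<eta>: "test_function \<eta>"
      unfolding \<eta>_def by (rule translated_test_function(1)[OF test_function_radial_bump]) simp
    have \<eta>0: "0 \<le> \<eta> x" for x by (simp add: \<eta>_def bump_simps)
    have \<eta>_ball: "\<eta> x > 0 \<longleftrightarrow> x \<in> ball x0 r" for x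
    proof -
      have "\<eta> x > 0 \<longleftrightarrow> (norm (x - x0))\<^sup>2 < r\<^sup>2"
        using bump_simps(1)[of "r\<^sup>2 - (norm (x - x0))\<^sup>2"] bump_simps(2)[of "r\<^sup>2 - (norm (x - x0))\<^sup>2"]
        unfolding \<eta>_def by (cases "(norm (x - x0))\<^sup>2 < r\<^sup>2") (auto simp: power2_norm_eq_inner)
      also have "\<dots> \<longleftrightarrow> norm (x - x0) < r"
        using r(1) by (metis abs_norm_cancel abs_of_pos power2_less_imp_less power_strict_mono norm_ge_zero less_imp_le zero_less_numeral pos2)
      finally show ?thesis by (simp add: dist_norm norm_minus_commute)
    qed
    define F where "F t = (LINT x|lebesgue. \<phi> x * \<eta> (x - t *\<^sub>R h))" for t
    define E where "E = (LINT x|lebesgue. \<eta> x)"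
    have tt: "test_function (\<lambda>x. \<eta> (x - t *\<^sub>R h))" "grad (\<lambda>x. \<eta> (x - t *\<^sub>R h)) x = grad \<eta> (x - t *\<^sub>R h)" for t x
      using translated_test_function[OF \<eta>, of "- (t *\<^sub>R h)"] by simp_all
    have li: "locally_integrable \<phi>" "locally_integrable G" using w by (auto simp: has_weak_grad_def)
    define F' where "F' t = - (LINT x|lebesgue. \<phi> x * (h \<bullet> grad \<eta> (x - t *\<^sub>R h)))" for t
    have dF: "(F has_real_derivative F' t) (at t)" for t
      unfolding F_def F'_def by (rule translated_pairing_deriv[OF \<phi> \<eta>])
    have F'_le: "F' t \<le> L * norm h * E" for t
    proof -
      have "(LINT x|lebesgue. \<phi> x *\<^sub>R grad (\<lambda>x. \<eta> (x - t *\<^sub>R h)) x) = - (LINT x|lebesgue. \<eta> (x - t *\<^sub>R h) *\<^sub>R G x)"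
        using w tt(1)[of t] unfolding has_weak_grad_def by blast
      then have "h \<bullet> (LINT x|lebesgue. \<phi> x *\<^sub>R grad (\<lambda>x. \<eta> (x - t *\<^sub>R h)) x) = - (h \<bullet> (LINT x|lebesgue. \<eta> (x - t *\<^sub>R h) *\<^sub>R G x))" by simp
      moreover have "h \<bullet> (LINT x|lebesgue. \<phi> x *\<^sub>R grad (\<lambda>x. \<eta> (x - t *\<^sub>R h)) x) = (LINT x|lebesgue. \<phi> x * (h \<bullet> grad \<eta> (x - t *\<^sub>R h)))"
        using integral_inner_right[of h lebesgue "\<lambda>x. \<phi> x *\<^sub>R grad (\<lambda>x. \<eta> (x - t *\<^sub>R h)) x"] locally_integrable_times_grad[OF tt(1) li(1), of t]
        by (simp add: tt(2))
      moreover have "h \<bullet> (LINT x|lebesgue. \<eta> (x - t *\<^sub>R h) *\<^sub>R G x) = (LINT x|lebesgue. \<eta> (x - t *\<^sub>R h) * (h \<bullet> G x))"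
        using integral_inner_right[of h lebesgue "\<lambda>x. \<eta> (x - t *\<^sub>R h) *\<^sub>R G x"] test_function_times_locally_integrable[OF tt(1) li(2), of t]
        by simp
      ultimately have "F' t = (LINT x|lebesgue. \<eta> (x - t *\<^sub>R h) * (h \<bullet> G x))" by (simp add: F'_def)
      also have "\<dots> \<le> (LINT x|lebesgue. \<eta> (x - t *\<^sub>R h) * (L * norm h))"
      proof (rule integral_mono_AE)
        have "integrable lebesgue (\<lambda>x. h \<bullet> (\<eta> (x - t *\<^sub>R h) *\<^sub>R G x))"
          by (intro integrable_inner_right test_function_times_locally_integrable tt li)
        then show "integrable lebesgue (\<lambda>x. \<eta> (x - t *\<^sub>R h) * (h \<bullet> G x))" by simp
        show "integrable lebesgue (\<lambda>x. \<eta> (x - t *\<^sub>R h) * (L * norm h))"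
          by (intro integrable_mult_left test_function_integrable(1)[OF tt(1)])
        show "AE x in lebesgue. \<eta> (x - t *\<^sub>R h) * (h \<bullet> G x) \<le> \<eta> (x - t *\<^sub>R h) * (L * norm h)"
          using b
        proof eventually_elim
          case (elim x)
          have "h \<bullet> G x \<le> norm h * norm (G x)" by (rule norm_cauchy_schwarz)
          also have "\<dots> \<le> L * norm h" using mult_left_mono[OF elim, of "norm h"] by (simp add: mult.commute)
          finally show ?case using \<eta>0 by (intro mult_left_mono) auto
        qed
      qed
      also have "\<dots> = L * norm h * (LINT x|lebesgue. \<eta> (x - t *\<^sub>R h))" by simp
      also have "(LINT x|lebesgue. \<eta> (x - t *\<^sub>R h)) = E"
        unfolding E_def using measure_preserving_integral[OF measure_preserving_translation[of "- (t *\<^sub>R h)"] test_function_integrable(3)[OF \<eta>]] by simp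
      finally show ?thesis .
    qed
    have "F 1 - F 0 \<le> L * norm h * E"
    proof -
      obtain z :: real where "F 1 - F 0 = (1 - 0) * F' z"
        using MVT2[of 0 1 F F'] dF by auto
      then show ?thesis using F'_le[of z] by simp
    qed
    \<comment> \<open>Translation invariance turns the shift of \<open>\<eta>\<close> into a shift
      of \<open>\<phi>\<close>.\<close>
    moreover have "F 1 = (LINT x|lebesgue. \<phi> (x + h) * \<eta> x)"
      using measure_preserving_integral[OF measure_preserving_translation[of h], of "\<lambda>x. \<phi> x * \<eta> (x - 1 *\<^sub>R h)"]
        continuous_imp_measurable_lebesgue[OF \<phi>] test_function_integrable(3)[OF tt(1), of 1]
      by (simp add: F_def)
    moreover have c\<phi>h: "continuous_on UNIV (\<lambda>x. \<phi> (x + h))"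
      by (rule continuous_on_UNIV_compose[OF \<phi>]) (intro continuous_intros)
    moreover have i1: "integrable lebesgue (\<lambda>x. \<phi> (x + h) * \<eta> x)" "integrable lebesgue (\<lambda>x. \<phi> x * \<eta> x)"
      using test_function_times_locally_integrable[OF \<eta> continuous_locally_integrable[OF c\<phi>h]]
        test_function_times_locally_integrable[OF \<eta> continuous_locally_integrable[OF \<phi>]] by (auto simp: mult.commute)
    moreover have i2: "integrable lebesgue (\<lambda>x. L * norm h * \<eta> x)"
      using test_function_integrable(1)[OF \<eta>] by simp
    moreover have "(LINT x|lebesgue. f x * \<eta> x) = (LINT x|lebesgue. \<phi> (x + h) * \<eta> x) - (LINT x|lebesgue. \<phi> x * \<eta> x) - (LINT x|lebesgue. L * norm h * \<eta> x)"
      unfolding f_def left_diff_distrib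
      by (simp only: Bochner_Integration.integral_diff[OF Bochner_Integration.integrable_diff[OF i1] i2] Bochner_Integration.integral_diff[OF i1])
    ultimately have le0: "(LINT x|lebesgue. f x * \<eta> x) \<le> 0" by (simp add: F_def E_def)
    have fi: "integrable lebesgue (\<lambda>x. f x * \<eta> x)"
      unfolding f_def left_diff_distrib by (intro Bochner_Integration.integrable_diff i1 i2)
    have nn: "0 \<le> f x * \<eta> x" for x
    proof (cases "x \<in> ball x0 r")
      case True
      then show ?thesis using r(2) \<eta>0 by (intro mult_nonneg_nonneg) auto
    next
      case False
      then have "\<eta> x = 0" using \<eta>_ball[of x] \<eta>0[of x] by linarith
      then show ?thesis by simp
    qed
    have "(LINT x|lebesgue. f x * \<eta> x) = 0" using le0 nn by (intro antisym integral_nonneg_AE) auto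
    then have "AE x in lebesgue. f x * \<eta> x = 0"
      using integral_nonneg_eq_0_iff_AE[OF fi] nn by simp
    then have "(\<lambda>x. f x * \<eta> x) = (\<lambda>x. 0)"
      by (intro continuous_AE_zero continuous_intros cf test_functionD(3)[OF \<eta>])
    then have "f x0 * \<eta> x0 = 0" by meson
    moreover have "f x0 > 0" "\<eta> x0 > 0" using pos \<eta>_ball[of x0] r(1) by (auto simp: f_def)
    ultimately show False by simp
  qed
  show ?thesis
  proof (rule lipschitz_onI[OF _ L])
    fix x y
    have "\<phi> x - \<phi> y \<le> L * norm (x - y)" using main[of y "x - y"] by simp
    moreover have "\<phi> y - \<phi> x \<le> L * norm (x - y)" using main[of x "y - x"] by (simp add: norm_minus_commute)
    ultimately show "dist (\<phi> x) (\<phi> y) \<le> L * dist x y" by (simp add: dist_real_def dist_norm)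
  qed
qed

section \<open>Radial functions\<close>

text \<open>The rotation by the angle \<open>t\<close> in the plane of the axes \<open>i\<close> and
  \<open>j\<close>, written as a perturbation of the identity so that the displacement and the
  derivative in \<open>t\<close> can be read off.\<close>

definition rot :: "3 \<Rightarrow> 3 \<Rightarrow> real \<Rightarrow> R3 \<Rightarrow> R3" where
  "rot i j t x = x + ((cos t - 1) * x $ i - sin t * x $ j) *\<^sub>R axis i 1 + ((cos t - 1) * x $ j + sin t * x $ i) *\<^sub>R axis j 1"

lemma rot_inner_self:
  assumes "i \<noteq> j"
  shows "rot i j t x \<bullet> rot i j t x = x \<bullet> x"
proof -
  define a b where "a = (cos t - 1) * x $ i - sin t * x $ j" and "b = (cos t - 1) * x $ j + sin t * x $ i"
  have "rot i j t x \<bullet> rot i j t x = x \<bullet> x + 2 * a * x $ i + 2 * b * x $ j + a\<^sup>2 + b\<^sup>2"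
  proof -
    have "axis i (1::real) $ j = 0" "axis j (1::real) $ i = 0" "axis i (1::real) $ i = 1" "axis j (1::real) $ j = 1"
      using assms by (simp_all add: axis_def)
    then show ?thesis unfolding rot_def a_def[symmetric] b_def[symmetric]
      by (simp add: inner_add_left inner_add_right inner_axis inner_axis' power2_eq_square algebra_simps)
  qed
  also have "\<dots> = x \<bullet> x + ((x $ i)\<^sup>2 + (x $ j)\<^sup>2) * ((sin t)\<^sup>2 + (cos t)\<^sup>2 - 1)"
  proof -
    \<comment> \<open>A polynomial identity in which sine and cosine are independent variables; the
      relation between them enters only afterwards.\<close>
    have "2 * ((c - 1) * p - s * q) * p + 2 * ((c - 1) * q + s * p) * q + ((c - 1) * p - s * q)\<^sup>2 + ((c - 1) * q + s * p)\<^sup>2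
        = (p\<^sup>2 + q\<^sup>2) * (s\<^sup>2 + c\<^sup>2 - 1)" for c s p q :: real
      by (simp add: power2_eq_square algebra_simps)
    from this[of "cos t" "x $ i" "sin t" "x $ j"] show ?thesis unfolding a_def b_def by linarith
  qed
  finally show ?thesis by simp
qed

lemma rot_orthogonal: "i \<noteq> j \<Longrightarrow> orthogonal_transformation (rot i j t)"
  unfolding orthogonal_transformation
proof (intro conjI allI)
  assume "i \<noteq> j"
  show "linear (rot i j t)"
    by (rule linearI) (auto simp: rot_def vec_eq_iff algebra_simps)
  show "norm (rot i j t v) = norm v" for v
    using rot_inner_self[OF \<open>i \<noteq> j\<close>] by (simp add: norm_eq_sqrt_inner)
qed

lemma radialD: "radial \<phi> \<Longrightarrow> orthogonal_transformation g \<Longrightarrow> \<phi> (g x) = \<phi> x"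
  unfolding radial_def by (auto simp: fun_eq_iff)

lemma rot_has_derivative:
  "((\<lambda>t. rot i j t x) has_vector_derivative (x $ i *\<^sub>R axis j 1 - x $ j *\<^sub>R axis i 1)) (at 0)"
  unfolding rot_def by (auto intro!: derivative_eq_intros)

lemma rot_sub_norm_le: "norm (rot i j t x - x) \<le> 4 * \<bar>t\<bar> * norm x"
proof -
  have s: "\<bar>sin t\<bar> \<le> \<bar>t\<bar>" by (rule abs_sin_x_le_abs_x)
  have c: "\<bar>cos t - 1\<bar> \<le> \<bar>t\<bar>"
  proof -
    have "cos t = 1 - 2 * (sin (t / 2))\<^sup>2" using cos_double_sin[of "t / 2"] by simp
    then have "\<bar>cos t - 1\<bar> = 2 * (\<bar>sin (t / 2)\<bar> * \<bar>sin (t / 2)\<bar>)" by (simp add: power2_eq_square abs_mult)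
    also have "\<dots> \<le> 2 * (\<bar>t / 2\<bar> * 1)"
      by (intro mult_left_mono mult_mono abs_sin_x_le_abs_x) auto
    finally show ?thesis by simp
  qed
  have x: "\<bar>x $ i\<bar> \<le> norm x" "\<bar>x $ j\<bar> \<le> norm x" by (rule component_le_norm_cart)+
  have ab: "\<bar>u * p\<bar> \<le> \<bar>t\<bar> * norm x" if "\<bar>u\<bar> \<le> \<bar>t\<bar>" "\<bar>p\<bar> \<le> norm x" for u p
    unfolding abs_mult using that by (intro mult_mono) auto
  define a b where "a = (cos t - 1) * x $ i - sin t * x $ j" and "b = (cos t - 1) * x $ j + sin t * x $ i"
  have "\<bar>a\<bar> \<le> 2 * (\<bar>t\<bar> * norm x)" "\<bar>b\<bar> \<le> 2 * (\<bar>t\<bar> * norm x)"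
    using ab[OF c x(1)] ab[OF s x(2)] ab[OF c x(2)] ab[OF s x(1)] unfolding a_def b_def by linarith+
  moreover have "norm (rot i j t x - x) \<le> \<bar>a\<bar> + \<bar>b\<bar>"
    unfolding rot_def a_def[symmetric] b_def[symmetric]
    using norm_triangle_ineq[of "a *\<^sub>R axis i 1" "b *\<^sub>R (axis j 1 :: R3)"] by simp
  ultimately show ?thesis by linarith
qed

text \<open>Difference quotients of \<open>\<psi>\<close> along rotations integrate to 0 against
  \<open>\<phi>\<close>, since \<open>\<phi>\<close> and Lebesgue measure are both invariant; their
  limit is the angular derivative.\<close>

lemma radial_pairing_rotation:
  assumes \<phi>: "continuous_on UNIV \<phi>" "radial \<phi>" and \<psi>: "test_function \<psi>" and ij: "i \<noteq> j"
  shows "(LINT x|lebesgue. \<phi> x * (x $ i * grad \<psi> x $ j - x $ j * grad \<psi> x $ i)) = 0"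
proof -
  obtain R M where R: "R > 0" "M > 0" "\<And>x. norm x > R \<Longrightarrow> \<psi> x = 0" "\<And>x. norm x > R \<Longrightarrow> grad \<psi> x = 0"
    "\<And>x. norm (grad \<psi> x) \<le> M"
    using test_function_bounds[OF \<psi>] by metis
  note [measurable] = continuous_imp_measurable_lebesgue[OF \<phi>(1)] test_function_integrable(3,4)[OF \<psi>]
  have og: "orthogonal_transformation (rot i j t)" for t by (rule rot_orthogonal[OF ij])
  have m\<psi>: "(\<lambda>x. \<psi> (rot i j t x)) \<in> borel_measurable lebesgue" for t
    by (rule measure_preserving_compose_measurable[OF measure_preserving_orthogonal[OF og]]) measurable
  note [measurable] = m\<psi>
  have mx [measurable]: "(\<lambda>x::R3. x $ k) \<in> borel_measurable lebesgue" for k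
    by (intro continuous_imp_measurable_lebesgue continuous_intros)
  have mgk [measurable]: "(\<lambda>x. grad \<psi> x $ k) \<in> borel_measurable lebesgue" for k
    using test_function_integrable(3)[OF test_function_grad_nth[OF \<psi>]] .
  have nr: "norm (rot i j t x) = norm x" for t x using orthogonal_transformation_norm[OF og] .
  define q where "q n x = \<phi> x * ((\<psi> (rot i j (1 / real (Suc n)) x) - \<psi> x) * real (Suc n))" for n x
  have "(\<lambda>n. LINT x|lebesgue. q n x) \<longlonglongrightarrow> (LINT x|lebesgue. \<phi> x * (x $ i * grad \<psi> x $ j - x $ j * grad \<psi> x $ i))"
  \<comment> \<open>Rotations keep the ball of radius \<open>R\<close>, and a rotation by
    \<open>t\<close> moves its points by at most \<open>4 * \<bar>t\<bar> * R\<close>.\<close>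
  proof (rule integral_dominated_convergence[where w = "\<lambda>x. \<bar>indicat_real (cball 0 R) x *\<^sub>R \<phi> x\<bar> * (M * (4 * R))"])
    show "integrable lebesgue (\<lambda>x. \<bar>indicat_real (cball 0 R) x *\<^sub>R \<phi> x\<bar> * (M * (4 * R)))"
      by (intro integrable_mult_left integrable_abs locally_integrable_cball continuous_locally_integrable \<phi>)
    show "q n \<in> borel_measurable lebesgue" for n unfolding q_def by measurable
    show "(\<lambda>x. \<phi> x * (x $ i * grad \<psi> x $ j - x $ j * grad \<psi> x $ i)) \<in> borel_measurable lebesgue" by measurable
    show "AE x in lebesgue. (\<lambda>n. q n x) \<longlonglongrightarrow> \<phi> x * (x $ i * grad \<psi> x $ j - x $ j * grad \<psi> x $ i)"
    proof (rule AE_I2)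
      fix x
      define v where "v = x $ i *\<^sub>R axis j 1 - x $ j *\<^sub>R (axis i 1 :: R3)"
      have r0: "rot i j 0 x = x" by (simp add: rot_def)
      have d: "((\<lambda>t. rot i j t x) has_derivative (\<lambda>t. t *\<^sub>R v)) (at 0)"
        using rot_has_derivative[of i j x] unfolding has_vector_derivative_def v_def .
      have "((\<lambda>t. \<psi> (rot i j t x)) has_derivative (\<lambda>t. (t *\<^sub>R v) \<bullet> grad \<psi> x)) (at 0)"
        using has_derivative_compose[OF d, of \<psi> "\<lambda>h. h \<bullet> grad \<psi> x"] test_functionD(2)[OF \<psi>, of x]
        unfolding r0 gderiv_def by simp
      then have "((\<lambda>t. \<psi> (rot i j t x)) has_derivative (\<lambda>t. (v \<bullet> grad \<psi> x) * t)) (at 0)"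
        by (simp add: mult.commute)
      then have "((\<lambda>t. \<psi> (rot i j t x)) has_real_derivative (v \<bullet> grad \<psi> x)) (at 0)"
        unfolding has_field_derivative_def .
      then have "((\<lambda>h. (\<psi> (rot i j h x) - \<psi> x) / h) \<longlongrightarrow> v \<bullet> grad \<psi> x) (at 0)"
        by (simp add: has_field_derivative_iff r0)
      moreover have "filterlim (\<lambda>n. 1 / real (Suc n)) (at 0) sequentially"
        unfolding filterlim_at using LIMSEQ_inverse_real_of_nat
        by (auto simp: inverse_eq_divide intro!: always_eventually)
      ultimately have "(\<lambda>n. (\<psi> (rot i j (1 / real (Suc n)) x) - \<psi> x) / (1 / real (Suc n))) \<longlonglongrightarrow> v \<bullet> grad \<psi> x"
        by (rule filterlim_compose)
      then have "(\<lambda>n. \<phi> x * ((\<psi> (rot i j (1 / real (Suc n)) x) - \<psi> x) / (1 / real (Suc n)))) \<longlonglongrightarrow> \<phi> x * (v \<bullet> grad \<psi> x)"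
        by (intro tendsto_intros)
      then show "(\<lambda>n. q n x) \<longlonglongrightarrow> \<phi> x * (x $ i * grad \<psi> x $ j - x $ j * grad \<psi> x $ i)"
        unfolding q_def v_def by (simp add: inner_diff_left inner_axis')
    qed
    show "AE x in lebesgue. norm (q n x) \<le> \<bar>indicat_real (cball 0 R) x *\<^sub>R \<phi> x\<bar> * (M * (4 * R))" for n
    proof (rule AE_I2)
      fix x
      show "norm (q n x) \<le> \<bar>indicat_real (cball 0 R) x *\<^sub>R \<phi> x\<bar> * (M * (4 * R))"
      proof (cases "norm x \<le> R")
        case True
        have "\<bar>\<psi> (rot i j (1 / real (Suc n)) x) - \<psi> x\<bar> \<le> M * norm (rot i j (1 / real (Suc n)) x - x)"
          by (rule gradient_bound_imp_Lipschitz[OF test_functionD(2)[OF \<psi>] R(5)])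
        also have "\<dots> \<le> M * (4 * \<bar>1 / real (Suc n)\<bar> * norm x)"
          using R(2) by (intro mult_left_mono rot_sub_norm_le) auto
        also have "\<dots> \<le> M * (4 * \<bar>1 / real (Suc n)\<bar> * R)"
          using R(2) True by (intro mult_left_mono) auto
        finally have "\<bar>\<psi> (rot i j (1 / real (Suc n)) x) - \<psi> x\<bar> * real (Suc n) \<le> M * (4 * R)"
          by (simp add: field_simps)
        then have "\<bar>\<phi> x\<bar> * \<bar>(\<psi> (rot i j (1 / real (Suc n)) x) - \<psi> x) * real (Suc n)\<bar> \<le> \<bar>\<phi> x\<bar> * (M * (4 * R))"
          by (intro mult_left_mono) (auto simp: abs_mult)
        then show ?thesis using True unfolding q_def by (simp add: abs_mult)
      next
        case False
        then show ?thesis unfolding q_def using R by (simp add: nr)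
      qed
    qed
  qed
  moreover have "(LINT x|lebesgue. q n x) = 0" for n
  proof -
    define r where "r = rot i j (1 / real (Suc n))"
    have mp: "measure_preserving r" unfolding r_def by (rule measure_preserving_orthogonal[OF og])
    have i: "integrable lebesgue (\<lambda>x. \<phi> x * \<psi> x)"
      using test_function_times_locally_integrable[OF \<psi> continuous_locally_integrable[OF \<phi>(1)]] by (simp add: mult.commute)
    have eq: "\<phi> (r x) * \<psi> (r x) = \<phi> x * \<psi> (r x)" for x
      using radialD[OF \<phi>(2) og] by (simp add: r_def)
    have "integrable lebesgue (\<lambda>x. \<phi> x * \<psi> (r x))" "(LINT x|lebesgue. \<phi> x * \<psi> (r x)) = (LINT x|lebesgue. \<phi> x * \<psi> x)"
      using measure_preserving_integrable[OF mp i] measure_preserving_integral[OF mp, of "\<lambda>x. \<phi> x * \<psi> x"] unfolding eq by auto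
    then have "(LINT x|lebesgue. (\<phi> x * \<psi> (r x) - \<phi> x * \<psi> x) * real (Suc n)) = 0"
      using i by simp
    then show ?thesis unfolding q_def r_def by (simp add: algebra_simps)
  qed
  ultimately show ?thesis using LIMSEQ_unique[OF _ tendsto_const] by simp
qed

lemma locally_integrable_nth_mult:
  assumes "locally_integrable (G :: R3 \<Rightarrow> R3)"
  shows "locally_integrable (\<lambda>x. x $ i * G x $ j)"
  unfolding locally_integrable_def set_integrable_def
proof (intro allI impI)
  fix K :: "R3 set" assume K: "compact K"
  then obtain R where R: "K \<subseteq> cball 0 R" by (rule compact_subset_cball)
  have [measurable]: "K \<in> sets lebesgue" using K by (simp add: borel_compact)
  have [measurable]: "(\<lambda>x::R3. x $ i) \<in> borel_measurable lebesgue"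
    by (intro continuous_imp_measurable_lebesgue continuous_intros)
  have li: "locally_integrable (\<lambda>x. G x $ j)"
    using locally_integrable_inner[OF assms, of "axis j 1"] by (simp add: inner_axis)
  have "integrable lebesgue (\<lambda>x. (indicat_real K x * x $ i) *\<^sub>R (G x $ j))"
  proof (rule integrable_locally_bounded[OF li, where M = "\<bar>R\<bar>" and R = R])
    show "\<bar>indicat_real K x * x $ i\<bar> \<le> \<bar>R\<bar>" for x
      using R component_le_norm_cart[of x i] by (auto simp: indicator_def intro: order_trans)
    show "indicat_real K x * x $ i = 0" if "norm x > R" for x
      using R that by (auto simp: indicator_def)
  qed measurable
  then show "integrable lebesgue (\<lambda>x. indicat_real K x *\<^sub>R (x $ i * G x $ j))" by (simp add: mult.assoc)
qed

text \<open>The pairing of \<open>\<phi>\<close> with a test function rotated by the angle \<open>t\<close> in the plane of \<open>i\<close> and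
  \<open>j\<close> does not depend on \<open>t\<close>; its derivative at \<open>t = 0\<close> is an angular derivative.\<close>

lemma radial_wgrad_nth:
  assumes \<phi>: "\<phi> \<in> lip_D12" "radial \<phi>"
  shows "AE x in lebesgue. x $ i * wgrad \<phi> x $ j = x $ j * wgrad \<phi> x $ i"
proof (cases "i = j")
  case False
  have w: "has_weak_grad \<phi> (wgrad \<phi>)" by (rule lip_D12_has_weak_grad[OF \<phi>(1)])
  then have li: "locally_integrable \<phi>" "locally_integrable (wgrad \<phi>)" by (auto simp: has_weak_grad_def)
  have lx: "locally_integrable (\<lambda>x. x $ k * wgrad \<phi> x $ l)" for k l
    by (rule locally_integrable_nth_mult[OF li(2)])
  have "AE x in lebesgue. x $ i * wgrad \<phi> x $ j + (-1) *\<^sub>R (x $ j * wgrad \<phi> x $ i) = 0"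
  proof (rule real_fundamental_lemma)
    show "locally_integrable (\<lambda>x. x $ i * wgrad \<phi> x $ j + (-1) *\<^sub>R (x $ j * wgrad \<phi> x $ i))"
      by (intro locally_integrable_add locally_integrable_scaleR lx)
    fix \<psi> assume \<psi>: "test_function \<psi>"
    \<comment> \<open>For \<open>k \<noteq> l\<close> the factor \<open>x $ k\<close> is constant in
      the direction \<open>l\<close>, so it can be absorbed into the test function.\<close>
    have parts: "(LINT x|lebesgue. \<phi> x * (x $ k * grad \<psi> x $ l)) = - (LINT x|lebesgue. \<psi> x * (x $ k * wgrad \<phi> x $ l))"
      "integrable lebesgue (\<lambda>x. \<phi> x * (x $ k * grad \<psi> x $ l))" if "k \<noteq> l" for k l
    proof -
      have t: "test_function (\<lambda>x. \<psi> x * x $ k)" by (intro test_function_mult \<psi> Ck_nth)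
      have gx: "grad (\<lambda>x. x $ k) x = axis k 1" for x :: R3
        using grad_eq[OF GDERIV_inner[of "axis k 1" x]] by (simp add: inner_axis)
      have g: "grad (\<lambda>x. \<psi> x * x $ k) x $ l = x $ k * grad \<psi> x $ l" for x
        using that by (simp add: grad_mult[OF \<psi> Ck_nth] gx axis_def)
      have "(LINT x|lebesgue. \<phi> x *\<^sub>R grad (\<lambda>x. \<psi> x * x $ k) x) = - (LINT x|lebesgue. (\<psi> x * x $ k) *\<^sub>R wgrad \<phi> x)"
        using w t unfolding has_weak_grad_def by blast
      then have "axis l 1 \<bullet> (LINT x|lebesgue. \<phi> x *\<^sub>R grad (\<lambda>x. \<psi> x * x $ k) x) = - (axis l 1 \<bullet> (LINT x|lebesgue. (\<psi> x * x $ k) *\<^sub>R wgrad \<phi> x))" by simp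
      moreover have "axis l 1 \<bullet> (LINT x|lebesgue. \<phi> x *\<^sub>R grad (\<lambda>x. \<psi> x * x $ k) x) = (LINT x|lebesgue. \<phi> x * (x $ k * grad \<psi> x $ l))"
        using integral_inner_right[of "axis l 1" lebesgue "\<lambda>x. \<phi> x *\<^sub>R grad (\<lambda>x. \<psi> x * x $ k) x"] locally_integrable_times_grad[OF t li(1)]
        by (simp add: inner_axis' g)
      moreover have "axis l 1 \<bullet> (LINT x|lebesgue. (\<psi> x * x $ k) *\<^sub>R wgrad \<phi> x) = (LINT x|lebesgue. \<psi> x * (x $ k * wgrad \<phi> x $ l))"
        using integral_inner_right[of "axis l 1" lebesgue "\<lambda>x. (\<psi> x * x $ k) *\<^sub>R wgrad \<phi> x"] test_function_times_locally_integrable[OF t li(2)]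
        by (simp add: inner_axis' mult.assoc)
      ultimately show "(LINT x|lebesgue. \<phi> x * (x $ k * grad \<psi> x $ l)) = - (LINT x|lebesgue. \<psi> x * (x $ k * wgrad \<phi> x $ l))" by simp
      show "integrable lebesgue (\<lambda>x. \<phi> x * (x $ k * grad \<psi> x $ l))"
        using integrable_inner_right[OF locally_integrable_times_grad[OF t li(1)], of "axis l 1"]
        by (simp add: inner_axis' g)
    qed
    have "0 = (LINT x|lebesgue. \<phi> x * (x $ i * grad \<psi> x $ j) - \<phi> x * (x $ j * grad \<psi> x $ i))"
      using radial_pairing_rotation[OF lip_D12_continuous[OF \<phi>(1)] \<phi>(2) \<psi> False] by (simp add: right_diff_distrib)
    also have "\<dots> = - (LINT x|lebesgue. \<psi> x * (x $ i * wgrad \<phi> x $ j)) + (LINT x|lebesgue. \<psi> x * (x $ j * wgrad \<phi> x $ i))"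
      using parts[OF False] parts[of j i] False by simp
    finally have "(LINT x|lebesgue. \<psi> x * (x $ i * wgrad \<phi> x $ j)) = (LINT x|lebesgue. \<psi> x * (x $ j * wgrad \<phi> x $ i))" by simp
    moreover have "integrable lebesgue (\<lambda>x. \<psi> x * (x $ k * wgrad \<phi> x $ l))" for k l
      using test_function_times_locally_integrable[OF \<psi> lx[of k l]] by simp
    ultimately show "(LINT x|lebesgue. \<psi> x * (x $ i * wgrad \<phi> x $ j + (-1) *\<^sub>R (x $ j * wgrad \<phi> x $ i))) = 0"
      by (simp add: right_diff_distrib)
  qed
  then show ?thesis by eventually_elim simp
qed simp

text \<open>Multiply the relation of \<open>radial_wgrad_nth\<close> by \<open>x $ i\<close> and sum
  over \<open>i\<close>. The form without division makes sense at the origin, too.\<close>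

lemma radial_wgrad_parallel:
  assumes "\<phi> \<in> lip_D12" "radial \<phi>"
  shows "AE x in lebesgue. (x \<bullet> x) *\<^sub>R wgrad \<phi> x = (x \<bullet> wgrad \<phi> x) *\<^sub>R x"
proof -
  have "AE x in lebesgue. \<forall>i\<in>UNIV. \<forall>j\<in>UNIV. x $ i * wgrad \<phi> x $ j = x $ j * wgrad \<phi> x $ i"
    by (intro AE_finite_allI radial_wgrad_nth[OF assms]) auto
  then show ?thesis
  proof eventually_elim
    case (elim x)
    show ?case
    proof (rule vec_eq_iff[THEN iffD2], rule allI)
      fix j
      have "((x \<bullet> x) *\<^sub>R wgrad \<phi> x) $ j = (\<Sum>i\<in>UNIV. x $ i * (x $ i * wgrad \<phi> x $ j))"
        by (simp add: inner_vec_def sum_distrib_right mult.assoc)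
      also have "\<dots> = (\<Sum>i\<in>UNIV. x $ i * (x $ j * wgrad \<phi> x $ i))" using elim by simp
      also have "\<dots> = ((x \<bullet> wgrad \<phi> x) *\<^sub>R x) $ j"
        by (simp add: inner_vec_def sum_distrib_left sum_distrib_right ac_simps)
      finally show "((x \<bullet> x) *\<^sub>R wgrad \<phi> x) $ j = ((x \<bullet> wgrad \<phi> x) *\<^sub>R x) $ j" .
    qed
  qed
qed

section \<open>Averages with a tent-shaped radial kernel\<close>

definition tent :: "real \<Rightarrow> R3 \<Rightarrow> real" where
  "tent \<delta> z = max 0 (1 - norm z / \<delta>)"

definition tent_mass :: "real \<Rightarrow> real" where
  "tent_mass \<delta> = (LINT z|lebesgue. tent \<delta> z)"

text \<open>Convolution with a normalized radial kernel. The kernel is merely Lipschitz, which is as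
  much regularity as continuous averages require.\<close>

definition tent_avg :: "real \<Rightarrow> (R3 \<Rightarrow> real) \<Rightarrow> R3 \<Rightarrow> real" where
  "tent_avg \<delta> f x = (LINT y|lebesgue. f y * tent \<delta> (y - x)) / tent_mass \<delta>"

context
  fixes \<delta> :: real
  assumes \<delta>: "\<delta> > 0"
begin

lemma tent_bounds: "0 \<le> tent \<delta> z" "tent \<delta> z \<le> 1" "norm z \<ge> \<delta> \<Longrightarrow> tent \<delta> z = 0"
  using \<delta> by (auto simp: tent_def)

lemma tent_Lipschitz: "\<bar>tent \<delta> z - tent \<delta> z'\<bar> \<le> norm (z - z') / \<delta>"
proof -
  have "\<bar>tent \<delta> z - tent \<delta> z'\<bar> \<le> \<bar>norm z / \<delta> - norm z' / \<delta>\<bar>" unfolding tent_def by linarith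
  also have "\<dots> = \<bar>norm z - norm z'\<bar> / \<delta>" using \<delta> by (simp add: diff_divide_distrib[symmetric])
  also have "\<dots> \<le> norm (z - z') / \<delta>" using \<delta> by (intro divide_right_mono norm_triangle_ineq3) auto
  finally show ?thesis .
qed

lemma tent_continuous: "continuous_on UNIV (tent \<delta>)"
  unfolding tent_def using \<delta> by (intro continuous_intros) auto

lemma tent_borel [measurable]: "tent \<delta> \<in> borel_measurable borel"
  by (rule borel_measurable_continuous_onI[OF tent_continuous])

lemma tent_translate_integrable:
  "integrable lebesgue (\<lambda>y. tent \<delta> (y - x))"
proof (rule integrable_continuous_bounded_support[where R = "norm x + \<delta>"])
  show "continuous_on UNIV (\<lambda>y. tent \<delta> (y - x))"
    by (rule continuous_on_UNIV_compose[OF tent_continuous]) (intro continuous_intros)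
  show "tent \<delta> (y - x) = 0" if "norm y > norm x + \<delta>" for y
    by (rule tent_bounds(3)) (use norm_triangle_ineq2[of y x] that in linarith)
qed

lemma tent_integral: "(LINT y|lebesgue. tent \<delta> (y - x)) = tent_mass \<delta>"
  unfolding tent_mass_def
  using measure_preserving_integral[OF measure_preserving_translation[of "- x"], of "tent \<delta>"] continuous_imp_measurable_lebesgue[OF tent_continuous] by simp

lemma tent_mass_pos: "tent_mass \<delta> > 0"
proof -
  have i: "integrable lebesgue (tent \<delta>)" using tent_translate_integrable[of 0] by simp
  have "tent_mass \<delta> \<noteq> 0"
  proof
    assume "tent_mass \<delta> = 0"
    then have "AE z in lebesgue. tent \<delta> z = 0"
      unfolding tent_mass_def using integral_nonneg_eq_0_iff_AE[OF i] tent_bounds(1) by simp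
    then have "tent \<delta> = (\<lambda>z. 0)" by (rule continuous_AE_zero[OF tent_continuous])
    then have "tent \<delta> 0 = 0" by metis
    then show False by (simp add: tent_def)
  qed
  moreover have "tent_mass \<delta> \<ge> 0" unfolding tent_mass_def by (intro integral_nonneg_AE AE_I2 tent_bounds)
  ultimately show ?thesis by simp
qed

lemma tent_nn_integral: "(\<integral>\<^sup>+x. ennreal (tent \<delta> (y - x)) \<partial>lborel) = ennreal (tent_mass \<delta>)"
proof -
  have "(\<integral>\<^sup>+x. ennreal (tent \<delta> (y - x)) \<partial>lborel) = (\<integral>\<^sup>+x. ennreal (tent \<delta> (y - x)) \<partial>lebesgue)"
    by (rule nn_integral_completion[symmetric])
  also have "\<dots> = (\<integral>\<^sup>+x. ennreal (tent \<delta> (x - y)) \<partial>lebesgue)" by (simp add: tent_def norm_minus_commute)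
  also have "\<dots> = ennreal (LINT x|lebesgue. tent \<delta> (x - y))"
    by (rule nn_integral_eq_integral[OF tent_translate_integrable]) (simp add: tent_bounds)
  finally show ?thesis by (simp add: tent_integral)
qed

lemma tent_avg_integrable:
  assumes "f \<in> borel_measurable lebesgue" "\<And>x. \<bar>f x\<bar> \<le> C"
  shows "integrable lebesgue (\<lambda>y. f y * tent \<delta> (y - x))"
proof (rule Bochner_Integration.integrable_bound)
  show "integrable lebesgue (\<lambda>y. C * tent \<delta> (y - x))" by (intro integrable_mult_right tent_translate_integrable)
  note [measurable] = assms(1) borel_measurable_integrable[OF tent_translate_integrable]
  show "(\<lambda>y. f y * tent \<delta> (y - x)) \<in> borel_measurable lebesgue" by measurable
  have "C \<ge> 0" using assms(2)[of 0] by linarith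
  then show "AE y in lebesgue. norm (f y * tent \<delta> (y - x)) \<le> norm (C * tent \<delta> (y - x))"
    using assms(2) tent_bounds by (intro AE_I2) (auto simp: abs_mult intro!: mult_right_mono)
qed

lemma tent_avg_bound:
  assumes "f \<in> borel_measurable lebesgue" "\<And>x. \<bar>f x\<bar> \<le> C"
  shows "\<bar>tent_avg \<delta> f x\<bar> \<le> C"
proof -
  have "\<bar>LINT y|lebesgue. f y * tent \<delta> (y - x)\<bar> \<le> (LINT y|lebesgue. \<bar>f y * tent \<delta> (y - x)\<bar>)"
    by (rule integral_abs_bound)
  also have "\<dots> \<le> (LINT y|lebesgue. C * tent \<delta> (y - x))"
    using assms(2) tent_bounds
    by (intro integral_mono integrable_abs tent_avg_integrable[OF assms] integrable_mult_right tent_translate_integrable)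
       (auto simp: abs_mult intro!: mult_right_mono)
  also have "\<dots> = C * tent_mass \<delta>" by (simp add: tent_integral)
  finally show ?thesis unfolding tent_avg_def using tent_mass_pos by (simp add: field_simps)
qed

text \<open>The averages inherit Lipschitz continuity from the kernel, because \<open>f\<close> is
  integrable.\<close>

lemma tent_avg_continuous:
  assumes f: "f \<in> borel_measurable lebesgue" "\<And>x. \<bar>f x\<bar> \<le> C" and R: "\<And>x. norm x > R \<Longrightarrow> f x = 0"
  shows "continuous_on UNIV (tent_avg \<delta> f)"
proof -
  have fi: "integrable lebesgue f" by (rule integrable_bounded_support[OF f(1) _ R]) (use f(2) in auto)
  define A where "A = (LINT y|lebesgue. \<bar>f y\<bar>)"
  have "(A / \<delta> / tent_mass \<delta>)-lipschitz_on UNIV (tent_avg \<delta> f)"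
  proof (rule lipschitz_onI)
    show "0 \<le> A / \<delta> / tent_mass \<delta>" using \<delta> tent_mass_pos by (simp add: A_def)
    fix x x'
    have "(LINT y|lebesgue. f y * tent \<delta> (y - x)) - (LINT y|lebesgue. f y * tent \<delta> (y - x'))
        = (LINT y|lebesgue. f y * tent \<delta> (y - x) - f y * tent \<delta> (y - x'))"
      by (rule Bochner_Integration.integral_diff[symmetric]; rule tent_avg_integrable[OF f])
    also have "\<bar>\<dots>\<bar> \<le> (LINT y|lebesgue. \<bar>f y * tent \<delta> (y - x) - f y * tent \<delta> (y - x')\<bar>)" by (rule integral_abs_bound)
    also have "\<dots> \<le> (LINT y|lebesgue. \<bar>f y\<bar> * (dist x x' / \<delta>))"
    proof (rule integral_mono)
      show "integrable lebesgue (\<lambda>y. \<bar>f y * tent \<delta> (y - x) - f y * tent \<delta> (y - x')\<bar>)"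
        by (intro integrable_abs Bochner_Integration.integrable_diff tent_avg_integrable[OF f])
      show "integrable lebesgue (\<lambda>y. \<bar>f y\<bar> * (dist x x' / \<delta>))" using fi by simp
      fix y
      have "\<bar>tent \<delta> (y - x) - tent \<delta> (y - x')\<bar> \<le> dist x x' / \<delta>"
        using tent_Lipschitz[of "y - x" "y - x'"] by (simp add: dist_norm norm_minus_commute)
      then show "\<bar>f y * tent \<delta> (y - x) - f y * tent \<delta> (y - x')\<bar> \<le> \<bar>f y\<bar> * (dist x x' / \<delta>)"
        unfolding right_diff_distrib[symmetric] abs_mult by (rule mult_left_mono) simp
    qed
    also have "\<dots> = A * (dist x x' / \<delta>)" unfolding A_def by simp
    finally have "\<bar>(LINT y|lebesgue. f y * tent \<delta> (y - x)) - (LINT y|lebesgue. f y * tent \<delta> (y - x'))\<bar> \<le> A * (dist x x' / \<delta>)" .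
    then have "\<bar>(LINT y|lebesgue. f y * tent \<delta> (y - x)) - (LINT y|lebesgue. f y * tent \<delta> (y - x'))\<bar> / tent_mass \<delta> \<le> A * (dist x x' / \<delta>) / tent_mass \<delta>"
      using tent_mass_pos by (intro divide_right_mono) auto
    then show "dist (tent_avg \<delta> f x) (tent_avg \<delta> f x') \<le> A / \<delta> / tent_mass \<delta> * dist x x'"
      unfolding tent_avg_def dist_real_def diff_divide_distrib[symmetric] abs_divide using tent_mass_pos by simp
  qed
  then show ?thesis by (rule lipschitz_on_continuous_on)
qed

text \<open>An integral does not see null sets: invariance of \<open>f\<close> up to a null set
  depending on \<open>g\<close> becomes invariance of the average at every point.\<close>

lemma tent_avg_orthogonal:
  assumes f: "f \<in> borel_measurable lebesgue" and g: "orthogonal_transformation g"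
    and inv: "AE x in lebesgue. f (g x) = f x"
  shows "tent_avg \<delta> f (g x) = tent_avg \<delta> f x"
proof -
  have mp: "measure_preserving g" by (rule measure_preserving_orthogonal[OF g])
  note [measurable] = f borel_measurable_integrable[OF tent_translate_integrable] measure_preserving_compose_measurable[OF mp f]
  have lin: "linear g" using g by (rule orthogonal_transformation_linear)
  have t: "tent \<delta> (g y - g x) = tent \<delta> (y - x)" for y
    unfolding tent_def linear_diff[OF lin, symmetric] orthogonal_transformation_norm[OF g] ..
  have "(LINT y|lebesgue. f y * tent \<delta> (y - g x)) = (LINT y|lebesgue. f (g y) * tent \<delta> (g y - g x))"
    by (rule measure_preserving_integral[OF mp, symmetric]) measurable
  also have "\<dots> = (LINT y|lebesgue. f y * tent \<delta> (y - x))"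
    unfolding t by (rule integral_cong_AE) (use inv in auto)
  finally show ?thesis by (simp add: tent_avg_def)
qed

text \<open>Tonelli's theorem for two copies of the Borel measure, whence the Borel measurability of
  \<open>f\<close>; the normalized kernel has mass 1.\<close>

lemma tent_avg_L1:
  assumes f: "f \<in> borel_measurable borel" "\<And>x. \<bar>f x\<bar> \<le> C"
  shows "(\<integral>\<^sup>+x. ennreal \<bar>tent_avg \<delta> f x\<bar> \<partial>lebesgue) \<le> (\<integral>\<^sup>+x. ennreal \<bar>f x\<bar> \<partial>lebesgue)"
proof -
  note [measurable] = f(1)
  have fl: "f \<in> borel_measurable lebesgue" by (intro measurable_completion) simp
  define c where "c = tent_mass \<delta>"
  have c: "c > 0" unfolding c_def by (rule tent_mass_pos)
  have "(\<integral>\<^sup>+x. ennreal \<bar>tent_avg \<delta> f x\<bar> \<partial>lebesgue) = (\<integral>\<^sup>+x. ennreal \<bar>tent_avg \<delta> f x\<bar> \<partial>(lborel :: R3 measure))"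
    by (rule nn_integral_completion)
  also have "\<dots> \<le> (\<integral>\<^sup>+x. (\<integral>\<^sup>+y. ennreal (\<bar>f y\<bar> / c) * ennreal (tent \<delta> (y - x)) \<partial>lborel) \<partial>lborel)"
  proof (rule nn_integral_mono)
    fix x
    have i: "integrable lebesgue (\<lambda>y. f y * tent \<delta> (y - x) / c)"
      by (intro integrable_divide tent_avg_integrable[OF fl f(2)])
    have "ennreal (norm (LINT y|lebesgue. f y * tent \<delta> (y - x) / c)) \<le> (\<integral>\<^sup>+y. ennreal (norm (f y * tent \<delta> (y - x) / c)) \<partial>lebesgue)"
      by (rule integral_norm_bound_ennreal[OF i])
    also have "(LINT y|lebesgue. f y * tent \<delta> (y - x) / c) = tent_avg \<delta> f x"
      unfolding tent_avg_def c_def by (rule integral_divide_zero)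
    also have "(\<integral>\<^sup>+y. ennreal (norm (f y * tent \<delta> (y - x) / c)) \<partial>lebesgue) = (\<integral>\<^sup>+y. ennreal (norm (f y * tent \<delta> (y - x) / c)) \<partial>lborel)"
      by (rule nn_integral_completion)
    also have "\<dots> = (\<integral>\<^sup>+y. ennreal (\<bar>f y\<bar> / c) * ennreal (tent \<delta> (y - x)) \<partial>lborel)"
      using c tent_bounds(1) by (intro nn_integral_cong) (simp add: ennreal_mult[symmetric] abs_mult abs_divide)
    finally show "ennreal \<bar>tent_avg \<delta> f x\<bar> \<le> (\<integral>\<^sup>+y. ennreal (\<bar>f y\<bar> / c) * ennreal (tent \<delta> (y - x)) \<partial>lborel)" by simp
  qed
  also have "\<dots> = (\<integral>\<^sup>+y. (\<integral>\<^sup>+x. ennreal (\<bar>f y\<bar> / c) * ennreal (tent \<delta> (y - x)) \<partial>lborel) \<partial>lborel)"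
    by (rule lborel_pair.Fubini') measurable
  also have "\<dots> = (\<integral>\<^sup>+y. ennreal (\<bar>f y\<bar> / c) * ennreal c \<partial>lborel)"
    unfolding c_def by (subst nn_integral_cmult) (auto simp: tent_nn_integral)
  also have "\<dots> = (\<integral>\<^sup>+y. ennreal \<bar>f y\<bar> \<partial>lborel)"
    using c by (simp add: ennreal_mult[symmetric])
  also have "\<dots> = (\<integral>\<^sup>+x. ennreal \<bar>f x\<bar> \<partial>lebesgue)" by (rule nn_integral_completion[symmetric])
  finally show ?thesis .
qed

lemma tent_avg_close:
  assumes f: "f \<in> borel_measurable lebesgue" "\<And>x. \<bar>f x\<bar> \<le> C"
    and e: "\<And>y. norm (y - x) < \<delta> \<Longrightarrow> \<bar>f y - f x\<bar> \<le> e"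
  shows "\<bar>tent_avg \<delta> f x - f x\<bar> \<le> e"
proof -
  have i: "integrable lebesgue (\<lambda>y. f y * tent \<delta> (y - x))" "integrable lebesgue (\<lambda>y. f x * tent \<delta> (y - x))"
    by (intro tent_avg_integrable[OF f] integrable_mult_right tent_translate_integrable)+
  have "(LINT y|lebesgue. f y * tent \<delta> (y - x)) - f x * tent_mass \<delta> = (LINT y|lebesgue. f y * tent \<delta> (y - x) - f x * tent \<delta> (y - x))"
    using i by (simp add: tent_integral)
  also have "\<bar>\<dots>\<bar> \<le> (LINT y|lebesgue. \<bar>f y * tent \<delta> (y - x) - f x * tent \<delta> (y - x)\<bar>)" by (rule integral_abs_bound)
  also have "\<dots> \<le> (LINT y|lebesgue. e * tent \<delta> (y - x))"
  proof (rule integral_mono)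
    show "integrable lebesgue (\<lambda>y. \<bar>f y * tent \<delta> (y - x) - f x * tent \<delta> (y - x)\<bar>)" by (intro integrable_abs Bochner_Integration.integrable_diff i)
    show "integrable lebesgue (\<lambda>y. e * tent \<delta> (y - x))" by (intro integrable_mult_right tent_translate_integrable)
    fix y
    show "\<bar>f y * tent \<delta> (y - x) - f x * tent \<delta> (y - x)\<bar> \<le> e * tent \<delta> (y - x)"
    proof (cases "norm (y - x) < \<delta>")
      case True
      then show ?thesis using e[OF True] tent_bounds(1)[of "y - x"]
        unfolding left_diff_distrib[symmetric] abs_mult by (simp add: mult_right_mono)
    next
      case False
      then show ?thesis by (simp add: tent_bounds)
    qed
  qed
  also have "\<dots> = e * tent_mass \<delta>" by (simp add: tent_integral)
  finally show ?thesis unfolding tent_avg_def using tent_mass_pos by (simp add: field_simps abs_divide)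
qed

end

section \<open>Approximation of a.e. radial functions by continuous radial profiles\<close>

lemma bounded_support_L1_approx:
  fixes f :: "R3 \<Rightarrow> real"
  assumes f: "f \<in> borel_measurable lebesgue" "\<And>x. \<bar>f x\<bar> \<le> C" and R: "\<And>x. norm x > R \<Longrightarrow> f x = 0" and e: "e > 0"
  shows "\<exists>c. continuous_on UNIV c \<and> (\<forall>x. \<bar>c x\<bar> \<le> C) \<and> (\<forall>x. norm x > R + 1 \<longrightarrow> c x = 0) \<and>
    (\<integral>\<^sup>+x. ennreal \<bar>f x - c x\<bar> \<partial>lebesgue) < ennreal e"
proof -
  obtain c :: "nat \<Rightarrow> R3 \<Rightarrow> real" where c: "\<And>n. continuous_on UNIV (c n)" "\<And>n x. \<bar>c n x\<bar> \<le> C"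
    "AE x in lebesgue. (\<lambda>n. c n x) \<longlonglongrightarrow> f x"
    using measurable_imp_AE_limit_continuous[OF f] by blast
  have C: "C \<ge> 0" using f(2)[of 0] by linarith
  \<comment> \<open>A cut-off that is 1 on the ball of radius \<open>R\<close>, so that
    multiplication by it leaves \<open>f\<close> unchanged.\<close>
  define k where "k x = max 0 (min 1 (R + 1 - norm x))" for x :: R3
  have ck: "continuous_on UNIV k" unfolding k_def by (intro continuous_intros)
  have k: "0 \<le> k x" "k x \<le> 1" "norm x > R + 1 \<Longrightarrow> k x = 0" "norm x \<le> R \<Longrightarrow> k x = 1" for x
    by (auto simp: k_def)
  have kf: "k x * f x = f x" for x using R[of x] k(4)[of x] by (cases "norm x \<le> R") auto
  have bd: "\<bar>k x * c n x\<bar> \<le> C" for n x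
    using mult_mono[of "\<bar>k x\<bar>" 1 "\<bar>c n x\<bar>" C] k c(2)[of n x] C by (simp add: abs_mult)
  note [measurable] = f(1) continuous_imp_measurable_lebesgue[OF ck] continuous_imp_measurable_lebesgue[OF c(1)]
  have i: "integrable lebesgue (\<lambda>x. \<bar>f x - k x * c n x\<bar>)" for n
  proof (rule integrable_bounded_support[where C = "2 * C" and R = "max R (R + 1)"])
    have "\<bar>f x - k x * c n x\<bar> \<le> 2 * C" for x using f(2)[of x] bd[of x n] by linarith
    then show "AE x in lebesgue. norm \<bar>f x - k x * c n x\<bar> \<le> 2 * C" by simp
    show "\<bar>f x - k x * c n x\<bar> = 0" if "norm x > max R (R + 1)" for x using that R k(3)[of x] by simp
  qed measurable
  have "(\<lambda>n. LINT x|lebesgue. \<bar>f x - k x * c n x\<bar>) \<longlonglongrightarrow> (LINT x|(lebesgue :: R3 measure). 0)"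
  proof (rule integral_dominated_convergence[where w = "\<lambda>x. indicat_real (cball 0 (max R (R + 1))) x *\<^sub>R (2 * C)"])
    show "AE x in lebesgue. (\<lambda>n. \<bar>f x - k x * c n x\<bar>) \<longlonglongrightarrow> 0"
      using c(3)
    proof eventually_elim
      case (elim x)
      then have "(\<lambda>n. \<bar>f x - k x * c n x\<bar>) \<longlonglongrightarrow> \<bar>f x - k x * f x\<bar>" by (intro tendsto_intros)
      then show ?case by (simp add: kf)
    qed
    show "AE x in lebesgue. norm \<bar>f x - k x * c n x\<bar> \<le> indicat_real (cball 0 (max R (R + 1))) x *\<^sub>R (2 * C)" for n
    proof (rule AE_I2)
      fix x
      have "\<bar>f x - k x * c n x\<bar> \<le> 2 * C" using f(2)[of x] bd[of x n] by linarith
      then show "norm \<bar>f x - k x * c n x\<bar> \<le> indicat_real (cball 0 (max R (R + 1))) x *\<^sub>R (2 * C)"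
        using R[of x] k(3)[of x] by (cases "norm x \<le> max R (R + 1)") (auto simp: indicator_def)
    qed
  qed (use integrable_indicator_cball in auto)
  then have "eventually (\<lambda>n. (LINT x|lebesgue. \<bar>f x - k x * c n x\<bar>) < e) sequentially"
    by (intro order_tendstoD(2)) (use e in auto)
  then obtain n where n: "(LINT x|lebesgue. \<bar>f x - k x * c n x\<bar>) < e"
    using eventually_happens'[OF sequentially_bot] by blast
  show ?thesis
  proof (intro exI[of _ "\<lambda>x. k x * c n x"] conjI allI impI)
    show "continuous_on UNIV (\<lambda>x. k x * c n x)" by (intro continuous_intros ck c)
    show "(\<integral>\<^sup>+x. ennreal \<bar>f x - k x * c n x\<bar> \<partial>lebesgue) < ennreal e"
      using n nn_integral_eq_integral[OF i] e by (simp add: ennreal_less_iff integral_nonneg_AE)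
  qed (use bd k in auto)
qed

text \<open>By uniform continuity the error is at most \<open>e'\<close> on a fixed ball, and it
  vanishes outside for radii of averaging below 1; \<open>e'\<close> is adapted to the volume of
  that ball.\<close>

lemma continuous_tent_avg_L1_small:
  fixes c :: "R3 \<Rightarrow> real"
  assumes c: "continuous_on UNIV c" "\<And>x. norm x > R \<Longrightarrow> c x = 0" and e: "e > 0"
  shows "\<exists>\<delta>0>0. \<forall>\<delta>. 0 < \<delta> \<longrightarrow> \<delta> < \<delta>0 \<longrightarrow> (\<integral>\<^sup>+x. ennreal \<bar>tent_avg \<delta> c x - c x\<bar> \<partial>lebesgue) \<le> ennreal e"
proof -
  obtain M where M: "\<And>x. \<bar>c x\<bar> \<le> M" using continuous_bounded_support[OF c] by (metis real_norm_def)
  define R' where "R' = \<bar>R\<bar> + 1"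
  define v where "v = measure lebesgue (cball (0::R3) (R' + 1))"
  have v: "v \<ge> 0" "emeasure lebesgue (cball (0::R3) (R' + 1)) = ennreal v"
    unfolding v_def using emeasure_lborel_cball_finite[of "0::R3" "R' + 1"]
    by (auto simp: emeasure_eq_ennreal_measure less_top)
  define e' where "e' = e / (v + 1)"
  have e': "e' > 0" "e' * v \<le> e" using e v by (auto simp: e'_def field_simps)
  have "uniformly_continuous_on (cball 0 (R' + 1)) c"
    by (rule compact_uniformly_continuous[OF continuous_on_subset[OF c(1)] compact_cball]) simp
  then obtain d where d: "d > 0" "\<And>x y. x \<in> cball 0 (R' + 1) \<Longrightarrow> y \<in> cball 0 (R' + 1) \<Longrightarrow> dist y x < d \<Longrightarrow> dist (c y) (c x) < e'"
    unfolding uniformly_continuous_on_def using e'(1) by metis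
  show ?thesis
  proof (intro exI[of _ "min d 1"] conjI allI impI)
    show "min d 1 > 0" using d by simp
    fix \<delta> :: real assume \<delta>: "0 < \<delta>" "\<delta> < min d 1"
    have close: "\<bar>c y - c x\<bar> \<le> e' * indicat_real (cball 0 (R' + 1)) x" if "norm (y - x) < \<delta>" for x y
    proof (cases "norm x \<le> R'")
      case True
      have "norm y \<le> norm x + norm (y - x)" using norm_triangle_ineq[of x "y - x"] by simp
      then have "norm y \<le> R' + 1" using True that \<delta> by linarith
      then have "dist (c y) (c x) < e'" using True that \<delta> by (intro d(2)) (auto simp: dist_norm)
      then show ?thesis using True by (simp add: dist_real_def)
    next
      case False
      have "norm x \<le> norm y + norm (y - x)" using norm_triangle_ineq[of y "x - y"] by (simp add: norm_minus_commute)
      then have "norm y > R" using False that \<delta> unfolding R'_def by linarith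
      moreover have "norm x > R" using False unfolding R'_def by linarith
      ultimately show ?thesis using c(2) e' by (simp add: indicator_def)
    qed
    have "(\<integral>\<^sup>+x. ennreal \<bar>tent_avg \<delta> c x - c x\<bar> \<partial>lebesgue) \<le> (\<integral>\<^sup>+x. ennreal e' * indicator (cball (0::R3) (R' + 1)) x \<partial>lebesgue)"
    proof (rule nn_integral_mono)
      fix x
      have "\<bar>tent_avg \<delta> c x - c x\<bar> \<le> e' * indicat_real (cball 0 (R' + 1)) x"
        by (rule tent_avg_close[OF \<delta>(1) continuous_imp_measurable_lebesgue[OF c(1)] M close])
      then show "ennreal \<bar>tent_avg \<delta> c x - c x\<bar> \<le> ennreal e' * indicator (cball 0 (R' + 1)) x"
        using ennreal_leI by (cases "x \<in> cball 0 (R' + 1)") fastforce+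
    qed
    also have "\<dots> = ennreal e' * ennreal v" using v by (subst nn_integral_cmult_indicator) auto
    also have "\<dots> \<le> ennreal e" using e' v by (simp add: ennreal_leI flip: ennreal_mult)
    finally show "(\<integral>\<^sup>+x. ennreal \<bar>tent_avg \<delta> c x - c x\<bar> \<partial>lebesgue) \<le> ennreal e" .
  qed
qed

text \<open>Split \<open>f\<close> into a continuous function \<open>c\<close> and a rest that is
  small in L^1. Averaging contracts the L^1 norm, so the rest contributes two small errors, and
  \<open>c\<close> contributes a third by uniform continuity: three times
  \<open>r / 3\<close>.\<close>

lemma tent_avg_L1_tendsto:
  fixes f :: "R3 \<Rightarrow> real"
  assumes f: "f \<in> borel_measurable borel" "\<And>x. \<bar>f x\<bar> \<le> C" and R: "\<And>x. norm x > R \<Longrightarrow> f x = 0"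
  shows "(\<lambda>n. \<integral>\<^sup>+x. ennreal \<bar>tent_avg (1 / real (Suc n)) f x - f x\<bar> \<partial>lebesgue) \<longlonglongrightarrow> 0"
proof (rule order_tendstoI)
  fix a :: ennreal assume "0 < a"
  then obtain b where b: "0 < b" "b < a" using dense by blast
  then obtain r where r: "b = ennreal r" "r > 0" by (cases b) (auto simp: ennreal_less_zero_iff top_unique)
  have fl: "f \<in> borel_measurable lebesgue" using f(1) by (intro measurable_completion) simp
  have r3: "r / 3 > 0" using r by simp
  obtain c where c: "continuous_on UNIV c" "\<And>x. \<bar>c x\<bar> \<le> C" "\<And>x. norm x > R + 1 \<Longrightarrow> c x = 0"
    "(\<integral>\<^sup>+x. ennreal \<bar>f x - c x\<bar> \<partial>lebesgue) < ennreal (r / 3)"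
    using bounded_support_L1_approx[OF fl f(2) R r3] by blast
  obtain \<delta>0 where \<delta>0: "\<delta>0 > 0" "\<And>\<delta>. 0 < \<delta> \<Longrightarrow> \<delta> < \<delta>0 \<Longrightarrow> (\<integral>\<^sup>+x. ennreal \<bar>tent_avg \<delta> c x - c x\<bar> \<partial>lebesgue) \<le> ennreal (r / 3)"
    using continuous_tent_avg_L1_small[OF c(1,3) r3] by blast
  have cl: "c \<in> borel_measurable lebesgue" by (rule continuous_imp_measurable_lebesgue[OF c(1)])
  have cb: "c \<in> borel_measurable borel" by (rule borel_measurable_continuous_onI[OF c(1)])
  note [measurable] = fl cl
  have "(\<lambda>n. 1 / real (Suc n)) \<longlonglongrightarrow> 0"
    using LIMSEQ_inverse_real_of_nat by (simp add: inverse_eq_divide)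
  then have "eventually (\<lambda>n. 1 / real (Suc n) < \<delta>0) sequentially" by (rule order_tendstoD) (rule \<delta>0(1))
  then show "eventually (\<lambda>n. (\<integral>\<^sup>+x. ennreal \<bar>tent_avg (1 / real (Suc n)) f x - f x\<bar> \<partial>lebesgue) < a) sequentially"
  proof eventually_elim
    case (elim n)
    define \<delta> where "\<delta> = 1 / real (Suc n)"
    have \<delta>: "\<delta> > 0" "\<delta> < \<delta>0" using elim by (auto simp: \<delta>_def)
    define d where "d x = f x - c x" for x
    have db: "d \<in> borel_measurable borel" "\<And>x. \<bar>d x\<bar> \<le> 2 * C"
    proof -
      show "d \<in> borel_measurable borel" unfolding d_def using f(1) cb by measurable
      show "\<bar>d x\<bar> \<le> 2 * C" for x using f(2)[of x] c(2)[of x] by (simp add: d_def)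
    qed
    have dl: "d \<in> borel_measurable lebesgue" using db(1) by (intro measurable_completion) simp
    have R1: "norm x > max R (R + 1) \<Longrightarrow> d x = 0" "norm x > R + 1 \<Longrightarrow> c x = 0" for x using R[of x] c(3)[of x] by (auto simp: d_def)
    note [measurable] = continuous_imp_measurable_lebesgue[OF tent_avg_continuous[OF \<delta>(1) dl db(2) R1(1)]]
      continuous_imp_measurable_lebesgue[OF tent_avg_continuous[OF \<delta>(1) cl c(2) R1(2)]]
    have split: "tent_avg \<delta> f x = tent_avg \<delta> d x + tent_avg \<delta> c x" for x
    proof -
      have "(LINT y|lebesgue. f y * tent \<delta> (y - x)) = (LINT y|lebesgue. d y * tent \<delta> (y - x) + c y * tent \<delta> (y - x))"
        by (simp add: d_def algebra_simps)
      also have "\<dots> = (LINT y|lebesgue. d y * tent \<delta> (y - x)) + (LINT y|lebesgue. c y * tent \<delta> (y - x))"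
        by (rule Bochner_Integration.integral_add; rule tent_avg_integrable[OF \<delta>(1)]) (use dl db(2) cl c(2) in auto)
      finally show ?thesis unfolding tent_avg_def by (simp add: add_divide_distrib)
    qed
    have "(\<integral>\<^sup>+x. ennreal \<bar>tent_avg \<delta> f x - f x\<bar> \<partial>lebesgue)
        \<le> (\<integral>\<^sup>+x. (ennreal \<bar>tent_avg \<delta> d x\<bar> + ennreal \<bar>tent_avg \<delta> c x - c x\<bar>) + ennreal \<bar>d x\<bar> \<partial>lebesgue)"
    proof (rule nn_integral_mono)
      fix x
      have "\<bar>tent_avg \<delta> f x - f x\<bar> \<le> \<bar>tent_avg \<delta> d x\<bar> + \<bar>tent_avg \<delta> c x - c x\<bar> + \<bar>d x\<bar>"
        unfolding split d_def by linarith
      then show "ennreal \<bar>tent_avg \<delta> f x - f x\<bar> \<le> (ennreal \<bar>tent_avg \<delta> d x\<bar> + ennreal \<bar>tent_avg \<delta> c x - c x\<bar>) + ennreal \<bar>d x\<bar>"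
        by (simp add: ennreal_leI flip: ennreal_plus)
    qed
    also have "\<dots> = ((\<integral>\<^sup>+x. ennreal \<bar>tent_avg \<delta> d x\<bar> \<partial>lebesgue) + (\<integral>\<^sup>+x. ennreal \<bar>tent_avg \<delta> c x - c x\<bar> \<partial>lebesgue)) + (\<integral>\<^sup>+x. ennreal \<bar>d x\<bar> \<partial>lebesgue)"
      using dl by (subst nn_integral_add; (subst nn_integral_add)?) auto
    also have "\<dots> \<le> (ennreal (r / 3) + ennreal (r / 3)) + ennreal (r / 3)"
    proof (intro add_mono)
      show d3: "(\<integral>\<^sup>+x. ennreal \<bar>d x\<bar> \<partial>lebesgue) \<le> ennreal (r / 3)" using c(4) by (simp add: d_def)
      show "(\<integral>\<^sup>+x. ennreal \<bar>tent_avg \<delta> d x\<bar> \<partial>lebesgue) \<le> ennreal (r / 3)"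
        by (rule order_trans[OF tent_avg_L1[OF \<delta>(1) db] d3])
      show "(\<integral>\<^sup>+x. ennreal \<bar>tent_avg \<delta> c x - c x\<bar> \<partial>lebesgue) \<le> ennreal (r / 3)" by (rule \<delta>0(2)[OF \<delta>])
    qed
    also have "\<dots> = ennreal r" using r by (simp flip: ennreal_plus)
    finally show ?case using b r unfolding \<delta>_def by simp
  qed
qed simp

text \<open>The averages are invariant at every point, hence functions of the norm, and along a
  subsequence they converge a.e. to \<open>f\<close>.\<close>

lemma ae_radial_AE_limit_Borel:
  fixes f :: "R3 \<Rightarrow> real"
  assumes f: "f \<in> borel_measurable borel" "\<And>x. \<bar>f x\<bar> \<le> C" and R: "\<And>x. norm x > R \<Longrightarrow> f x = 0"
    and rad: "ae_radial f"
  obtains h :: "nat \<Rightarrow> real \<Rightarrow> real" where "\<And>n. continuous_on UNIV (h n)" "\<And>n t. \<bar>h n t\<bar> \<le> C"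
    "AE x in lebesgue. (\<lambda>n. h n (x \<bullet> x)) \<longlonglongrightarrow> f x"
proof -
  have fl: "f \<in> borel_measurable lebesgue" using f(1) by (intro measurable_completion) simp
  have p: "1 / real (Suc n) > 0" for n by simp
  define F where "F n = tent_avg (1 / real (Suc n)) f" for n
  have cF: "continuous_on UNIV (F n)" for n
    unfolding F_def by (rule tent_avg_continuous[OF p fl f(2) R])
  have bF: "\<bar>F n x\<bar> \<le> C" for n x
    unfolding F_def by (rule tent_avg_bound[OF p fl f(2)])
  note [measurable] = fl continuous_imp_measurable_lebesgue[OF cF]
  have fi: "integrable lebesgue f" by (rule integrable_bounded_support[OF fl _ R]) (use f(2) in auto)
  have i: "integrable lebesgue (\<lambda>x. F n x - f x)" for n
  proof -
    have "(\<integral>\<^sup>+x. ennreal \<bar>F n x\<bar> \<partial>lebesgue) \<le> (\<integral>\<^sup>+x. ennreal \<bar>f x\<bar> \<partial>lebesgue)"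
      unfolding F_def by (rule tent_avg_L1[OF p f])
    also have "\<dots> < \<infinity>" using fi by (simp add: integrable_iff_bounded)
    finally have "integrable lebesgue (F n)" by (intro integrableI_bounded) auto
    then show ?thesis using fi by simp
  qed
  have "(\<lambda>n. ennreal (LINT x|lebesgue. norm (F n x - f x))) \<longlonglongrightarrow> 0"
    using tent_avg_L1_tendsto[OF f R] unfolding F_def[symmetric]
    by (subst (asm) nn_integral_eq_integral) (use i in auto)
  then have "(\<lambda>n. LINT x|lebesgue. norm (F n x - f x)) \<longlonglongrightarrow> 0"
    by (subst (asm) ennreal_tendsto_0_iff) (auto intro: integral_nonneg_AE)
  from tendsto_L1_AE_subseq[OF i this] obtain r :: "nat \<Rightarrow> nat"
    where r: "AE x in lebesgue. (\<lambda>n. F (r n) x - f x) \<longlonglongrightarrow> 0" by blast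
  \<comment> \<open>The profile is read off along the first axis; \<open>max 0 t\<close> extends it
    continuously to negative arguments.\<close>
  define h where "h n t = F (r n) (sqrt (max 0 t) *\<^sub>R axis 1 1)" for n t
  have "F n x = F n (norm x *\<^sub>R axis 1 1)" for n x
  proof -
    have "norm x = norm (norm x *\<^sub>R axis 1 1 :: R3)" by simp
    then obtain g :: "R3 \<Rightarrow> R3" where g: "orthogonal_transformation g" "g x = norm x *\<^sub>R axis 1 1"
      by (rule orthogonal_transformation_exists)
    have "F n (g x) = F n x"
      unfolding F_def using rad g(1) by (intro tent_avg_orthogonal[OF p fl g(1)]) (simp add: ae_radial_def)
    then show ?thesis using g(2) by simp
  qed
  then have eq: "h n (x \<bullet> x) = F (r n) x" for n x
    unfolding h_def by (simp add: norm_eq_sqrt_inner)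
  show ?thesis
  proof (rule that[of h])
    show "continuous_on UNIV (h n)" for n unfolding h_def
      by (rule continuous_on_UNIV_compose[OF cF]) (intro continuous_intros)
    show "\<bar>h n t\<bar> \<le> C" for n t unfolding h_def by (rule bF)
    show "AE x in lebesgue. (\<lambda>n. h n (x \<bullet> x)) \<longlonglongrightarrow> f x"
      using r unfolding eq by eventually_elim (simp add: LIM_zero_iff)
  qed
qed

text \<open>Passage to a Borel representative. The bound and the support condition hold for the
  representative only a.e.; clamping it and restricting it to the ball restore them
  everywhere.\<close>

lemma ae_radial_AE_limit:
  fixes f :: "R3 \<Rightarrow> real"
  assumes f: "f \<in> borel_measurable lebesgue" "\<And>x. \<bar>f x\<bar> \<le> C" and R: "\<And>x. norm x > R \<Longrightarrow> f x = 0"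
    and rad: "ae_radial f"
  obtains h :: "nat \<Rightarrow> real \<Rightarrow> real" where "\<And>n. continuous_on UNIV (h n)" "\<And>n t. \<bar>h n t\<bar> \<le> C"
    "AE x in lebesgue. (\<lambda>n. h n (x \<bullet> x)) \<longlonglongrightarrow> f x"
proof -
  obtain f0 where f0: "f0 \<in> borel_measurable borel" "AE x in lborel. f x = f0 x"
    using completion_ex_borel_measurable_real[OF f(1)] by auto
  have C: "C \<ge> 0" using f(2)[of 0] by linarith
  define f' where "f' x = indicat_real (cball 0 R) x * max (- C) (min C (f0 x))" for x
  have ae: "AE x in lebesgue. f' x = f x"
    using AE_completion[OF f0(2)]
  proof eventually_elim
    case (elim x)
    then show ?case using f(2)[of x] R[of x] unfolding f'_def
      by (cases "norm x \<le> R") (auto simp: indicator_def)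
  qed
  have [measurable]: "f0 \<in> borel_measurable borel" "cball (0::R3) R \<in> sets borel" using f0(1) by auto
  have m: "f' \<in> borel_measurable borel" unfolding f'_def by measurable
  have b: "\<bar>f' x\<bar> \<le> C" for x unfolding f'_def using C by (auto simp: indicator_def)
  have z: "norm x > R \<Longrightarrow> f' x = 0" for x unfolding f'_def by (simp add: indicator_def)
  have rad': "ae_radial f'"
    unfolding ae_radial_def
  proof (intro allI impI)
    fix g :: "R3 \<Rightarrow> R3" assume g: "orthogonal_transformation g"
    have "AE x in lebesgue. f (g x) = f x" using rad g by (simp add: ae_radial_def)
    then show "AE x in lebesgue. f' (g x) = f' x"
      using ae measure_preserving_AE[OF measure_preserving_orthogonal[OF g] ae] by eventually_elim simp
  qed
  obtain h where h: "\<And>n. continuous_on UNIV (h n)" "\<And>n t. \<bar>h n t\<bar> \<le> C"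
    "AE x in lebesgue. (\<lambda>n. h n (x \<bullet> x)) \<longlonglongrightarrow> f' x"
    using ae_radial_AE_limit_Borel[OF m b z rad'] by blast
  have "AE x in lebesgue. (\<lambda>n. h n (x \<bullet> x)) \<longlonglongrightarrow> f x"
    using h(3) ae by eventually_elim simp
  with h show ?thesis by (intro that)
qed

section \<open>Limits of gradients and potentials of radial fields\<close>

lemma sq_dist_AE_cong:
  assumes "square_integrable G" "square_integrable H" "square_integrable G'" "square_integrable H'"
    "AE x in lebesgue. G x = G' x" "AE x in lebesgue. H x = H' x"
  shows "sq_dist G H = sq_dist G' H'"
  unfolding sq_dist_def
proof (rule integral_cong_AE)
  note [measurable] = assms(1-4)[THEN square_integrable_measurable]
  show "(\<lambda>x. (norm (G x - H x))\<^sup>2) \<in> borel_measurable lebesgue"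
    "(\<lambda>x. (norm (G' x - H' x))\<^sup>2) \<in> borel_measurable lebesgue" by measurable
  show "AE x in lebesgue. (norm (G x - H x))\<^sup>2 = (norm (G' x - H' x))\<^sup>2"
    using assms(5,6) by eventually_elim simp
qed

lemma sq_dist_eq_0_AE:
  assumes "square_integrable G" "square_integrable H" "sq_dist G H = 0"
  shows "AE x in lebesgue. G x = H x"
proof -
  have "AE x in lebesgue. (norm (G x - H x))\<^sup>2 = 0"
    using integral_nonneg_eq_0_iff_AE[OF square_integrable_integrable[OF square_integrable_diff[OF assms(1,2)]]] assms(3)
    unfolding sq_dist_def by simp
  then show ?thesis by eventually_elim simp
qed

lemma sq_dist_tendsto_Cauchy:
  assumes "\<And>n. square_integrable (F n)" "square_integrable G" "(\<lambda>n. sq_dist (F n) G) \<longlonglongrightarrow> 0" "e > 0"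
  shows "\<exists>N::nat. \<forall>m\<ge>N. \<forall>n\<ge>N. sq_dist (F m) (F n) < e"
proof -
  have "eventually (\<lambda>n. sq_dist (F n) G < e / 4) sequentially"
    by (rule order_tendstoD[OF assms(3)]) (use assms(4) in simp)
  then obtain N where N: "\<And>n. n \<ge> N \<Longrightarrow> sq_dist (F n) G < e / 4" by (auto simp: eventually_sequentially)
  have "sq_dist (F m) (F n) < e" if "m \<ge> N" "n \<ge> N" for m n
    using sq_dist_triangle[OF assms(1)[of m] assms(1)[of n] assms(2)] N[OF that(1)] N[OF that(2)]
      sq_dist_commute[of G "F n"] by simp
  then show ?thesis by blast
qed

lemma sq_dist_limit_AE_unique:
  assumes "\<And>n::nat. square_integrable (F n)" "square_integrable G" "square_integrable H" "(\<lambda>n. sq_dist (F n) G) \<longlonglongrightarrow> 0" "(\<lambda>n. sq_dist (F n) H) \<longlonglongrightarrow> 0"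
  shows "AE x in lebesgue. G x = H x"
proof (rule sq_dist_eq_0_AE[OF assms(2,3)])
  have "(\<lambda>n. 2 * sq_dist (F n) G + 2 * sq_dist (F n) H) \<longlonglongrightarrow> 2 * 0 + 2 * 0" by (intro tendsto_intros assms)
  moreover have "sq_dist G H \<le> 2 * sq_dist (F n) G + 2 * sq_dist (F n) H" for n
    using sq_dist_triangle[OF assms(2,3) assms(1)[of n]] by (simp add: sq_dist_commute[of G])
  ultimately have "sq_dist G H \<le> 2 * 0 + 2 * 0" by (intro LIMSEQ_le_const) auto
  then show "sq_dist G H = 0" using sq_dist_nonneg[of G H] by simp
qed

text \<open>The constant of integration is fixed at the right end: \<open>P\<close> vanishes beyond
  \<open>b\<close> and is constant below \<open>a\<close>. For \<open>a > 0\<close> the radial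
  function with profile \<open>P\<close> then has bounded support and is constant near the
  origin.\<close>

lemma compactly_supported_antiderivative:
  fixes h :: "real \<Rightarrow> real"
  assumes c: "continuous_on UNIV h" and a: "\<And>t. t \<le> a \<Longrightarrow> h t = 0" and b: "\<And>t. t \<ge> b \<Longrightarrow> h t = 0" and ab: "a < b"
  shows "\<exists>P. (\<forall>t. (P has_real_derivative h t) (at t)) \<and> (\<forall>t\<ge>b. P t = 0)"
proof -
  \<comment> \<open>Starting at \<open>a - 1\<close> leaves room: the fundamental theorem applies
    beyond the starting point, and \<open>Q\<close> vanishes identically near every
    \<open>t \<le> a - 1\<close>.\<close>
  define Q where "Q t = integral {a - 1..t} h" for t
  have dQ: "(Q has_real_derivative h t) (at t)" for t
  proof (cases "t > a - 1")
    case True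
    have "((\<lambda>x. integral {a - 1..x} h) has_real_derivative h t) (at t within {a - 1..t + 1})"
      by (rule integral_has_real_derivative[OF continuous_on_subset[OF c]]) (use True in auto)
    moreover have "at t within {a - 1..t + 1} = at t" by (rule at_within_Icc_at) (use True in auto)
    ultimately show ?thesis unfolding Q_def by simp
  next
    case False
    have z: "0 = Q s" if "s < a" for s
    proof -
      have "Q s = integral {a - 1..s} (\<lambda>_. 0)" unfolding Q_def
        by (rule integral_cong) (use a that in auto)
      then show ?thesis by simp
    qed
    have "eventually (\<lambda>s. s \<in> {..<a}) (nhds t)"
      by (rule eventually_nhds_in_open) (use False in auto)
    then have ev: "eventually (\<lambda>s. 0 = Q s) (nhds t)" by eventually_elim (rule z, simp)
    have "((\<lambda>t. 0) has_real_derivative h t) (at t)" using a[of t] False by simp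
    then show ?thesis by (rule DERIV_cong_ev[OF refl ev refl, THEN iffD1])
  qed
  have Qb: "Q t = Q b" if tb: "t \<ge> b" for t
  proof (cases "t = b")
    case False
    with tb have "b < t" by simp
    from MVT2[OF this dQ] obtain z where "z > b" "Q t - Q b = (t - b) * h z" by blast
    then show ?thesis using b[of z] by simp
  qed simp
  show ?thesis
  proof (intro exI[of _ "\<lambda>t. Q t - Q b"] conjI allI impI)
    show "((\<lambda>t. Q t - Q b) has_real_derivative h t) (at t)" for t
      using DERIV_diff[OF dQ DERIV_const[of "Q b"]] by simp
    show "Q t - Q b = 0" if "t \<ge> b" for t using Qb[OF that] by (simp only: diff_self)
  qed
qed

text \<open>Approximate the profile of \<open>f\<close> by polynomials times cut-offs; their radial
  antiderivatives are test functions.\<close>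

lemma radial_potential_exists:
  assumes f: "f \<in> borel_measurable lebesgue" "\<And>x. \<bar>f x\<bar> \<le> C" "ae_radial f"
    and ab: "0 < a" "a < b" and z: "\<And>x. \<not> (a < x \<bullet> x \<and> x \<bullet> x < b) \<Longrightarrow> f x = 0"
  obtains W where "W \<in> lip_D12" "AE x in lebesgue. wgrad W x = (2 * f x) *\<^sub>R x"
proof -
  \<comment> \<open>\<open>a\<close> and \<open>b\<close> are bounds for
    \<open>x \<bullet> x\<close>, so the support lies in the ball of radius
    \<open>sqrt b\<close>.\<close>
  define R where "R = sqrt b"
  have R: "R > 0" "\<And>x::R3. norm x > R \<longleftrightarrow> x \<bullet> x > b"
    using ab by (auto simp: R_def norm_eq_sqrt_inner)
  have fz: "f x = 0" if "norm x > R" for x using z[of x] R(2)[of x] that by auto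
  have C: "C \<ge> 0" using f(2)[of 0] by linarith
  obtain h :: "nat \<Rightarrow> real \<Rightarrow> real" where h: "\<And>n. continuous_on UNIV (h n)" "\<And>n t. \<bar>h n t\<bar> \<le> C"
    "AE x in lebesgue. (\<lambda>n. h n (x \<bullet> x)) \<longlonglongrightarrow> f x"
    using ae_radial_AE_limit[OF f(1,2) fz f(3)] by blast
  have "\<exists>p. real_polynomial_function p \<and> (\<forall>t\<in>{a..b}. \<bar>h n t - p t\<bar> < 1 / real (Suc n))" for n
  proof -
    have "continuous_on {a..b} (h n)" by (rule continuous_on_subset[OF h(1)]) simp
    moreover have "1 / real (Suc n) > 0" by simp
    ultimately obtain p where "real_polynomial_function p"
      "\<And>t. t \<in> {a..b} \<Longrightarrow> \<bar>h n t - p t\<bar> < 1 / real (Suc n)"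
      by (rule Stone_Weierstrass_real_polynomial_function[OF compact_Icc]) blast
    then show ?thesis by blast
  qed
  then have "\<forall>n. \<exists>p. real_polynomial_function p \<and> (\<forall>t\<in>{a..b}. \<bar>h n t - p t\<bar> < 1 / real (Suc n))" by blast
  from choice[OF this] obtain p where p: "\<And>n. real_polynomial_function (p n)"
    "\<And>n t. t \<in> {a..b} \<Longrightarrow> \<bar>h n t - p n t\<bar> < 1 / real (Suc n)" by blast
  \<comment> \<open>The polynomial times smooth cut-offs to the interval from \<open>a\<close> to
    \<open>b\<close> that sharpen with \<open>n\<close>; \<open>k n (x \<bullet> x)\<close> is
    uniformly bounded and tends a.e. to \<open>f x\<close>.\<close>
  define k where "k n t = p n t * (bump (real n * t + (- real n * a)) * bump ((- real n) * t + real n * b))" for n t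
  have k0: "k n t = 0" if "\<not> (a < t \<and> t < b)" for n t
  proof -
    have "real n * t + (- real n * a) = real n * (t - a)" "(- real n) * t + real n * b = real n * (b - t)"
      by (simp_all add: algebra_simps)
    then show ?thesis unfolding k_def using that
      by (auto simp: not_less bump_simps mult_nonneg_nonpos)
  qed
  have Ck_real: "Ck_real m (k n)" for m n
    unfolding k_def by (intro Ck_real_mult Ck_real_affine_compose Ck_real_flat Ck_real_real_polynomial_function p)
  have kb: "\<bar>k n t\<bar> \<le> C + 1" for n t
  proof (cases "a < t \<and> t < b")
    case True
    have "1 / real (Suc n) \<le> 1" by simp
    moreover have "\<bar>h n t - p n t\<bar> < 1 / real (Suc n)" using True by (intro p(2)) auto
    ultimately have "\<bar>p n t\<bar> \<le> C + 1" using h(2)[of n t] by argo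
    moreover have "\<bar>bump (real n * t + (- real n * a)) * bump ((- real n) * t + real n * b)\<bar> \<le> 1"
      unfolding abs_mult by (intro mult_le_one) (auto simp: bump_simps)
    ultimately show ?thesis unfolding k_def abs_mult[of "p n t"]
      using mult_mono[of "\<bar>p n t\<bar>" "C + 1" "\<bar>bump (real n * t + (- real n * a)) * bump ((- real n) * t + real n * b)\<bar>" 1] C by simp
  qed (use k0 C in simp)
  have inv0: "(\<lambda>n. 1 / real (Suc n)) \<longlonglongrightarrow> 0"
    using LIMSEQ_inverse_real_of_nat by (simp add: inverse_eq_divide)
  have klim: "AE x in lebesgue. (\<lambda>n. k n (x \<bullet> x)) \<longlonglongrightarrow> f x"
    using h(3)
  proof eventually_elim
    case (elim x)
    define t where "t = x \<bullet> x"
    show ?case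
    proof (cases "a < t \<and> t < b")
      case True
      have "(\<lambda>n. p n t - h n t) \<longlonglongrightarrow> 0"
      proof (rule Lim_null_comparison[OF always_eventually inv0], rule allI)
        show "norm (p n t - h n t) \<le> 1 / real (Suc n)" for n
          using p(2)[of t n] True by (simp add: abs_minus_commute less_imp_le)
      qed
      from tendsto_add[OF this elim[folded t_def]] have pl: "(\<lambda>n. p n t) \<longlonglongrightarrow> f x" by simp
      have "(\<lambda>n. p n t * (bump (real n * (t - a)) * bump (real n * (b - t)))) \<longlonglongrightarrow> f x * ((if t - a > 0 then 1 else 0) * (if b - t > 0 then 1 else 0))"
        by (intro tendsto_mult pl bump_scaled_tendsto)
      moreover have "k n t = p n t * (bump (real n * (t - a)) * bump (real n * (b - t)))" for n
        unfolding k_def by (simp add: algebra_simps)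
      ultimately show ?thesis using True unfolding t_def[symmetric] by simp
    next
      case False
      then show ?thesis using k0 z[of x] unfolding t_def by simp
    qed
  qed
  have "\<forall>n. \<exists>P. (\<forall>t. (P has_real_derivative k n t) (at t)) \<and> (\<forall>t\<ge>b. P t = 0)"
    by (intro allI compactly_supported_antiderivative[OF Ck_real_continuous[OF Ck_real] k0 k0 ab(2)]) auto
  from choice[OF this] obtain P where P: "\<And>n t. (P n has_real_derivative k n t) (at t)" "\<And>n t. t \<ge> b \<Longrightarrow> P n t = 0" by blast
  define U where "U n x = P n (x \<bullet> x)" for n and x :: R3
  have SP: "Ck_real m (P n)" for m n
  proof -
    have "Ck_real (Suc m) (P n)" unfolding Ck_real.simps using P(1) Ck_real by blast
    then show ?thesis by (rule Ck_real_Suc_imp)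
  qed
  have U: "test_function (U n)" for n
    unfolding U_def by (rule test_functionI[OF Ck_radial[OF SP], of R]) (use R(2) P(2) in auto)
  have gU: "grad (U n) x = (2 * k n (x \<bullet> x)) *\<^sub>R x" for n x
    unfolding U_def by (intro grad_eq GDERIV_radial P)
  have vec_bound: "norm ((2 * s) *\<^sub>R x) \<le> 2 * M * R" if "\<bar>s\<bar> \<le> M" "\<not> (a < x \<bullet> x \<and> x \<bullet> x < b) \<Longrightarrow> s = 0" for s M and x :: R3
  proof (cases "norm x \<le> R")
    case True
    have "\<bar>s\<bar> * norm x \<le> M * R" using True that(1) by (intro mult_mono) auto
    then show ?thesis by (simp add: abs_mult)
  next
    case False
    then have "s = 0" using that(2) R(2)[of x] by auto
    then show ?thesis using that(1) R(1) by simp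
  qed
  have zero_out: "s *\<^sub>R x = 0" if "norm x > R" "\<not> (a < x \<bullet> x \<and> x \<bullet> x < b) \<Longrightarrow> s = 0" for s and x :: R3
    using that R(2)[of x] by auto
  \<comment> \<open>One Lipschitz constant for all \<open>U n\<close>, as
    \<open>lip_D12_limit\<close> demands.\<close>
  define L where "L = 2 * (C + 1) * R"
  have gUL: "norm (grad (U n) x) \<le> L" for n x
    unfolding gU L_def by (rule vec_bound[OF kb]) (use k0 in auto)
  have lipU: "L-lipschitz_on UNIV (U n)" for n
    using gradient_bound_imp_Lipschitz[OF test_functionD(2)[OF U] gUL] C R(1)
    by (intro lipschitz_onI) (auto simp: dist_norm L_def)
  define G where "G x = (2 * f x) *\<^sub>R x" for x
  note [measurable] = f(1)
  have mid [measurable]: "(\<lambda>x::R3. x) \<in> borel_measurable lebesgue"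
    by (intro continuous_imp_measurable_lebesgue continuous_intros)
  have mG [measurable]: "G \<in> borel_measurable lebesgue" unfolding G_def by measurable
  have GL: "norm (G x) \<le> L" for x
    unfolding G_def L_def by (rule vec_bound) (use f(2)[of x] z in auto)
  have sG: "square_integrable G"
    unfolding square_integrable_def
  proof
    show "integrable lebesgue (\<lambda>x. (norm (G x))\<^sup>2)"
    proof (rule integrable_bounded_support[where C = "L\<^sup>2" and R = R])
      show "AE x in lebesgue. norm ((norm (G x))\<^sup>2) \<le> L\<^sup>2" using GL by (intro AE_I2) (simp add: power_mono)
      show "(norm (G x))\<^sup>2 = 0" if "norm x > R" for x using fz[OF that] by (simp add: G_def)
    qed measurable
  qed (rule mG)
  have dG: "(\<lambda>n. sq_dist (grad (U n)) G) \<longlonglongrightarrow> 0"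
  proof -
    note [measurable] = test_function_integrable(4)[OF U]
    have "(\<lambda>n. LINT x|lebesgue. (norm (grad (U n) x - G x))\<^sup>2) \<longlonglongrightarrow> (LINT x|(lebesgue :: R3 measure). 0)"
    proof (rule integral_dominated_convergence[where w = "\<lambda>x. indicat_real (cball 0 R) x *\<^sub>R (2 * L)\<^sup>2"])
      show "AE x in lebesgue. (\<lambda>n. (norm (grad (U n) x - G x))\<^sup>2) \<longlonglongrightarrow> 0"
        using klim
      proof eventually_elim
        case (elim x)
        then have "(\<lambda>n. (norm ((2 * k n (x \<bullet> x)) *\<^sub>R x - (2 * f x) *\<^sub>R x))\<^sup>2) \<longlonglongrightarrow> (norm ((2 * f x) *\<^sub>R x - (2 * f x) *\<^sub>R x))\<^sup>2"
          by (intro tendsto_intros)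
        then show ?case unfolding gU G_def by simp
      qed
      show "AE x in lebesgue. norm ((norm (grad (U n) x - G x))\<^sup>2) \<le> indicat_real (cball 0 R) x *\<^sub>R (2 * L)\<^sup>2" for n
      proof (rule AE_I2)
        fix x
        show "norm ((norm (grad (U n) x - G x))\<^sup>2) \<le> indicat_real (cball 0 R) x *\<^sub>R (2 * L)\<^sup>2"
        proof (cases "norm x \<le> R")
          case True
          have "norm (grad (U n) x - G x) \<le> 2 * L"
            using norm_triangle_ineq4[of "grad (U n) x" "G x"] gUL[of n x] GL[of x] by linarith
          then have "(norm (grad (U n) x - G x))\<^sup>2 \<le> (2 * L)\<^sup>2" by (intro power_mono) auto
          then show ?thesis using True by simp
        next
          case False
          then have "\<not> (a < x \<bullet> x \<and> x \<bullet> x < b)" using R(2)[of x] by auto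
          then show ?thesis unfolding gU G_def using k0 z by simp
        qed
      qed
    qed (use integrable_indicator_cball in auto)
    then show ?thesis by (simp add: sq_dist_def)
  qed
  have UV: "U n \<in> lip_D12" and wU: "AE x in lebesgue. grad (U n) x = wgrad (U n) x" for n
    using test_function_in_lip_D12[OF U[of n]] by auto
  have sU: "square_integrable (wgrad (U n))" for n by (rule lip_D12_square_integrable[OF UV])
  have dw: "(\<lambda>n. sq_dist (wgrad (U n)) G) \<longlonglongrightarrow> 0"
    using dG sq_dist_AE_cong[OF test_function_square_integrable[OF U] sG sU sG wU] by simp
  obtain W where W: "W \<in> lip_D12" "L-lipschitz_on UNIV W" "(\<lambda>n. sq_dist (wgrad (U n)) (wgrad W)) \<longlonglongrightarrow> 0"
    by (rule lip_D12_limit[OF UV lipU sq_dist_tendsto_Cauchy[OF sU sG dw]]) blast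
  have "AE x in lebesgue. wgrad W x = G x"
    by (rule sq_dist_limit_AE_unique[OF sU lip_D12_square_integrable[OF W(1)] sG W(3) dw])
  then have "AE x in lebesgue. wgrad W x = (2 * f x) *\<^sub>R x" unfolding G_def .
  then show ?thesis by (rule that[OF W(1)])
qed

section \<open>Concavity of powers\<close>

text \<open>After division by a power of \<open>a\<close> this is Young's inequality for
  \<open>c / a\<close> and 1 with weights \<open>\<alpha>\<close> and \<open>1 - \<alpha>\<close>.
  The value \<open>c = 0\<close> is allowed, while \<open>a\<close> is positive because the slope is
  infinite at 0 when \<open>\<alpha> < 1\<close>.\<close>

lemma powr_concave_tangent:
  fixes a c \<alpha> :: real
  assumes "0 < a" "0 \<le> c" "0 < \<alpha>" "\<alpha> \<le> 1"
  shows "c powr \<alpha> \<le> a powr \<alpha> + \<alpha> * a powr (\<alpha> - 1) * (c - a)"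
proof -
  have "(c / a) powr \<alpha> \<le> 1 + \<alpha> * (c / a - 1)"
  proof (cases "c = 0")
    case False
    have "(c / a) powr \<alpha> * 1 powr (1 - \<alpha>) \<le> \<alpha> * (c / a) + (1 - \<alpha>) * 1"
      using assms False by (intro Youngs_inequality_0) auto
    then show ?thesis by (simp add: algebra_simps)
  qed (use assms in simp)
  then have "a powr \<alpha> * (c / a) powr \<alpha> \<le> a powr \<alpha> * (1 + \<alpha> * (c / a - 1))" by (intro mult_left_mono) auto
  moreover have "a powr \<alpha> * (c / a) powr \<alpha> = c powr \<alpha>"
    using assms by (simp add: powr_mult[symmetric])
  moreover have "a powr \<alpha> * (1 + \<alpha> * (c / a - 1)) = a powr \<alpha> + \<alpha> * a powr (\<alpha> - 1) * (c - a)"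
    using assms by (simp add: powr_diff field_simps)
  ultimately show ?thesis by simp
qed

text \<open>Two tangent inequalities at the intermediate point; if that point is 0, both weighted
  values vanish.\<close>

lemma powr_concave:
  fixes s r \<alpha> t :: real
  assumes "0 \<le> s" "0 \<le> r" "0 < \<alpha>" "\<alpha> \<le> 1" "0 \<le> t" "t \<le> 1"
  shows "(1 - t) * s powr \<alpha> + t * r powr \<alpha> \<le> ((1 - t) * s + t * r) powr \<alpha>"
proof (cases "(1 - t) * s + t * r = 0")
  case True
  then have "(1 - t) * s = 0" "t * r = 0" using assms by (simp_all add: add_nonneg_eq_0_iff)
  then have "(1 - t) * s powr \<alpha> = 0" "t * r powr \<alpha> = 0" by auto
  then show ?thesis by (simp only: True) simp
next
  case False
  define m where "m = (1 - t) * s + t * r"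
  have m: "m > 0" using False assms unfolding m_def by (metis add_nonneg_nonneg diff_ge_0_iff_ge less_eq_real_def mult_nonneg_nonneg)
  have "s powr \<alpha> \<le> m powr \<alpha> + \<alpha> * m powr (\<alpha> - 1) * (s - m)" "r powr \<alpha> \<le> m powr \<alpha> + \<alpha> * m powr (\<alpha> - 1) * (r - m)"
    using powr_concave_tangent[OF m] assms by auto
  then have "(1 - t) * s powr \<alpha> + t * r powr \<alpha>
      \<le> (1 - t) * (m powr \<alpha> + \<alpha> * m powr (\<alpha> - 1) * (s - m)) + t * (m powr \<alpha> + \<alpha> * m powr (\<alpha> - 1) * (r - m))"
    using assms by (intro add_mono mult_left_mono) auto
  also have "\<dots> = m powr \<alpha> + \<alpha> * m powr (\<alpha> - 1) * (((1 - t) * s + t * r) - m)"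
    by (simp add: algebra_simps)
  also have "\<dots> = m powr \<alpha>" by (simp add: m_def)
  finally show ?thesis by (simp add: m_def)
qed

text \<open>This makes the energy density integrable: its modulus is dominated by the one for
  exponent 1, which is quadratic in the gradient.\<close>

lemma abs_one_minus_powr_le:
  fixes y \<alpha> :: real
  assumes "0 \<le> y" "0 < \<alpha>" "\<alpha> \<le> 1"
  shows "\<bar>1 - y powr \<alpha>\<bar> \<le> \<bar>1 - y\<bar>"
proof (cases "y \<le> 1")
  case True
  have "y powr \<alpha> \<le> 1" using assms True powr_mono2[of \<alpha> y 1] by simp
  moreover have "y \<le> y powr \<alpha>"
  proof (cases "y = 0")
    case False
    then show ?thesis using powr_mono'[of \<alpha> 1 y] assms True by simp
  qed simp
  ultimately show ?thesis using True by simp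
next
  case False
  have "y powr \<alpha> \<le> y powr 1" using False assms by (intro powr_mono) auto
  moreover have "1 \<le> y powr \<alpha>" using False assms by (intro ge_one_powr_ge_zero) auto
  ultimately show ?thesis using False by simp
qed

section \<open>Minimizing the radial comparison functional\<close>

text \<open>The gradient bound is carried along because it lets a multiple of \<open>\<phi>\<close>
  satisfy the constraint of \<open>XB B\<close>, so that \<open>\<phi>\<close> lies in its
  span.\<close>

definition lip_bounded :: "(R3 \<Rightarrow> real) set" where
  "lip_bounded = {\<phi> \<in> lip_D12. \<exists>M. AE x in lebesgue. norm (wgrad \<phi> x) \<le> M}"

definition feasible :: "(R3 \<Rightarrow> real) \<Rightarrow> (R3 \<Rightarrow> real) set" where
  "feasible \<beta> = {\<phi> \<in> lip_D12. AE x in lebesgue. (norm (wgrad \<phi> x))\<^sup>2 \<le> 1 + \<beta> x}"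

lemma lip_bounded_cmult: "\<phi> \<in> lip_bounded \<Longrightarrow> (\<lambda>x. c * \<phi> x) \<in> lip_bounded"
proof -
  assume "\<phi> \<in> lip_bounded"
  then obtain M where \<phi>: "\<phi> \<in> lip_D12" and M: "AE x in lebesgue. norm (wgrad \<phi> x) \<le> M" by (auto simp: lip_bounded_def)
  have "AE x in lebesgue. norm (wgrad (\<lambda>x. c * \<phi> x) x) \<le> \<bar>c\<bar> * M"
    using M lip_D12_wgrad_cmult[OF \<phi>, of c] by eventually_elim (simp add: mult_left_mono)
  then show ?thesis using lip_D12_cmult[OF \<phi>] by (auto simp: lip_bounded_def)
qed

text \<open>The last term is the source of uniform convexity.\<close>

lemma norm_convex_combination_sq:
  fixes p r :: "'a::real_inner"
  shows "(norm ((1 - t) *\<^sub>R p + t *\<^sub>R r))\<^sup>2 = (1 - t) * (norm p)\<^sup>2 + t * (norm r)\<^sup>2 - t * (1 - t) * (norm (p - r))\<^sup>2"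
  unfolding power2_norm_eq_inner
  by (simp add: inner_add_left inner_add_right inner_diff_left inner_diff_right inner_commute algebra_simps)

text \<open>The comparison problem sees the field only through its squared norm
  \<open>\<beta>\<close>, which is a.e. radial. Continuity of \<open>\<rho>\<close> is assumed at 0
  alone; linearity extends it to all feasible functions.\<close>

locale radial_problem =
  fixes q C :: real and \<beta> :: "R3 \<Rightarrow> real" and \<rho> :: "(R3 \<Rightarrow> real) \<Rightarrow> real"
  assumes q: "1 \<le> q" "q < 2" and C: "0 \<le> C"
    and \<beta>_nonneg: "\<And>x. 0 \<le> \<beta> x" and \<beta>_int: "integrable lebesgue \<beta>"
    and \<beta>_bound: "AE x in lebesgue. \<beta> x \<le> C" and \<beta>_rad: "ae_radial \<beta>"
    and \<rho>_add: "\<And>\<phi> \<psi>. \<phi> \<in> lip_bounded \<Longrightarrow> \<psi> \<in> lip_bounded \<Longrightarrow> \<rho> (\<lambda>x. \<phi> x + \<psi> x) = \<rho> \<phi> + \<rho> \<psi>"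
    and \<rho>_cmult: "\<And>\<phi> c. \<phi> \<in> lip_bounded \<Longrightarrow> \<rho> (\<lambda>x. c * \<phi> x) = c * \<rho> \<phi>"
    and \<rho>_cont: "\<And>e. e > 0 \<Longrightarrow> \<exists>d>0. \<forall>\<psi>\<in>feasible \<beta>. sq_dist (wgrad \<psi>) (\<lambda>x. 0) < d \<longrightarrow> \<bar>\<rho> \<psi>\<bar> < e"
    and \<rho>_rad: "\<And>\<phi> g. \<phi> \<in> lip_bounded \<Longrightarrow> orthogonal_transformation g \<Longrightarrow> \<rho> (\<lambda>x. \<phi> (g x)) = \<rho> \<phi>"
begin

abbreviation "\<alpha> \<equiv> q / 2"

abbreviation "\<Lambda> \<equiv> sqrt (1 + C)"

definition gap :: "(R3 \<Rightarrow> real) \<Rightarrow> R3 \<Rightarrow> real" where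
  "gap \<phi> x = 1 + \<beta> x - (norm (wgrad \<phi> x))\<^sup>2"

definition density_integral :: "(R3 \<Rightarrow> real) \<Rightarrow> real" where
  "density_integral \<phi> = (LINT x|lebesgue. 1 - gap \<phi> x powr \<alpha>)"

definition energy :: "(R3 \<Rightarrow> real) \<Rightarrow> real" where
  "energy \<phi> = 1 / q * density_integral \<phi> - \<rho> \<phi>"

definition dirichlet :: "(R3 \<Rightarrow> real) \<Rightarrow> real" where
  "dirichlet \<phi> = (LINT x|lebesgue. (norm (wgrad \<phi> x))\<^sup>2)"

lemma dirichlet_sq_dist: "sq_dist (wgrad \<phi>) (\<lambda>x. 0) = dirichlet \<phi>"
  by (simp add: dirichlet_def sq_dist_def)

lemma dirichlet_nonneg: "0 \<le> dirichlet \<phi>" by (simp add: dirichlet_def)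

lemma \<beta>_meas [measurable]: "\<beta> \<in> borel_measurable lebesgue"
  using \<beta>_int by (rule borel_measurable_integrable)

lemma \<alpha>: "0 < \<alpha>" "\<alpha> < 1" "\<alpha> \<le> 1" using q by auto

lemma feasible_lip_D12: "\<phi> \<in> feasible \<beta> \<Longrightarrow> \<phi> \<in> lip_D12" by (simp add: feasible_def)

lemma lip_D12_wgrad_measurable [measurable]: "\<phi> \<in> lip_D12 \<Longrightarrow> wgrad \<phi> \<in> borel_measurable lebesgue"
  by (intro square_integrable_measurable lip_D12_square_integrable)

lemma gap_measurable [measurable]: "\<phi> \<in> lip_D12 \<Longrightarrow> gap \<phi> \<in> borel_measurable lebesgue"
  unfolding gap_def by measurable

lemma feasible_gap: "\<phi> \<in> feasible \<beta> \<Longrightarrow> AE x in lebesgue. 0 \<le> gap \<phi> x"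
  unfolding feasible_def gap_def by auto

lemma gap_le: "AE x in lebesgue. gap \<phi> x \<le> 1 + C"
  using \<beta>_bound
proof eventually_elim
  case (elim x)
  then show ?case using zero_le_power2[of "norm (wgrad \<phi> x)"] unfolding gap_def by linarith
qed

lemma feasible_norm_le: "\<phi> \<in> feasible \<beta> \<Longrightarrow> AE x in lebesgue. norm (wgrad \<phi> x) \<le> \<Lambda>"
proof -
  assume \<phi>: "\<phi> \<in> feasible \<beta>"
  show ?thesis using feasible_gap[OF \<phi>] \<beta>_bound
    by eventually_elim (simp add: gap_def real_le_rsqrt)
qed

lemma feasible_lip_bounded: "\<phi> \<in> feasible \<beta> \<Longrightarrow> \<phi> \<in> lip_bounded"
  using feasible_norm_le feasible_lip_D12 by (auto simp: lip_bounded_def)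

text \<open>A common constant for all competitors, so that \<open>lip_D12_limit\<close> applies to
  minimizing sequences.\<close>

lemma feasible_Lipschitz: "\<phi> \<in> feasible \<beta> \<Longrightarrow> \<Lambda>-lipschitz_on UNIV \<phi>"
  using C by (intro weak_grad_bound_imp_Lipschitz[OF lip_D12_continuous lip_D12_has_weak_grad feasible_norm_le]) (auto dest: feasible_lip_D12)

lemma dirichlet_integrable: "\<phi> \<in> lip_D12 \<Longrightarrow> integrable lebesgue (\<lambda>x. (norm (wgrad \<phi> x))\<^sup>2)"
  by (intro square_integrable_integrable lip_D12_square_integrable)

lemma density_integrable:
  assumes \<phi>: "\<phi> \<in> feasible \<beta>"
  shows "integrable lebesgue (\<lambda>x. 1 - gap \<phi> x powr \<alpha>)"
proof (rule Bochner_Integration.integrable_bound)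
  note [measurable] = gap_measurable[OF feasible_lip_D12[OF \<phi>]]
  show "integrable lebesgue (\<lambda>x. \<beta> x + (norm (wgrad \<phi> x))\<^sup>2)"
    by (intro Bochner_Integration.integrable_add \<beta>_int dirichlet_integrable feasible_lip_D12 \<phi>)
  show "(\<lambda>x. 1 - gap \<phi> x powr \<alpha>) \<in> borel_measurable lebesgue" by measurable
  show "AE x in lebesgue. norm (1 - gap \<phi> x powr \<alpha>) \<le> norm (\<beta> x + (norm (wgrad \<phi> x))\<^sup>2)"
    using feasible_gap[OF \<phi>]
  proof eventually_elim
    case (elim x)
    have "\<bar>1 - gap \<phi> x powr \<alpha>\<bar> \<le> \<bar>1 - gap \<phi> x\<bar>" using elim \<alpha> by (intro abs_one_minus_powr_le) auto
    also have "\<dots> \<le> \<beta> x + (norm (wgrad \<phi> x))\<^sup>2"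
      using \<beta>_nonneg[of x] zero_le_power2[of "norm (wgrad \<phi> x)"] unfolding gap_def by linarith
    finally show ?case by simp
  qed
qed

text \<open>The tangent inequality for the power at the point 1. It makes the energy grow
  quadratically in the gradient.\<close>

lemma density_ge:
  assumes \<phi>: "\<phi> \<in> feasible \<beta>"
  shows "AE x in lebesgue. \<alpha> * (norm (wgrad \<phi> x))\<^sup>2 - \<alpha> * \<beta> x \<le> 1 - gap \<phi> x powr \<alpha>"
  using feasible_gap[OF \<phi>]
proof eventually_elim
  case (elim x)
  have "gap \<phi> x powr \<alpha> \<le> 1 powr \<alpha> + \<alpha> * 1 powr (\<alpha> - 1) * (gap \<phi> x - 1)"
    using \<alpha> elim by (intro powr_concave_tangent) auto
  then show ?case by (simp add: gap_def algebra_simps)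
qed

lemma density_integral_ge:
  assumes \<phi>: "\<phi> \<in> feasible \<beta>"
  shows "\<alpha> * dirichlet \<phi> - \<alpha> * (LINT x|lebesgue. \<beta> x) \<le> density_integral \<phi>"
proof -
  have "\<alpha> * dirichlet \<phi> - \<alpha> * (LINT x|lebesgue. \<beta> x) = (LINT x|lebesgue. \<alpha> * (norm (wgrad \<phi> x))\<^sup>2 - \<alpha> * \<beta> x)"
    unfolding dirichlet_def using dirichlet_integrable[OF feasible_lip_D12[OF \<phi>]] \<beta>_int by simp
  also have "\<dots> \<le> density_integral \<phi>" unfolding density_integral_def
    using dirichlet_integrable[OF feasible_lip_D12[OF \<phi>]] \<beta>_int
    by (intro integral_mono_AE density_ge density_integrable \<phi>) auto
  finally show ?thesis .
qed

text \<open>The gap is a strictly concave function of the gradient, which gives convexity of the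
  constraint set as well as the excess term used in \<open>energy_midpoint\<close>.\<close>

lemma feasible_combination:
  assumes \<phi>: "\<phi> \<in> feasible \<beta>" and \<psi>: "\<psi> \<in> feasible \<beta>" and t: "0 \<le> t" "t \<le> 1"
  defines "\<zeta> \<equiv> \<lambda>x. (1 - t) * \<phi> x + t * \<psi> x"
  shows "\<zeta> \<in> feasible \<beta>" "AE x in lebesgue. wgrad \<zeta> x = (1 - t) *\<^sub>R wgrad \<phi> x + t *\<^sub>R wgrad \<psi> x"
    "AE x in lebesgue. gap \<zeta> x = (1 - t) * gap \<phi> x + t * gap \<psi> x + t * (1 - t) * (norm (wgrad \<phi> x - wgrad \<psi> x))\<^sup>2"
proof -
  have V: "\<zeta> \<in> lip_D12" unfolding \<zeta>_def by (intro lip_D12_add lip_D12_cmult feasible_lip_D12 \<phi> \<psi>)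
  show g: "AE x in lebesgue. wgrad \<zeta> x = (1 - t) *\<^sub>R wgrad \<phi> x + t *\<^sub>R wgrad \<psi> x"
    using lip_D12_wgrad_add[OF lip_D12_cmult[OF feasible_lip_D12[OF \<phi>], of "1 - t"] lip_D12_cmult[OF feasible_lip_D12[OF \<psi>], of t]]
      lip_D12_wgrad_cmult[OF feasible_lip_D12[OF \<phi>], of "1 - t"] lip_D12_wgrad_cmult[OF feasible_lip_D12[OF \<psi>], of t]
    unfolding \<zeta>_def by eventually_elim simp
  show s: "AE x in lebesgue. gap \<zeta> x = (1 - t) * gap \<phi> x + t * gap \<psi> x + t * (1 - t) * (norm (wgrad \<phi> x - wgrad \<psi> x))\<^sup>2"
    using g
  proof eventually_elim
    case (elim x)
    show ?case unfolding gap_def elim norm_convex_combination_sq by (simp add: algebra_simps)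
  qed
  have "AE x in lebesgue. (norm (wgrad \<zeta> x))\<^sup>2 \<le> 1 + \<beta> x"
    using s feasible_gap[OF \<phi>] feasible_gap[OF \<psi>]
  proof eventually_elim
    case (elim x)
    have "0 \<le> gap \<zeta> x" unfolding elim(1) using elim(2,3) t by (intro add_nonneg_nonneg mult_nonneg_nonneg) auto
    then show ?case by (simp add: gap_def)
  qed
  then show "\<zeta> \<in> feasible \<beta>" using V by (simp add: feasible_def)
qed

lemma zero_in_feasible: "(\<lambda>x. 0) \<in> feasible \<beta>"
proof -
  have "AE x in lebesgue. (norm (wgrad (\<lambda>x. 0) x))\<^sup>2 \<le> 1 + \<beta> x"
    using zero_in_lip_D12(2) by eventually_elim (use \<beta>_nonneg in \<open>simp add: add_increasing\<close>)
  then show ?thesis using zero_in_lip_D12(1) by (simp add: feasible_def)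
qed

lemma feasible_cmult:
  assumes \<phi>: "\<phi> \<in> feasible \<beta>" and t: "\<bar>t\<bar> \<le> 1"
  shows "(\<lambda>x. t * \<phi> x) \<in> feasible \<beta>"
proof -
  have "AE x in lebesgue. (norm (wgrad (\<lambda>x. t * \<phi> x) x))\<^sup>2 \<le> 1 + \<beta> x"
    using lip_D12_wgrad_cmult[OF feasible_lip_D12[OF \<phi>], of t] feasible_gap[OF \<phi>]
  proof eventually_elim
    case (elim x)
    have "t\<^sup>2 * (norm (wgrad \<phi> x))\<^sup>2 \<le> 1 * (norm (wgrad \<phi> x))\<^sup>2"
      using t by (intro mult_right_mono) (auto simp: abs_square_le_1)
    then show ?case using elim by (simp add: gap_def power_mult_distrib)
  qed
  then show ?thesis using lip_D12_cmult[OF feasible_lip_D12[OF \<phi>], of t] by (simp add: feasible_def)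
qed

lemma dirichlet_cmult: "\<phi> \<in> lip_D12 \<Longrightarrow> dirichlet (\<lambda>x. t * \<phi> x) = t\<^sup>2 * dirichlet \<phi>"
proof -
  assume \<phi>: "\<phi> \<in> lip_D12"
  have "dirichlet (\<lambda>x. t * \<phi> x) = (LINT x|lebesgue. t\<^sup>2 * (norm (wgrad \<phi> x))\<^sup>2)"
    unfolding dirichlet_def
    by (rule integral_cong_AE)
       (use lip_D12_wgrad_cmult[OF \<phi>, of t] lip_D12_wgrad_measurable[OF \<phi>] lip_D12_wgrad_measurable[OF lip_D12_cmult[OF \<phi>, of t]]
         in \<open>auto simp: power_mult_distrib\<close>)
  then show ?thesis by (simp add: dirichlet_def)
qed

text \<open>A difference of feasible functions may violate the constraint, but half of it is a
  convex combination of \<open>\<phi>\<close> and the negative of \<open>\<psi>\<close>. This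
  carries the continuity of \<open>\<rho>\<close> from 0 to arbitrary points.\<close>

lemma half_diff_in_feasible:
  assumes \<phi>: "\<phi> \<in> feasible \<beta>" and \<psi>: "\<psi> \<in> feasible \<beta>"
  shows "(\<lambda>x. 1 / 2 * \<phi> x + 1 / 2 * (- 1 * \<psi> x)) \<in> feasible \<beta>"
    "dirichlet (\<lambda>x. 1 / 2 * \<phi> x + 1 / 2 * (- 1 * \<psi> x)) = sq_dist (wgrad \<phi>) (wgrad \<psi>) / 4"
    "\<rho> (\<lambda>x. 1 / 2 * \<phi> x + 1 / 2 * (- 1 * \<psi> x)) = (\<rho> \<phi> - \<rho> \<psi>) / 2"
proof -
  have m: "(\<lambda>x. - 1 * \<psi> x) \<in> feasible \<beta>" by (rule feasible_cmult[OF \<psi>]) simp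
  define h where "h = (\<lambda>x. 1 / 2 * \<phi> x + 1 / 2 * (- 1 * \<psi> x))"
  have hK: "h \<in> feasible \<beta>" and hw: "AE x in lebesgue. wgrad h x = (1 / 2) *\<^sub>R wgrad \<phi> x + (1 / 2) *\<^sub>R wgrad (\<lambda>x. - 1 * \<psi> x) x"
    using feasible_combination(1,2)[OF \<phi> m, of "1 / 2"] unfolding h_def by simp_all
  then show "(\<lambda>x. 1 / 2 * \<phi> x + 1 / 2 * (- 1 * \<psi> x)) \<in> feasible \<beta>" unfolding h_def by simp
  have "dirichlet h = (LINT x|lebesgue. (norm (wgrad \<phi> x - wgrad \<psi> x))\<^sup>2 / 4)"
    unfolding dirichlet_def
  proof (rule integral_cong_AE)
    note [measurable] = lip_D12_wgrad_measurable[OF feasible_lip_D12[OF \<phi>]] lip_D12_wgrad_measurable[OF feasible_lip_D12[OF \<psi>]] lip_D12_wgrad_measurable[OF feasible_lip_D12[OF hK]]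
    show "(\<lambda>x. (norm (wgrad h x))\<^sup>2) \<in> borel_measurable lebesgue"
      "(\<lambda>x. (norm (wgrad \<phi> x - wgrad \<psi> x))\<^sup>2 / 4) \<in> borel_measurable lebesgue" by measurable
    show "AE x in lebesgue. (norm (wgrad h x))\<^sup>2 = (norm (wgrad \<phi> x - wgrad \<psi> x))\<^sup>2 / 4"
      using hw lip_D12_wgrad_cmult[OF feasible_lip_D12[OF \<psi>], of "-1"]
    proof eventually_elim
      case (elim x)
      have "wgrad h x = (1 / 2) *\<^sub>R (wgrad \<phi> x - wgrad \<psi> x)" using elim by (simp add: algebra_simps)
      then show ?case by (simp add: power_divide)
    qed
  qed
  then show "dirichlet (\<lambda>x. 1 / 2 * \<phi> x + 1 / 2 * (- 1 * \<psi> x)) = sq_dist (wgrad \<phi>) (wgrad \<psi>) / 4"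
    unfolding h_def[symmetric] sq_dist_def by simp
  show "\<rho> (\<lambda>x. 1 / 2 * \<phi> x + 1 / 2 * (- 1 * \<psi> x)) = (\<rho> \<phi> - \<rho> \<psi>) / 2"
    using \<rho>_add[OF lip_bounded_cmult[OF feasible_lip_bounded[OF \<phi>], of "1 / 2"] lip_bounded_cmult[OF feasible_lip_bounded[OF m], of "1 / 2"]]
      \<rho>_cmult[OF feasible_lip_bounded[OF \<phi>], of "1 / 2"] \<rho>_cmult[OF feasible_lip_bounded[OF m], of "1 / 2"] \<rho>_cmult[OF feasible_lip_bounded[OF \<psi>], of "- 1"]
    by (simp only:) (simp add: diff_divide_distrib)
qed

section \<open>Continuity and growth of the charge; lower bound for the energy\<close>

lemma \<rho>_tendsto:
  assumes "\<And>n::nat. \<phi> n \<in> feasible \<beta>" "\<psi> \<in> feasible \<beta>" "(\<lambda>n. sq_dist (wgrad (\<phi> n)) (wgrad \<psi>)) \<longlonglongrightarrow> 0"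
  shows "(\<lambda>n. \<rho> (\<phi> n)) \<longlonglongrightarrow> \<rho> \<psi>"
proof (rule LIMSEQ_I)
  fix e :: real assume "e > 0"
  then obtain d where d: "d > 0" "\<And>\<psi>. \<psi> \<in> feasible \<beta> \<Longrightarrow> dirichlet \<psi> < d \<Longrightarrow> \<bar>\<rho> \<psi>\<bar> < e / 2"
    using \<rho>_cont[of "e / 2"] unfolding dirichlet_sq_dist by auto
  \<comment> \<open>The factor 4 compensates the halving: the Dirichlet integral of the half
    difference is a quarter of the squared distance.\<close>
  have "eventually (\<lambda>n. sq_dist (wgrad (\<phi> n)) (wgrad \<psi>) < 4 * d) sequentially"
    by (rule order_tendstoD[OF assms(3)]) (use d in simp)
  then obtain N where N: "\<And>n. n \<ge> N \<Longrightarrow> sq_dist (wgrad (\<phi> n)) (wgrad \<psi>) < 4 * d" by (auto simp: eventually_sequentially)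
  have "\<bar>\<rho> (\<phi> n) - \<rho> \<psi>\<bar> < e" if "n \<ge> N" for n
    using d(2)[OF half_diff_in_feasible(1)[OF assms(1,2), of n]] N[OF that]
    unfolding half_diff_in_feasible(2,3)[OF assms(1,2)] by simp
  then show "\<exists>no. \<forall>n\<ge>no. norm (\<rho> (\<phi> n) - \<rho> \<psi>) < e" by auto
qed

text \<open>A small multiple of \<open>\<phi>\<close> is feasible and has Dirichlet integral below
  the threshold at which \<open>\<rho>\<close> is less than 1; scaling back gives linear growth in
  the Dirichlet norm.\<close>

lemma \<rho>_growth:
  obtains d where "d > 0" "\<And>\<phi>. \<phi> \<in> feasible \<beta> \<Longrightarrow> \<bar>\<rho> \<phi>\<bar> \<le> 1 + 2 * sqrt (dirichlet \<phi>) / d"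
proof -
  obtain d where d: "d > 0" "\<And>\<psi>. \<psi> \<in> feasible \<beta> \<Longrightarrow> dirichlet \<psi> < d \<Longrightarrow> \<bar>\<rho> \<psi>\<bar> < 1"
    using \<rho>_cont[of 1] unfolding dirichlet_sq_dist by auto
  have "\<bar>\<rho> \<phi>\<bar> \<le> 1 + 2 * sqrt (dirichlet \<phi>) / sqrt d" if \<phi>: "\<phi> \<in> feasible \<beta>" for \<phi>
  proof (cases "dirichlet \<phi> < d")
    case True
    then have "\<bar>\<rho> \<phi>\<bar> < 1" by (rule d(2)[OF \<phi>])
    moreover have "0 \<le> 2 * sqrt (dirichlet \<phi>) / sqrt d" using dirichlet_nonneg[of \<phi>] d(1) by simp
    ultimately show ?thesis by simp
  next
    case False
    \<comment> \<open>Chosen so that the Dirichlet integral of the multiple by \<open>t\<close> is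
      \<open>d / 4\<close>, which is below \<open>d\<close>.\<close>
    define t where "t = sqrt d / (2 * sqrt (dirichlet \<phi>))"
    have E0: "dirichlet \<phi> > 0" using False d(1) by linarith
    have t: "t > 0" "t \<le> 1" unfolding t_def using False d(1) E0 by (auto simp: field_simps intro: order_trans[of _ "sqrt (dirichlet \<phi>)"])
    have "t\<^sup>2 * dirichlet \<phi> = d / 4" unfolding t_def using E0 d(1) by (simp add: power_divide power_mult_distrib)
    then have "dirichlet (\<lambda>x. t * \<phi> x) < d" unfolding dirichlet_cmult[OF feasible_lip_D12[OF \<phi>]] using d(1) by simp
    moreover have "(\<lambda>x. t * \<phi> x) \<in> feasible \<beta>" by (rule feasible_cmult[OF \<phi>]) (use t in auto)
    ultimately have "\<bar>\<rho> (\<lambda>x. t * \<phi> x)\<bar> < 1" by (intro d(2))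
    then have "t * \<bar>\<rho> \<phi>\<bar> < 1" unfolding \<rho>_cmult[OF feasible_lip_bounded[OF \<phi>]] using t by (simp add: abs_mult)
    then have "\<bar>\<rho> \<phi>\<bar> \<le> 1 / t" using t by (simp add: field_simps)
    also have "1 / t = 2 * sqrt (dirichlet \<phi>) / sqrt d" using d(1) E0 by (simp add: t_def)
    finally show ?thesis by simp
  qed
  then show ?thesis using that[of "sqrt d"] d(1) by simp
qed

lemma energy_bounded_below: "\<exists>m. \<forall>\<phi>\<in>feasible \<beta>. m \<le> energy \<phi>"
proof -
  obtain d where d: "d > 0" "\<And>\<phi>. \<phi> \<in> feasible \<beta> \<Longrightarrow> \<bar>\<rho> \<phi>\<bar> \<le> 1 + 2 * sqrt (dirichlet \<phi>) / d" using \<rho>_growth by blast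
  define b where "b = (LINT x|lebesgue. \<beta> x)"
  \<comment> \<open>Quadratic growth beats linear growth: completing the square shows that
    \<open>s\<^sup>2 / 2 - 2 * s / d\<close> is at least \<open>- 2 / d\<^sup>2\<close>.\<close>
  have "- b / 2 - 1 - 2 / d\<^sup>2 \<le> energy \<phi>" if \<phi>: "\<phi> \<in> feasible \<beta>" for \<phi>
  proof -
    define s where "s = sqrt (dirichlet \<phi>)"
    have s: "dirichlet \<phi> = s\<^sup>2" using dirichlet_nonneg by (simp add: s_def)
    have "1 / q * (\<alpha> * dirichlet \<phi> - \<alpha> * b) \<le> 1 / q * density_integral \<phi>"
      using density_integral_ge[OF \<phi>] q unfolding b_def by (intro mult_left_mono) auto
    moreover have "1 / q * (\<alpha> * dirichlet \<phi> - \<alpha> * b) = s\<^sup>2 / 2 - b / 2" using q unfolding s by (simp add: right_diff_distrib)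
    ultimately have "s\<^sup>2 / 2 - b / 2 \<le> 1 / q * density_integral \<phi>" by simp
    moreover have "\<rho> \<phi> \<le> 1 + 2 * s / d" using d(2)[OF \<phi>] unfolding s_def by linarith
    moreover have "0 \<le> (s - 2 / d)\<^sup>2 / 2" by simp
    moreover have "(s - 2 / d)\<^sup>2 / 2 = s\<^sup>2 / 2 - 2 * s / d + 2 / d\<^sup>2"
      using d(1) by (simp add: power2_eq_square field_simps)
    ultimately show ?thesis unfolding energy_def by linarith
  qed
  then show ?thesis by blast
qed

text \<open>A quarter of the slope of the power at \<open>1 + C\<close>, the smallest slope over the
  values that the gap can take. The quarter is \<open>t * (1 - t)\<close> at the midpoint.\<close>

definition \<kappa> :: real where "\<kappa> = \<alpha> * (1 + C) powr (\<alpha> - 1) / 4"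

lemma \<kappa>: "\<kappa> > 0" using \<alpha> C by (simp add: \<kappa>_def)

lemma powr_midpoint:
  assumes "0 \<le> m" "0 \<le> \<delta>" "m + \<delta> \<le> 1 + C"
  shows "m powr \<alpha> + 4 * \<kappa> * \<delta> \<le> (m + \<delta>) powr \<alpha>"
proof (cases "m + \<delta> = 0")
  case False
  then have p: "m + \<delta> > 0" using assms by simp
  have "m powr \<alpha> \<le> (m + \<delta>) powr \<alpha> + \<alpha> * (m + \<delta>) powr (\<alpha> - 1) * (m - (m + \<delta>))"
    using \<alpha> assms p by (intro powr_concave_tangent) auto
  moreover have "4 * \<kappa> * \<delta> \<le> \<alpha> * (m + \<delta>) powr (\<alpha> - 1) * \<delta>"
  proof -
    have "(1 + C) powr (\<alpha> - 1) \<le> (m + \<delta>) powr (\<alpha> - 1)" using \<alpha> p assms by (intro powr_mono2') auto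
    then show ?thesis unfolding \<kappa>_def using \<alpha> assms by (simp add: mult_left_mono mult_right_mono)
  qed
  ultimately show ?thesis by (simp add: algebra_simps)
qed (use assms in \<open>simp add: add_nonneg_eq_0_iff\<close>)

text \<open>At the midpoint the gap is the mean of the two gaps plus a quarter of the squared
  distance of the gradients. Concavity handles the mean, and the slope bound in
  \<open>powr_midpoint\<close> turns the excess into a definite decrease of the energy.\<close>

lemma energy_midpoint:
  assumes \<phi>: "\<phi> \<in> feasible \<beta>" and \<psi>: "\<psi> \<in> feasible \<beta>"
  shows "energy (\<lambda>x. 1 / 2 * \<phi> x + 1 / 2 * \<psi> x) \<le> (energy \<phi> + energy \<psi>) / 2 - \<kappa> / q * sq_dist (wgrad \<phi>) (wgrad \<psi>)"
    "(\<lambda>x. 1 / 2 * \<phi> x + 1 / 2 * \<psi> x) \<in> feasible \<beta>"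
proof -
  define h where "h = (\<lambda>x. 1 / 2 * \<phi> x + 1 / 2 * \<psi> x)"
  have hK: "h \<in> feasible \<beta>" and hs: "AE x in lebesgue. gap h x = gap \<phi> x / 2 + gap \<psi> x / 2 + (norm (wgrad \<phi> x - wgrad \<psi> x))\<^sup>2 / 4"
    using feasible_combination(1,3)[OF \<phi> \<psi>, of "1 / 2"] unfolding h_def by simp_all
  then show "(\<lambda>x. 1 / 2 * \<phi> x + 1 / 2 * \<psi> x) \<in> feasible \<beta>" unfolding h_def by simp
  have di: "integrable lebesgue (\<lambda>x. (norm (wgrad \<phi> x - wgrad \<psi> x))\<^sup>2)"
    by (intro square_integrable_integrable square_integrable_diff lip_D12_square_integrable feasible_lip_D12 \<phi> \<psi>)
  have "density_integral h \<le> (LINT x|lebesgue. (1 - gap \<phi> x powr \<alpha>) / 2 + (1 - gap \<psi> x powr \<alpha>) / 2 - \<kappa> * (norm (wgrad \<phi> x - wgrad \<psi> x))\<^sup>2)"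
    unfolding density_integral_def
  proof (rule integral_mono_AE)
    show "integrable lebesgue (\<lambda>x. 1 - gap h x powr \<alpha>)" by (rule density_integrable[OF hK])
    show "integrable lebesgue (\<lambda>x. (1 - gap \<phi> x powr \<alpha>) / 2 + (1 - gap \<psi> x powr \<alpha>) / 2 - \<kappa> * (norm (wgrad \<phi> x - wgrad \<psi> x))\<^sup>2)"
      by (intro Bochner_Integration.integrable_diff Bochner_Integration.integrable_add integrable_divide integrable_mult_right density_integrable \<phi> \<psi> di)
    show "AE x in lebesgue. 1 - gap h x powr \<alpha> \<le> (1 - gap \<phi> x powr \<alpha>) / 2 + (1 - gap \<psi> x powr \<alpha>) / 2 - \<kappa> * (norm (wgrad \<phi> x - wgrad \<psi> x))\<^sup>2"
      using hs feasible_gap[OF \<phi>] feasible_gap[OF \<psi>] gap_le[of h]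
    proof eventually_elim
      case (elim x)
      define m \<delta> where "m = gap \<phi> x / 2 + gap \<psi> x / 2" and "\<delta> = (norm (wgrad \<phi> x - wgrad \<psi> x))\<^sup>2 / 4"
      have "m powr \<alpha> + 4 * \<kappa> * \<delta> \<le> (m + \<delta>) powr \<alpha>"
        using elim by (intro powr_midpoint) (auto simp: m_def \<delta>_def)
      moreover have hx: "gap h x = m + \<delta>" using elim(1) by (simp add: m_def \<delta>_def)
      moreover have "(1 - 1 / 2) * gap \<phi> x powr \<alpha> + 1 / 2 * gap \<psi> x powr \<alpha> \<le> ((1 - 1 / 2) * gap \<phi> x + 1 / 2 * gap \<psi> x) powr \<alpha>"
        using elim \<alpha> by (intro powr_concave) auto
      then have "gap \<phi> x powr \<alpha> / 2 + gap \<psi> x powr \<alpha> / 2 \<le> m powr \<alpha>" by (simp add: m_def)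
      moreover have "4 * \<kappa> * \<delta> = \<kappa> * (norm (wgrad \<phi> x - wgrad \<psi> x))\<^sup>2" by (simp add: \<delta>_def)
      ultimately show ?case unfolding hx diff_divide_distrib by linarith
    qed
  qed
  also have "\<dots> = (density_integral \<phi> + density_integral \<psi>) / 2 - \<kappa> * sq_dist (wgrad \<phi>) (wgrad \<psi>)"
  proof -
    have i: "integrable lebesgue (\<lambda>x. (1 - gap \<phi> x powr \<alpha>) / 2)" "integrable lebesgue (\<lambda>x. (1 - gap \<psi> x powr \<alpha>) / 2)"
      "integrable lebesgue (\<lambda>x. \<kappa> * (norm (wgrad \<phi> x - wgrad \<psi> x))\<^sup>2)"
      by (intro integrable_divide integrable_mult_right density_integrable \<phi> \<psi> di)+
    show ?thesis
      unfolding Bochner_Integration.integral_diff[OF Bochner_Integration.integrable_add[OF i(1,2)] i(3)] Bochner_Integration.integral_add[OF i(1,2)]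
      by (simp add: density_integral_def sq_dist_def add_divide_distrib)
  qed
  finally have F: "density_integral h \<le> (density_integral \<phi> + density_integral \<psi>) / 2 - \<kappa> * sq_dist (wgrad \<phi>) (wgrad \<psi>)" .
  have "\<rho> h = (\<rho> \<phi> + \<rho> \<psi>) / 2"
    using \<rho>_add[OF lip_bounded_cmult[OF feasible_lip_bounded[OF \<phi>], of "1 / 2"] lip_bounded_cmult[OF feasible_lip_bounded[OF \<psi>], of "1 / 2"]]
      \<rho>_cmult[OF feasible_lip_bounded[OF \<phi>], of "1 / 2"] \<rho>_cmult[OF feasible_lip_bounded[OF \<psi>], of "1 / 2"]
    unfolding h_def by (simp only:) (simp add: add_divide_distrib)
  moreover have "1 / q * density_integral h \<le> 1 / q * ((density_integral \<phi> + density_integral \<psi>) / 2 - \<kappa> * sq_dist (wgrad \<phi>) (wgrad \<psi>))"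
    using F q by (intro mult_left_mono) auto
  moreover have "1 / q * ((density_integral \<phi> + density_integral \<psi>) / 2 - \<kappa> * sq_dist (wgrad \<phi>) (wgrad \<psi>)) = (1 / q * density_integral \<phi> + 1 / q * density_integral \<psi>) / 2 - \<kappa> / q * sq_dist (wgrad \<phi>) (wgrad \<psi>)"
    using q by (simp add: field_simps)
  ultimately have "energy h \<le> (energy \<phi> + energy \<psi>) / 2 - \<kappa> / q * sq_dist (wgrad \<phi>) (wgrad \<psi>)"
    unfolding energy_def[of h] energy_def[of \<phi>] energy_def[of \<psi>] by argo
  then show "energy (\<lambda>x. 1 / 2 * \<phi> x + 1 / 2 * \<psi> x) \<le> (energy \<phi> + energy \<psi>) / 2 - \<kappa> / q * sq_dist (wgrad \<phi>) (wgrad \<psi>)"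
    unfolding h_def .
qed

text \<open>The constraint is pointwise, so it survives along a subsequence of a.e. convergent
  gradients.\<close>

lemma feasible_closed:
  assumes \<phi>: "\<And>n::nat. \<phi> n \<in> feasible \<beta>" and \<psi>: "\<psi> \<in> lip_D12" and l: "(\<lambda>n. sq_dist (wgrad (\<phi> n)) (wgrad \<psi>)) \<longlonglongrightarrow> 0"
  shows "\<psi> \<in> feasible \<beta>"
proof -
  obtain r :: "nat \<Rightarrow> nat" where r: "AE x in lebesgue. (\<lambda>n. wgrad (\<phi> (r n)) x) \<longlonglongrightarrow> wgrad \<psi> x"
    using sq_dist_AE_subseq[OF lip_D12_square_integrable[OF feasible_lip_D12[OF \<phi>]] lip_D12_square_integrable[OF \<psi>] l] by blast
  have "AE x in lebesgue. \<forall>n. 0 \<le> gap (\<phi> n) x" unfolding AE_all_countable using feasible_gap[OF \<phi>] by blast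
  then have "AE x in lebesgue. (norm (wgrad \<psi> x))\<^sup>2 \<le> 1 + \<beta> x"
    using r
  proof eventually_elim
    case (elim x)
    have "(\<lambda>n. (norm (wgrad (\<phi> (r n)) x))\<^sup>2) \<longlonglongrightarrow> (norm (wgrad \<psi> x))\<^sup>2" by (intro tendsto_intros elim)
    then show ?case by (rule LIMSEQ_le_const2) (use elim(1) in \<open>auto simp: gap_def\<close>)
  qed
  then show ?thesis using \<psi> by (simp add: feasible_def)
qed

text \<open>The density may be negative, but adding the integrable function \<open>\<beta>\<close>
  makes it nonnegative, so that Fatou's lemma applies; \<open>\<rho>\<close> is continuous along the
  sequence.\<close>

lemma energy_lower_semicontinuous:
  assumes \<phi>: "\<And>n::nat. \<phi> n \<in> feasible \<beta>" and \<psi>: "\<psi> \<in> feasible \<beta>" and l: "(\<lambda>n. sq_dist (wgrad (\<phi> n)) (wgrad \<psi>)) \<longlonglongrightarrow> 0"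
    and m: "(\<lambda>n. energy (\<phi> n)) \<longlonglongrightarrow> m"
  shows "energy \<psi> \<le> m"
proof -
  obtain r :: "nat \<Rightarrow> nat" where r: "strict_mono r" "AE x in lebesgue. (\<lambda>n. wgrad (\<phi> (r n)) x) \<longlonglongrightarrow> wgrad \<psi> x"
    using sq_dist_AE_subseq[OF lip_D12_square_integrable[OF feasible_lip_D12[OF \<phi>]] lip_D12_square_integrable[OF feasible_lip_D12[OF \<psi>]] l] by blast
  define b where "b = (LINT x|lebesgue. \<beta> x)"
  \<comment> \<open>Nonnegative by \<open>density_ge\<close>, since
    \<open>\<alpha> \<le> 1\<close>.\<close>
  define dn where "dn \<phi> x = 1 - gap \<phi> x powr \<alpha> + \<beta> x" for \<phi> x
  have dn_nn: "AE x in lebesgue. 0 \<le> dn \<phi> x" if "\<phi> \<in> feasible \<beta>" for \<phi>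
    using density_ge[OF that]
  proof eventually_elim
    case (elim x)
    have "0 \<le> \<alpha> * (norm (wgrad \<phi> x))\<^sup>2" using \<alpha> by simp
    moreover have "\<alpha> * \<beta> x \<le> 1 * \<beta> x" using \<alpha> \<beta>_nonneg by (intro mult_right_mono) auto
    ultimately show ?case using elim unfolding dn_def by linarith
  qed
  have dn_int: "integrable lebesgue (dn \<phi>)" "(LINT x|lebesgue. dn \<phi> x) = density_integral \<phi> + b" if "\<phi> \<in> feasible \<beta>" for \<phi>
    unfolding dn_def density_integral_def b_def using density_integrable[OF that] \<beta>_int by simp_all
  have dn_nn_int: "(\<integral>\<^sup>+x. ennreal (dn \<phi> x) \<partial>lebesgue) = ennreal (density_integral \<phi> + b)" if "\<phi> \<in> feasible \<beta>" for \<phi>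
    using nn_integral_eq_integral[OF dn_int(1)[OF that] dn_nn[OF that]] dn_int(2)[OF that] by simp
  have F0: "0 \<le> density_integral \<phi> + b" if "\<phi> \<in> feasible \<beta>" for \<phi>
    unfolding dn_int(2)[OF that, symmetric] by (intro integral_nonneg_AE dn_nn that)
  have "(\<lambda>n. \<rho> (\<phi> n)) \<longlonglongrightarrow> \<rho> \<psi>" by (rule \<rho>_tendsto[OF \<phi> \<psi> l])
  then have "(\<lambda>n. q * (energy (\<phi> n) + \<rho> (\<phi> n))) \<longlonglongrightarrow> q * (m + \<rho> \<psi>)" by (intro tendsto_intros m)
  moreover have "q * (energy \<phi> + \<rho> \<phi>) = density_integral \<phi>" for \<phi> using q by (simp add: energy_def)
  ultimately have "(\<lambda>n. density_integral (\<phi> n)) \<longlonglongrightarrow> q * (m + \<rho> \<psi>)" by simp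
  then have Fl: "(\<lambda>n. density_integral (\<phi> (r n))) \<longlonglongrightarrow> q * (m + \<rho> \<psi>)"
    using LIMSEQ_subseq_LIMSEQ[OF _ r(1)] by (simp add: comp_def)
  \<comment> \<open>Fatou's lemma is applied with an eventual bound on the integrals, so the limit
    is approached with a margin \<open>e\<close>.\<close>
  have "density_integral \<psi> \<le> q * (m + \<rho> \<psi>) + e" if e: "e > 0" for e
  proof -
    define c where "c = q * (m + \<rho> \<psi>) + e"
    have ev: "eventually (\<lambda>n. density_integral (\<phi> (r n)) < c) sequentially"
      by (rule order_tendstoD[OF Fl]) (use e in \<open>simp add: c_def\<close>)
    then obtain n0 where "density_integral (\<phi> (r n0)) < c" using eventually_happens'[OF sequentially_bot] by blast
    then have c0: "0 \<le> c + b" using F0[OF \<phi>[of "r n0"]] by linarith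
    have "(\<integral>\<^sup>+x. ennreal (dn \<psi> x) \<partial>lebesgue) \<le> ennreal (c + b)"
    proof (rule nn_integral_le_of_AE_limit[where f = "\<lambda>n x. ennreal (dn (\<phi> (r n)) x)"])
      show "(\<lambda>x. ennreal (dn (\<phi> (r n)) x)) \<in> borel_measurable lebesgue" for n
        using borel_measurable_integrable[OF dn_int(1)[OF \<phi>[of "r n"]]] by measurable
      have "AE x in lebesgue. \<forall>n. 0 \<le> gap (\<phi> n) x" unfolding AE_all_countable using feasible_gap[OF \<phi>] by blast
      then show "AE x in lebesgue. (\<lambda>n. ennreal (dn (\<phi> (r n)) x)) \<longlonglongrightarrow> ennreal (dn \<psi> x)"
        using r(2) feasible_gap[OF \<psi>]
      proof eventually_elim
        case (elim x)
        have "(\<lambda>n. gap (\<phi> (r n)) x) \<longlonglongrightarrow> gap \<psi> x" unfolding gap_def by (intro tendsto_intros elim)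
        then have "(\<lambda>n. gap (\<phi> (r n)) x powr \<alpha>) \<longlonglongrightarrow> gap \<psi> x powr \<alpha>"
          by (rule tendsto_powr2[OF _ tendsto_const]) (use elim(1) \<alpha> in auto)
        then show ?case unfolding dn_def by (intro tendsto_ennrealI tendsto_add tendsto_diff tendsto_const)
      qed
      show "\<forall>\<^sub>F n in sequentially. (\<integral>\<^sup>+ x. ennreal (dn (\<phi> (r n)) x) \<partial>lebesgue) \<le> ennreal (c + b)"
        using ev by eventually_elim (simp add: dn_nn_int[OF \<phi>] ennreal_leI)
    qed
    then show ?thesis unfolding dn_nn_int[OF \<psi>] c_def[symmetric] using c0 F0[OF \<psi>] by (simp add: ennreal_le_iff)
  qed
  then have "density_integral \<psi> \<le> q * (m + \<rho> \<psi>)" by (rule field_le_epsilon)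
  then have "1 / q * density_integral \<psi> \<le> m + \<rho> \<psi>" using q by (simp add: field_simps)
  then show ?thesis by (simp add: energy_def)
qed

section \<open>Uniqueness, existence and symmetry of the minimizer\<close>

lemma minimizer_unique:
  assumes "\<phi> \<in> feasible \<beta>" "\<psi> \<in> feasible \<beta>" "\<And>\<zeta>. \<zeta> \<in> feasible \<beta> \<Longrightarrow> energy \<phi> \<le> energy \<zeta>" "energy \<psi> \<le> energy \<phi>"
  shows "\<psi> = \<phi>"
proof -
  \<comment> \<open>Minimality is tested at the midpoint, whose energy would be smaller unless the
    gradients agree.\<close>
  have "energy \<phi> \<le> (energy \<phi> + energy \<psi>) / 2 - \<kappa> / q * sq_dist (wgrad \<phi>) (wgrad \<psi>)"
    using assms(3)[OF energy_midpoint(2)[OF assms(1,2)]] energy_midpoint(1)[OF assms(1,2)] by simp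
  then have "\<kappa> / q * sq_dist (wgrad \<phi>) (wgrad \<psi>) \<le> 0" using assms(4) by argo
  then have "sq_dist (wgrad \<phi>) (wgrad \<psi>) = 0"
    using \<kappa> q sq_dist_nonneg[of "wgrad \<phi>" "wgrad \<psi>"] by (simp add: mult_le_0_iff divide_le_0_iff)
  then have "AE x in lebesgue. wgrad \<phi> x = wgrad \<psi> x"
    by (intro sq_dist_eq_0_AE lip_D12_square_integrable feasible_lip_D12 assms)
  then show ?thesis using lip_D12_eqI[OF feasible_lip_D12[OF assms(1)] feasible_lip_D12[OF assms(2)]] by simp
qed

lemma minimizer_exists:
  obtains u where "u \<in> feasible \<beta>" "\<And>\<phi>. \<phi> \<in> feasible \<beta> \<Longrightarrow> energy u \<le> energy \<phi>"
proof -
  define m where "m = Inf (energy ` feasible \<beta>)"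
  have bdd: "bdd_below (energy ` feasible \<beta>)" using energy_bounded_below by (auto simp: bdd_below_def)
  have ne: "energy ` feasible \<beta> \<noteq> {}" using zero_in_feasible by auto
  have m: "m \<le> energy \<phi>" if "\<phi> \<in> feasible \<beta>" for \<phi> unfolding m_def using that bdd by (intro cInf_lower) auto
  have "\<exists>\<phi>. \<phi> \<in> feasible \<beta> \<and> energy \<phi> < m + 1 / real (Suc n)" for n
  proof -
    have "Inf (energy ` feasible \<beta>) < m + 1 / real (Suc n)" by (simp add: m_def)
    then show ?thesis using cInf_lessD[OF ne] by blast
  qed
  then have "\<forall>n. \<exists>\<phi>. \<phi> \<in> feasible \<beta> \<and> energy \<phi> < m + 1 / real (Suc n)" by blast
  from choice[OF this] obtain \<phi> where \<phi>: "\<And>n. \<phi> n \<in> feasible \<beta>" "\<And>n. energy (\<phi> n) < m + 1 / real (Suc n)" by blast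
  have inv0: "(\<lambda>n. 1 / real (Suc n)) \<longlonglongrightarrow> 0"
    using LIMSEQ_inverse_real_of_nat by (simp add: inverse_eq_divide)
  have Jm: "(\<lambda>n. energy (\<phi> n)) \<longlonglongrightarrow> m"
  proof (rule tendsto_sandwich[OF always_eventually always_eventually tendsto_const])
    show "(\<lambda>n. m + 1 / real (Suc n)) \<longlonglongrightarrow> m" using tendsto_add[OF tendsto_const[of m] inv0] by simp
  qed (use m[OF \<phi>(1)] \<phi>(2) in \<open>auto intro: less_imp_le\<close>)
  define k where "k = \<kappa> / q"
  have k: "k > 0" using \<kappa> q by (simp add: k_def)
  have cau: "\<exists>N. \<forall>i\<ge>N. \<forall>j\<ge>N. sq_dist (wgrad (\<phi> i)) (wgrad (\<phi> j)) < e" if e: "e > 0" for e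
  proof -
    have "eventually (\<lambda>n. energy (\<phi> n) < m + k * e) sequentially"
      by (rule order_tendstoD[OF Jm]) (use e k in simp)
    then obtain N where N: "\<And>n. n \<ge> N \<Longrightarrow> energy (\<phi> n) < m + k * e" by (auto simp: eventually_sequentially)
    have "sq_dist (wgrad (\<phi> i)) (wgrad (\<phi> j)) < e" if "i \<ge> N" "j \<ge> N" for i j
    proof -
      have "m \<le> (energy (\<phi> i) + energy (\<phi> j)) / 2 - k * sq_dist (wgrad (\<phi> i)) (wgrad (\<phi> j))"
        using m[OF energy_midpoint(2)[OF \<phi>(1) \<phi>(1), of i j]] energy_midpoint(1)[OF \<phi>(1) \<phi>(1), of i j] unfolding k_def by linarith
      then have "k * sq_dist (wgrad (\<phi> i)) (wgrad (\<phi> j)) < k * e" using N[OF that(1)] N[OF that(2)] by argo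
      then show ?thesis using k by simp
    qed
    then show ?thesis by blast
  qed
  \<comment> \<open>The common Lipschitz constant makes the L^2 limit of the gradients the gradient
    of a function in the space.\<close>
  obtain u where u: "u \<in> lip_D12" "\<Lambda>-lipschitz_on UNIV u" "(\<lambda>n. sq_dist (wgrad (\<phi> n)) (wgrad u)) \<longlonglongrightarrow> 0"
    by (rule lip_D12_limit[OF feasible_lip_D12[OF \<phi>(1)] feasible_Lipschitz[OF \<phi>(1)] cau]) blast
  have u_feasible: "u \<in> feasible \<beta>" by (rule feasible_closed[OF \<phi>(1) u(1,3)])
  have "energy u \<le> m" by (rule energy_lower_semicontinuous[OF \<phi>(1) u_feasible u(3) Jm])
  then show ?thesis using that[OF u_feasible] m order_trans by blast
qed

text \<open>The adjoint of \<open>g\<close> keeps norms and \<open>\<beta>\<close> is a.e.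
  invariant, so the gap is merely composed with \<open>g\<close>, which preserves Lebesgue
  measure.\<close>

lemma feasible_orthogonal:
  assumes \<phi>: "\<phi> \<in> feasible \<beta>" and g: "orthogonal_transformation g"
  shows "(\<lambda>x. \<phi> (g x)) \<in> feasible \<beta>" "energy (\<lambda>x. \<phi> (g x)) = energy \<phi>"
proof -
  have mp: "measure_preserving g" by (rule measure_preserving_orthogonal[OF g])
  have V: "(\<lambda>x. \<phi> (g x)) \<in> lip_D12" by (rule lip_D12_orthogonal[OF feasible_lip_D12[OF \<phi>] g])
  have "AE x in lebesgue. \<beta> (g x) = \<beta> x" using \<beta>_rad g by (simp add: ae_radial_def)
  then have s: "AE x in lebesgue. gap (\<lambda>x. \<phi> (g x)) x = gap \<phi> (g x)"
    using lip_D12_wgrad_orthogonal[OF feasible_lip_D12[OF \<phi>] g]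
    by eventually_elim (simp add: gap_def adjoint_orthogonal(3)[OF g])
  have "AE x in lebesgue. (norm (wgrad (\<lambda>x. \<phi> (g x)) x))\<^sup>2 \<le> 1 + \<beta> x"
    using s measure_preserving_AE[OF mp feasible_gap[OF \<phi>]]
  proof eventually_elim
    case (elim x)
    then have "0 \<le> gap (\<lambda>x. \<phi> (g x)) x" by simp
    then show ?case by (simp add: gap_def)
  qed
  then show K: "(\<lambda>x. \<phi> (g x)) \<in> feasible \<beta>" using V by (simp add: feasible_def)
  note [measurable] = gap_measurable[OF V] gap_measurable[OF feasible_lip_D12[OF \<phi>]]
  have [measurable]: "(\<lambda>x. gap \<phi> (g x)) \<in> borel_measurable lebesgue" by (rule measure_preserving_compose_measurable[OF mp]) measurable
  have "density_integral (\<lambda>x. \<phi> (g x)) = (LINT x|lebesgue. 1 - gap \<phi> (g x) powr \<alpha>)"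
    unfolding density_integral_def by (rule integral_cong_AE) (use s in auto)
  also have "\<dots> = density_integral \<phi>" unfolding density_integral_def by (rule measure_preserving_integral[OF mp, of "\<lambda>x. 1 - gap \<phi> x powr \<alpha>"]) measurable
  finally show "energy (\<lambda>x. \<phi> (g x)) = energy \<phi>" unfolding energy_def using \<rho>_rad[OF feasible_lip_bounded[OF \<phi>] g] by simp
qed

lemma minimizer_radial:
  assumes "u \<in> feasible \<beta>" "\<And>\<phi>. \<phi> \<in> feasible \<beta> \<Longrightarrow> energy u \<le> energy \<phi>"
  shows "radial u"
  unfolding radial_def
proof (intro allI impI)
  fix g :: "R3 \<Rightarrow> R3" assume g: "orthogonal_transformation g"
  have "(\<lambda>x. u (g x)) = u"
    using feasible_orthogonal[OF assms(1) g] by (intro minimizer_unique[OF assms(1) _ assms(2)]) auto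
  then show "u \<circ> g = u" by (simp add: comp_def)
qed

end

section \<open>The Euler--Lagrange equation\<close>

locale radial_minimizer = radial_problem +
  fixes u :: "R3 \<Rightarrow> real"
  assumes u_feasible: "u \<in> feasible \<beta>" and umin: "\<And>\<phi>. \<phi> \<in> feasible \<beta> \<Longrightarrow> energy u \<le> energy \<phi>"
begin

lemma powr_difference_ge:
  assumes "0 < w" "0 \<le> c"
  shows "\<alpha> * w powr (\<alpha> - 1) * (w - c) \<le> w powr \<alpha> - c powr \<alpha>"
proof -
  have "c powr \<alpha> \<le> w powr \<alpha> + \<alpha> * w powr (\<alpha> - 1) * (c - w)"
    using assms \<alpha> by (intro powr_concave_tangent) auto
  moreover have "\<alpha> * w powr (\<alpha> - 1) * (c - w) = - (\<alpha> * w powr (\<alpha> - 1) * (w - c))"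
    unfolding mult_minus_right[symmetric] by simp
  ultimately show ?thesis by linarith
qed

lemma u_lip_D12: "u \<in> lip_D12" by (rule feasible_lip_D12[OF u_feasible])

lemma u_radial: "radial u" by (rule minimizer_radial[OF u_feasible umin])

lemmas u_measurable [measurable] = lip_D12_wgrad_measurable[OF u_lip_D12] gap_measurable[OF u_lip_D12]

text \<open>Compares \<open>u\<close> with the multiple \<open>(1 - \<epsilon> / (2 * (1 + C))) * u\<close>, whose gap is at most
  \<open>gap u + \<epsilon>\<close>.\<close>

lemma scaling_bound:
  assumes \<epsilon>: "0 < \<epsilon>" "\<epsilon> < 1"
  shows "(\<integral>\<^sup>+x. ennreal ((gap u x + \<epsilon>) powr (\<alpha> - 1) * (norm (wgrad u x))\<^sup>2) \<partial>lebesgue) \<le> ennreal (2 * \<rho> u)"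
proof -
  \<comment> \<open>Chosen with \<open>(1 - t) * (2 * (1 + C)) = \<epsilon>\<close>: as
    \<open>1 - t\<^sup>2 \<le> (1 - t) * 2\<close> and the squared gradient is at most
    \<open>1 + C\<close>, the gap grows by at most \<open>\<epsilon>\<close>.\<close>
  define t where "t = 1 - \<epsilon> / (2 * (1 + C))"
  have t: "0 < t" "t < 1" "(1 - t) * (2 * (1 + C)) = \<epsilon>" using \<epsilon> C by (auto simp: t_def field_simps)
  define v where "v = (\<lambda>x. t * u x)"
  have vK: "v \<in> feasible \<beta>" unfolding v_def by (rule feasible_cmult[OF u_feasible]) (use t in auto)
  note [measurable] = gap_measurable[OF feasible_lip_D12[OF vK]]
  have "1 / q * density_integral u - \<rho> u \<le> 1 / q * density_integral v - t * \<rho> u"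
    using umin[OF vK] unfolding energy_def v_def \<rho>_cmult[OF feasible_lip_bounded[OF u_feasible]] .
  then have "1 / q * (density_integral u - density_integral v) \<le> (1 - t) * \<rho> u" by (simp add: algebra_simps)
  then have F: "density_integral u - density_integral v \<le> q * ((1 - t) * \<rho> u)" using q by (simp add: field_simps)
  define f where "f x = (gap u x + \<epsilon>) powr (\<alpha> - 1) * (norm (wgrad u x))\<^sup>2" for x
  have pt: "AE x in lebesgue. 0 \<le> f x \<and> (\<alpha> * (1 - t)) * f x \<le> (1 - gap u x powr \<alpha>) - (1 - gap v x powr \<alpha>)"
    using feasible_gap[OF u_feasible] feasible_norm_le[OF u_feasible] lip_D12_wgrad_cmult[OF u_lip_D12, of t]
  proof eventually_elim
    case (elim x)
    define w p c where "w = gap u x" and "p = (norm (wgrad u x))\<^sup>2" and "c = gap v x"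
    have c: "c = w + (1 - t\<^sup>2) * p"
      using elim(3) unfolding c_def w_def p_def v_def gap_def by (simp add: power_mult_distrib algebra_simps)
    have w: "w \<ge> 0" and p: "p \<ge> 0" using elim by (auto simp: w_def p_def)
    have p2: "p \<le> 1 + C"
      using power_mono[OF elim(2), of 2] C unfolding p_def by simp
    have t2: "1 - t\<^sup>2 = (1 - t) * (1 + t)" by (simp add: power2_eq_square algebra_simps)
    have t2': "1 - t \<le> 1 - t\<^sup>2" "1 - t\<^sup>2 \<le> (1 - t) * 2"
      unfolding t2 using t mult_left_mono[of 1 "1 + t" "1 - t"] mult_left_mono[of "1 + t" 2 "1 - t"] by auto
    have cle: "c \<le> w + \<epsilon>"
    proof -
      have "(1 - t\<^sup>2) * p \<le> ((1 - t) * 2) * (1 + C)" using t2' p p2 t by (intro mult_mono) auto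
      moreover have "((1 - t) * 2) * (1 + C) = (1 - t) * (2 * (1 + C))" by (rule mult.assoc)
      ultimately show ?thesis using t(3) unfolding c by linarith
    qed
    \<comment> \<open>The tangent at \<open>c\<close> bounds the difference of the powers from
      below; since \<open>\<alpha> - 1\<close> is negative, \<open>c\<close> may be replaced by the
      larger \<open>w + \<epsilon>\<close>. For \<open>c = 0\<close> there is no tangent, but then
      \<open>w\<close> and \<open>p\<close> vanish as well.\<close>
    have "(\<alpha> * (1 - t)) * ((w + \<epsilon>) powr (\<alpha> - 1) * p) \<le> c powr \<alpha> - w powr \<alpha>"
    proof (cases "c = 0")
      case True
      have "(1 - t\<^sup>2) * p \<ge> (1 - t) * p" using t2'(1) p by (intro mult_right_mono)
      then have "(1 - t) * p \<le> 0" "w = 0" using True w p t unfolding c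
        by (auto simp: add_nonneg_eq_0_iff mult_nonneg_nonneg t2)
      then have "p = 0" using t p by (simp add: mult_le_0_iff)
      then show ?thesis using True \<open>w = 0\<close> by simp
    next
      case False
      then have cp: "c > 0" using c w p t2' t by (simp add: less_le add_nonneg_nonneg mult_nonneg_nonneg)
      have "c - w = (1 - t\<^sup>2) * p" by (simp add: c)
      then have "\<alpha> * c powr (\<alpha> - 1) * ((1 - t\<^sup>2) * p) \<le> c powr \<alpha> - w powr \<alpha>"
        using powr_difference_ge[OF cp w] by simp
      moreover have "\<alpha> * (w + \<epsilon>) powr (\<alpha> - 1) * ((1 - t) * p) \<le> \<alpha> * c powr (\<alpha> - 1) * ((1 - t\<^sup>2) * p)"
        using \<alpha> cp cle p t t2' by (intro mult_mono mult_left_mono powr_mono2' mult_right_mono mult_nonneg_nonneg) auto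
      ultimately show ?thesis by (simp add: ac_simps)
    qed
    then show ?case using p unfolding f_def w_def p_def c_def by simp
  qed
  have [measurable]: "f \<in> borel_measurable lebesgue" unfolding f_def by measurable
  have di: "integrable lebesgue (\<lambda>x. (1 - gap u x powr \<alpha>) - (1 - gap v x powr \<alpha>))"
    by (intro Bochner_Integration.integrable_diff density_integrable u_feasible vK)
  have a: "\<alpha> * (1 - t) > 0" using \<alpha> t by simp
  have fi: "integrable lebesgue (\<lambda>x. (\<alpha> * (1 - t)) * f x)"
  proof (rule Bochner_Integration.integrable_bound[OF di])
    show "AE x in lebesgue. norm ((\<alpha> * (1 - t)) * f x) \<le> norm ((1 - gap u x powr \<alpha>) - (1 - gap v x powr \<alpha>))"
      using pt
    proof eventually_elim
      case (elim x)
      have "0 \<le> (\<alpha> * (1 - t)) * f x" using mult_nonneg_nonneg[OF less_imp_le[OF a]] elim by blast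
      then show ?case using elim unfolding real_norm_def by linarith
    qed
  qed measurable
  have "inverse A * (A * y) = y" if "0 < A" for A y :: real using that by simp
  from this[OF a] integrable_mult_right[OF fi, of "inverse (\<alpha> * (1 - t))"]
  have fi': "integrable lebesgue f" by simp
  have "(\<alpha> * (1 - t)) * (LINT x|lebesgue. f x) = (LINT x|lebesgue. (\<alpha> * (1 - t)) * f x)" by simp
  also have "\<dots> \<le> (LINT x|lebesgue. (1 - gap u x powr \<alpha>) - (1 - gap v x powr \<alpha>))"
    by (rule integral_mono_AE[OF fi di]) (use pt in eventually_elim, simp)
  also have "\<dots> = density_integral u - density_integral v" unfolding density_integral_def by (intro Bochner_Integration.integral_diff density_integrable u_feasible vK)
  \<comment> \<open>Here 2 is \<open>q / \<alpha>\<close>.\<close>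
  also have "\<dots> \<le> (\<alpha> * (1 - t)) * (2 * \<rho> u)" using F by simp
  finally have "(LINT x|lebesgue. f x) \<le> 2 * \<rho> u" using a by (simp only: mult_le_cancel_left_pos)
  moreover have "(\<integral>\<^sup>+x. ennreal (f x) \<partial>lebesgue) = ennreal (LINT x|lebesgue. f x)"
    by (rule nn_integral_eq_integral[OF fi']) (use pt in eventually_elim, simp)
  ultimately show ?thesis unfolding f_def by (simp add: ennreal_leI)
qed

text \<open>Fatou's lemma in \<open>scaling_bound\<close> as \<open>\<epsilon>\<close> tends to 0.
  Where the gap vanishes, the squared gradient is at least 1 and the integrands tend to infinity;
  the finite bound makes that set null.\<close>

lemma gap_positive_and_integrable:
  shows "AE x in lebesgue. 0 < gap u x"
    "integrable lebesgue (\<lambda>x. gap u x powr (\<alpha> - 1) * (norm (wgrad u x))\<^sup>2)"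
proof -
  define e where "e n = 1 / (real n + 2)" for n
  have e: "0 < e n" "e n < 1" for n by (auto simp: e_def)
  have e0: "e \<longlonglongrightarrow> 0" unfolding e_def by real_asymp
  define f where "f n x = ennreal ((gap u x + e n) powr (\<alpha> - 1) * (norm (wgrad u x))\<^sup>2)" for n x
  \<comment> \<open>The value infinity is the true limit at points with gap 0; the expression with
    \<open>powr\<close> would be 0 there.\<close>
  define g where "g x = (if gap u x > 0 then ennreal (gap u x powr (\<alpha> - 1) * (norm (wgrad u x))\<^sup>2) else \<infinity>)" for x
  have [measurable]: "f n \<in> borel_measurable lebesgue" for n unfolding f_def by measurable
  have [measurable]: "g \<in> borel_measurable lebesgue" unfolding g_def by measurable
  have "(\<integral>\<^sup>+x. g x \<partial>lebesgue) \<le> ennreal (2 * \<rho> u)"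
  proof (rule nn_integral_le_of_AE_limit[where f = f])
    show "\<forall>\<^sub>F n in sequentially. (\<integral>\<^sup>+x. f n x \<partial>lebesgue) \<le> ennreal (2 * \<rho> u)"
      unfolding f_def by (intro always_eventually allI scaling_bound e)
    show "AE x in lebesgue. (\<lambda>n. f n x) \<longlonglongrightarrow> g x"
      using feasible_gap[OF u_feasible]
    proof eventually_elim
      case (elim x)
      show ?case
      proof (cases "gap u x > 0")
        case True
        have "(\<lambda>n. gap u x + e n) \<longlonglongrightarrow> gap u x + 0" by (intro tendsto_intros e0)
        then have "(\<lambda>n. (gap u x + e n) powr (\<alpha> - 1)) \<longlonglongrightarrow> gap u x powr (\<alpha> - 1)"
          using True by (intro tendsto_powr tendsto_const) auto
        then show ?thesis using True unfolding f_def g_def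
          by (simp, intro tendsto_ennrealI tendsto_mult tendsto_const)
      next
        case False
        then have z: "gap u x = 0" using elim by simp
        then have p: "(norm (wgrad u x))\<^sup>2 \<ge> 1" using \<beta>_nonneg[of x] by (simp add: gap_def)
        have pw: "(e n) powr (\<alpha> - 1) = (real n + 2) powr (1 - \<alpha>)" for n
          by (simp add: e_def powr_divide powr_minus_divide[symmetric])
        have "filterlim (\<lambda>n. (real n + 2) powr (1 - \<alpha>)) at_top sequentially"
          using \<alpha> by real_asymp
        then have "filterlim (\<lambda>n. (gap u x + e n) powr (\<alpha> - 1) * (norm (wgrad u x))\<^sup>2) at_top sequentially"
        proof (rule filterlim_at_top_mono, intro always_eventually allI)
          fix n
          have "(e n) powr (\<alpha> - 1) * 1 \<le> (e n) powr (\<alpha> - 1) * (norm (wgrad u x))\<^sup>2"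
            using p by (intro mult_left_mono) auto
          then show "(real n + 2) powr (1 - \<alpha>) \<le> (gap u x + e n) powr (\<alpha> - 1) * (norm (wgrad u x))\<^sup>2"
            by (simp add: z pw)
        qed
        then have "(\<lambda>n. f n x) \<longlonglongrightarrow> top" unfolding f_def ennreal_tendsto_top_eq_at_top .
        then show ?thesis using False unfolding g_def by simp
      qed
    qed
  qed measurable
  then have gf: "(\<integral>\<^sup>+x. g x \<partial>lebesgue) < \<infinity>" by (rule le_less_trans) simp
  then have "AE x in lebesgue. g x \<noteq> \<infinity>" by (intro nn_integral_PInf_AE) auto
  then show pos: "AE x in lebesgue. 0 < gap u x" by eventually_elim (auto simp: g_def split: if_splits)
  have "(\<integral>\<^sup>+x. ennreal (norm (gap u x powr (\<alpha> - 1) * (norm (wgrad u x))\<^sup>2)) \<partial>lebesgue) = (\<integral>\<^sup>+x. g x \<partial>lebesgue)"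
    by (rule nn_integral_cong_AE) (use pos in eventually_elim, simp add: g_def)
  then show "integrable lebesgue (\<lambda>x. gap u x powr (\<alpha> - 1) * (norm (wgrad u x))\<^sup>2)"
    using gf by (intro integrableI_bounded) auto
qed

text \<open>The left-hand side of the weak equation without the terms in
  \<open>wgrad u x \<bullet> B x\<close>, which vanish a.e. for radial \<open>u\<close>.\<close>

definition flux :: "(R3 \<Rightarrow> real) \<Rightarrow> real" where
  "flux \<psi> = (LINT x|lebesgue. gap u x powr (\<alpha> - 1) * (wgrad u x \<bullet> wgrad \<psi> x))"

text \<open>Where the gradient of \<open>u\<close> has norm below 1/2, the gap is at least 3/4 and
  the weight is bounded. Elsewhere the norm is at most twice its square, and the weighted integral
  of the square is finite.\<close>

lemma flux_integrable:
  assumes \<psi>: "\<psi> \<in> feasible \<beta>"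
  shows "integrable lebesgue (\<lambda>x. gap u x powr (\<alpha> - 1) * (wgrad u x \<bullet> wgrad \<psi> x))"
proof (rule Bochner_Integration.integrable_bound)
  note [measurable] = lip_D12_wgrad_measurable[OF feasible_lip_D12[OF \<psi>]]
  show "integrable lebesgue (\<lambda>x. (2 * \<Lambda>) * (gap u x powr (\<alpha> - 1) * (norm (wgrad u x))\<^sup>2)
      + 2 * ((norm (wgrad u x))\<^sup>2 + (norm (wgrad \<psi> x))\<^sup>2))"
    by (intro Bochner_Integration.integrable_add integrable_mult_right gap_positive_and_integrable(2) dirichlet_integrable u_lip_D12 feasible_lip_D12 \<psi>)
  show "(\<lambda>x. gap u x powr (\<alpha> - 1) * (wgrad u x \<bullet> wgrad \<psi> x)) \<in> borel_measurable lebesgue" by measurable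
  show "AE x in lebesgue. norm (gap u x powr (\<alpha> - 1) * (wgrad u x \<bullet> wgrad \<psi> x))
    \<le> norm ((2 * \<Lambda>) * (gap u x powr (\<alpha> - 1) * (norm (wgrad u x))\<^sup>2) + 2 * ((norm (wgrad u x))\<^sup>2 + (norm (wgrad \<psi> x))\<^sup>2))"
    using feasible_norm_le[OF \<psi>]
  proof eventually_elim
    case (elim x)
    define s p r where "s = gap u x powr (\<alpha> - 1)" and "p = norm (wgrad u x)" and "r = norm (wgrad \<psi> x)"
    have spr: "s \<ge> 0" "p \<ge> 0" "r \<ge> 0" "r \<le> \<Lambda>" using elim by (auto simp: s_def p_def r_def)
    have n1: "0 \<le> (2 * \<Lambda>) * (s * p\<^sup>2)" "0 \<le> 2 * (p\<^sup>2 + r\<^sup>2)" using spr C by auto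
    have "s * (p * r) \<le> (2 * \<Lambda>) * (s * p\<^sup>2) + 2 * (p\<^sup>2 + r\<^sup>2)"
    proof (cases "p \<ge> 1 / 2")
      case True
      have "p * r \<le> p * \<Lambda>" using spr by (intro mult_left_mono)
      also have "\<dots> \<le> p * (\<Lambda> * (2 * p))" using True spr C by (intro mult_left_mono) auto
      finally have "s * (p * r) \<le> s * (p * (\<Lambda> * (2 * p)))" by (rule mult_left_mono[OF _ spr(1)])
      also have "\<dots> = (2 * \<Lambda>) * (s * p\<^sup>2)" by (simp add: power2_eq_square)
      finally show ?thesis using n1(2) by (rule add_increasing2[rotated])
    next
      case False
      have "p\<^sup>2 \<le> (1 / 2)\<^sup>2" using False spr by (intro power_mono) auto
      then have w: "gap u x \<ge> 1 / 2" using \<beta>_nonneg[of x] unfolding gap_def p_def by (simp add: power_divide)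
      have "s \<le> (1 / 2) powr (\<alpha> - 1)" unfolding s_def using w \<alpha> by (intro powr_mono2') auto
      also have "\<dots> \<le> (1 / 2) powr (- 1)" using \<alpha> by (intro powr_mono') auto
      also have "\<dots> = 2" by (simp add: powr_minus)
      finally have "s * (p * r) \<le> 2 * (p * r)" using spr by (intro mult_right_mono) auto
      moreover have "p * r \<le> p\<^sup>2 + r\<^sup>2"
        using zero_le_power2[of "p - r"] zero_le_power2[of p] zero_le_power2[of r] unfolding power2_diff by linarith
      then have "2 * (p * r) \<le> 2 * (p\<^sup>2 + r\<^sup>2)" by simp
      ultimately have "s * (p * r) \<le> 2 * (p\<^sup>2 + r\<^sup>2)" by (rule order_trans)
      then show ?thesis by (rule add_increasing[OF n1(1)])
    qed
    moreover have "\<bar>wgrad u x \<bullet> wgrad \<psi> x\<bar> \<le> p * r" unfolding p_def r_def by (rule Cauchy_Schwarz_ineq2)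
    then have "s * \<bar>wgrad u x \<bullet> wgrad \<psi> x\<bar> \<le> s * (p * r)" using spr by (intro mult_left_mono)
    ultimately have "s * \<bar>wgrad u x \<bullet> wgrad \<psi> x\<bar> \<le> (2 * \<Lambda>) * (s * p\<^sup>2) + 2 * (p\<^sup>2 + r\<^sup>2)" by linarith
    moreover have "norm ((2 * \<Lambda>) * (s * p\<^sup>2) + 2 * (p\<^sup>2 + r\<^sup>2)) = (2 * \<Lambda>) * (s * p\<^sup>2) + 2 * (p\<^sup>2 + r\<^sup>2)"
      using n1 by simp
    ultimately show ?case unfolding s_def[symmetric] p_def[symmetric] r_def[symmetric]
      using spr by (simp add: abs_mult)
  qed
qed

text \<open>The one-sided derivative of the energy along the segment from \<open>u\<close> to
  \<open>v\<close>. Convexity of the density confines the difference quotients between their limit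
  and the chord, so dominated convergence applies although the weight is singular.\<close>

lemma variational_inequality:
  assumes v: "v \<in> feasible \<beta>"
  shows "\<rho> v - \<rho> u \<le> flux v - flux u"
proof -
  define t where "t n = 1 / real (Suc n)" for n
  have t: "0 < t n" "t n \<le> 1" for n by (auto simp: t_def)
  have t0: "t \<longlonglongrightarrow> 0" unfolding t_def using LIMSEQ_inverse_real_of_nat by (simp add: inverse_eq_divide)
  define z where "z n = (\<lambda>x. (1 - t n) * u x + t n * v x)" for n
  have zK: "z n \<in> feasible \<beta>" and zs: "AE x in lebesgue. gap (z n) x = (1 - t n) * gap u x + t n * gap v x + t n * (1 - t n) * (norm (wgrad u x - wgrad v x))\<^sup>2" for n
    using feasible_combination(1,3)[OF u_feasible v, of "t n"] t[of n] unfolding z_def by auto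
  define Q where "Q n x = ((1 - gap (z n) x powr \<alpha>) - (1 - gap u x powr \<alpha>)) / t n" for n x
  define l where "l x = q * (gap u x powr (\<alpha> - 1) * (wgrad u x \<bullet> wgrad v x) - gap u x powr (\<alpha> - 1) * (wgrad u x \<bullet> wgrad u x))" for x
  note [measurable] = lip_D12_wgrad_measurable[OF feasible_lip_D12[OF v]] gap_measurable[OF feasible_lip_D12[OF v]] gap_measurable[OF feasible_lip_D12[OF zK]]
  have li: "integrable lebesgue l"
    unfolding l_def by (intro integrable_mult_right Bochner_Integration.integrable_diff flux_integrable v u_feasible)
  have Qi: "integrable lebesgue (Q n)" for n
    unfolding Q_def by (intro integrable_divide Bochner_Integration.integrable_diff density_integrable zK u_feasible)
  have Qint: "q * (\<rho> v - \<rho> u) \<le> (LINT x|lebesgue. Q n x)" for n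
  proof -
    have "\<rho> (z n) = (1 - t n) * \<rho> u + t n * \<rho> v"
      unfolding z_def using \<rho>_add[OF lip_bounded_cmult[OF feasible_lip_bounded[OF u_feasible], of "1 - t n"] lip_bounded_cmult[OF feasible_lip_bounded[OF v], of "t n"]]
      by (simp add: \<rho>_cmult[OF feasible_lip_bounded[OF u_feasible]] \<rho>_cmult[OF feasible_lip_bounded[OF v]])
    then have "1 / q * density_integral u - \<rho> u \<le> 1 / q * density_integral (z n) - ((1 - t n) * \<rho> u + t n * \<rho> v)"
      using umin[OF zK[of n]] unfolding energy_def by simp
    then have "t n * (\<rho> v - \<rho> u) \<le> 1 / q * (density_integral (z n) - density_integral u)" by (simp add: algebra_simps)
    then have "q * (\<rho> v - \<rho> u) \<le> (density_integral (z n) - density_integral u) / t n" using q t[of n] by (simp add: field_simps)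
    also have "\<dots> = (LINT x|lebesgue. Q n x)"
      unfolding Q_def density_integral_def integral_divide_zero
        Bochner_Integration.integral_diff[OF density_integrable[OF zK] density_integrable[OF u_feasible]] ..
    finally show ?thesis .
  qed
  have pt: "AE x in lebesgue. (\<forall>n. l x \<le> Q n x \<and> Q n x \<le> gap u x powr \<alpha> - gap v x powr \<alpha>) \<and> (\<lambda>n. Q n x) \<longlonglongrightarrow> l x"
  proof -
    have "AE x in lebesgue. \<forall>n. gap (z n) x = (1 - t n) * gap u x + t n * gap v x + t n * (1 - t n) * (norm (wgrad u x - wgrad v x))\<^sup>2"
      unfolding AE_all_countable using zs by blast
    then show ?thesis
      using gap_positive_and_integrable(1) feasible_gap[OF v]
    proof eventually_elim
      case (elim x)
      define w s d where "w = gap u x" and "s = gap v x" and "d = wgrad v x - wgrad u x"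
      define c where "c n = gap (z n) x" for n
      define y where "y = 2 * (wgrad u x \<bullet> d)"
      have w: "w > 0" and s: "s \<ge> 0" using elim by (auto simp: w_def s_def)
      have c1: "c n = (1 - t n) * w + t n * s + t n * (1 - t n) * (norm d)\<^sup>2" for n
        using elim(1) unfolding c_def w_def s_def d_def by (simp add: norm_minus_commute)
      have sw: "w - s = y + (norm d)\<^sup>2"
        unfolding w_def s_def y_def d_def gap_def power2_norm_eq_inner
        by (simp add: inner_diff_left inner_diff_right inner_commute algebra_simps)
      have c2: "w - c n = t n * (y + t n * (norm d)\<^sup>2)" for n
      proof -
        have "w - c n = t n * ((w - s) - (1 - t n) * (norm d)\<^sup>2)" unfolding c1 by (simp add: algebra_simps)
        then show ?thesis unfolding sw by (simp add: algebra_simps)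
      qed
      have cge: "(1 - t n) * w + t n * s \<le> c n" for n
        unfolding c1 using t[of n] by simp
      have c0: "0 \<le> c n" for n
        by (rule order_trans[OF _ cge]) (use t[of n] w s in auto)
      have Qe: "Q n x = (w powr \<alpha> - c n powr \<alpha>) / t n" for n by (simp add: Q_def w_def c_def)
      \<comment> \<open>The factor \<open>q\<close> is twice \<open>\<alpha>\<close>, and the 2 is
        part of \<open>y\<close>.\<close>
      have le: "l x = \<alpha> * w powr (\<alpha> - 1) * y"
        unfolding l_def y_def d_def w_def by (simp add: inner_diff_right algebra_simps)
      have lower: "l x \<le> Q n x" for n
      proof -
        have "\<alpha> * w powr (\<alpha> - 1) * (w - c n) \<le> w powr \<alpha> - c n powr \<alpha>" by (rule powr_difference_ge[OF w c0])
        then have "t n * (\<alpha> * w powr (\<alpha> - 1) * (y + t n * (norm d)\<^sup>2)) \<le> w powr \<alpha> - c n powr \<alpha>"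
          unfolding c2 by (simp add: ac_simps)
        then have "\<alpha> * w powr (\<alpha> - 1) * (y + t n * (norm d)\<^sup>2) \<le> Q n x"
          unfolding Qe using t(1)[of n] by (simp add: pos_le_divide_eq mult.commute)
        moreover have "\<alpha> * w powr (\<alpha> - 1) * y \<le> \<alpha> * w powr (\<alpha> - 1) * (y + t n * (norm d)\<^sup>2)"
          using \<alpha> t(1)[of n] by (intro mult_left_mono) auto
        ultimately show ?thesis unfolding le by linarith
      qed
      have upper: "Q n x \<le> w powr \<alpha> - s powr \<alpha>" for n
      proof -
        have "(1 - t n) * w powr \<alpha> + t n * s powr \<alpha> \<le> ((1 - t n) * w + t n * s) powr \<alpha>"
          using w s \<alpha> t[of n] by (intro powr_concave) auto
        also have "\<dots> \<le> c n powr \<alpha>" using cge w s t[of n] \<alpha> by (intro powr_mono2) auto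
        finally have "w powr \<alpha> - c n powr \<alpha> \<le> t n * (w powr \<alpha> - s powr \<alpha>)" by (simp add: algebra_simps)
        then show ?thesis unfolding Qe using t(1)[of n] by (simp add: pos_divide_le_eq mult.commute)
      qed
      have cl: "c \<longlonglongrightarrow> w"
      proof -
        have "(\<lambda>n. w - t n * (y + t n * (norm d)\<^sup>2)) \<longlonglongrightarrow> w - 0 * (y + 0 * (norm d)\<^sup>2)"
          by (intro tendsto_intros t0)
        moreover have "c = (\<lambda>n. w - t n * (y + t n * (norm d)\<^sup>2))" using c2 by (auto simp: fun_eq_iff algebra_simps)
        ultimately show ?thesis by simp
      qed
      have "(\<lambda>n. \<alpha> * c n powr (\<alpha> - 1) * (y + t n * (norm d)\<^sup>2)) \<longlonglongrightarrow> \<alpha> * w powr (\<alpha> - 1) * (y + 0 * (norm d)\<^sup>2)"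
        using w by (intro tendsto_intros cl t0) auto
      then have ul: "(\<lambda>n. \<alpha> * c n powr (\<alpha> - 1) * (y + t n * (norm d)\<^sup>2)) \<longlonglongrightarrow> l x" unfolding le by simp
      have "eventually (\<lambda>n. c n > 0) sequentially" by (rule order_tendstoD(1)[OF cl w])
      \<comment> \<open>The tangent at \<open>c n\<close>, instead of \<open>w\<close>, bounds
        \<open>Q n x\<close> from above, and this bound tends to \<open>l x\<close> too.\<close>
      then have ev: "eventually (\<lambda>n. Q n x \<le> \<alpha> * c n powr (\<alpha> - 1) * (y + t n * (norm d)\<^sup>2)) sequentially"
      proof eventually_elim
        case (elim n)
        have "w powr \<alpha> \<le> c n powr \<alpha> + \<alpha> * c n powr (\<alpha> - 1) * (w - c n)"
          using elim w \<alpha> by (intro powr_concave_tangent) auto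
        then have "w powr \<alpha> - c n powr \<alpha> \<le> t n * (\<alpha> * c n powr (\<alpha> - 1) * (y + t n * (norm d)\<^sup>2))"
          unfolding c2 by (simp add: ac_simps)
        then show ?case unfolding Qe using t(1)[of n] by (simp add: pos_divide_le_eq mult.commute)
      qed
      have "(\<lambda>n. Q n x) \<longlonglongrightarrow> l x"
        by (rule tendsto_sandwich[OF always_eventually ev tendsto_const ul]) (use lower in simp)
      then show ?case using lower upper unfolding w_def s_def by blast
    qed
  qed
  have "(\<lambda>n. LINT x|lebesgue. Q n x) \<longlonglongrightarrow> (LINT x|lebesgue. l x)"
  proof (rule integral_dominated_convergence[where w = "\<lambda>x. \<bar>l x\<bar> + \<bar>(1 - gap v x powr \<alpha>) - (1 - gap u x powr \<alpha>)\<bar>"])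
    show "integrable lebesgue (\<lambda>x. \<bar>l x\<bar> + \<bar>(1 - gap v x powr \<alpha>) - (1 - gap u x powr \<alpha>)\<bar>)"
      by (intro Bochner_Integration.integrable_add integrable_abs li Bochner_Integration.integrable_diff density_integrable u_feasible v)
    show "AE x in lebesgue. norm (Q n x) \<le> \<bar>l x\<bar> + \<bar>(1 - gap v x powr \<alpha>) - (1 - gap u x powr \<alpha>)\<bar>" for n
      using pt
    proof eventually_elim
      case (elim x)
      then have "l x \<le> Q n x" "Q n x \<le> gap u x powr \<alpha> - gap v x powr \<alpha>" by blast+
      then show ?case unfolding real_norm_def by linarith
    qed
    show "AE x in lebesgue. (\<lambda>n. Q n x) \<longlonglongrightarrow> l x" using pt by eventually_elim blast
  qed (use li Qi in \<open>auto intro: borel_measurable_integrable\<close>)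
  then have "q * (\<rho> v - \<rho> u) \<le> (LINT x|lebesgue. l x)"
    by (rule LIMSEQ_le_const) (use Qint in auto)
  also have "\<dots> = q * (flux v - flux u)"
    unfolding l_def flux_def by (simp add: flux_integrable v u_feasible)
  finally show ?thesis using q by (simp only: mult_le_cancel_left_pos)
qed

text \<open>The set on which \<open>u\<close> may be perturbed; the shell keeps the coefficient
  \<open>(x \<bullet> wgrad u x) / (x \<bullet> x)\<close> bounded.\<close>

definition perturbable :: "nat \<Rightarrow> R3 set" where
  "perturbable n = {x. 1 / (real n + 2) < gap u x \<and> 1 / (real n + 2) < x \<bullet> x \<and> x \<bullet> x < real n + 2 \<and> norm (wgrad u x) \<le> \<Lambda>}"

text \<open>By \<open>radial_wgrad_parallel\<close> the gradient is
  \<open>((x \<bullet> wgrad u x) / (x \<bullet> x)) *\<^sub>R x\<close> a.e. off the origin.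
  Restricted to \<open>perturbable n\<close> the coefficient is bounded and a.e. radial, and it
  lives in a shell, so \<open>radial_potential_exists\<close> supplies a potential.\<close>

lemma truncation_exists:
  obtains W where "W \<in> lip_D12" "AE x in lebesgue. wgrad W x = indicat_real (perturbable n) x *\<^sub>R wgrad u x"
proof -
  define k where "k = real n + 2"
  have k: "k \<ge> 2" "1 / k < k" "1 / k > 0"
  proof -
    show "k \<ge> 2" by (simp add: k_def)
    then have "1 / k \<le> 1" by simp
    then show "1 / k < k" "1 / k > 0" using \<open>k \<ge> 2\<close> by (linarith, simp)
  qed
  \<comment> \<open>Half of the coefficient, because the potential belonging to \<open>f\<close> has
    gradient \<open>(2 * f x) *\<^sub>R x\<close>.\<close>
  define f where "f x = indicat_real (perturbable n) x * ((x \<bullet> wgrad u x) / (x \<bullet> x)) / 2" for x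
  have mx [measurable]: "(\<lambda>x::R3. x) \<in> borel_measurable lebesgue"
    by (intro continuous_imp_measurable_lebesgue continuous_intros)
  have perturbable_sets [measurable]: "perturbable n \<in> sets lebesgue"
  proof -
    have "{x \<in> space lebesgue. 1 / (real n + 2) < gap u x \<and> 1 / (real n + 2) < x \<bullet> x \<and> x \<bullet> x < real n + 2 \<and> norm (wgrad u x) \<le> \<Lambda>} \<in> sets lebesgue"
      by measurable
    then show ?thesis by (simp add: perturbable_def)
  qed
  have fm: "f \<in> borel_measurable lebesgue" unfolding f_def by measurable
  have fb: "\<bar>f x\<bar> \<le> \<Lambda> * k" for x
  proof (cases "x \<in> perturbable n")
    case True
    then have g: "1 / k < x \<bullet> x" "norm (wgrad u x) \<le> \<Lambda>" "x \<bullet> x < k" by (auto simp: perturbable_def k_def)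
    have np: "norm x > 0" using g(1) k(3) by (metis inner_eq_zero_iff less_numeral_extra(3) less_trans zero_less_norm_iff)
    have nx: "norm x \<ge> 1 / k"
    proof (rule ccontr)
      assume "\<not> 1 / k \<le> norm x"
      then have "norm x < 1 / k" by simp
      moreover have "1 / k < 1" using k(1) by simp
      ultimately have "norm x * norm x < 1 / k * 1" using np k(3) by (intro mult_strict_mono) linarith+
      then show False using g(1) by (simp add: power2_norm_eq_inner[symmetric] power2_eq_square)
    qed
    have "\<bar>x \<bullet> wgrad u x\<bar> \<le> norm x * norm (wgrad u x)" by (rule Cauchy_Schwarz_ineq2)
    also have "\<dots> \<le> norm x * \<Lambda>" using g by (intro mult_left_mono) auto
    finally have "\<bar>x \<bullet> wgrad u x\<bar> / (x \<bullet> x) \<le> (norm x * \<Lambda>) / (x \<bullet> x)" by (intro divide_right_mono) auto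
    also have "\<dots> = \<Lambda> * (1 / norm x)" using np by (simp add: power2_norm_eq_inner[symmetric] power2_eq_square)
    also have "\<dots> \<le> \<Lambda> * k" using nx np k C by (intro mult_left_mono) (auto simp: field_simps)
    finally have "\<bar>x \<bullet> wgrad u x\<bar> / (x \<bullet> x) \<le> \<Lambda> * k" .
    moreover have "\<bar>f x\<bar> = \<bar>x \<bullet> wgrad u x\<bar> / (x \<bullet> x) / 2" using True unfolding f_def by (simp add: abs_divide)
    moreover have half: "a / 2 \<le> a" if "0 \<le> a" for a :: real using that by simp
    have "\<bar>x \<bullet> wgrad u x\<bar> / (x \<bullet> x) / 2 \<le> \<bar>x \<bullet> wgrad u x\<bar> / (x \<bullet> x)" by (rule half) simp
    ultimately show ?thesis by simp
  next
    case False
    then show ?thesis unfolding f_def using C k by simp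
  qed
  have fr: "ae_radial f"
    unfolding ae_radial_def
  proof (intro allI impI)
    fix g :: "R3 \<Rightarrow> R3" assume g: "orthogonal_transformation g"
    have ug: "(\<lambda>x. u (g x)) = u" using radialD[OF u_radial g] by auto
    have "AE x in lebesgue. \<beta> (g x) = \<beta> x" using \<beta>_rad g by (simp add: ae_radial_def)
    then show "AE x in lebesgue. f (g x) = f x"
      using lip_D12_wgrad_orthogonal[OF u_lip_D12 g] unfolding ug
    proof eventually_elim
      case (elim x)
      have 1: "norm (wgrad u (g x)) = norm (wgrad u x)" unfolding elim(2) adjoint_orthogonal(3)[OF g] ..
      have 2: "g x \<bullet> wgrad u (g x) = x \<bullet> wgrad u x"
        unfolding elim(2) adjoint_works[OF orthogonal_transformation_linear[OF g]] ..
      have 3: "g x \<bullet> g x = x \<bullet> x" using orthogonal_transformation_norm[OF g, of x] by (simp add: norm_eq_sqrt_inner)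
      have 4: "gap u (g x) = gap u x" by (simp add: gap_def 1 elim(1))
      \<comment> \<open>The set is described by invariant quantities only.\<close>
      have "g x \<in> perturbable n \<longleftrightarrow> x \<in> perturbable n" by (simp add: perturbable_def 1 3 4)
      then show ?case by (simp add: f_def 2 3 indicator_def)
    qed
  qed
  have fz: "f x = 0" if "\<not> (1 / k < x \<bullet> x \<and> x \<bullet> x < k)" for x
    using that by (auto simp: f_def perturbable_def k_def indicator_def)
  obtain W where W: "W \<in> lip_D12" "AE x in lebesgue. wgrad W x = (2 * f x) *\<^sub>R x"
    using radial_potential_exists[OF fm fb fr k(3,2) fz] by blast
  have "AE x in lebesgue. wgrad W x = indicat_real (perturbable n) x *\<^sub>R wgrad u x"
    using W(2) radial_wgrad_parallel[OF u_lip_D12 u_radial]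
  proof eventually_elim
    case (elim x)
    show ?case
    proof (cases "x \<in> perturbable n")
      case True
      then have x: "x \<bullet> x \<noteq> 0" by (auto simp: perturbable_def)
      have "wgrad W x = (1 / (x \<bullet> x)) *\<^sub>R ((x \<bullet> wgrad u x) *\<^sub>R x)"
        unfolding elim(1) f_def using True by simp
      also have "\<dots> = wgrad u x" unfolding elim(2)[symmetric] using x by simp
      finally show ?thesis using True by simp
    qed (simp add: elim(1) f_def)
  qed
  with W(1) show ?thesis by (rule that)
qed

lemma flux_ge: "\<rho> u \<le> flux u"
proof -
  have "\<forall>n. \<exists>W. W \<in> lip_D12 \<and> (AE x in lebesgue. wgrad W x = indicat_real (perturbable n) x *\<^sub>R wgrad u x)"
    using truncation_exists by metis
  from choice[OF this] obtain W where WV: "\<And>n. W n \<in> lip_D12"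
    and Wg: "\<And>n. AE x in lebesgue. wgrad (W n) x = indicat_real (perturbable n) x *\<^sub>R wgrad u x" by blast
  note [measurable] = lip_D12_wgrad_measurable[OF WV]
  have WK: "W n \<in> feasible \<beta>" for n
  proof -
    have "AE x in lebesgue. (norm (wgrad (W n) x))\<^sup>2 \<le> 1 + \<beta> x"
      using Wg[of n] feasible_gap[OF u_feasible]
      by eventually_elim (use \<beta>_nonneg in \<open>auto simp: gap_def indicator_def add_increasing\<close>)
    then show ?thesis using WV by (simp add: feasible_def)
  qed
  have PW: "\<rho> (W n) \<le> flux (W n)" for n
  proof -
    \<comment> \<open>The squared gradient grows by \<open>(2 * t + t * t) * p\<^sup>2\<close>,
      hence by at most \<open>3 * t * (1 + C)\<close>. With this \<open>D\<close> and
      \<open>t\<close> the latter is \<open>1 / (real n + 2)\<close>, which is less than the gap on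
      \<open>perturbable n\<close>.\<close>
    define D where "D = 3 * (1 + C)"
    have D: "1 \<le> D" using C by (simp add: D_def)
    define t where "t = 1 / (D * (real n + 2))"
    have "1 \<le> D * (real n + 2)" using mult_mono[of 1 D 1 "real n + 2"] D by auto
    then have "0 < t" "t \<le> 1" by (simp_all add: t_def)
    moreover have "D * t = 1 / (real n + 2)" using D by (simp add: t_def)
    ultimately have t: "0 < t" "t \<le> 1" "3 * (1 + C) * t = 1 / (real n + 2)" unfolding D_def by auto
    define v where "v = (\<lambda>x. u x + t * W n x)"
    have vV: "v \<in> lip_D12" unfolding v_def by (intro lip_D12_add lip_D12_cmult u_lip_D12 WV)
    have vg: "AE x in lebesgue. wgrad v x = wgrad u x + t *\<^sub>R wgrad (W n) x"
      using lip_D12_wgrad_add[OF u_lip_D12 lip_D12_cmult[OF WV[of n], of t]] lip_D12_wgrad_cmult[OF WV[of n], of t]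
      unfolding v_def by eventually_elim simp
    have "AE x in lebesgue. (norm (wgrad v x))\<^sup>2 \<le> 1 + \<beta> x"
      using vg Wg[of n] feasible_gap[OF u_feasible]
    proof eventually_elim
      case (elim x)
      show ?case
      proof (cases "x \<in> perturbable n")
        case True
        define p where "p = norm (wgrad u x)"
        have p: "0 \<le> p" "p \<le> \<Lambda>" "1 / (real n + 2) < 1 + \<beta> x - p\<^sup>2" using True by (auto simp: perturbable_def p_def gap_def)
        have p2: "p\<^sup>2 \<le> 1 + C" using power_mono[OF p(2,1), of 2] C by simp
        have "wgrad v x = (1 + t) *\<^sub>R wgrad u x" using elim True by (simp add: scaleR_add_left)
        then have "(norm (wgrad v x))\<^sup>2 = (1 + t)\<^sup>2 * p\<^sup>2" by (simp add: p_def power_mult_distrib)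
        also have "\<dots> = p\<^sup>2 + (2 * t + t * t) * p\<^sup>2" by (simp add: power2_eq_square algebra_simps)
        also have "(2 * t + t * t) * p\<^sup>2 \<le> (3 * t) * (1 + C)"
          using t mult_left_mono[of t 1 t] p2 by (intro mult_mono) auto
        finally have "(norm (wgrad v x))\<^sup>2 \<le> p\<^sup>2 + 1 / (real n + 2)" using t(3) by (simp add: ac_simps)
        then show ?thesis using p(3) by linarith
      next
        case False
        then show ?thesis using elim by (simp add: gap_def)
      qed
    qed
    then have vK: "v \<in> feasible \<beta>" using vV by (simp add: feasible_def)
    have "flux v = (LINT x|lebesgue. gap u x powr (\<alpha> - 1) * (wgrad u x \<bullet> wgrad u x) + t * (gap u x powr (\<alpha> - 1) * (wgrad u x \<bullet> wgrad (W n) x)))"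
      unfolding flux_def
    proof (rule integral_cong_AE)
      note [measurable] = lip_D12_wgrad_measurable[OF vV]
      show "(\<lambda>x. gap u x powr (\<alpha> - 1) * (wgrad u x \<bullet> wgrad v x)) \<in> borel_measurable lebesgue"
        "(\<lambda>x. gap u x powr (\<alpha> - 1) * (wgrad u x \<bullet> wgrad u x) + t * (gap u x powr (\<alpha> - 1) * (wgrad u x \<bullet> wgrad (W n) x))) \<in> borel_measurable lebesgue"
        by measurable
      show "AE x in lebesgue. gap u x powr (\<alpha> - 1) * (wgrad u x \<bullet> wgrad v x) =
          gap u x powr (\<alpha> - 1) * (wgrad u x \<bullet> wgrad u x) + t * (gap u x powr (\<alpha> - 1) * (wgrad u x \<bullet> wgrad (W n) x))"
        using vg by eventually_elim (simp add: inner_add_right algebra_simps)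
    qed
    also have "\<dots> = flux u + t * flux (W n)"
      unfolding flux_def using flux_integrable[OF u_feasible] flux_integrable[OF WK[of n]] by simp
    finally have Pv: "flux v = flux u + t * flux (W n)" .
    have "\<rho> v = \<rho> u + t * \<rho> (W n)"
      unfolding v_def using \<rho>_add[OF feasible_lip_bounded[OF u_feasible] lip_bounded_cmult[OF feasible_lip_bounded[OF WK[of n]], of t]] \<rho>_cmult[OF feasible_lip_bounded[OF WK[of n]], of t] by simp
    then have "t * \<rho> (W n) \<le> t * flux (W n)" using variational_inequality[OF vK] Pv by simp
    then show ?thesis using t(1) by simp
  qed
  \<comment> \<open>The sets \<open>perturbable n\<close> exhaust almost all of R^3, because the gap
    is positive a.e.\<close>
  have glim: "AE x in lebesgue. (\<lambda>n. indicat_real (perturbable n) x) \<longlonglongrightarrow> 1"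
  proof -
    have "{0::R3} \<in> null_sets lebesgue" by (simp add: negligible_iff_null_sets[symmetric])
    then have "AE x::R3 in lebesgue. x \<noteq> 0" by (rule AE_I') auto
    then show ?thesis
      using gap_positive_and_integrable(1) feasible_norm_le[OF u_feasible]
    proof eventually_elim
      case (elim x)
      have e: "(\<lambda>n. 1 / (real n + 2)) \<longlonglongrightarrow> 0" by real_asymp
      have x: "x \<bullet> x > 0" using elim by simp
      have "filterlim (\<lambda>n. real n + 2) at_top sequentially" by real_asymp
      then have "eventually (\<lambda>n. x \<bullet> x < real n + 2) sequentially" by (simp add: filterlim_at_top_dense)
      moreover have "eventually (\<lambda>n. 1 / (real n + 2) < gap u x) sequentially" by (rule order_tendstoD(2)[OF e elim(2)])
      moreover have "eventually (\<lambda>n. 1 / (real n + 2) < x \<bullet> x) sequentially" by (rule order_tendstoD(2)[OF e x])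
      ultimately have "eventually (\<lambda>n. indicat_real (perturbable n) x = 1) sequentially"
        by eventually_elim (use elim(3) in \<open>simp add: perturbable_def\<close>)
      then show ?case by (rule tendsto_eventually)
    qed
  qed
  have PWl: "(\<lambda>n. flux (W n)) \<longlonglongrightarrow> flux u"
    unfolding flux_def
  proof (rule integral_dominated_convergence[where w = "\<lambda>x. gap u x powr (\<alpha> - 1) * (norm (wgrad u x))\<^sup>2"])
    show "integrable lebesgue (\<lambda>x. gap u x powr (\<alpha> - 1) * (norm (wgrad u x))\<^sup>2)" by (rule gap_positive_and_integrable(2))
    have all: "AE x in lebesgue. \<forall>n. wgrad (W n) x = indicat_real (perturbable n) x *\<^sub>R wgrad u x"
      unfolding AE_all_countable using Wg by blast
    then show "AE x in lebesgue. (\<lambda>n. gap u x powr (\<alpha> - 1) * (wgrad u x \<bullet> wgrad (W n) x)) \<longlonglongrightarrow> gap u x powr (\<alpha> - 1) * (wgrad u x \<bullet> wgrad u x)"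
      using glim
    proof eventually_elim
      case (elim x)
      have "(\<lambda>n. gap u x powr (\<alpha> - 1) * (wgrad u x \<bullet> (indicat_real (perturbable n) x *\<^sub>R wgrad u x))) \<longlonglongrightarrow> gap u x powr (\<alpha> - 1) * (wgrad u x \<bullet> (1 *\<^sub>R wgrad u x))"
        by (intro tendsto_intros elim)
      then show ?case using elim(1) by simp
    qed
    show "AE x in lebesgue. norm (gap u x powr (\<alpha> - 1) * (wgrad u x \<bullet> wgrad (W n) x)) \<le> gap u x powr (\<alpha> - 1) * (norm (wgrad u x))\<^sup>2" for n
      using Wg[of n] by eventually_elim (auto simp: indicator_def power2_norm_eq_inner)
  qed measurable
  \<comment> \<open>The gradients of \<open>W n\<close> and \<open>u\<close> differ only off
    \<open>perturbable n\<close>; convergence in L^2 carries \<open>\<rho>\<close> to the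
    limit.\<close>
  have dl: "(\<lambda>n. sq_dist (wgrad (W n)) (wgrad u)) \<longlonglongrightarrow> 0"
  proof -
    have "(\<lambda>n. LINT x|lebesgue. (norm (wgrad (W n) x - wgrad u x))\<^sup>2) \<longlonglongrightarrow> (LINT x|(lebesgue :: R3 measure). 0)"
    proof (rule integral_dominated_convergence[where w = "\<lambda>x. (norm (wgrad u x))\<^sup>2"])
      show "integrable lebesgue (\<lambda>x. (norm (wgrad u x))\<^sup>2)" by (rule dirichlet_integrable[OF u_lip_D12])
      have all: "AE x in lebesgue. \<forall>n. wgrad (W n) x = indicat_real (perturbable n) x *\<^sub>R wgrad u x"
        unfolding AE_all_countable using Wg by blast
      then show "AE x in lebesgue. (\<lambda>n. (norm (wgrad (W n) x - wgrad u x))\<^sup>2) \<longlonglongrightarrow> 0"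
        using glim
      proof eventually_elim
        case (elim x)
        have "(\<lambda>n. (norm (indicat_real (perturbable n) x *\<^sub>R wgrad u x - wgrad u x))\<^sup>2) \<longlonglongrightarrow> (norm (1 *\<^sub>R wgrad u x - wgrad u x))\<^sup>2"
          by (intro tendsto_intros elim)
        then show ?case using elim(1) by simp
      qed
      show "AE x in lebesgue. norm ((norm (wgrad (W n) x - wgrad u x))\<^sup>2) \<le> (norm (wgrad u x))\<^sup>2" for n
        using Wg[of n] by eventually_elim (auto simp: indicator_def)
    qed measurable
    then show ?thesis by (simp add: sq_dist_def)
  qed
  have "(\<lambda>n. \<rho> (W n)) \<longlonglongrightarrow> \<rho> u" by (rule \<rho>_tendsto[OF WK u_feasible dl])
  then show ?thesis using PWl PW by (intro LIMSEQ_le) auto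
qed

text \<open>The linear functional \<open>flux - \<rho>\<close> attains its minimum over the symmetric set \<open>feasible \<beta>\<close> at \<open>u\<close>,
  and it is nonnegative there.\<close>

theorem Euler_Lagrange:
  assumes \<psi>: "\<psi> \<in> feasible \<beta>"
  shows "flux \<psi> = \<rho> \<psi>"
proof -
  have ge: "\<rho> \<phi> \<le> flux \<phi>" if "\<phi> \<in> feasible \<beta>" for \<phi>
    using variational_inequality[OF that] flux_ge by linarith
  have m: "(\<lambda>x. - 1 * \<psi> x) \<in> feasible \<beta>" by (rule feasible_cmult[OF \<psi>]) simp
  have "flux (\<lambda>x. - 1 * \<psi> x) = (LINT x|lebesgue. - (gap u x powr (\<alpha> - 1) * (wgrad u x \<bullet> wgrad \<psi> x)))"
    unfolding flux_def
  proof (rule integral_cong_AE)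
    note [measurable] = lip_D12_wgrad_measurable[OF feasible_lip_D12[OF \<psi>]] lip_D12_wgrad_measurable[OF feasible_lip_D12[OF m]]
    show "(\<lambda>x. gap u x powr (\<alpha> - 1) * (wgrad u x \<bullet> wgrad (\<lambda>x. - 1 * \<psi> x) x)) \<in> borel_measurable lebesgue"
      "(\<lambda>x. - (gap u x powr (\<alpha> - 1) * (wgrad u x \<bullet> wgrad \<psi> x))) \<in> borel_measurable lebesgue" by measurable
    show "AE x in lebesgue. gap u x powr (\<alpha> - 1) * (wgrad u x \<bullet> wgrad (\<lambda>x. - 1 * \<psi> x) x) = - (gap u x powr (\<alpha> - 1) * (wgrad u x \<bullet> wgrad \<psi> x))"
      using lip_D12_wgrad_cmult[OF feasible_lip_D12[OF \<psi>], of "-1"] by eventually_elim simp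
  qed
  then have "flux (\<lambda>x. - 1 * \<psi> x) = - flux \<psi>" by (simp add: flux_def)
  moreover have "\<rho> (\<lambda>x. - 1 * \<psi> x) = - \<rho> \<psi>" using \<rho>_cmult[OF feasible_lip_bounded[OF \<psi>], of "-1"] by simp
  ultimately show ?thesis using ge[OF m] ge[OF \<psi>] by linarith
qed

end

section \<open>The electrostatic problem\<close>

interpretation real_fun: module "\<lambda>(c::real) (\<phi>::R3 \<Rightarrow> real) x. c * \<phi> x"
  by standard (auto simp: fun_eq_iff algebra_simps)

lemma XB_span_base: "\<phi> \<in> XB B \<Longrightarrow> \<phi> \<in> XB_span B"
  unfolding XB_span_def by (rule real_fun.span_base)

lemma XB_span_cmult: "\<phi> \<in> XB_span B \<Longrightarrow> (\<lambda>x. c * \<phi> x) \<in> XB_span B"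
  unfolding XB_span_def by (rule real_fun.span_scale)

text \<open>For gradients of norm at most 1 the constraint holds whatever \<open>B\<close> is, by
  the Cauchy-Schwarz inequality. Small multiples of functions with bounded gradient therefore enter
  \<open>XB B\<close>.\<close>

lemma XB_I:
  assumes \<phi>: "\<phi> \<in> lip_D12" and n: "AE x in lebesgue. norm (wgrad \<phi> x) \<le> 1"
  shows "\<phi> \<in> XB B"
proof -
  have "AE x in lebesgue. (norm (wgrad \<phi> x))\<^sup>2 + (wgrad \<phi> x \<bullet> B x)\<^sup>2 \<le> 1 + (norm (B x))\<^sup>2"
    using n
  proof eventually_elim
    case (elim x)
    have 1: "(norm (wgrad \<phi> x))\<^sup>2 \<le> 1" using elim by (simp add: abs_square_le_1)
    have "(wgrad \<phi> x \<bullet> B x)\<^sup>2 \<le> (norm (wgrad \<phi> x) * norm (B x))\<^sup>2"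
      using Cauchy_Schwarz_ineq2[of "wgrad \<phi> x" "B x"] by (intro power2_le_iff_abs_le[THEN iffD2]) auto
    also have "\<dots> \<le> (norm (B x))\<^sup>2" using mult_right_mono[OF 1, of "(norm (B x))\<^sup>2"] by (simp add: power_mult_distrib)
    finally show ?case using 1 by linarith
  qed
  then show ?thesis using \<phi> by (simp add: XB_def lip_D12_def)
qed

lemma scaled_in_XB:
  assumes \<phi>: "\<phi> \<in> lip_D12" and M: "AE x in lebesgue. norm (wgrad \<phi> x) \<le> M" "M > 0"
  shows "(\<lambda>x. 1 / M * \<phi> x) \<in> XB B"
proof (rule XB_I)
  show "(\<lambda>x. 1 / M * \<phi> x) \<in> lip_D12" by (rule lip_D12_cmult[OF \<phi>])
  show "AE x in lebesgue. norm (wgrad (\<lambda>x. 1 / M * \<phi> x) x) \<le> 1"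
    using M(1) lip_D12_wgrad_cmult[OF \<phi>, of "1 / M"] by eventually_elim (use M(2) in simp)
qed

lemma lip_bounded_subset_XB_span: "\<phi> \<in> lip_bounded \<Longrightarrow> \<phi> \<in> XB_span B"
proof -
  assume "\<phi> \<in> lip_bounded"
  then obtain M where \<phi>: "\<phi> \<in> lip_D12" and M: "AE x in lebesgue. norm (wgrad \<phi> x) \<le> M" by (auto simp: lip_bounded_def)
  define N where "N = max 1 M"
  have N: "N > 0" and "AE x in lebesgue. norm (wgrad \<phi> x) \<le> N" using M by (auto simp: N_def)
  then have "(\<lambda>x. 1 / N * \<phi> x) \<in> XB B" by (intro scaled_in_XB \<phi>)
  then have "(\<lambda>x. N * (1 / N * \<phi> x)) \<in> XB_span B" by (intro XB_span_cmult XB_span_base)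
  then show ?thesis using N by simp
qed

lemma XB_lip_D12: "\<phi> \<in> XB B \<Longrightarrow> \<phi> \<in> lip_D12" by (simp add: XB_def lip_D12_def)

lemma slack_nonneg: "\<phi> \<in> XB B \<Longrightarrow> AE x in lebesgue. 0 \<le> slack B \<phi> x"
  by (simp add: XB_def slack_def algebra_simps)

lemma XB_feasible: "\<phi> \<in> XB B \<Longrightarrow> \<phi> \<in> feasible (\<lambda>x. (norm (B x))\<^sup>2)"
proof -
  assume \<phi>: "\<phi> \<in> XB B"
  have "AE x in lebesgue. (norm (wgrad \<phi> x))\<^sup>2 \<le> 1 + (norm (B x))\<^sup>2"
    using slack_nonneg[OF \<phi>]
  proof eventually_elim
    case (elim x)
    then show ?case using zero_le_power2[of "wgrad \<phi> x \<bullet> B x"] unfolding slack_def by linarith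
  qed
  then show ?thesis using XB_lip_D12[OF \<phi>] by (simp add: feasible_def)
qed

text \<open>The plane contains the third axis and is still a null set; off it the denominator in
  \<open>B_field\<close> is positive.\<close>

lemma off_axis: "AE x::R3 in lebesgue. x $ 1 \<noteq> 0"
proof (rule AE_I')
  show "{x::R3. x $ 1 = 0} \<in> null_sets lebesgue"
    using negligible_standard_hyperplane_cart[of "1::3"] by (simp add: negligible_iff_null_sets)
qed auto

lemma B_field_eq: "B_field b x = (b x / sqrt ((x$1)\<^sup>2 + (x$2)\<^sup>2)) *\<^sub>R ((- x$2) *\<^sub>R axis 1 1 + (x$1) *\<^sub>R axis 2 1)"
  by (simp add: B_field_def vec_eq_iff forall_3 axis_def)

lemma norm_B_field: "x $ 1 \<noteq> 0 \<Longrightarrow> (norm (B_field b x))\<^sup>2 = (b x)\<^sup>2"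
proof -
  assume x: "x $ 1 \<noteq> 0"
  define r where "r = (x$1)\<^sup>2 + (x$2)\<^sup>2"
  have r: "r > 0" using x unfolding r_def by (simp add: add_pos_nonneg)
  have "(norm (vector [- x$2, x$1, 0] :: R3))\<^sup>2 = r"
    unfolding power2_norm_eq_inner inner_vec_def sum_3 vector_3 r_def by (simp add: power2_eq_square)
  then have "(norm (B_field b x))\<^sup>2 = (b x)\<^sup>2 / r * r"
    using r unfolding B_field_def r_def[symmetric] by (simp add: power_mult_distrib power_divide)
  then show ?thesis using r by simp
qed

lemma B_field_measurable:
  assumes [measurable]: "b \<in> borel_measurable lebesgue"
  shows "B_field b \<in> borel_measurable lebesgue"
proof -
  have [measurable]: "(\<lambda>x::R3. x $ i) \<in> borel_measurable lebesgue" for i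
    by (intro continuous_imp_measurable_lebesgue continuous_intros)
  show ?thesis unfolding B_field_eq[abs_def] by measurable
qed

text \<open>\<open>C\<close> bounds the squared norm of the field; it fixes the common gradient
  bound and the modulus of convexity.\<close>

locale electrostatic_problem =
  fixes q :: real and b :: "R3 \<Rightarrow> real" and B :: "R3 \<Rightarrow> R3" and \<rho> :: "(R3 \<Rightarrow> real) \<Rightarrow> real" and C :: real
  assumes q: "1 \<le> q" "q < 2" and b: "b \<in> L2_Linf" "ae_radial b" and B: "B = B_field b"
    and \<rho>: "\<rho> \<in> XB_dual B" "radial_distribution B \<rho>"
    and C_nonneg: "0 \<le> C" and B_bound: "AE x in lebesgue. (norm (B x))\<^sup>2 \<le> C"
begin

abbreviation "\<beta> \<equiv> \<lambda>x. (norm (B x))\<^sup>2"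

lemma B_measurable [measurable]: "B \<in> borel_measurable lebesgue"
  using b B by (simp add: L2_Linf_def B_field_measurable)

lemma norm_B: "AE x in lebesgue. \<beta> x = (b x)\<^sup>2"
  using off_axis by eventually_elim (simp add: B norm_B_field)

lemma \<rho>_span_add: "\<phi> \<in> XB_span B \<Longrightarrow> \<psi> \<in> XB_span B \<Longrightarrow> \<rho> (\<phi> + \<psi>) = \<rho> \<phi> + \<rho> \<psi>"
  using \<rho>(1) by (simp add: XB_dual_def)

lemma \<rho>_span_cmult: "\<phi> \<in> XB_span B \<Longrightarrow> \<rho> (\<lambda>x. c * \<phi> x) = c * \<rho> \<phi>"
  using \<rho>(1) by (simp add: XB_dual_def)

text \<open>Feasible functions need not lie in \<open>XB B\<close>, where the continuity of
  \<open>\<rho>\<close> is given. Divided by \<open>\<Lambda>\<close> they do, and since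
  \<open>\<Lambda> \<ge> 1\<close> the Dirichlet norm does not increase.\<close>

lemma \<rho>_continuous_at_0:
  assumes e: "e > 0"
  shows "\<exists>d>0. \<forall>\<psi>\<in>feasible \<beta>. sq_dist (wgrad \<psi>) (\<lambda>x. 0) < d \<longrightarrow> \<bar>\<rho> \<psi>\<bar> < e"
proof -
  define \<Lambda> where "\<Lambda> = sqrt (1 + C)"
  have \<Lambda>: "\<Lambda> \<ge> 1" using C_nonneg by (simp add: \<Lambda>_def)
  define N where "N = (\<lambda>x::R3. 0::real)"
  have N: "N \<in> XB B"
    unfolding N_def by (rule XB_I[OF zero_in_lip_D12(1)]) (use zero_in_lip_D12(2) in eventually_elim, simp)
  have "\<rho> (\<lambda>x. 0 * N x) = 0 * \<rho> N" by (rule \<rho>_span_cmult[OF XB_span_base[OF N]])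
  then have \<rho>0: "\<rho> N = 0" by (simp add: N_def)
  have diff_N: "\<psi> - N = \<psi>" for \<psi> by (simp add: N_def fun_eq_iff)
  have "e / \<Lambda> > 0" using e \<Lambda> by simp
  then have "\<exists>d>0. \<forall>\<psi>\<in>XB B. D12_norm (\<psi> - N) < d \<longrightarrow> \<bar>\<rho> \<psi> - \<rho> N\<bar> < e / \<Lambda>"
    using \<rho>(1) N unfolding XB_dual_def by blast
  then obtain d where d: "d > 0" "\<And>\<psi>. \<psi> \<in> XB B \<Longrightarrow> D12_norm \<psi> < d \<Longrightarrow> \<bar>\<rho> \<psi>\<bar> < e / \<Lambda>"
    unfolding \<rho>0 diff_N by auto
  have "\<bar>\<rho> \<psi>\<bar> < e" if \<psi>: "\<psi> \<in> feasible \<beta>" and small: "sq_dist (wgrad \<psi>) (\<lambda>x. 0) < d\<^sup>2" for \<psi>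
  proof -
    have V: "\<psi> \<in> lip_D12" using \<psi> by (simp add: feasible_def)
    have "AE x in lebesgue. norm (wgrad \<psi> x) \<le> \<Lambda>"
    proof -
      have "AE x in lebesgue. (norm (wgrad \<psi> x))\<^sup>2 \<le> 1 + \<beta> x" using \<psi> by (simp add: feasible_def)
      then show ?thesis using B_bound by eventually_elim (simp add: \<Lambda>_def real_le_rsqrt)
    qed
    then have X: "(\<lambda>x. 1 / \<Lambda> * \<psi> x) \<in> XB B" using \<Lambda> by (intro scaled_in_XB V) auto
    have "(LINT x|lebesgue. (norm (wgrad (\<lambda>x. 1 / \<Lambda> * \<psi> x) x))\<^sup>2) \<le> (LINT x|lebesgue. (norm (wgrad \<psi> x))\<^sup>2)"
    proof (rule integral_mono_AE)
      show "integrable lebesgue (\<lambda>x. (norm (wgrad (\<lambda>x. 1 / \<Lambda> * \<psi> x) x))\<^sup>2)"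
        "integrable lebesgue (\<lambda>x. (norm (wgrad \<psi> x))\<^sup>2)"
        by (intro square_integrable_integrable lip_D12_square_integrable V XB_lip_D12[OF X])+
      show "AE x in lebesgue. (norm (wgrad (\<lambda>x. 1 / \<Lambda> * \<psi> x) x))\<^sup>2 \<le> (norm (wgrad \<psi> x))\<^sup>2"
        using lip_D12_wgrad_cmult[OF V, of "1 / \<Lambda>"]
      proof eventually_elim
        case (elim x)
        have "norm (wgrad \<psi> x) / \<Lambda> \<le> norm (wgrad \<psi> x) / 1" using \<Lambda> by (intro divide_left_mono) auto
        then show ?case unfolding elim using \<Lambda> by (intro power_mono) auto
      qed
    qed
    also have "\<dots> < d\<^sup>2" using small by (simp add: sq_dist_def)
    finally have "D12_norm (\<lambda>x. 1 / \<Lambda> * \<psi> x) < d"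
      unfolding D12_norm_def using d(1) by (intro real_less_lsqrt) auto
    then have "\<bar>\<rho> (\<lambda>x. 1 / \<Lambda> * \<psi> x)\<bar> < e / \<Lambda>" by (rule d(2)[OF X])
    moreover have "\<rho> (\<lambda>x. \<Lambda> * (1 / \<Lambda> * \<psi> x)) = \<Lambda> * \<rho> (\<lambda>x. 1 / \<Lambda> * \<psi> x)"
      by (rule \<rho>_span_cmult[OF XB_span_base[OF X]])
    then have "\<rho> \<psi> = \<Lambda> * \<rho> (\<lambda>x. 1 / \<Lambda> * \<psi> x)" using \<Lambda> by simp
    ultimately show ?thesis using \<Lambda> by (simp add: abs_mult pos_less_divide_eq mult.commute)
  qed
  then show ?thesis using d(1) by (intro exI[of _ "d\<^sup>2"]) auto
qed

sublocale radial_problem q C \<beta> \<rho>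
proof
  show "integrable lebesgue \<beta>"
  proof (rule integrable_cong_AE_imp)
    show "integrable lebesgue (\<lambda>x. (b x)\<^sup>2)" using b by (simp add: L2_Linf_def)
    show "AE x in lebesgue. (b x)\<^sup>2 = \<beta> x" using norm_B by eventually_elim simp
  qed measurable
  show "ae_radial \<beta>" unfolding ae_radial_def
  proof (intro allI impI)
    fix g :: "R3 \<Rightarrow> R3" assume g: "orthogonal_transformation g"
    have "AE x in lebesgue. b (g x) = b x" using b(2) g by (simp add: ae_radial_def)
    then show "AE x in lebesgue. \<beta> (g x) = \<beta> x"
      using norm_B measure_preserving_AE[OF measure_preserving_orthogonal[OF g] norm_B] by eventually_elim simp
  qed
  show "\<rho> (\<lambda>x. \<phi> x + \<psi> x) = \<rho> \<phi> + \<rho> \<psi>" if "\<phi> \<in> lip_bounded" "\<psi> \<in> lip_bounded" for \<phi> \<psi>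
    using \<rho>_span_add[OF lip_bounded_subset_XB_span[OF that(1)] lip_bounded_subset_XB_span[OF that(2)]] by (simp add: plus_fun_def)
  show "\<rho> (\<lambda>x. c * \<phi> x) = c * \<rho> \<phi>" if "\<phi> \<in> lip_bounded" for \<phi> c
    by (rule \<rho>_span_cmult[OF lip_bounded_subset_XB_span[OF that]])
  show "\<rho> (\<lambda>x. \<phi> (g x)) = \<rho> \<phi>" if "\<phi> \<in> lip_bounded" "orthogonal_transformation g" for \<phi> g
    using \<rho>(2) lip_bounded_subset_XB_span[OF that(1), of B] that(2) by (simp add: radial_distribution_def comp_def)
qed (use q C_nonneg B_bound \<rho>_continuous_at_0 in auto)

lemma slack_le_gap: "slack B \<phi> x \<le> gap \<phi> x"
  by (simp add: slack_def gap_def)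

text \<open>\<open>B\<close> points in the direction of rotation about the third axis, so the
  product is a multiple of the angular derivative in the plane of the axes 1 and 2.\<close>

lemma radial_wgrad_B:
  assumes "\<phi> \<in> lip_D12" "radial \<phi>"
  shows "AE x in lebesgue. wgrad \<phi> x \<bullet> B x = 0"
  using radial_wgrad_nth[OF assms, of 1 2]
proof eventually_elim
  case (elim x)
  have "wgrad \<phi> x \<bullet> vector [- x$2, x$1, 0] = x$1 * wgrad \<phi> x $ 2 - x$2 * wgrad \<phi> x $ 1"
    by (simp add: inner_vec_def sum_3 mult.commute)
  then show ?case unfolding B B_field_def inner_scaleR_right using elim by simp
qed

lemma slack_measurable [measurable]: "\<phi> \<in> lip_D12 \<Longrightarrow> slack B \<phi> \<in> borel_measurable lebesgue"
  unfolding slack_def by measurable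

text \<open>Monotonicity of the integral, as the slack is at most the gap. Integrability of both
  densities matters, because a non-integrable function has integral 0; the additional term is
  controlled by \<open>C * (norm (wgrad \<phi> x))\<^sup>2\<close>.\<close>

lemma energy_le_IB:
  assumes \<phi>: "\<phi> \<in> XB B"
  shows "energy \<phi> \<le> IB q B \<rho> \<phi>"
proof -
  note [measurable] = lip_D12_wgrad_measurable[OF XB_lip_D12[OF \<phi>]] slack_measurable[OF XB_lip_D12[OF \<phi>]]
  have "integrable lebesgue (\<lambda>x. 1 - slack B \<phi> x powr \<alpha>)"
  proof (rule Bochner_Integration.integrable_bound)
    show "integrable lebesgue (\<lambda>x. \<beta> x + (C + 1) * (norm (wgrad \<phi> x))\<^sup>2)"
      by (intro Bochner_Integration.integrable_add \<beta>_int integrable_mult_right dirichlet_integrable XB_lip_D12[OF \<phi>])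
    show "AE x in lebesgue. norm (1 - slack B \<phi> x powr \<alpha>) \<le> norm (\<beta> x + (C + 1) * (norm (wgrad \<phi> x))\<^sup>2)"
      using slack_nonneg[OF \<phi>] B_bound
    proof eventually_elim
      case (elim x)
      define g where "g = (norm (wgrad \<phi> x))\<^sup>2"
      define h where "h = (wgrad \<phi> x \<bullet> B x)\<^sup>2"
      have "h \<le> (norm (wgrad \<phi> x) * norm (B x))\<^sup>2" unfolding h_def
        using Cauchy_Schwarz_ineq2[of "wgrad \<phi> x" "B x"] by (intro power2_le_iff_abs_le[THEN iffD2]) auto
      also have "\<dots> = g * \<beta> x" by (simp add: g_def power_mult_distrib)
      also have "\<dots> \<le> g * C" using elim(2) by (intro mult_left_mono) (auto simp: g_def)
      finally have h: "h \<le> C * g" by (simp add: mult.commute)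
      have n: "0 \<le> \<beta> x" "0 \<le> g" "0 \<le> h" by (auto simp: g_def h_def)
      have "\<bar>1 - slack B \<phi> x powr \<alpha>\<bar> \<le> \<bar>1 - slack B \<phi> x\<bar>"
        using elim \<alpha> by (intro abs_one_minus_powr_le) auto
      also have "1 - slack B \<phi> x = g + h - \<beta> x" by (simp add: slack_def g_def h_def)
      also have "\<bar>g + h - \<beta> x\<bar> \<le> \<beta> x + (C + 1) * g"
        using n h unfolding distrib_right by linarith
      finally show ?case unfolding g_def by simp
    qed
  qed measurable
  moreover have "AE x in lebesgue. 1 - gap \<phi> x powr \<alpha> \<le> 1 - slack B \<phi> x powr \<alpha>"
    using slack_nonneg[OF \<phi>]
  proof eventually_elim
    case (elim x)
    show ?case using powr_mono2[OF less_imp_le[OF \<alpha>(1)] elim slack_le_gap] by simp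
  qed
  ultimately have "density_integral \<phi> \<le> (LINT x|lebesgue. 1 - slack B \<phi> x powr \<alpha>)"
    unfolding density_integral_def by (intro integral_mono_AE density_integrable XB_feasible \<phi>)
  then have "1 / q * density_integral \<phi> \<le> 1 / q * (LINT x|lebesgue. 1 - slack B \<phi> x powr \<alpha>)"
    using q by (intro mult_left_mono) auto
  then show ?thesis by (simp add: energy_def IB_def)
qed

lemma radial_slack_eq:
  assumes \<phi>: "\<phi> \<in> feasible \<beta>" "radial \<phi>"
  shows "AE x in lebesgue. slack B \<phi> x = gap \<phi> x" "\<phi> \<in> XB B" "IB q B \<rho> \<phi> = energy \<phi>"
proof -
  show s: "AE x in lebesgue. slack B \<phi> x = gap \<phi> x"
    using radial_wgrad_B[OF feasible_lip_D12[OF \<phi>(1)] \<phi>(2)] by eventually_elim (simp add: slack_def gap_def)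
  have "AE x in lebesgue. (norm (wgrad \<phi> x))\<^sup>2 + (wgrad \<phi> x \<bullet> B x)\<^sup>2 \<le> 1 + (norm (B x))\<^sup>2"
    using s feasible_gap[OF \<phi>(1)]
  proof eventually_elim
    case (elim x)
    then have "0 \<le> slack B \<phi> x" by simp
    then show ?case by (simp add: slack_def)
  qed
  then show X: "\<phi> \<in> XB B" using feasible_lip_D12[OF \<phi>(1)] by (simp add: XB_def lip_D12_def)
  note [measurable] = slack_measurable[OF feasible_lip_D12[OF \<phi>(1)]] gap_measurable[OF feasible_lip_D12[OF \<phi>(1)]]
  have "(LINT x|lebesgue. 1 - slack B \<phi> x powr \<alpha>) = density_integral \<phi>"
    unfolding density_integral_def by (rule integral_cong_AE) (use s in auto)
  then show "IB q B \<rho> \<phi> = energy \<phi>" by (simp add: energy_def IB_def)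
qed

lemma minimizer_is_weak_solution:
  assumes nz: "dual_nonzero B \<rho>"
  shows "\<exists>\<phi>. is_arg_min (IB q B \<rho>) (\<lambda>\<psi>. \<psi> \<in> XB B) \<phi> \<and>
           (\<forall>\<psi>. is_arg_min (IB q B \<rho>) (\<lambda>\<psi>. \<psi> \<in> XB B) \<psi> \<longrightarrow> \<psi> = \<phi>) \<and>
           (\<exists>x. \<phi> x \<noteq> 0) \<and> radial \<phi> \<and> weak_solution q B \<rho> \<phi>"
proof -
  obtain u where u: "u \<in> feasible \<beta>" "\<And>\<phi>. \<phi> \<in> feasible \<beta> \<Longrightarrow> energy u \<le> energy \<phi>" by (rule minimizer_exists) blast
  interpret radial_minimizer q C \<beta> \<rho> u by unfold_locales (use u in auto)
  note eq = radial_slack_eq[OF u(1) u_radial]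
  have min: "IB q B \<rho> u \<le> IB q B \<rho> \<psi>" if "\<psi> \<in> XB B" for \<psi>
    using energy_le_IB[OF that] u(2)[OF XB_feasible[OF that]] unfolding eq(3) by linarith
  \<comment> \<open>A minimizer of \<open>IB\<close> has comparison energy at most that of
    \<open>u\<close>, so uniqueness on the larger set applies.\<close>
  have unique: "\<psi> = u" if "\<psi> \<in> XB B" "IB q B \<rho> \<psi> \<le> IB q B \<rho> u" for \<psi>
    by (rule minimizer_unique[OF u(1) XB_feasible[OF that(1)] u(2)])
       (use energy_le_IB[OF that(1)] that(2) eq(3) in auto)
  have pos: "AE x in lebesgue. 0 < slack B u x"
    using eq(1) gap_positive_and_integrable(1) by eventually_elim simp
  have weak: "has_bochner_integral lebesgue
        (\<lambda>x. ((wgrad u x + (wgrad u x \<bullet> B x) *\<^sub>R B x) \<bullet> wgrad \<psi> x) / slack B u x powr (1 - \<alpha>)) (\<rho> \<psi>)"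
    if \<psi>: "\<psi> \<in> XB B" for \<psi>
  proof -
    note [measurable] = lip_D12_wgrad_measurable[OF XB_lip_D12[OF \<psi>]] slack_measurable[OF u_lip_D12]
    have base: "has_bochner_integral lebesgue (\<lambda>x. gap u x powr (\<alpha> - 1) * (wgrad u x \<bullet> wgrad \<psi> x)) (\<rho> \<psi>)"
      using flux_integrable[OF XB_feasible[OF \<psi>]] Euler_Lagrange[OF XB_feasible[OF \<psi>]]
      unfolding flux_def by (simp add: has_bochner_integral_iff)
    \<comment> \<open>The terms with \<open>wgrad u x \<bullet> B x\<close> vanish a.e., and gap and
      slack agree.\<close>
    have ae: "AE x in lebesgue. gap u x powr (\<alpha> - 1) * (wgrad u x \<bullet> wgrad \<psi> x) =
        ((wgrad u x + (wgrad u x \<bullet> B x) *\<^sub>R B x) \<bullet> wgrad \<psi> x) / slack B u x powr (1 - \<alpha>)"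
      using eq(1) radial_wgrad_B[OF u_lip_D12 u_radial]
    proof eventually_elim
      case (elim x)
      have "slack B u x powr (\<alpha> - 1) = inverse (slack B u x powr (1 - \<alpha>))"
        using powr_minus[of "slack B u x" "1 - \<alpha>"] by simp
      then show ?case using elim by (simp add: field_simps)
    qed
    have "(\<lambda>x. gap u x powr (\<alpha> - 1) * (wgrad u x \<bullet> wgrad \<psi> x)) \<in> borel_measurable lebesgue"
      "(\<lambda>x. ((wgrad u x + (wgrad u x \<bullet> B x) *\<^sub>R B x) \<bullet> wgrad \<psi> x) / slack B u x powr (1 - \<alpha>)) \<in> borel_measurable lebesgue"
      by measurable
    from has_bochner_integral_cong_AE[OF this ae] base show ?thesis by blast
  qed
  \<comment> \<open>If \<open>u\<close> were 0, the flux would vanish, and the Euler-Lagrange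
    equation would make \<open>\<rho>\<close> vanish on \<open>XB B\<close>, hence on its
    span.\<close>
  have nontriv: "\<exists>x. u x \<noteq> 0"
  proof (rule ccontr)
    assume "\<not> (\<exists>x. u x \<noteq> 0)"
    then have u0: "u = (\<lambda>x. 0)" by auto
    have w0: "AE x in lebesgue. wgrad u x = 0" unfolding u0 by (rule zero_in_lip_D12(2))
    have z: "\<rho> \<psi> = 0" if \<psi>: "\<psi> \<in> XB B" for \<psi>
    proof -
      note [measurable] = lip_D12_wgrad_measurable[OF XB_lip_D12[OF \<psi>]]
      have "flux \<psi> = (LINT x|(lebesgue :: R3 measure). 0)"
        unfolding flux_def
      proof (rule integral_cong_AE)
        show "AE x in lebesgue. gap u x powr (\<alpha> - 1) * (wgrad u x \<bullet> wgrad \<psi> x) = 0"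
          using w0 by eventually_elim simp
      qed measurable
      then show ?thesis using Euler_Lagrange[OF XB_feasible[OF \<psi>]] by simp
    qed
    \<comment> \<open>Membership in the span is part of the induction, because additivity of
      \<open>\<rho>\<close> is available only there.\<close>
    have "\<phi> \<in> XB_span B \<and> \<rho> \<phi> = 0" if "\<phi> \<in> XB_span B" for \<phi>
      using that unfolding XB_span_def
    proof (induction rule: real_fun.span_induct_alt)
      case base
      have "\<rho> (\<lambda>x. 0 * u x) = 0 * \<rho> u" by (rule \<rho>_span_cmult[OF XB_span_base[OF eq(2)]])
      moreover have "(\<lambda>x. 0 * u x) = 0" by (simp add: fun_eq_iff)
      ultimately show ?case using real_fun.span_zero[of "XB B"] by simp
    next
      case (step c \<phi> \<psi>)
      have s: "(\<lambda>x. c * \<phi> x) \<in> XB_span B" "\<psi> \<in> XB_span B"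
        using step XB_span_cmult[OF XB_span_base] by (auto simp: XB_span_def)
      have "\<rho> ((\<lambda>x. c * \<phi> x) + \<psi>) = 0"
        using \<rho>_span_add[OF s] \<rho>_span_cmult[OF XB_span_base[OF step(1)], of c] z[OF step(1)] step(2) by simp
      then show ?case using real_fun.span_add[OF s[unfolded XB_span_def]] by blast
    qed
    then show False using nz by (auto simp: dual_nonzero_def)
  qed
  have "is_arg_min (IB q B \<rho>) (\<lambda>\<psi>. \<psi> \<in> XB B) u"
    using eq(2) min by (simp add: is_arg_min_linorder)
  moreover have "\<psi> = u" if "is_arg_min (IB q B \<rho>) (\<lambda>\<psi>. \<psi> \<in> XB B) \<psi>" for \<psi>
    using that eq(2) unfolding is_arg_min_linorder by (intro unique) auto
  moreover have "weak_solution q B \<rho> u"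
    using eq(2) pos weak by (simp add: weak_solution_def)
  ultimately show ?thesis using nontriv u_radial by blast
qed

end

theorem theorem1p1:
  fixes q :: real and b :: "R3 \<Rightarrow> real" and B :: "R3 \<Rightarrow> R3"
    and \<rho> :: "(R3 \<Rightarrow> real) \<Rightarrow> real"
  assumes "1 \<le> q" and "q < 2"
    and "b \<in> L2_Linf" and "ae_radial b"
    and "B = B_field b"
    and "\<rho> \<in> XB_dual B" and "dual_nonzero B \<rho>" and "radial_distribution B \<rho>"
  shows "\<exists>\<phi>. is_arg_min (IB q B \<rho>) (\<lambda>\<psi>. \<psi> \<in> XB B) \<phi> \<and>
           (\<forall>\<psi>. is_arg_min (IB q B \<rho>) (\<lambda>\<psi>. \<psi> \<in> XB B) \<psi> \<longrightarrow> \<psi> = \<phi>) \<and>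
           (\<exists>x. \<phi> x \<noteq> 0) \<and>
           radial \<phi> \<and>
           weak_solution q B \<rho> \<phi>"
proof -
  obtain c where c: "AE x in lebesgue. \<bar>b x\<bar> \<le> c" using assms(3) by (auto simp: L2_Linf_def)
  have "AE x in lebesgue. (norm (B x))\<^sup>2 \<le> c\<^sup>2"
    using c off_axis
  proof eventually_elim
    case (elim x)
    have "(b x)\<^sup>2 \<le> c\<^sup>2" using power_mono[OF elim(1), of 2] by simp
    then show ?case using norm_B_field[OF elim(2)] by (simp add: assms(5))
  qed
  then interpret electrostatic_problem q b B \<rho> "c\<^sup>2"
    by unfold_locales (use assms in auto)
  show ?thesis by (rule minimizer_is_weak_solution[OF assms(7)])
qed

end
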